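(* Let $\varphi:\mathbb{R}\to\,]0,\infty[$ be a Borel function with $\int_{\mathbb{R}}\varphi(u)\,du=1$, let $\Phi(x)=\int_{-\infty}^x\varphi(y)\,dy$ and $$M_t^\varphi=(S_t-X_t)\varphi(S_t)+1-\Phi(S_t),\qquad t\ge0.$$ 1. Let $u\ge0$ and $x\in\mathbb{R}$. For any $\Gamma_u\in\mathcal{F}_u$, $$\lim_{t\to\infty}\frac{E_x[1_{\Gamma_u}\varphi(S_t)]}{E_x[\varphi(S_t)]}=\frac{1}{1-\Phi(x)}E_x[1_{\Gamma_u}M_u^\varphi].$$ 2. Let $(Q_x^\varphi)_{x\in\mathbb{R}}$ be the family of probabilities on $(\Omega,\mathcal{F}_\infty)$ determined by $$Q_x^\varphi(\Gamma_u)=\frac{1}{1-\Phi(x)}E_x[1_{\Gamma_u}M_u^\varphi],\quad u\ge0,\ \Gamma_u\in\mathcal{F}_u.$$ Then, under $Q_x^\varphi$, the process $\left(X_t-x+\int_0^t\frac{\varphi(S_u)}{M_u^\varphi}\,du;\ t\ge0\right)$ is a Brownian motion started at $0$.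
   Context: $\Omega=\mathcal{C}(\mathbb{R}_+,\mathbb{R})$ is the canonical space, $(X_t)_{t\ge0}$ the coordinate process, $\mathcal{F}_t=\sigma(X_s;0\le s\le t)$, $\mathcal{F}_\infty=\sigma(X_s;s\ge0)$; $P_x$ is the law of Brownian motion started at $x$, with expectation $E_x$. $S_t=\sup_{0\le u\le t}X_u$ is the one-sided maximum. The process $(M_t^\varphi)$ is a $P_x$-martingale with $M_0^\varphi=1-\Phi(x)$, $P_x$-a.s. *)

theory Defs
  imports "HOL-Probability.Probability"
begin

(* The canonical space C(R_+, R).  Time is the type real restricted to {0..}; extensionality on {0..}
   makes a path carry no information at negative times, so that each continuous function on R_+ is
   represented exactly once. *)
definition path_space :: "(real \<Rightarrow> real) set" where
  "path_space = {\<omega>. continuous_on {0..} \<omega> \<and> \<omega> \<in> extensional {0..}}"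

definition coord :: "real \<Rightarrow> (real \<Rightarrow> real) \<Rightarrow> real" where
  "coord t \<omega> = \<omega> t"

definition coord_sigma :: "real set \<Rightarrow> (real \<Rightarrow> real) measure" where
  "coord_sigma I =
     sigma path_space {coord s -` A \<inter> path_space | s A. s \<in> I \<and> A \<in> sets (borel :: real measure)}"

abbreviation path_filtration :: "real \<Rightarrow> (real \<Rightarrow> real) measure" where
  "path_filtration t \<equiv> coord_sigma {0..t}"

abbreviation path_algebra :: "(real \<Rightarrow> real) measure" where
  "path_algebra \<equiv> coord_sigma {0..}"

(* The second parameter of normal_density is the standard deviation.  Continuity is required
   almost surely. *)
definition brownian_motion :: "'a measure \<Rightarrow> real \<Rightarrow> (real \<Rightarrow> 'a \<Rightarrow> real) \<Rightarrow> bool" where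
  "brownian_motion M x B \<longleftrightarrow>
     prob_space M \<and>
     (\<forall>t\<ge>0. B t \<in> borel_measurable M) \<and>
     (AE \<omega> in M. B 0 \<omega> = x) \<and>
     (AE \<omega> in M. continuous_on {0..} (\<lambda>t. B t \<omega>)) \<and>
     (\<forall>s t. 0 \<le> s \<and> s < t \<longrightarrow>
        distributed M lborel (\<lambda>\<omega>. B t \<omega> - B s \<omega>) (normal_density 0 (sqrt (t - s)))) \<and>
     (\<forall>(n::nat) (\<tau>::nat \<Rightarrow> real). 0 \<le> \<tau> 0 \<and> (\<forall>i<n. \<tau> i < \<tau> (Suc i)) \<longrightarrow>
        prob_space.indep_vars M (\<lambda>_. borel) (\<lambda>i \<omega>. B (\<tau> (Suc i)) \<omega> - B (\<tau> i) \<omega>) {..<n})"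

definition brownian_law :: "real \<Rightarrow> (real \<Rightarrow> real) measure \<Rightarrow> bool" where
  "brownian_law x P \<longleftrightarrow> sets P = sets path_algebra \<and> brownian_motion P x coord"

definition running_max :: "real \<Rightarrow> (real \<Rightarrow> real) \<Rightarrow> real" where
  "running_max t \<omega> = (SUP u\<in>{0..t}. coord u \<omega>)"

definition primitive :: "(real \<Rightarrow> real) \<Rightarrow> real \<Rightarrow> real" where
  "primitive \<phi> x = (LINT y:{..x}|lborel. \<phi> y)"

definition max_martingale :: "(real \<Rightarrow> real) \<Rightarrow> real \<Rightarrow> (real \<Rightarrow> real) \<Rightarrow> real" where
  "max_martingale \<phi> t \<omega> =
     (running_max t \<omega> - coord t \<omega>) * \<phi> (running_max t \<omega>) + 1 - primitive \<phi> (running_max t \<omega>)"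

definition penalised_family ::
  "(real \<Rightarrow> real) \<Rightarrow> (real \<Rightarrow> (real \<Rightarrow> real) measure) \<Rightarrow> (real \<Rightarrow> (real \<Rightarrow> real) measure) \<Rightarrow> bool" where
  "penalised_family \<phi> P Q \<longleftrightarrow>
     (\<forall>x. prob_space (Q x) \<and> sets (Q x) = sets path_algebra \<and>
       (\<forall>u\<ge>0. \<forall>\<Gamma>\<in>sets (path_filtration u).
          measure (Q x) \<Gamma> =
            1 / (1 - primitive \<phi> x) * (LINT \<omega>|P x. indicator \<Gamma> \<omega> * max_martingale \<phi> u \<omega>)))"

(* The integral may diverge on a null set of paths, where the Bochner integral is 0 by convention. *)
definition drift_corrected ::
  "(real \<Rightarrow> real) \<Rightarrow> real \<Rightarrow> real \<Rightarrow> (real \<Rightarrow> real) \<Rightarrow> real" where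
  "drift_corrected \<phi> x t \<omega> =
     coord t \<omega> - x + (LINT u:{0..t}|lborel. \<phi> (running_max u \<omega>) / max_martingale \<phi> u \<omega>)"

end

(* A one-sided maximum S over a Brownian path gains, after time u, only through
   S_t = max S_u (X_u + S'_{t-u}) with S' the maximum of an independent Brownian motion.  By the
   reflection principle S'_r has density sqrt (2 / (pi r)) exp (-z^2 / (2 r)) on the positive
   half-line, so E[phi (max s (y + S'_r))] divided by sqrt (2 / (pi r)) increases to
   m(s, y) = int_0^oo phi (max s (y + z)) dz = (s - y) phi(s) + 1 - Phi(s), which is M at (S, X) = (s, y).
   This gives the limit and, by consistency of the limits, the martingale property; Q is then a
   Kolmogorov extension.

   For the drift, let Z_t = exp (i theta X_t + theta^2 t / 2).  The key identity is that
   M_t Z_t + i theta int_0^t phi(S_v) Z_v dv is a P-martingale.  It is linear in phi, and for phi the indicator of a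
   half-line it comes from optional stopping of Z at a hitting time, differentiated in theta.
   Under Q it says that Z_t + i theta int_0^t (phi(S_v) / M_v) Z_v dv is a martingale; multiplying by
   exp (i theta int_0^t phi(S_v) / M_v dv), along ever finer partitions, shows that the
   drift-corrected process has independent Gaussian increments. *)
theory Submission
  imports Defs
begin

section \<open>Path space\<close>

text \<open>Since \<open>\<phi>\<close> is only Borel, \<open>M\<close> need not be a smooth
  function of \<open>(S, X)\<close>, so no stochastic calculus is used: martingale properties are
  tested against bounded weights known at the earlier time. For the indicator of
  \<open>{s..<c}\<close> the gain \<open>m\<close> is \<open>c - y\<close> while the maximum is
  below \<open>c\<close> and 0 afterwards. Let \<open>T\<close> be the minimum of \<open>r\<close>
  and the hitting time of \<open>b\<close>. Differentiating \<open>E[Z_T] = 1\<close> in \<theta>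
  brings down the factor \<open>i X_T + \<theta> T\<close>. After a hit \<open>X_T = b\<close>, so
  \<open>b - X_T\<close> survives only on \<open>S_r < b\<close>; and \<open>T\<close> is the length
  of the set of times with \<open>S_v < b\<close>, which produces the time integral. The obstacle is
  integrability, as \<open>\<phi>\<close> may be locally unbounded. Under \<open>P\<close> the mean
  of \<open>\<phi> (S_v)\<close> is of order at most \<open>v powr (- 1/2)\<close>, integrable at 0;
  under \<open>Q\<close> the factor \<open>M_v\<close> cancels the denominator of the drift and
  gives the same order. Before the limit theorem only the inequality
  \<open>E[M_u] \<le> 1 - \<Phi>(x)\<close> is available, from Fatou's lemma; this is enough for
  domination, and equality follows from the limit.\<close>

lemma sets_finite_conj:
  fixes f :: "'i \<Rightarrow> 'a \<Rightarrow> real"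
  assumes "finite U" "\<And>u. u \<in> U \<Longrightarrow> f u \<in> borel_measurable M" "\<And>u. u \<in> U \<Longrightarrow> A u \<in> sets borel"
  shows "{\<omega>\<in>space M. \<forall>u\<in>U. f u \<omega> \<in> A u} \<in> sets M"
proof (rule sets.sets_Collect_finite_All[OF _ assms(1)])
  fix u assume "u \<in> U"
  from measurable_sets[OF assms(2,3)[OF this]]
  show "{\<omega>\<in>space M. f u \<omega> \<in> A u} \<in> sets M" by (simp add: vimage_def Int_def conj_commute)
qed

lemma space_coord_sigma [simp]: "space (coord_sigma I) = path_space"
  unfolding coord_sigma_def by (rule space_measure_of) auto

lemma sets_coord_sigma:
  "sets (coord_sigma I) =
     sigma_sets path_space {coord s -` A \<inter> path_space | s A. s \<in> I \<and> A \<in> sets (borel :: real measure)}"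
  unfolding coord_sigma_def by (rule sets_measure_of) auto

lemma borel_measurable_coord: "s \<in> I \<Longrightarrow> coord s \<in> borel_measurable (coord_sigma I)"
  by (rule measurableI) (auto simp: sets_coord_sigma intro!: sigma_sets.Basic)

lemma measurable_coord_sigmaI:
  assumes "\<And>x. x \<in> space N \<Longrightarrow> f x \<in> path_space"
    and "\<And>s. s \<in> I \<Longrightarrow> (\<lambda>x. coord s (f x)) \<in> borel_measurable N"
  shows "f \<in> N \<rightarrow>\<^sub>M coord_sigma I"
  unfolding coord_sigma_def
proof (rule measurable_sigma_sets[OF sets_measure_of])
  fix B assume "B \<in> {coord s -` A \<inter> path_space | s A. s \<in> I \<and> A \<in> sets (borel :: real measure)}"
  then obtain s A where B: "B = coord s -` A \<inter> path_space" "s \<in> I" "A \<in> sets borel" by auto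
  have "f -` B \<inter> space N = (\<lambda>x. coord s (f x)) -` A \<inter> space N"
    using assms(1) by (auto simp: B)
  also have "\<dots> \<in> sets N" using assms(2)[OF B(2)] B(3) by (rule measurable_sets)
  finally show "f -` B \<inter> space N \<in> sets N" .
qed (use assms in auto)

lemma sets_coord_sigma_mono: "I \<subseteq> J \<Longrightarrow> sets (coord_sigma I) \<subseteq> sets (coord_sigma J)"
  unfolding sets_coord_sigma by (rule sigma_sets_mono') auto

lemma measurable_id_coord_sigma: "I \<subseteq> J \<Longrightarrow> (\<lambda>x. x) \<in> coord_sigma J \<rightarrow>\<^sub>M coord_sigma I"
  by (rule measurable_coord_sigmaI) (auto intro: borel_measurable_coord)

lemma continuous_on_path: "\<omega> \<in> path_space \<Longrightarrow> I \<subseteq> {0..} \<Longrightarrow> continuous_on I (\<lambda>t. coord t \<omega>)"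
  unfolding path_space_def coord_def by (auto intro: continuous_on_subset)

lemma tendsto_coord:
  assumes "\<omega> \<in> path_space" "f \<longlonglongrightarrow> t" "\<And>n. 0 \<le> f n" "0 \<le> t"
  shows "(\<lambda>n. coord (f n) \<omega>) \<longlonglongrightarrow> coord t \<omega>"
  using continuous_on_tendsto_compose[OF continuous_on_path[OF assms(1) order_refl] assms(2)] assms(3,4)
  by auto

text \<open>The grid points approach \<open>v\<close> from below (\<open>floor_approx_le\<close>),
  so evaluating a path at them never looks beyond time \<open>v\<close>; this keeps later
  measurability statements inside a given filtration.\<close>

lemma floor_approx_tendsto:
  fixes v :: real assumes "0 \<le> v"
  shows "(\<lambda>n. real (nat \<lfloor>v * real (Suc n)\<rfloor>) / real (Suc n)) \<longlonglongrightarrow> v"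
proof (rule tendsto_sandwich)
  show "(\<lambda>n. v - 1 / real (Suc n)) \<longlonglongrightarrow> v"
    by (rule tendsto_eq_intros tendsto_const LIMSEQ_Suc[OF lim_1_over_n])+ simp
  show "\<forall>\<^sub>F n in sequentially. v - 1 / real (Suc n) \<le> real (nat \<lfloor>v * real (Suc n)\<rfloor>) / real (Suc n)"
  proof (rule always_eventually, rule allI)
    fix n
    have "v * real (Suc n) - 1 \<le> real (nat \<lfloor>v * real (Suc n)\<rfloor>)" by linarith
    then have "(v * real (Suc n) - 1) / real (Suc n) \<le> real (nat \<lfloor>v * real (Suc n)\<rfloor>) / real (Suc n)"
      by (rule divide_right_mono) simp
    then show "v - 1 / real (Suc n) \<le> real (nat \<lfloor>v * real (Suc n)\<rfloor>) / real (Suc n)"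
      by (simp add: diff_divide_distrib)
  qed
  show "\<forall>\<^sub>F n in sequentially. real (nat \<lfloor>v * real (Suc n)\<rfloor>) / real (Suc n) \<le> v"
  proof (rule always_eventually, rule allI)
    fix n
    have "0 \<le> v * real (Suc n)" using assms by simp
    then have "real (nat \<lfloor>v * real (Suc n)\<rfloor>) \<le> v * real (Suc n)" by linarith
    then show "real (nat \<lfloor>v * real (Suc n)\<rfloor>) / real (Suc n) \<le> v"
      by (simp add: field_simps)
  qed
qed simp

lemma floor_approx_le:
  fixes v :: real assumes "0 \<le> v"
  shows "real (nat \<lfloor>v * real (Suc n)\<rfloor>) / real (Suc n) \<le> v"
proof -
  have "0 \<le> v * real (Suc n)" using assms by simp
  then have "real (nat \<lfloor>v * real (Suc n)\<rfloor>) \<le> v * real (Suc n)" by linarith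
  then show ?thesis by (simp add: field_simps)
qed

text \<open>By continuity, evaluation at a random time is the limit of evaluations at grid times
  below it. The hypothesis on \<open>I\<close> says that it is an initial part of the half-line, so
  those grid times stay in \<open>I\<close>: \<open>{0..t}\<close> gives progressive measurability,
  \<open>{0..}\<close> plain joint measurability.\<close>

lemma borel_measurable_coord_joint:
  assumes I: "\<And>v. v \<in> I \<Longrightarrow> 0 \<le> v \<and> {0..v} \<subseteq> I"
    and h: "h \<in> borel_measurable N" "\<And>x. x \<in> space N \<Longrightarrow> h x \<in> I"
    and w: "w \<in> N \<rightarrow>\<^sub>M coord_sigma I"
  shows "(\<lambda>x. coord (h x) (w x)) \<in> borel_measurable N"
proof (rule borel_measurable_LIMSEQ_real)
  define d where "d n v = real (nat \<lfloor>v * real (Suc n)\<rfloor>) / real (Suc n)" for n and v :: real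
  fix x assume x: "x \<in> space N"
  then have hx: "0 \<le> h x" using I h(2) by blast
  have wx: "w x \<in> path_space" using measurable_space[OF w x] by simp
  show "(\<lambda>n. coord (d n (h x)) (w x)) \<longlonglongrightarrow> coord (h x) (w x)"
    using floor_approx_tendsto[OF hx] unfolding d_def by (intro tendsto_coord wx) (auto simp: hx)
next
  fix n
  \<comment> \<open>The value 0 off \<open>I\<close> makes every \<open>f i\<close> measurable; the
    index actually chosen always gives a time in \<open>I\<close>.\<close>
  define f where "f i x = (if real i / real (Suc n) \<in> I then coord (real i / real (Suc n)) (w x) else 0)" for i :: nat and x
  have "(\<lambda>x. f (nat \<lfloor>h x * real (Suc n)\<rfloor>) x) \<in> borel_measurable N"
  proof (rule measurable_compose_countable)
    show "(\<lambda>x. f i x) \<in> borel_measurable N" for i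
      unfolding f_def using measurable_compose[OF w borel_measurable_coord] by (cases "real i / real (Suc n) \<in> I") auto
    show "(\<lambda>x. nat \<lfloor>h x * real (Suc n)\<rfloor>) \<in> N \<rightarrow>\<^sub>M count_space UNIV"
      using h(1) by measurable
  qed
  moreover have "f (nat \<lfloor>h x * real (Suc n)\<rfloor>) x = coord (real (nat \<lfloor>h x * real (Suc n)\<rfloor>) / real (Suc n)) (w x)"
    if "x \<in> space N" for x
  proof -
    have "real (nat \<lfloor>h x * real (Suc n)\<rfloor>) / real (Suc n) \<in> {0..h x}"
      using floor_approx_le[of "h x" n] I[OF h(2)[OF that]] by (simp del: of_nat_Suc)
    then have "real (nat \<lfloor>h x * real (Suc n)\<rfloor>) / real (Suc n) \<in> I"
      using I[OF h(2)[OF that]] by blast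
    then show ?thesis by (simp add: f_def)
  qed
  ultimately show "(\<lambda>x. coord (real (nat \<lfloor>h x * real (Suc n)\<rfloor>) / real (Suc n)) (w x)) \<in> borel_measurable N"
    by (simp cong: measurable_cong)
qed

section \<open>The running maximum and its measurability\<close>

lemma bdd_above_coord: "\<omega> \<in> path_space \<Longrightarrow> 0 \<le> t \<Longrightarrow> bdd_above ((\<lambda>u. coord u \<omega>) ` {0..t})"
  by (intro bounded_imp_bdd_above compact_imp_bounded compact_continuous_image continuous_on_path) auto

lemma coord_le_running_max: "\<omega> \<in> path_space \<Longrightarrow> 0 \<le> u \<Longrightarrow> u \<le> t \<Longrightarrow> coord u \<omega> \<le> running_max t \<omega>"
  unfolding running_max_def by (rule cSUP_upper) (auto intro!: bdd_above_coord)

lemma running_max_leI: "0 \<le> t \<Longrightarrow> (\<And>u. 0 \<le> u \<Longrightarrow> u \<le> t \<Longrightarrow> coord u \<omega> \<le> a) \<Longrightarrow> running_max t \<omega> \<le> a"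
  unfolding running_max_def by (rule cSUP_least) auto

lemma running_max_attained:
  assumes "\<omega> \<in> path_space" "0 \<le> t"
  obtains u where "0 \<le> u" "u \<le> t" "running_max t \<omega> = coord u \<omega>"
proof -
  have "\<exists>u\<in>{0..t}. \<forall>v\<in>{0..t}. coord v \<omega> \<le> coord u \<omega>"
    using assms by (intro continuous_attains_sup continuous_on_path) auto
  then obtain u where u: "u \<in> {0..t}" "\<forall>v\<in>{0..t}. coord v \<omega> \<le> coord u \<omega>" by blast
  then have "running_max t \<omega> = coord u \<omega>"
    using assms coord_le_running_max[of \<omega> u t] running_max_leI[of t \<omega> "coord u \<omega>"] by fastforce
  with u show ?thesis using that by auto
qed

lemma running_max_mono: "\<omega> \<in> path_space \<Longrightarrow> 0 \<le> s \<Longrightarrow> s \<le> t \<Longrightarrow> running_max s \<omega> \<le> running_max t \<omega>"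
  by (rule running_max_leI) (auto intro: coord_le_running_max)

lemma running_max_0: "running_max 0 \<omega> = coord 0 \<omega>"
  unfolding running_max_def by simp

text \<open>Scaling the time interval to \<open>[0, 1]\<close> makes the countable index set
  independent of \<open>t\<close>, so the formula still expresses a measurable supremum when
  \<open>t\<close> is a random time.\<close>

lemma running_max_eq_rational:
  assumes w: "\<omega> \<in> path_space" and t: "0 \<le> t"
  shows "running_max t \<omega> = (SUP q\<in>{0..1} \<inter> \<rat>. coord (t * q) \<omega>)"
proof (rule antisym)
  have sub: "(\<lambda>q. coord (t * q) \<omega>) ` ({0..1} \<inter> \<rat>) \<subseteq> (\<lambda>u. coord u \<omega>) ` {0..t}"
    using t mult_left_le[of _ t] by auto
  have bdd: "bdd_above ((\<lambda>q. coord (t * q) \<omega>) ` ({0..1} \<inter> \<rat>))"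
    using bdd_above_mono[OF bdd_above_coord[OF w t] sub] .
  have ne: "{0..1} \<inter> \<rat> \<noteq> ({} :: real set)" using Rats_0 by fastforce
  show "(SUP q\<in>{0..1} \<inter> \<rat>. coord (t * q) \<omega>) \<le> running_max t \<omega>"
    using ne t w mult_left_le[of _ t] by (intro cSUP_least coord_le_running_max) auto
  show "running_max t \<omega> \<le> (SUP q\<in>{0..1} \<inter> \<rat>. coord (t * q) \<omega>)"
  proof (rule running_max_leI[OF t])
    fix u assume u: "0 \<le> u" "u \<le> t"
    define v where "v = (if t = 0 then 0 else u / t)"
    have v: "0 \<le> v" "v \<le> 1" "t * v = u" using u by (auto simp: v_def)
    define q where "q n = real (nat \<lfloor>v * real (Suc n)\<rfloor>) / real (Suc n)" for n
    have q: "q n \<in> {0..1} \<inter> \<rat>" for n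
      using order_trans[OF floor_approx_le[OF v(1), of n] v(2)] by (simp add: q_def del: of_nat_Suc)
    have "q \<longlonglongrightarrow> v" using floor_approx_tendsto[OF v(1)] by (simp add: q_def[abs_def])
    then have "(\<lambda>n. t * q n) \<longlonglongrightarrow> u" using v(3) tendsto_mult_left[of q v sequentially t] by simp
    then have "(\<lambda>n. coord (t * q n) \<omega>) \<longlonglongrightarrow> coord u \<omega>"
      using q t u by (intro tendsto_coord w) auto
    then show "coord u \<omega> \<le> (SUP q\<in>{0..1} \<inter> \<rat>. coord (t * q) \<omega>)"
      by (rule LIMSEQ_le_const2) (intro exI[of _ 0] allI impI cSUP_upper bdd q)
  qed
qed

lemma borel_measurable_running_max_joint:
  assumes I: "\<And>v. v \<in> I \<Longrightarrow> 0 \<le> v \<and> {0..v} \<subseteq> I"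
    and h: "h \<in> borel_measurable N" "\<And>x. x \<in> space N \<Longrightarrow> h x \<in> I"
    and w: "w \<in> N \<rightarrow>\<^sub>M coord_sigma I"
  shows "(\<lambda>x. running_max (h x) (w x)) \<in> borel_measurable N"
proof -
  have hx: "0 \<le> h x" and wx: "w x \<in> path_space" if "x \<in> space N" for x
    using I h(2)[OF that] measurable_space[OF w that] by auto
  have "(\<lambda>x. SUP q\<in>{0..1} \<inter> \<rat>. coord (h x * q) (w x)) \<in> borel_measurable N"
  proof (rule borel_measurable_cSUP)
    show "countable ({0..1} \<inter> \<rat> :: real set)" using countable_rat by blast
    fix q :: real assume q: "q \<in> {0..1} \<inter> \<rat>"
    show "(\<lambda>x. coord (h x * q) (w x)) \<in> borel_measurable N"
    proof (rule borel_measurable_coord_joint[OF I _ _ w])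
      fix x assume x: "x \<in> space N"
      show "h x * q \<in> I" using I[OF h(2)[OF x]] q hx[OF x] mult_left_le[of q "h x"] by auto
    qed (use h in auto)
  next
    fix x assume x: "x \<in> space N"
    have "(\<lambda>q. coord (h x * q) (w x)) ` ({0..1} \<inter> \<rat>) \<subseteq> (\<lambda>u. coord u (w x)) ` {0..h x}"
      using hx[OF x] mult_left_le[of _ "h x"] by auto
    then show "bdd_above ((\<lambda>q. coord (h x * q) (w x)) ` ({0..1} \<inter> \<rat>))"
      by (rule bdd_above_mono[OF bdd_above_coord[OF wx[OF x] hx[OF x]]])
  qed
  then show ?thesis
    by (rule measurable_cong[THEN iffD1, rotated]) (simp add: running_max_eq_rational hx wx)
qed

lemma borel_measurable_running_max: "0 \<le> s \<Longrightarrow> {0..s} \<subseteq> I \<Longrightarrow> running_max s \<in> borel_measurable (coord_sigma I)"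
  using measurable_compose[OF measurable_id_coord_sigma borel_measurable_running_max_joint[of "{0..s}" "\<lambda>_. s" "coord_sigma {0..s}" "\<lambda>x. x"]]
  by (auto simp: measurable_ident)

section \<open>Cylinder sets as an intersection-stable generator\<close>

definition cylinders :: "real set \<Rightarrow> (real \<Rightarrow> real) set set" where
  "cylinders I = {{\<omega>\<in>path_space. \<forall>u\<in>U. coord u \<omega> \<in> A u} | U A. finite U \<and> U \<subseteq> I \<and> (\<forall>u\<in>U. A u \<in> sets (borel :: real measure))}"

lemma cylindersI: "finite U \<Longrightarrow> U \<subseteq> I \<Longrightarrow> (\<And>u. u \<in> U \<Longrightarrow> A u \<in> sets borel) \<Longrightarrow>
   {\<omega>\<in>path_space. \<forall>u\<in>U. coord u \<omega> \<in> A u} \<in> cylinders I"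
  unfolding cylinders_def by blast

lemma cylindersD:
  assumes "C \<in> cylinders I"
  shows "\<exists>U A. C = {\<omega>\<in>path_space. \<forall>u\<in>U. coord u \<omega> \<in> A u} \<and> finite U \<and> U \<subseteq> I \<and> (\<forall>u. A u \<in> sets borel)"
proof -
  from assms obtain U A where *: "C = {\<omega>\<in>path_space. \<forall>u\<in>U. coord u \<omega> \<in> A u}" "finite U" "U \<subseteq> I"
    "\<And>u. u \<in> U \<Longrightarrow> A u \<in> sets borel" unfolding cylinders_def by blast
  show ?thesis
    by (rule exI[of _ U], rule exI[of _ "\<lambda>u. if u \<in> U then A u else {}"]) (use * in auto)
qed

lemma Int_stable_cylinders: "Int_stable (cylinders I)"
proof (rule Int_stableI)
  fix C D assume CI: "C \<in> cylinders I" and "D \<in> cylinders I"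
  from cylindersD[OF CI] obtain U A where C: "C = {\<omega>\<in>path_space. \<forall>u\<in>U. coord u \<omega> \<in> A u}" "finite U" "U \<subseteq> I" "\<And>u. A u \<in> sets borel"
    by (elim exE conjE) (erule that; simp)
  obtain V B where D: "D = {\<omega>\<in>path_space. \<forall>u\<in>V. coord u \<omega> \<in> B u}" "finite V" "V \<subseteq> I" "\<And>u. B u \<in> sets borel"
    using cylindersD[OF \<open>D \<in> cylinders I\<close>] by (elim exE conjE) (erule that; simp)
  have "C \<inter> D = {\<omega>\<in>path_space. \<forall>u\<in>U \<union> V. coord u \<omega> \<in> (if u \<in> U then A u else UNIV) \<inter> (if u \<in> V then B u else UNIV)}"
    unfolding C D by auto
  also have "\<dots> \<in> cylinders I"
    using C D by (intro cylindersI) auto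
  finally show "C \<inter> D \<in> cylinders I" .
qed

lemma sets_cylinders: "cylinders I \<subseteq> sets (coord_sigma I)"
proof
  fix C assume "C \<in> cylinders I"
  from cylindersD[OF this] obtain U A where C: "C = {\<omega>\<in>path_space. \<forall>u\<in>U. coord u \<omega> \<in> A u}" "finite U" "U \<subseteq> I" "\<And>u. A u \<in> sets borel"
    by (elim exE conjE) (erule that; simp)
  have "C = {\<omega>\<in>space (coord_sigma I). \<forall>u\<in>U. coord u \<omega> \<in> A u}" by (simp add: C)
  also have "\<dots> \<in> sets (coord_sigma I)"
    using C by (intro sets_finite_conj borel_measurable_coord) auto
  finally show "C \<in> sets (coord_sigma I)" .
qed

lemma sigma_sets_cylinders: "sigma_sets path_space (cylinders I) = sets (coord_sigma I)"
proof
  show "sigma_sets path_space (cylinders I) \<subseteq> sets (coord_sigma I)"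
    using sets.sigma_sets_subset[OF sets_cylinders] by simp
  show "sets (coord_sigma I) \<subseteq> sigma_sets path_space (cylinders I)"
    unfolding sets_coord_sigma
  proof (rule sigma_sets_mono')
    show "{coord s -` A \<inter> path_space | s A. s \<in> I \<and> A \<in> sets (borel :: real measure)} \<subseteq> cylinders I"
    proof safe
      fix s and A :: "real set" assume "s \<in> I" "A \<in> sets borel"
      then have "{\<omega>\<in>path_space. \<forall>u\<in>{s}. coord u \<omega> \<in> A} \<in> cylinders I" by (intro cylindersI) auto
      also have "{\<omega>\<in>path_space. \<forall>u\<in>{s}. coord u \<omega> \<in> A} = coord s -` A \<inter> path_space" by auto
      finally show "coord s -` A \<inter> path_space \<in> cylinders I" .
    qed
  qed
qed

lemma path_space_in_cylinders: "path_space \<in> cylinders I"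
  using cylindersI[of "{}" I "\<lambda>_. {}"] by simp

lemma measure_eqI_cylinders:
  assumes "prob_space M" "prob_space N" "sets M = sets (coord_sigma I)" "sets N = sets (coord_sigma I)"
    and "\<And>C. C \<in> cylinders I \<Longrightarrow> measure M C = measure N C"
  shows "M = N"
proof (rule measure_eqI_generator_eq[OF Int_stable_cylinders[of I], where \<Omega>=path_space and A="\<lambda>_. path_space"])
  interpret M: prob_space M by fact
  interpret N: prob_space N by fact
  show "cylinders I \<subseteq> Pow path_space" unfolding cylinders_def by auto
  show "emeasure M X = emeasure N X" if "X \<in> cylinders I" for X
    using assms(5)[OF that] by (simp add: M.emeasure_eq_measure N.emeasure_eq_measure)
  show "sets M = sigma_sets path_space (cylinders I)" "sets N = sigma_sets path_space (cylinders I)"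
    by (simp_all add: assms sigma_sets_cylinders)
  show "range (\<lambda>_::nat. path_space) \<subseteq> cylinders I" by (simp add: path_space_in_cylinders)
  show "emeasure M path_space \<noteq> \<infinity>" for i :: nat by (simp add: M.emeasure_eq_measure)
qed auto

section \<open>Independent increments and the Markov property\<close>

text \<open>The increments after time \<open>s\<close>: under a Brownian law this path is
  independent of the past, and its law does not depend on the starting point. The restriction to
  \<open>{0..}\<close> keeps it in the extensional \<open>path_space\<close>.\<close>

definition path_shift :: "real \<Rightarrow> (real \<Rightarrow> real) \<Rightarrow> real \<Rightarrow> real" where
  "path_shift s \<omega> = (\<lambda>v\<in>{0..}. coord (s + v) \<omega> - coord s \<omega>)"

lemma coord_path_shift: "0 \<le> v \<Longrightarrow> coord v (path_shift s \<omega>) = coord (s + v) \<omega> - coord s \<omega>"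
  by (simp add: path_shift_def coord_def)

lemma path_shift_in_path_space: "\<omega> \<in> path_space \<Longrightarrow> 0 \<le> s \<Longrightarrow> path_shift s \<omega> \<in> path_space"
proof -
  assume w: "\<omega> \<in> path_space" "0 \<le> s"
  have "continuous_on ((\<lambda>v. s + v) ` {0..}) (\<lambda>t. coord t \<omega>)"
    using w by (intro continuous_on_path) auto
  from continuous_on_compose[OF continuous_on_add[OF continuous_on_const continuous_on_id] this]
  have "continuous_on {0..} (\<lambda>v. coord (s + v) \<omega> - coord s \<omega>)"
    by (intro continuous_on_diff continuous_on_const) (simp add: o_def)
  then have "continuous_on {0..} (path_shift s \<omega>)"
    by (rule continuous_on_cong[THEN iffD1, rotated -1]) (auto simp: path_shift_def)
  then show ?thesis by (simp add: path_space_def path_shift_def)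
qed

lemma measurable_path_shift: "0 \<le> s \<Longrightarrow> path_shift s \<in> path_algebra \<rightarrow>\<^sub>M path_algebra"
proof (rule measurable_coord_sigmaI)
  fix v :: real assume s: "0 \<le> s" and v: "v \<in> {0..}"
  have "(\<lambda>\<omega>. coord (s + v) \<omega> - coord s \<omega>) \<in> borel_measurable path_algebra"
    using s v by (intro borel_measurable_diff borel_measurable_coord) auto
  then show "(\<lambda>\<omega>. coord v (path_shift s \<omega>)) \<in> borel_measurable path_algebra"
    using v by (simp add: coord_path_shift)
qed (simp add: path_shift_in_path_space)

text \<open>\<open>brownian_motion\<close> speaks about increasing sequences of times, cylinders
  about finite sets of times; this passes from the latter to the former. Including 0 lets every
  value be written as the initial value plus a sum of increments.\<close>

lemma finite_times_enum:
  fixes U :: "real set"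
  assumes "finite U" "0 \<in> U" "U \<subseteq> {0..}"
  shows "\<exists>n \<tau>. \<tau> 0 = 0 \<and> (\<forall>i<n. \<tau> i < \<tau> (Suc i)) \<and> U = \<tau> ` {..n::nat} \<and> strict_mono_on {..n} \<tau>"
proof -
  define xs where "xs = sorted_list_of_set U"
  have xs: "set xs = U" "sorted_wrt (<) xs" using assms(1) by (auto simp: xs_def)
  then have ne: "xs \<noteq> []" using assms by auto
  define n where "n = length xs - 1"
  have len: "length xs = Suc n" using ne by (simp add: n_def)
  have lt: "xs ! i < xs ! j" if "i < j" "j \<le> n" for i j
    using sorted_wrt_nth_less[OF xs(2)] that len by simp
  have U: "U = (\<lambda>i. xs ! i) ` {..n}"
    using xs(1) len by (auto simp: set_conv_nth less_Suc_eq_le image_def)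
  have "xs ! 0 = 0"
  proof -
    obtain i where i: "i \<le> n" "xs ! i = 0" using assms(2) U by auto
    have "0 \<le> xs ! 0" using U assms(3) by auto
    then show ?thesis using lt[of 0 i] i by (cases "i = 0") auto
  qed
  then show ?thesis using lt U by (intro exI[of _ n] exI[of _ "\<lambda>i. xs ! i"]) (auto simp: strict_mono_on_def)
qed

lemma increasing_times_nonneg:
  fixes \<tau> :: "nat \<Rightarrow> real"
  assumes "0 \<le> \<tau> 0" "\<And>i. i < n \<Longrightarrow> \<tau> i < \<tau> (Suc i)" "i \<le> n"
  shows "0 \<le> \<tau> i"
  using assms(3)
proof (induction i)
  case (Suc i)
  then show ?case using assms(2)[of i] by simp
qed (use assms in simp)

lemma sum_increments:
  fixes f :: "nat \<Rightarrow> 'a::ab_group_add"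
  assumes "k \<le> j" shows "f j - f k = (\<Sum>i=k..<j. f (Suc i) - f i)"
  using assms by (simp add: sum_Suc_diff')

context
  fixes M :: "'a measure" and x :: real and B :: "real \<Rightarrow> 'a \<Rightarrow> real"
  assumes BM: "brownian_motion M x B"
begin

lemma bm_prob_space: "prob_space M"
  using BM by (simp add: brownian_motion_def)

interpretation prob_space M by (rule bm_prob_space)

lemma bm_measurable: "0 \<le> t \<Longrightarrow> B t \<in> borel_measurable M"
  using BM by (simp add: brownian_motion_def)

lemma bm_start: "AE \<omega> in M. B 0 \<omega> = x"
  using BM by (simp add: brownian_motion_def)

lemma bm_increment: "0 \<le> s \<Longrightarrow> s < t \<Longrightarrow> distributed M lborel (\<lambda>\<omega>. B t \<omega> - B s \<omega>) (normal_density 0 (sqrt (t - s)))"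
  using BM by (simp add: brownian_motion_def)

lemma bm_indep:
  fixes n :: nat assumes "0 \<le> \<tau> 0" "\<And>i. i < n \<Longrightarrow> \<tau> i < \<tau> (Suc i)"
  shows "indep_vars (\<lambda>_. borel) (\<lambda>i \<omega>. B (\<tau> (Suc i)) \<omega> - B (\<tau> i) \<omega>) {..<n}"
  using BM assms by (simp add: brownian_motion_def)

lemma bm_law:
  fixes n :: nat assumes t0: "0 \<le> \<tau> 0" and t: "\<And>i. i < n \<Longrightarrow> \<tau> i < \<tau> (Suc i)" and n: "n \<noteq> 0"
  shows "distr M (\<Pi>\<^sub>M i\<in>{..<n}. borel) (\<lambda>\<omega>. \<lambda>i\<in>{..<n}. B (\<tau> (Suc i)) \<omega> - B (\<tau> i) \<omega>) =
     (\<Pi>\<^sub>M i\<in>{..<n}. density lborel (\<lambda>y. ennreal (normal_density 0 (sqrt (\<tau> (Suc i) - \<tau> i)) y)))"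
proof -
  have pos: "0 \<le> \<tau> i" if "i \<le> n" for i
    using increasing_times_nonneg[of \<tau> n i] t0 t that by simp
  have "distr M (\<Pi>\<^sub>M i\<in>{..<n}. borel) (\<lambda>\<omega>. \<lambda>i\<in>{..<n}. B (\<tau> (Suc i)) \<omega> - B (\<tau> i) \<omega>)
     = (\<Pi>\<^sub>M i\<in>{..<n}. distr M borel (\<lambda>\<omega>. B (\<tau> (Suc i)) \<omega> - B (\<tau> i) \<omega>))"
    using n pos bm_measurable
    by (subst indep_vars_iff_distr_eq_PiM'[symmetric]) (auto intro!: bm_indep t0 t borel_measurable_diff)
  also have "\<dots> = (\<Pi>\<^sub>M i\<in>{..<n}. density lborel (\<lambda>y. ennreal (normal_density 0 (sqrt (\<tau> (Suc i) - \<tau> i)) y)))"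
  proof (rule PiM_cong[OF refl])
    fix i assume i: "i \<in> {..<n}"
    have "distributed M lborel (\<lambda>\<omega>. B (\<tau> (Suc i)) \<omega> - B (\<tau> i) \<omega>) (normal_density 0 (sqrt (\<tau> (Suc i) - \<tau> i)))"
      using i t pos by (intro bm_increment) auto
    from distributed_distr_eq_density[OF this]
    show "distr M borel (\<lambda>\<omega>. B (\<tau> (Suc i)) \<omega> - B (\<tau> i) \<omega>) =
      density lborel (\<lambda>y. ennreal (normal_density 0 (sqrt (\<tau> (Suc i) - \<tau> i)) y))"
      by (simp cong: distr_cong)
  qed
  finally show ?thesis .
qed

lemma bm_shift: 
  assumes s: "0 \<le> s"
  shows "brownian_motion M 0 (\<lambda>v \<omega>. B (s + v) \<omega> - B s \<omega>)"
  unfolding brownian_motion_def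
proof (intro conjI allI impI)
  show "AE \<omega> in M. continuous_on {0..} (\<lambda>t. B (s + t) \<omega> - B s \<omega>)"
  proof -
    have "AE \<omega> in M. continuous_on {0..} (\<lambda>t. B t \<omega>)" using BM by (simp add: brownian_motion_def)
    then show ?thesis
    proof eventually_elim
      fix \<omega> assume "continuous_on {0..} (\<lambda>t. B t \<omega>)"
      then have "continuous_on ((\<lambda>v. s + v) ` {0..}) (\<lambda>t. B t \<omega>)"
        by (rule continuous_on_subset) (use s in auto)
      from continuous_on_compose[OF continuous_on_add[OF continuous_on_const continuous_on_id] this]
      show "continuous_on {0..} (\<lambda>t. B (s + t) \<omega> - B s \<omega>)"
        by (intro continuous_on_diff continuous_on_const) (simp add: o_def)
    qed
  qed
  show "distributed M lborel (\<lambda>\<omega>. B (s + t) \<omega> - B s \<omega> - (B (s + u) \<omega> - B s \<omega>)) (\<lambda>x. ennreal (normal_density 0 (sqrt (t - u)) x))"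
    if "0 \<le> u \<and> u < t" for u t
    using bm_increment[of "s + u" "s + t"] that s by simp
  show "indep_vars (\<lambda>_. borel) (\<lambda>i \<omega>. B (s + \<tau> (Suc i)) \<omega> - B s \<omega> - (B (s + \<tau> i) \<omega> - B s \<omega>)) {..<n}"
    if "0 \<le> \<tau> 0 \<and> (\<forall>i<n. \<tau> i < \<tau> (Suc i))" for n :: nat and \<tau> :: "nat \<Rightarrow> real"
    using bm_indep[of "\<lambda>i. s + \<tau> i" n] that s by simp
qed (use s bm_measurable bm_prob_space in auto)

text \<open>Refine all times involved to one increasing grid that contains \<open>s\<close>. Values
  up to \<open>s\<close> are sums over the grid increments before \<open>s\<close>, increments from
  \<open>s\<close> on are sums over the later ones, and these two blocks of independent increments
  are disjoint.\<close>

lemma bm_increments_indep: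
  assumes s: "0 \<le> s" and U: "finite U" "U \<subseteq> {0..s}" and V: "finite V" "V \<subseteq> {0..}"
    and A: "\<And>u. A u \<in> sets borel" and A': "\<And>v. A' v \<in> sets borel"
  shows "prob {\<omega>\<in>space M. (\<forall>u\<in>U. B u \<omega> \<in> A u) \<and> (\<forall>v\<in>V. B (s + v) \<omega> - B s \<omega> \<in> A' v)} =
    prob {\<omega>\<in>space M. \<forall>u\<in>U. B u \<omega> \<in> A u} * prob {\<omega>\<in>space M. \<forall>v\<in>V. B (s + v) \<omega> - B s \<omega> \<in> A' v}"
proof -
  define T where "T = {0, s} \<union> U \<union> (\<lambda>v. s + v) ` V"
  have "finite T" "0 \<in> T" "T \<subseteq> {0..}" using U V s by (auto simp: T_def)
  from finite_times_enum[OF this] obtain n \<tau>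
    where t0: "\<tau> 0 = 0" and t: "\<And>i. i < n \<Longrightarrow> \<tau> i < \<tau> (Suc i)" and T: "T = \<tau> ` {..n}" and mono: "strict_mono_on {..n} \<tau>"
    by blast
  have "\<forall>u\<in>T. \<exists>j\<le>n. \<tau> j = u" using T by auto
  then obtain j where j: "\<And>u. u \<in> T \<Longrightarrow> j u \<le> n \<and> \<tau> (j u) = u" by metis
  have jle: "j u \<le> j v" if "u \<le> v" "u \<in> T" "v \<in> T" for u v
    using strict_mono_onD[OF mono, of "j v" "j u"] j[OF that(2)] j[OF that(3)] that(1) by (force simp: not_le[symmetric])
  define D where "D i \<omega> = B (\<tau> (Suc i)) \<omega> - B (\<tau> i) \<omega>" for i \<omega>
  define k where "k = j s"
  have k: "k \<le> n" "\<tau> k = s" using j[of s] by (auto simp: k_def T_def)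
  have pos: "0 \<le> \<tau> i" if "i \<le> n" for i
    using increasing_times_nonneg[of \<tau> n i] t0 t that by simp
  have indep: "indep_vars (\<lambda>_. borel) D {..<n}"
    unfolding D_def by (rule bm_indep) (use t0 t in auto)
  have iv: "indep_var (\<Pi>\<^sub>M i\<in>{..<k}. borel) (\<lambda>\<omega>. \<lambda>i\<in>{..<k}. D i \<omega>) (\<Pi>\<^sub>M i\<in>{k..<n}. borel) (\<lambda>\<omega>. \<lambda>i\<in>{k..<n}. D i \<omega>)"
    by (rule indep_var_restrict[OF indep]) (use k in auto)
  \<comment> \<open>The start is the constant \<open>x\<close>, since \<open>B 0\<close> is not a
    function of the increments; the resulting event \<open>E1\<close> therefore agrees with the past
    event almost surely, not pointwise.\<close>
  define S1 where "S1 = {d \<in> space (\<Pi>\<^sub>M i\<in>{..<k}. (borel::real measure)). \<forall>u\<in>U. x + (\<Sum>i=0..<j u. d i) \<in> A u}"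
  define S2 where "S2 = {d \<in> space (\<Pi>\<^sub>M i\<in>{k..<n}. (borel::real measure)). \<forall>v\<in>V. (\<Sum>i=k..<j (s + v). d i) \<in> A' v}"
  have jU: "j u \<le> k" if "u \<in> U" for u
    unfolding k_def using U that by (intro jle) (auto simp: T_def)
  have jV: "k \<le> j (s + v)" "j (s + v) \<le> n" if "v \<in> V" for v
    unfolding k_def using V that j[of "s + v"] by (auto simp: T_def intro!: jle)
  have S1: "S1 \<in> sets (\<Pi>\<^sub>M i\<in>{..<k}. borel)"
    unfolding S1_def using jU A
    by (intro sets_finite_conj U borel_measurable_add borel_measurable_sum measurable_component_singleton borel_measurable_const)
       (auto intro: less_le_trans)
  have S2: "S2 \<in> sets (\<Pi>\<^sub>M i\<in>{k..<n}. borel)"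
    unfolding S2_def using jV A'
    by (intro sets_finite_conj V borel_measurable_sum measurable_component_singleton) (auto intro: less_le_trans)
  define E1 where "E1 = (\<lambda>\<omega>. \<lambda>i\<in>{..<k}. D i \<omega>) -` S1 \<inter> space M"
  define E2 where "E2 = (\<lambda>\<omega>. \<lambda>i\<in>{k..<n}. D i \<omega>) -` S2 \<inter> space M"
  have E12: "prob (E1 \<inter> E2) = prob E1 * prob E2"
  proof -
    have "E1 \<inter> E2 = (\<lambda>\<omega>. (\<lambda>i\<in>{..<k}. D i \<omega>, \<lambda>i\<in>{k..<n}. D i \<omega>)) -` (S1 \<times> S2) \<inter> space M"
      by (auto simp: E1_def E2_def)
    then show ?thesis using indep_varD[OF iv S1 S2] by (simp add: E1_def E2_def)
  qed
  have E1m: "E1 \<in> events" "E2 \<in> events"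
    using indep_var_rv1[OF iv] indep_var_rv2[OF iv] S1 S2 by (auto simp: E1_def E2_def intro: measurable_sets)
  have sumU: "B u \<omega> = B 0 \<omega> + (\<Sum>i=0..<j u. D i \<omega>)" if "u \<in> U" for u \<omega>
    using sum_increments[of 0 "j u" "\<lambda>i. B (\<tau> i) \<omega>"] j[of u] that by (simp add: D_def t0 T_def)
  have sumV: "B (s + v) \<omega> - B s \<omega> = (\<Sum>i=k..<j (s + v). D i \<omega>)" if "v \<in> V" for v \<omega>
    using sum_increments[OF jV(1)[OF that], of "\<lambda>i. B (\<tau> i) \<omega>"] j[of "s + v"] that k by (simp add: D_def T_def)
  have E1: "\<omega> \<in> E1 \<longleftrightarrow> (\<forall>u\<in>U. B u \<omega> \<in> A u)" if "\<omega> \<in> space M" "B 0 \<omega> = x" for \<omega>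
  proof -
    have "(\<Sum>i=0..<j u. (\<lambda>i\<in>{..<k}. D i \<omega>) i) = (\<Sum>i=0..<j u. D i \<omega>)" if "u \<in> U" for u
      using jU[OF that] by (intro sum.cong) auto
    then show ?thesis using that by (auto simp: E1_def S1_def space_PiM sumU)
  qed
  have E2: "E2 = {\<omega>\<in>space M. \<forall>v\<in>V. B (s + v) \<omega> - B s \<omega> \<in> A' v}"
  proof -
    have "(\<Sum>i=k..<j (s + v). (\<lambda>i\<in>{k..<n}. D i \<omega>) i) = (\<Sum>i=k..<j (s + v). D i \<omega>)" if "v \<in> V" for v \<omega>
      using jV[OF that] by (intro sum.cong) auto
    then show ?thesis by (auto simp: E2_def S2_def space_PiM sumV)
  qed
  have C1: "{\<omega>\<in>space M. \<forall>u\<in>U. B u \<omega> \<in> A u} \<in> events"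
    using U A by (intro sets_finite_conj bm_measurable) auto
  have "prob {\<omega>\<in>space M. \<forall>u\<in>U. B u \<omega> \<in> A u} = prob E1"
    by (rule measure_eq_AE[OF _ C1 E1m(1)]) (use bm_start AE_space in \<open>eventually_elim, simp add: E1\<close>)
  moreover have "prob {\<omega>\<in>space M. (\<forall>u\<in>U. B u \<omega> \<in> A u) \<and> (\<forall>v\<in>V. B (s + v) \<omega> - B s \<omega> \<in> A' v)} = prob (E1 \<inter> E2)"
  proof (rule measure_eq_AE)
    have "{\<omega>\<in>space M. (\<forall>u\<in>U. B u \<omega> \<in> A u) \<and> (\<forall>v\<in>V. B (s + v) \<omega> - B s \<omega> \<in> A' v)} = {\<omega>\<in>space M. \<forall>u\<in>U. B u \<omega> \<in> A u} \<inter> E2"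
      unfolding E2 by auto
    then show "{\<omega>\<in>space M. (\<forall>u\<in>U. B u \<omega> \<in> A u) \<and> (\<forall>v\<in>V. B (s + v) \<omega> - B s \<omega> \<in> A' v)} \<in> events"
      using C1 E1m by auto
    show "AE \<omega> in M. (\<omega> \<in> {\<omega>\<in>space M. (\<forall>u\<in>U. B u \<omega> \<in> A u) \<and> (\<forall>v\<in>V. B (s + v) \<omega> - B s \<omega> \<in> A' v)}) = (\<omega> \<in> E1 \<inter> E2)"
      using bm_start AE_space by eventually_elim (auto simp: E1 E2)
  qed (use E1m in auto)
  ultimately show ?thesis using E12 unfolding E2 by simp
qed

end

text \<open>Both probabilities are the same functional of independent normal increments, whose joint
  law \<open>bm_law\<close> makes explicit.\<close>

lemma bm_fdd_unique:
  assumes M: "brownian_motion M x B" and N: "brownian_motion N x C"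
    and U: "finite U" "U \<subseteq> {0..}" and A: "\<And>u. A u \<in> sets borel"
  shows "measure M {\<omega>\<in>space M. \<forall>u\<in>U. B u \<omega> \<in> A u} = measure N {\<omega>\<in>space N. \<forall>u\<in>U. C u \<omega> \<in> A u}"
proof -
  \<comment> \<open>The time 1 guarantees at least one increment, as \<open>bm_law\<close>
    requires.\<close>
  define T where "T = {0, 1} \<union> U"
  have "finite T" "0 \<in> T" "T \<subseteq> {0..}" using U by (auto simp: T_def)
  from finite_times_enum[OF this] obtain n \<tau>
    where t0: "\<tau> 0 = 0" and t: "\<And>i. i < n \<Longrightarrow> \<tau> i < \<tau> (Suc i)" and T: "T = \<tau> ` {..n}"
    by blast
  have n: "n \<noteq> 0"
  proof
    assume "n = 0" then have "T = {0}" using T t0 by simp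
    then show False by (auto simp: T_def)
  qed
  have "\<forall>u\<in>T. \<exists>j\<le>n. \<tau> j = u" using T by auto
  then obtain j where j: "\<And>u. u \<in> T \<Longrightarrow> j u \<le> n \<and> \<tau> (j u) = u" by metis
  have pos: "0 \<le> \<tau> i" if "i \<le> n" for i
    using increasing_times_nonneg[of \<tau> n i] t0 t that by simp
  define R where "R = (\<Pi>\<^sub>M i\<in>{..<n}. (borel::real measure))"
  define S where "S = {d \<in> space R. \<forall>u\<in>U. x + (\<Sum>i=0..<j u. d i) \<in> A u}"
  have S: "S \<in> sets R"
    unfolding S_def R_def using A j
    by (intro sets_finite_conj U borel_measurable_add borel_measurable_sum measurable_component_singleton borel_measurable_const)
       (auto simp: T_def intro: less_le_trans)
  have key: "measure M {\<omega>\<in>space M. \<forall>u\<in>U. B u \<omega> \<in> A u} =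
     measure (\<Pi>\<^sub>M i\<in>{..<n}. density lborel (\<lambda>y. ennreal (normal_density 0 (sqrt (\<tau> (Suc i) - \<tau> i)) y))) S"
    if M: "brownian_motion M x B" for M :: "'c measure" and B
  proof -
    interpret prob_space M by (rule bm_prob_space[OF M])
    define D where "D \<omega> = (\<lambda>i\<in>{..<n}. B (\<tau> (Suc i)) \<omega> - B (\<tau> i) \<omega>)" for \<omega>
    have D: "D \<in> M \<rightarrow>\<^sub>M R"
      unfolding D_def R_def using pos
      by (intro measurable_restrict borel_measurable_diff bm_measurable[OF M]) auto
    have "measure M {\<omega>\<in>space M. \<forall>u\<in>U. B u \<omega> \<in> A u} = measure M (D -` S \<inter> space M)"
    proof (rule measure_eq_AE)
      show "AE \<omega> in M. (\<omega> \<in> {\<omega>\<in>space M. \<forall>u\<in>U. B u \<omega> \<in> A u}) = (\<omega> \<in> D -` S \<inter> space M)"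
        using bm_start[OF M] AE_space
      proof eventually_elim
        fix \<omega> assume w: "B 0 \<omega> = x" "\<omega> \<in> space M"
        have "B u \<omega> = x + (\<Sum>i=0..<j u. D \<omega> i)" if "u \<in> U" for u
        proof -
          have "(\<Sum>i=0..<j u. D \<omega> i) = (\<Sum>i=0..<j u. B (\<tau> (Suc i)) \<omega> - B (\<tau> i) \<omega>)"
            using j[of u] that by (intro sum.cong) (auto simp: D_def T_def)
          also have "\<dots> = B u \<omega> - B 0 \<omega>"
            using sum_increments[of 0 "j u" "\<lambda>i. B (\<tau> i) \<omega>"] j[of u] that t0 by (simp add: T_def)
          finally show ?thesis using w by simp
        qed
        moreover have "D \<omega> \<in> space R" using measurable_space[OF D] w by simp
        ultimately show "(\<omega> \<in> {\<omega>\<in>space M. \<forall>u\<in>U. B u \<omega> \<in> A u}) = (\<omega> \<in> D -` S \<inter> space M)"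
          using w by (auto simp: S_def)
      qed
      show "{\<omega>\<in>space M. \<forall>u\<in>U. B u \<omega> \<in> A u} \<in> events"
        using U A by (intro sets_finite_conj bm_measurable[OF M]) auto
    qed (use D S in \<open>auto intro: measurable_sets\<close>)
    also have "\<dots> = measure (distr M R D) S" using D S by (simp add: measure_distr)
    also have "distr M R D = (\<Pi>\<^sub>M i\<in>{..<n}. density lborel (\<lambda>y. ennreal (normal_density 0 (sqrt (\<tau> (Suc i) - \<tau> i)) y)))"
      unfolding R_def D_def by (rule bm_law[OF M]) (use t0 t n in auto)
    finally show ?thesis .
  qed
  show ?thesis using key[OF M] key[OF N] by simp
qed

lemma brownian_lawD:
  assumes "brownian_law x P"
  shows "brownian_motion P x coord" "prob_space P" "sets P = sets path_algebra" "space P = path_space"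
  using assms sets_eq_imp_space_eq[of P path_algebra] bm_prob_space[of P x coord] by (auto simp: brownian_law_def)

lemma distr_path_shift:
  assumes P: "brownian_law x P" and W: "brownian_law 0 W" and s: "0 \<le> s"
  shows "distr P path_algebra (path_shift s) = W"
proof -
  note PD = brownian_lawD[OF P] and WD = brownian_lawD[OF W]
  have sh: "path_shift s \<in> P \<rightarrow>\<^sub>M path_algebra"
    using measurable_path_shift[OF s] by (simp add: measurable_cong_sets[OF PD(3) refl])
  show ?thesis
  proof (rule measure_eqI_cylinders[OF prob_space.prob_space_distr[OF PD(2) sh] WD(2)])
    fix C assume C0: "C \<in> cylinders {0..}"
    from cylindersD[OF C0] obtain U A where C: "C = {\<omega>\<in>path_space. \<forall>u\<in>U. coord u \<omega> \<in> A u}" "finite U" "U \<subseteq> {0..}" "\<And>u. A u \<in> sets borel"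
      by (elim exE conjE) (erule that; simp)
    have "measure (distr P path_algebra (path_shift s)) C = measure P (path_shift s -` C \<inter> space P)"
      using sh sets_cylinders C0 by (intro measure_distr) auto
    also have "path_shift s -` C \<inter> space P = {\<omega>\<in>space P. \<forall>u\<in>U. coord (s + u) \<omega> - coord s \<omega> \<in> A u}"
      using C s PD(4) by (auto simp: C(1) coord_path_shift path_shift_in_path_space subset_eq)
    also have "measure P \<dots> = measure W {\<omega>\<in>space W. \<forall>u\<in>U. coord u \<omega> \<in> A u}"
      by (rule bm_fdd_unique[OF bm_shift[OF PD(1) s] WD(1)]) (use C in auto)
    finally show "measure (distr P path_algebra (path_shift s)) C = measure W C"
      by (simp add: C(1) WD(4))
  qed (use WD in auto)
qed

text \<open>Independence is checked on two intersection-stable generators, the cylinders before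
  \<open>s\<close> and the cylinders of the shifted path. The past component is the path itself seen
  through \<open>path_filtration s\<close>; stating the result as a product law turns conditioning
  at time \<open>s\<close> into Fubini.\<close>

lemma distr_markov:
  assumes P: "brownian_law x P" and W: "brownian_law 0 W" and s: "0 \<le> s"
  shows "distr P (path_filtration s \<Otimes>\<^sub>M path_algebra) (\<lambda>\<omega>. (\<omega>, path_shift s \<omega>)) =
    distr P (path_filtration s) (\<lambda>\<omega>. \<omega>) \<Otimes>\<^sub>M W"
proof -
  note PD = brownian_lawD[OF P]
  interpret prob_space P by (rule PD(2))
  have sh: "path_shift s \<in> P \<rightarrow>\<^sub>M path_algebra"
    using measurable_path_shift[OF s] by (simp add: measurable_cong_sets[OF PD(3) refl])
  have id: "(\<lambda>\<omega>. \<omega>) \<in> P \<rightarrow>\<^sub>M path_filtration s"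
    using measurable_id_coord_sigma[of "{0..s}" "{0..}"] by (simp add: measurable_cong_sets[OF PD(3) refl])
  have "indep_var (path_filtration s) (\<lambda>\<omega>. \<omega>) path_algebra (path_shift s)"
    unfolding indep_var_eq
  proof (intro conjI id sh)
    define G where "G = {path_shift s -` C \<inter> path_space | C. C \<in> cylinders {0..}}"
    have 1: "{(\<lambda>\<omega>. \<omega>) -` A \<inter> space P | A. A \<in> sets (path_filtration s)} = sets (path_filtration s)"
      using PD(4) sets.sets_into_space[of _ "path_filtration s"] by (auto simp: Int_absorb2)
    have 2: "{path_shift s -` A \<inter> space P | A. A \<in> sets path_algebra} = sigma_sets path_space G"
      unfolding PD(4) G_def sigma_sets_cylinders[symmetric]
      using sigma_sets_vimage_commute[of "path_shift s" path_space path_space "cylinders {0..}"]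
      by (simp add: path_shift_in_path_space s)
    have "indep_set (cylinders {0..s}) G"
    proof (rule indep_setI)
      show "cylinders {0..s} \<subseteq> events"
        using sets_cylinders[of "{0..s}"] sets_coord_sigma_mono[of "{0..s}" "{0..}"] PD(3) by auto
      show "G \<subseteq> events"
        unfolding G_def using measurable_sets[OF sh] sets_cylinders[of "{0..}"] PD(4) by auto
      fix C D assume C0: "C \<in> cylinders {0..s}" and "D \<in> G"
      then obtain D' where D': "D = path_shift s -` D' \<inter> path_space" "D' \<in> cylinders {0..}" by (auto simp: G_def)
      from cylindersD[OF C0] obtain U A where C: "C = {\<omega>\<in>path_space. \<forall>u\<in>U. coord u \<omega> \<in> A u}" "finite U" "U \<subseteq> {0..s}" "\<And>u. A u \<in> sets borel"
        by (elim exE conjE) (erule that; simp)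
      from cylindersD[OF D'(2)] obtain V A' where V: "D' = {\<omega>\<in>path_space. \<forall>u\<in>V. coord u \<omega> \<in> A' u}" "finite V" "V \<subseteq> {0..}" "\<And>u. A' u \<in> sets borel"
        by (elim exE conjE) (erule that; simp)
      have D: "D = {\<omega>\<in>space P. \<forall>v\<in>V. coord (s + v) \<omega> - coord s \<omega> \<in> A' v}"
        using V s PD(4) by (auto simp: D'(1) V(1) coord_path_shift path_shift_in_path_space subset_eq)
      have CD: "C \<inter> D = {\<omega>\<in>space P. (\<forall>u\<in>U. coord u \<omega> \<in> A u) \<and> (\<forall>v\<in>V. coord (s + v) \<omega> - coord s \<omega> \<in> A' v)}"
        using PD(4) by (auto simp: C(1) D)
      have C1: "C = {\<omega>\<in>space P. \<forall>u\<in>U. coord u \<omega> \<in> A u}" using C PD(4) by simp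
      show "prob (C \<inter> D) = prob C * prob D"
        unfolding CD unfolding C1 D by (rule bm_increments_indep[OF PD(1) s C(2,3) V(2,3)]) (use C V in auto)
    qed
    moreover have "Int_stable G"
    proof (rule Int_stableI)
      fix a b assume "a \<in> G" "b \<in> G"
      then obtain C D where "a = path_shift s -` C \<inter> path_space" "b = path_shift s -` D \<inter> path_space" "C \<in> cylinders {0..}" "D \<in> cylinders {0..}"
        by (auto simp: G_def)
      then show "a \<inter> b \<in> G" using Int_stableD[OF Int_stable_cylinders, of C "{0..}" D]
        by (auto simp: G_def intro!: exI[of _ "C \<inter> D"])
    qed
    ultimately have "indep_set (sigma_sets (space P) (cylinders {0..s})) (sigma_sets (space P) G)"
      by (intro indep_set_sigma_sets Int_stable_cylinders)
    then show "indep_set (sigma_sets (space P) {(\<lambda>\<omega>. \<omega>) -` A \<inter> space P | A. A \<in> sets (path_filtration s)})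
        (sigma_sets (space P) {path_shift s -` A \<inter> space P | A. A \<in> sets path_algebra})"
      unfolding 1 2 unfolding PD(4) sigma_sets_cylinders[symmetric]
      by (subst (1 2) sigma_sets_sigma_sets_eq) (auto simp: cylinders_def G_def)
  qed
  then show ?thesis
    by (simp add: indep_var_distribution_eq distr_path_shift[OF P W s])
qed

lemma measurable_id_filtration:
  assumes "sets P = sets path_algebra"
  shows "(\<lambda>\<omega>. \<omega>) \<in> P \<rightarrow>\<^sub>M path_filtration s"
  using measurable_id_coord_sigma[of "{0..s}" "{0..}"] by (simp add: measurable_cong_sets[OF assms refl])

lemma measurable_filtration_imp:
  assumes "sets P = sets path_algebra" "f \<in> path_filtration s \<rightarrow>\<^sub>M N"
  shows "f \<in> P \<rightarrow>\<^sub>M N"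
  using measurable_compose[OF measurable_id_filtration[OF assms(1)] assms(2)] by simp

lemma measurable_filtration_mono:
  assumes "s \<le> t" "f \<in> path_filtration s \<rightarrow>\<^sub>M N"
  shows "f \<in> path_filtration t \<rightarrow>\<^sub>M N"
  using measurable_compose[OF measurable_id_coord_sigma assms(2), of "{0..t}"] assms(1) by simp

lemma (in prob_space) normal_char:
  assumes "distributed M lborel X (normal_density 0 \<sigma>)" "0 < \<sigma>"
  shows "(\<integral>\<omega>. cis (\<theta> * X \<omega>) \<partial>M) = of_real (exp (- (\<theta>\<^sup>2 * \<sigma>\<^sup>2) / 2))"
proof -
  have d: "distributed M lborel (\<lambda>\<omega>. X \<omega> / \<sigma>) std_normal_density"
    using assms normal_standard_normal_convert[OF assms(2), of X 0] by simp
  have X[measurable]: "X \<in> borel_measurable M" using distributed_measurable[OF assms(1)] by simp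
  have "char std_normal_distribution (\<theta> * \<sigma>) = char (distr M borel (\<lambda>\<omega>. X \<omega> / \<sigma>)) (\<theta> * \<sigma>)"
    using distributed_distr_eq_density[OF d] by (simp cong: distr_cong)
  also have "\<dots> = (\<integral>\<omega>. cis (\<theta> * X \<omega>) \<partial>M)"
    using assms(2) unfolding char_def by (subst integral_distr) (auto simp: cis_conv_exp)
  finally show ?thesis by (simp add: char_std_normal_distribution power_mult_distrib)
qed

text \<open>Conditioning on the past freezes \<open>\<omega>\<close> and replaces the later
  increments by an independent Brownian path from 0.\<close>

lemma markov_nn_integral:
  assumes P: "brownian_law x P" and W: "brownian_law 0 W" and s: "0 \<le> s"
    and f: "f \<in> borel_measurable (path_filtration s \<Otimes>\<^sub>M path_algebra)"
  shows "(\<integral>\<^sup>+\<omega>. f (\<omega>, path_shift s \<omega>) \<partial>P) = (\<integral>\<^sup>+\<omega>. \<integral>\<^sup>+\<omega>'. f (\<omega>, \<omega>') \<partial>W \<partial>P)"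
proof -
  note PD = brownian_lawD[OF P] and WD = brownian_lawD[OF W]
  interpret W: prob_space W by (rule WD)
  have sh: "path_shift s \<in> P \<rightarrow>\<^sub>M path_algebra"
    using measurable_path_shift[OF s] by (simp add: measurable_cong_sets[OF PD(3) refl])
  note id = measurable_id_filtration[OF PD(3), of s]
  have fW: "f \<in> borel_measurable (path_filtration s \<Otimes>\<^sub>M W)"
    using f by (simp add: measurable_cong_sets[OF sets_pair_measure_cong[OF refl WD(3)] refl])
  then have fD: "f \<in> borel_measurable (distr P (path_filtration s) (\<lambda>\<omega>. \<omega>) \<Otimes>\<^sub>M W)"
    by (subst measurable_cong_sets[OF sets_pair_measure_cong[OF sets_distr refl] refl])
  have "(\<integral>\<^sup>+\<omega>. f (\<omega>, path_shift s \<omega>) \<partial>P) =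
    (\<integral>\<^sup>+p. f p \<partial>distr P (path_filtration s \<Otimes>\<^sub>M path_algebra) (\<lambda>\<omega>. (\<omega>, path_shift s \<omega>)))"
    by (rule nn_integral_distr[symmetric]) (use f id sh in \<open>auto intro!: measurable_Pair\<close>)
  also have "\<dots> = (\<integral>\<^sup>+p. f p \<partial>(distr P (path_filtration s) (\<lambda>\<omega>. \<omega>) \<Otimes>\<^sub>M W))"
    by (simp add: distr_markov[OF P W s])
  also have "\<dots> = (\<integral>\<^sup>+\<omega>. \<integral>\<^sup>+\<omega>'. f (\<omega>, \<omega>') \<partial>W \<partial>distr P (path_filtration s) (\<lambda>\<omega>. \<omega>))"
    by (rule W.nn_integral_fst[symmetric, OF fD])
  also have "\<dots> = (\<integral>\<^sup>+\<omega>. \<integral>\<^sup>+\<omega>'. f (\<omega>, \<omega>') \<partial>W \<partial>P)"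
    by (intro nn_integral_distr[OF id] W.borel_measurable_nn_integral_fst fD)
  finally show ?thesis .
qed

lemma markov_integral:
  fixes f :: "_ \<Rightarrow> 'b::{banach, second_countable_topology}"
  assumes P: "brownian_law x P" and W: "brownian_law 0 W" and s: "0 \<le> s"
    and f: "f \<in> borel_measurable (path_filtration s \<Otimes>\<^sub>M path_algebra)"
    and int: "integrable P (\<lambda>\<omega>. f (\<omega>, path_shift s \<omega>))"
  shows "(\<integral>\<omega>. f (\<omega>, path_shift s \<omega>) \<partial>P) = (\<integral>\<omega>. \<integral>\<omega>'. f (\<omega>, \<omega>') \<partial>W \<partial>P)" (is ?A)
    and "integrable P (\<lambda>\<omega>. \<integral>\<omega>'. f (\<omega>, \<omega>') \<partial>W)" (is ?B)
proof -
  note PD = brownian_lawD[OF P] and WD = brownian_lawD[OF W]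
  interpret P: prob_space P by (rule PD)
  interpret W: prob_space W by (rule WD)
  let ?D = "distr P (path_filtration s) (\<lambda>\<omega>. \<omega>)"
  have sh: "path_shift s \<in> P \<rightarrow>\<^sub>M path_algebra"
    using measurable_path_shift[OF s] by (simp add: measurable_cong_sets[OF PD(3) refl])
  note id = measurable_id_filtration[OF PD(3), of s]
  interpret D: prob_space ?D by (rule P.prob_space_distr[OF id])
  interpret DW: pair_sigma_finite ?D W by unfold_locales
  have pr: "(\<lambda>\<omega>. (\<omega>, path_shift s \<omega>)) \<in> P \<rightarrow>\<^sub>M path_filtration s \<Otimes>\<^sub>M path_algebra" using id sh by simp
  have "integrable (distr P (path_filtration s \<Otimes>\<^sub>M path_algebra) (\<lambda>\<omega>. (\<omega>, path_shift s \<omega>))) f"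
    using int by (subst integrable_distr_eq[OF pr f])
  then have fi: "integrable (?D \<Otimes>\<^sub>M W) f" by (simp add: distr_markov[OF P W s])
  have fm: "(\<lambda>\<omega>. \<integral>\<omega>'. f (\<omega>, \<omega>') \<partial>W) \<in> borel_measurable (path_filtration s)"
    by (rule W.borel_measurable_lebesgue_integral)
       (use f in \<open>simp add: measurable_cong_sets[OF sets_pair_measure_cong[OF refl WD(3)] refl]\<close>)
  have "(\<integral>\<omega>. f (\<omega>, path_shift s \<omega>) \<partial>P) = (\<integral>p. f p \<partial>(?D \<Otimes>\<^sub>M W))"
    unfolding distr_markov[OF P W s, symmetric] by (rule integral_distr[OF pr f, symmetric])
  also have "\<dots> = (\<integral>\<omega>. \<integral>\<omega>'. f (\<omega>, \<omega>') \<partial>W \<partial>?D)" by (rule DW.integral_fst'[OF fi, symmetric])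
  also have "\<dots> = (\<integral>\<omega>. \<integral>\<omega>'. f (\<omega>, \<omega>') \<partial>W \<partial>P)" by (rule integral_distr[OF id fm])
  finally show ?A .
  show ?B using DW.integrable_fst'[OF fi] by (subst (asm) integrable_distr_eq[OF id fm])
qed

text \<open>The process \<open>Z\<close> of the overview. Separating the real factor shows that its
  modulus depends on time alone, which supplies the dominating constants below.\<close>

definition wald :: "real \<Rightarrow> real \<Rightarrow> real \<Rightarrow> complex" where
  "wald \<theta> t y = of_real (exp (\<theta>\<^sup>2 * t / 2)) * cis (\<theta> * y)"

lemma norm_wald [simp]: "norm (wald \<theta> t y) = exp (\<theta>\<^sup>2 * t / 2)"
  by (simp add: wald_def norm_mult)

lemma wald_add: "wald \<theta> (s + t) (x + y) = wald \<theta> s x * wald \<theta> t y"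
  by (simp add: wald_def cis_mult[symmetric] exp_add[symmetric] of_real_mult[symmetric] algebra_simps add_divide_distrib del: of_real_mult)

lemma wald_0 [simp]: "wald \<theta> 0 0 = 1"
  by (simp add: wald_def)

lemma borel_measurable_cis [measurable]: "cis \<in> borel_measurable borel"
  by (rule borel_measurable_continuous_onI[OF continuous_on_cis[OF continuous_on_id]])

lemma borel_measurable_wald [measurable (raw)]:
  assumes "f \<in> borel_measurable M" "g \<in> borel_measurable M"
  shows "(\<lambda>x. wald \<theta> (f x) (g x)) \<in> borel_measurable M"
  unfolding wald_def using assms by measurable

lemma continuous_wald:
  "(f \<longlongrightarrow> t) F \<Longrightarrow> (g \<longlongrightarrow> y) F \<Longrightarrow> ((\<lambda>n. wald \<theta> (f n) (g n)) \<longlongrightarrow> wald \<theta> t y) F"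
  unfolding wald_def cis_conv_exp by (intro tendsto_intros) auto

text \<open>The first entrance into \<open>{b..}\<close>. For a path that never reaches
  \<open>b\<close> this is \<open>Inf {}\<close>, about which nothing is known, so it is used only
  on the event that the running maximum has reached \<open>b\<close>.\<close>

definition hit_time :: "real \<Rightarrow> (real \<Rightarrow> real) \<Rightarrow> real" where
  "hit_time b \<omega> = Inf {t. 0 \<le> t \<and> b \<le> coord t \<omega>}"

lemma hit_time:
  assumes w: "\<omega> \<in> path_space" and r: "0 \<le> r" "b \<le> running_max r \<omega>"
  shows "0 \<le> hit_time b \<omega>" "hit_time b \<omega> \<le> r" "b \<le> coord (hit_time b \<omega>) \<omega>"
    "0 \<le> t \<Longrightarrow> b \<le> running_max t \<omega> \<longleftrightarrow> hit_time b \<omega> \<le> t"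
    "coord 0 \<omega> \<le> b \<Longrightarrow> coord (hit_time b \<omega>) \<omega> = b"
proof -
  define H where "H = {t. 0 \<le> t \<and> b \<le> coord t \<omega>}"
  have hit: "hit_time b \<omega> = Inf H" by (simp add: hit_time_def H_def)
  obtain u where u: "0 \<le> u" "u \<le> r" "running_max r \<omega> = coord u \<omega>" using running_max_attained[OF w r(1)] .
  then have uH: "u \<in> H" using r by (simp add: H_def)
  have bdd: "bdd_below H" by (rule bdd_belowI[of _ 0]) (simp add: H_def)
  have "H = {0..} \<inter> (\<lambda>t. coord t \<omega>) -` {b..}" by (auto simp: H_def)
  moreover have "closed ({0..} \<inter> (\<lambda>t. coord t \<omega>) -` {b..})"
    by (intro continuous_closed_preimage continuous_on_path w) auto
  ultimately have "closed H" by simp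
  then have inH: "Inf H \<in> H" using uH bdd by (intro closed_contains_Inf) auto
  show 1: "0 \<le> hit_time b \<omega>" "b \<le> coord (hit_time b \<omega>) \<omega>" using inH by (auto simp: hit H_def)
  show "hit_time b \<omega> \<le> r" unfolding hit using cInf_lower[OF uH bdd] u by simp
  show "b \<le> running_max t \<omega> \<longleftrightarrow> hit_time b \<omega> \<le> t" if t: "0 \<le> t"
  proof
    assume "b \<le> running_max t \<omega>"
    moreover obtain v where v: "0 \<le> v" "v \<le> t" "running_max t \<omega> = coord v \<omega>" using running_max_attained[OF w t] .
    ultimately have "v \<in> H" by (simp add: H_def)
    then show "hit_time b \<omega> \<le> t" unfolding hit using cInf_lower[OF _ bdd, of v] v by simp
  next
    assume "hit_time b \<omega> \<le> t"
    then show "b \<le> running_max t \<omega>" using 1 coord_le_running_max[OF w, of "hit_time b \<omega>" t] by simp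
  qed
  show "coord (hit_time b \<omega>) \<omega> = b" if "coord 0 \<omega> \<le> b"
  \<comment> \<open>Overshooting would, by the intermediate value theorem, put an earlier time at
    level \<open>b\<close>, against the choice of the infimum.\<close>
  proof (rule ccontr)
    assume "coord (hit_time b \<omega>) \<omega> \<noteq> b"
    then have gt: "b < coord (hit_time b \<omega>) \<omega>" using 1 by simp
    have "\<exists>v\<ge>0. v \<le> hit_time b \<omega> \<and> coord v \<omega> = b"
      by (rule IVT') (use that gt 1 in \<open>auto intro!: continuous_on_path w\<close>)
    then obtain v where v: "0 \<le> v" "v \<le> hit_time b \<omega>" "coord v \<omega> = b" by blast
    then have "v \<in> H" by (simp add: H_def)
    then have "hit_time b \<omega> \<le> v" unfolding hit by (rule cInf_lower[OF _ bdd])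
    then show False using v gt by simp
  qed
qed

text \<open>The reference law: Brownian motion from 0, which is the law of the increments after any
  time under every \<open>P_x\<close>.\<close>

locale wiener =
  fixes W :: "(real \<Rightarrow> real) measure"
  assumes W: "brownian_law 0 W"
begin

lemmas WD = brownian_lawD[OF W]

sublocale prob_space W by (rule WD(2))

lemma measurable_W: "f \<in> path_algebra \<rightarrow>\<^sub>M N \<Longrightarrow> f \<in> W \<rightarrow>\<^sub>M N"
  by (simp add: measurable_cong_sets[OF WD(3) refl])

lemma measurable_coord_W [measurable]: "0 \<le> t \<Longrightarrow> coord t \<in> borel_measurable W"
  by (intro measurable_W borel_measurable_coord) simp

lemma measurable_running_max_W [measurable]: "0 \<le> t \<Longrightarrow> running_max t \<in> borel_measurable W"
  by (intro measurable_W borel_measurable_running_max) auto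

lemma start_0: "AE \<omega> in W. coord 0 \<omega> = 0"
  using bm_start[OF WD(1)] .

lemma distributed_coord: "0 < r \<Longrightarrow> distributed W lborel (coord r) (normal_density 0 (sqrt r))"
proof -
  assume r: "0 < r"
  have d: "distributed W lborel (\<lambda>\<omega>. coord r \<omega> - coord 0 \<omega>) (normal_density 0 (sqrt r))"
    using bm_increment[OF WD(1), of 0 r] r by simp
  have "distr W lborel (coord r) = distr W lborel (\<lambda>\<omega>. coord r \<omega> - coord 0 \<omega>)"
    by (rule distr_cong_AE) (use start_0 r in \<open>auto simp: measurable_lborel1\<close>)
  then show ?thesis using d r by (auto simp: distributed_def measurable_lborel1)
qed

lemma integral_wald: "0 \<le> r \<Longrightarrow> (\<integral>\<omega>. wald \<theta> r (coord r \<omega>) \<partial>W) = 1"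
proof (cases "r = 0")
  case True
  have "(\<integral>\<omega>. wald \<theta> r (coord r \<omega>) \<partial>W) = (\<integral>\<omega>. 1 \<partial>W)"
    by (rule integral_cong_AE) (use start_0 True in \<open>auto elim: eventually_mono\<close>)
  then show ?thesis by (simp add: prob_space)
next
  case False
  assume "0 \<le> r"
  then have r: "0 < r" using False by simp
  have "(\<integral>\<omega>. wald \<theta> r (coord r \<omega>) \<partial>W) = of_real (exp (\<theta>\<^sup>2 * r / 2)) * (\<integral>\<omega>. cis (\<theta> * coord r \<omega>) \<partial>W)"
    unfolding wald_def by simp
  also have "\<dots> = of_real (exp (\<theta>\<^sup>2 * r / 2) * exp (- (\<theta>\<^sup>2 * r) / 2))"
    using normal_char[OF distributed_coord[OF r], of \<theta>] r by simp
  also have "\<dots> = 1" by (simp add: exp_add[symmetric])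
  finally show ?thesis .
qed

lemma integrable_bounded_W:
  fixes f :: "_ \<Rightarrow> 'b::{banach, second_countable_topology}"
  assumes "f \<in> borel_measurable W" "\<And>\<omega>. \<omega> \<in> path_space \<Longrightarrow> norm (f \<omega>) \<le> K"
  shows "integrable W f"
  using assms WD(4) by (intro integrable_const_bound[of _ K]) auto

lemma bound_nonneg:
  assumes "\<And>\<omega>. \<omega> \<in> path_space \<Longrightarrow> norm (f \<omega>) \<le> K"
  shows "0 \<le> K"
proof -
  obtain \<omega> where "\<omega> \<in> path_space" using not_empty WD(4) by blast
  then show ?thesis using order_trans[OF norm_ge_zero assms] by blast
qed

text \<open>\<open>wald_add\<close> splits off the factor for the increment after \<open>s\<close>,
  which is independent of the past and has mean 1. Testing against bounded weights \<open>H\<close>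
  takes the place of conditional expectations.\<close>

lemma wald_martingale:
  assumes st: "0 \<le> s" "s \<le> t" and H: "H \<in> borel_measurable (path_filtration s)"
    and bd: "\<And>\<omega>. \<omega> \<in> path_space \<Longrightarrow> norm (H \<omega>) \<le> K"
  shows "(\<integral>\<omega>. H \<omega> * wald \<theta> t (coord t \<omega>) \<partial>W) = (\<integral>\<omega>. H \<omega> * wald \<theta> s (coord s \<omega>) \<partial>W)"
proof -
  define f where "f = (\<lambda>p. H (fst p) * (wald \<theta> s (coord s (fst p)) * wald \<theta> (t - s) (coord (t - s) (snd p))))"
  have c1: "coord s \<in> borel_measurable (path_filtration s)" using st by (intro borel_measurable_coord) auto
  have c2: "coord (t - s) \<in> borel_measurable path_algebra" using st by (intro borel_measurable_coord) auto
  have f: "f \<in> borel_measurable (path_filtration s \<Otimes>\<^sub>M path_algebra)"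
    unfolding f_def
    using measurable_compose[OF measurable_fst H] measurable_compose[OF measurable_fst c1] measurable_compose[OF measurable_snd c2]
    by measurable
  have eq: "f (\<omega>, path_shift s \<omega>) = H \<omega> * wald \<theta> t (coord t \<omega>)" for \<omega>
    using wald_add[of \<theta> s "t - s" "coord s \<omega>" "coord t \<omega> - coord s \<omega>"] st
    by (simp add: f_def coord_path_shift)
  have HW: "H \<in> borel_measurable W" by (rule measurable_filtration_imp[OF WD(3) H])
  have int: "integrable W (\<lambda>\<omega>. f (\<omega>, path_shift s \<omega>))"
    unfolding eq using st
    by (intro integrable_bounded_W[where K="K * exp (\<theta>\<^sup>2 * t / 2)"])
       (auto simp: norm_mult bd mult_right_mono intro!: borel_measurable_times HW)
  have "(\<integral>\<omega>. H \<omega> * wald \<theta> t (coord t \<omega>) \<partial>W) = (\<integral>\<omega>. \<integral>\<omega>'. f (\<omega>, \<omega>') \<partial>W \<partial>W)"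
    using markov_integral(1)[OF W W st(1) f int] by (simp add: eq)
  also have "\<dots> = (\<integral>\<omega>. H \<omega> * wald \<theta> s (coord s \<omega>) \<partial>W)"
    using integral_wald[of "t - s" \<theta>] st by (simp add: f_def)
  finally show ?thesis .
qed

end

section \<open>Optional stopping and the reflection principle\<close>

lemma mult_inverse_cancel: "a * d = 1 \<Longrightarrow> a * b * (c * d) = b * c" for a b c d :: complex
  by algebra

lemma cis_shift_wald: "cis (\<theta> * (x - b)) = cis (- \<theta> * b) * of_real (exp (- \<theta>\<^sup>2 * r / 2)) * wald \<theta> r x"
proof -
  have "of_real (exp (- \<theta>\<^sup>2 * r / 2)) * complex_of_real (exp (\<theta>\<^sup>2 * r / 2)) = 1"
    unfolding of_real_mult[symmetric] exp_add[symmetric] by simp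
  moreover have "cis (\<theta> * (x - b)) = cis (- \<theta> * b) * cis (\<theta> * x)"
    by (simp add: cis_mult algebra_simps)
  ultimately show ?thesis unfolding wald_def
    by (metis mult.assoc mult.left_neutral)
qed

lemma (in prob_space) integral_uniform_measure:
  fixes f :: "'a \<Rightarrow> complex"
  assumes f: "f \<in> borel_measurable M" and G: "G \<in> events" "prob G \<noteq> 0"
  shows "(\<integral>\<omega>. f \<omega> \<partial>uniform_measure M G) = (\<integral>\<omega>. indicator G \<omega> * f \<omega> \<partial>M) / of_real (prob G)"
proof -
  have "uniform_measure M G = density M (\<lambda>\<omega>. ennreal (indicator G \<omega> / prob G))"
    unfolding uniform_measure_def using G
    by (intro arg_cong[where f="density M"] ext) (auto simp: emeasure_eq_measure indicator_def divide_ennreal[symmetric] zero_less_measure_iff)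
  then have "(\<integral>\<omega>. f \<omega> \<partial>uniform_measure M G) = (\<integral>\<omega>. (indicator G \<omega> / prob G) *\<^sub>R f \<omega> \<partial>M)"
    using f G by (simp add: integral_density)
  also have "\<dots> = (\<integral>\<omega>. indicator G \<omega> * f \<omega> / of_real (prob G) \<partial>M)"
    by (rule Bochner_Integration.integral_cong) (auto simp: indicator_def scaleR_conv_of_real divide_simps)
  finally show ?thesis by simp
qed

text \<open>The only step of the indicator lies between \<open>j - 1\<close> and \<open>j\<close>,
  and \<open>z\<close> is taken at its right end.\<close>

lemma sum_unit_jump:
  fixes z :: "nat \<Rightarrow> complex" and j n :: nat
  assumes "1 \<le> j" "j \<le> n"
  shows "(\<Sum>k<n. z (Suc k) * ((if j \<le> Suc k then 1 else 0) - (if j \<le> k then 1 else 0))) = z j"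
proof -
  have "(\<Sum>k<n. z (Suc k) * ((if j \<le> Suc k then 1 else 0) - (if j \<le> k then 1 else 0))) = (\<Sum>k<n. if k = j - 1 then z j else 0)"
    using assms by (intro sum.cong) auto
  also have "\<dots> = z j" using assms by simp
  finally show ?thesis .
qed

context wiener
begin

text \<open>The minimum of \<open>r\<close> and the hitting time of \<open>b\<close>; deciding by
  the maximum avoids \<open>hit_time\<close> where the level is not reached.\<close>

definition stopped_time :: "real \<Rightarrow> real \<Rightarrow> (real \<Rightarrow> real) \<Rightarrow> real" where
  "stopped_time b r \<omega> = (if running_max r \<omega> < b then r else hit_time b \<omega>)"

text \<open>The position at \<open>stopped_time\<close> for paths started at or below
  \<open>b\<close>, written with the constant \<open>b\<close> after a hit, so that no path is
  evaluated at a random time.\<close>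

definition stopped_value :: "real \<Rightarrow> real \<Rightarrow> (real \<Rightarrow> real) \<Rightarrow> real" where
  "stopped_value b r \<omega> = (if running_max r \<omega> < b then coord r \<omega> else b)"

lemma measurable_stopped_value [measurable]: "0 \<le> r \<Longrightarrow> stopped_value b r \<in> borel_measurable W"
  unfolding stopped_value_def by measurable

lemma stopped_time_le_iff:
  assumes w: "\<omega> \<in> path_space" and r: "0 \<le> r"
  shows "stopped_time b r \<omega> \<le> a \<longleftrightarrow> r \<le> a \<or> 0 \<le> a \<and> b \<le> running_max a \<omega>"
proof (cases "running_max r \<omega> < b")
  case True
  have "\<not> b \<le> running_max a \<omega>" if "0 \<le> a" "a < r"
    using running_max_mono[OF w, of a r] that True by simp
  then show ?thesis using True by (cases "r \<le> a") (auto simp: stopped_time_def)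
next
  case False
  then have "b \<le> running_max r \<omega>" by simp
  note h = hit_time[OF w r this]
  have "hit_time b \<omega> \<le> a \<longleftrightarrow> 0 \<le> a \<and> b \<le> running_max a \<omega>"
    using h(1) h(4)[of a] by (cases "0 \<le> a") auto
  then show ?thesis using False h(2) by (auto simp: stopped_time_def)
qed

lemma measurable_stopped_time [measurable]: "0 \<le> r \<Longrightarrow> stopped_time b r \<in> borel_measurable W"
proof (rule borel_measurableI_le)
  fix a assume r: "0 \<le> r"
  have "{\<omega> \<in> space W. stopped_time b r \<omega> \<le> a} =
    (if r \<le> a then space W else if 0 \<le> a then {\<omega> \<in> space W. b \<le> running_max a \<omega>} else {})"
    using r WD(4) by (auto simp: stopped_time_le_iff)
  also have "\<dots> \<in> sets W" using measurable_running_max_W[of a] by (auto intro: borel_measurable_le)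
  finally show "{\<omega> \<in> space W. stopped_time b r \<omega> \<le> a} \<in> sets W" .
qed

lemma stopped_time_bounds:
  assumes "\<omega> \<in> path_space" "0 \<le> r" shows "0 \<le> stopped_time b r \<omega>" "stopped_time b r \<omega> \<le> r"
  using hit_time[OF assms, of b] assms by (auto simp: stopped_time_def not_less)

text \<open>Approximating the hitting time from above by grid times gives stopping times with
  finitely many values, for which the martingale property applies value by value. The expectations
  do not depend on the grid, while the stopped values converge by path continuity and stay bounded
  by \<open>exp (\<theta>\<^sup>2 * r / 2)\<close>.\<close>

lemma optional_stopping:
  assumes b: "0 < b" and r: "0 \<le> r"
  shows "(\<integral>\<omega>. indicator {\<omega>. b \<le> running_max r \<omega>} \<omega> * wald \<theta> r (coord r \<omega>) \<partial>W) =
    (\<integral>\<omega>. indicator {\<omega>. b \<le> running_max r \<omega>} \<omega> * wald \<theta> (hit_time b \<omega>) b \<partial>W)"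
proof (cases "r = 0")
  case True
  have "AE \<omega> in W. \<not> b \<le> running_max r \<omega>"
    using start_0 b True by (auto simp: running_max_0 elim: eventually_mono)
  then have "AE \<omega> in W. indicator {\<omega>. b \<le> running_max r \<omega>} \<omega> = (0::complex)" by eventually_elim simp
  then have "(\<integral>\<omega>. indicator {\<omega>. b \<le> running_max r \<omega>} \<omega> * wald \<theta> r (coord r \<omega>) \<partial>W) = 0"
     "(\<integral>\<omega>. indicator {\<omega>. b \<le> running_max r \<omega>} \<omega> * wald \<theta> (hit_time b \<omega>) b \<partial>W) = 0"
    by (auto intro!: integral_eq_zero_AE elim!: eventually_mono)
  then show ?thesis by simp
next
  case False
  then have r: "0 < r" using r by simp
  define G where "G t = (indicator {\<omega>. b \<le> running_max t \<omega>} :: (real \<Rightarrow> real) \<Rightarrow> complex)" for t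
  define t where "t n k = r * real k / real (Suc n)" for n k
  \<comment> \<open>For a path from 0, \<open>G\<close> jumps at the first grid time not before the
    hit, so \<open>V n\<close> is \<open>Z\<close> at that grid time if there is a hit up to
    \<open>r\<close>, and 0 otherwise.\<close>
  define V where "V n \<omega> = (\<Sum>k<Suc n. wald \<theta> (t n (Suc k)) (coord (t n (Suc k)) \<omega>) * (G (t n (Suc k)) \<omega> - G (t n k) \<omega>))" for n \<omega>
  have tpos: "0 \<le> t n k" for n k using r by (simp add: t_def)
  have tmono: "k \<le> l \<Longrightarrow> t n k \<le> t n l" for n k l using r by (simp add: t_def divide_right_mono)
  have tr: "t n (Suc n) = r" "t n 0 = 0" for n by (simp_all add: t_def)
  have Gm: "0 \<le> s \<Longrightarrow> s \<le> u \<Longrightarrow> G s \<in> borel_measurable (path_filtration u)" for s u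
    using borel_measurable_running_max[of s "{0..u}"] unfolding G_def by measurable
  have GW [measurable]: "0 \<le> s \<Longrightarrow> G s \<in> borel_measurable W" for s
    by (rule measurable_filtration_imp[OF WD(3) Gm]) auto
  have Vm [measurable]: "V n \<in> borel_measurable W" for n
    unfolding V_def using tpos by (intro borel_measurable_sum borel_measurable_times borel_measurable_diff borel_measurable_wald GW) auto
  have intz: "integrable W (\<lambda>\<omega>. wald \<theta> s (coord s \<omega>) * G u \<omega>)" if "0 \<le> s" "0 \<le> u" for s u
    using that by (intro integrable_bounded_W[where K="exp (\<theta>\<^sup>2 * s / 2)"])
      (auto simp: norm_mult G_def indicator_def)
  have EV: "(\<integral>\<omega>. V n \<omega> \<partial>W) = (\<integral>\<omega>. G r \<omega> * wald \<theta> r (coord r \<omega>) \<partial>W)" for n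
  proof -
    have "(\<integral>\<omega>. V n \<omega> \<partial>W) = (\<Sum>k<Suc n. \<integral>\<omega>. wald \<theta> (t n (Suc k)) (coord (t n (Suc k)) \<omega>) * (G (t n (Suc k)) \<omega> - G (t n k) \<omega>) \<partial>W)"
      unfolding V_def by (rule Bochner_Integration.integral_sum) (unfold right_diff_distrib, intro Bochner_Integration.integrable_diff intz tpos)
    \<comment> \<open>The jump of \<open>G\<close> is known at the right end of its cell, so the
      martingale property moves \<open>Z\<close> from there to \<open>r\<close>; the jumps then
      telescope.\<close>
    also have "\<dots> = (\<Sum>k<Suc n. \<integral>\<omega>. wald \<theta> r (coord r \<omega>) * (G (t n (Suc k)) \<omega> - G (t n k) \<omega>) \<partial>W)"
    proof (rule sum.cong[OF refl])
      fix k assume k: "k \<in> {..<Suc n}"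
      have le: "t n (Suc k) \<le> r" using tmono[of "Suc k" "Suc n" n] k by (simp add: tr)
      have "(\<integral>\<omega>. (G (t n (Suc k)) \<omega> - G (t n k) \<omega>) * wald \<theta> r (coord r \<omega>) \<partial>W) =
        (\<integral>\<omega>. (G (t n (Suc k)) \<omega> - G (t n k) \<omega>) * wald \<theta> (t n (Suc k)) (coord (t n (Suc k)) \<omega>) \<partial>W)"
      proof (rule wald_martingale[where K=1, OF tpos le])
        show "(\<lambda>\<omega>. G (t n (Suc k)) \<omega> - G (t n k) \<omega>) \<in> borel_measurable (path_filtration (t n (Suc k)))"
          by (intro borel_measurable_diff Gm tpos tmono) auto
      qed (simp add: G_def indicator_def)
      then show "(\<integral>\<omega>. wald \<theta> (t n (Suc k)) (coord (t n (Suc k)) \<omega>) * (G (t n (Suc k)) \<omega> - G (t n k) \<omega>) \<partial>W) =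
         (\<integral>\<omega>. wald \<theta> r (coord r \<omega>) * (G (t n (Suc k)) \<omega> - G (t n k) \<omega>) \<partial>W)"
        by (simp add: mult.commute)
    qed
    also have "\<dots> = (\<integral>\<omega>. (\<Sum>k<Suc n. wald \<theta> r (coord r \<omega>) * (G (t n (Suc k)) \<omega> - G (t n k) \<omega>)) \<partial>W)"
      using r by (intro Bochner_Integration.integral_sum[symmetric], unfold right_diff_distrib, intro Bochner_Integration.integrable_diff intz tpos) auto
    also have "\<dots> = (\<integral>\<omega>. wald \<theta> r (coord r \<omega>) * (G r \<omega> - G 0 \<omega>) \<partial>W)"
    proof -
      have "(\<Sum>k<Suc n. G (t n (Suc k)) \<omega> - G (t n k) \<omega>) = G r \<omega> - G 0 \<omega>" for \<omega>
        using sum_lessThan_telescope[of "\<lambda>k. G (t n k) \<omega>" "Suc n"] by (simp only: tr)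
      then show ?thesis by (simp only: sum_distrib_left[symmetric])
    qed
    also have "\<dots> = (\<integral>\<omega>. G r \<omega> * wald \<theta> r (coord r \<omega>) \<partial>W)"
    proof (rule integral_cong_AE)
      show "AE \<omega> in W. wald \<theta> r (coord r \<omega>) * (G r \<omega> - G 0 \<omega>) = G r \<omega> * wald \<theta> r (coord r \<omega>)"
        using start_0 by eventually_elim (use b in \<open>simp add: G_def running_max_0\<close>)
    qed (use r in auto)
    finally show ?thesis .
  qed
  have AEs: "AE \<omega> in W. (\<lambda>n. V n \<omega>) \<longlonglongrightarrow> G r \<omega> * wald \<theta> (stopped_time b r \<omega>) b \<and> (\<forall>n. norm (V n \<omega>) \<le> exp (\<theta>\<^sup>2 * r / 2))"
    using start_0 AE_space
  proof eventually_elim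
    fix \<omega> assume w0: "coord 0 \<omega> = 0" and "\<omega> \<in> space W"
    then have w: "\<omega> \<in> path_space" using WD(4) by simp
    show "(\<lambda>n. V n \<omega>) \<longlonglongrightarrow> G r \<omega> * wald \<theta> (stopped_time b r \<omega>) b \<and> (\<forall>n. norm (V n \<omega>) \<le> exp (\<theta>\<^sup>2 * r / 2))"
    proof (cases "running_max r \<omega> < b")
      case True
      have "G (t n k) \<omega> = 0" if "k \<le> Suc n" for n k
      proof -
        have "running_max (t n k) \<omega> \<le> running_max r \<omega>"
          using tmono[OF that, of n] by (intro running_max_mono w tpos) (simp add: tr)
        then show ?thesis using True by (simp add: G_def)
      qed
      then have "V n \<omega> = 0" for n unfolding V_def by (intro sum.neutral) auto
      moreover have "G r \<omega> = 0" using True by (simp add: G_def)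
      ultimately show ?thesis by simp
    next
      case False
      then have br: "b \<le> running_max r \<omega>" by simp
      note h = hit_time[OF w less_imp_le[OF r] br]
      define T where "T = hit_time b \<omega>"
      have XT: "coord T \<omega> = b" using h(5) w0 b by (simp add: T_def)
      have T: "0 < T" "T \<le> r" using h(1,2) XT w0 b by (auto simp: T_def less_le)
      \<comment> \<open>Rounding up gives the first grid time not before \<open>T\<close>; it
        exceeds \<open>T\<close> by at most the mesh \<open>r / Suc n\<close>.\<close>
      define j where "j n = nat \<lceil>T * real (Suc n) / r\<rceil>" for n
      have jT: "j n \<le> k \<longleftrightarrow> T \<le> t n k" for n k
      proof -
        have "j n \<le> k \<longleftrightarrow> T * real (Suc n) / r \<le> real k" by (simp add: j_def ceiling_le_iff)
        also have "\<dots> \<longleftrightarrow> T \<le> t n k" using r by (simp add: t_def field_simps)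
        finally show ?thesis .
      qed
      have j1: "1 \<le> j n" "j n \<le> Suc n" for n
        using jT[of n 0] jT[of n "Suc n"] T by (auto simp: tr)
      have Geq: "G (t n k) \<omega> = (if j n \<le> k then 1 else 0)" for n k
        using h(4)[OF tpos] jT by (simp add: G_def T_def)
      have V: "V n \<omega> = wald \<theta> (t n (j n)) (coord (t n (j n)) \<omega>)" for n
        unfolding V_def Geq using sum_unit_jump[OF j1, of "\<lambda>k. wald \<theta> (t n k) (coord (t n k) \<omega>)" n] by simp
      have lo: "T \<le> t n (j n)" for n unfolding jT[symmetric] by simp
      have up: "t n (j n) \<le> T + r / real (Suc n)" for n
      proof -
        have "\<not> j n \<le> j n - 1" using j1(1)[of n] by linarith
        then have "\<not> T \<le> t n (j n - 1)" unfolding jT .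
        moreover have "t n (j n) = t n (j n - 1) + r / real (Suc n)"
          using j1(1)[of n] r by (simp add: t_def of_nat_diff add_divide_distrib[symmetric] algebra_simps)
        ultimately show ?thesis by simp
      qed
      have lim: "(\<lambda>n. T + r / real (Suc n)) \<longlonglongrightarrow> T"
        using tendsto_add[OF tendsto_const[of T] tendsto_mult[OF tendsto_const[of r] LIMSEQ_Suc[OF lim_1_over_n]]] by simp
      have tj: "(\<lambda>n. t n (j n)) \<longlonglongrightarrow> T"
        by (rule tendsto_sandwich[OF always_eventually always_eventually tendsto_const lim]) (use lo up in auto)
      have "(\<lambda>n. coord (t n (j n)) \<omega>) \<longlonglongrightarrow> coord T \<omega>"
        using T by (intro tendsto_coord w tj tpos) auto
      then have "(\<lambda>n. V n \<omega>) \<longlonglongrightarrow> wald \<theta> T b" unfolding V XT by (intro continuous_wald tj)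
      moreover have "norm (V n \<omega>) \<le> exp (\<theta>\<^sup>2 * r / 2)" for n
        unfolding V using tmono[OF j1(2)[of n], of n] by (simp add: tr mult_left_mono)
      ultimately show ?thesis using br by (simp add: G_def T_def stopped_time_def)
    qed
  qed
  have "(\<lambda>n. \<integral>\<omega>. V n \<omega> \<partial>W) \<longlonglongrightarrow> (\<integral>\<omega>. G r \<omega> * wald \<theta> (stopped_time b r \<omega>) b \<partial>W)"
    by (rule integral_dominated_convergence[where w="\<lambda>_. exp (\<theta>\<^sup>2 * r / 2)"])
       (use AEs r in \<open>auto elim: eventually_mono\<close>)
  moreover have "(\<lambda>n. \<integral>\<omega>. V n \<omega> \<partial>W) \<longlonglongrightarrow> (\<integral>\<omega>. G r \<omega> * wald \<theta> r (coord r \<omega>) \<partial>W)"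
    unfolding EV by simp
  ultimately have "(\<integral>\<omega>. G r \<omega> * wald \<theta> r (coord r \<omega>) \<partial>W) = (\<integral>\<omega>. G r \<omega> * wald \<theta> (stopped_time b r \<omega>) b \<partial>W)"
    by (rule LIMSEQ_unique[rotated])
  also have "\<dots> = (\<integral>\<omega>. G r \<omega> * wald \<theta> (hit_time b \<omega>) b \<partial>W)"
    by (rule Bochner_Integration.integral_cong) (auto simp: G_def stopped_time_def indicator_def)
  finally show ?thesis by (simp add: G_def)
qed

lemma no_atom: "0 < r \<Longrightarrow> measure W {\<omega> \<in> space W. coord r \<omega> = a} = 0"
proof -
  assume r: "0 < r"
  have "AE y in lborel. y \<noteq> a" by (rule AE_lborel_singleton)
  then have "AE y in density lborel (normal_density 0 (sqrt r)). y \<noteq> a" by (subst AE_density) auto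
  then have "AE y in distr W lborel (coord r). y \<noteq> a"
    unfolding distributed_distr_eq_density[OF distributed_coord[OF r]] .
  then have "AE \<omega> in W. coord r \<omega> \<noteq> a" using r by (subst (asm) AE_distr_iff) (auto simp: measurable_lborel1)
  then have "AE \<omega> in W. \<not> (coord r \<omega> = a)" by simp
  then show ?thesis using r by (subst prob_eq_0) auto
qed

text \<open>Optional stopping shows that on the event \<open>b \<le> S\<^sub>r\<close> the characteristic function of
  \<open>X\<^sub>r - b\<close> is real, that is, that \<open>X\<^sub>r - b\<close> is symmetric there.\<close>

lemma reflection_principle:
  assumes b: "0 < b" and r: "0 < r"
  shows "prob {\<omega> \<in> space W. b \<le> running_max r \<omega>} = 2 * prob {\<omega> \<in> space W. b < coord r \<omega>}"
proof -
  have r0: "0 \<le> r" using r by simp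
  define G where "G = {\<omega> \<in> space W. b \<le> running_max r \<omega>}"
  have G [measurable]: "G \<in> events" unfolding G_def using r0 by measurable
  have up: "{\<omega> \<in> space W. b < coord r \<omega>} \<subseteq> G"
    using coord_le_running_max[of _ r r] r WD(4) by (fastforce simp: G_def)
  have upm [measurable]: "{\<omega> \<in> space W. b < coord r \<omega>} \<in> events" "{\<omega> \<in> space W. coord r \<omega> < b} \<in> events"
    using r0 by measurable
  have real: "(\<integral>\<omega>. indicator G \<omega> * cis (\<theta> * (coord r \<omega> - b)) \<partial>W) \<in> \<real>" for \<theta>
  proof -
    have "(\<integral>\<omega>. indicator G \<omega> * cis (\<theta> * (coord r \<omega> - b)) \<partial>W) =
      (\<integral>\<omega>. cis (- \<theta> * b) * of_real (exp (- \<theta>\<^sup>2 * r / 2)) * (indicator {\<omega>. b \<le> running_max r \<omega>} \<omega> * wald \<theta> r (coord r \<omega>)) \<partial>W)"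
    proof (rule Bochner_Integration.integral_cong[OF refl])
      fix \<omega> assume "\<omega> \<in> space W"
      then have "indicator G \<omega> = (indicator {\<omega>. b \<le> running_max r \<omega>} \<omega> :: complex)" by (simp add: G_def indicator_def)
      then show "indicator G \<omega> * cis (\<theta> * (coord r \<omega> - b)) = cis (- \<theta> * b) * of_real (exp (- \<theta>\<^sup>2 * r / 2)) * (indicator {\<omega>. b \<le> running_max r \<omega>} \<omega> * wald \<theta> r (coord r \<omega>))"
        unfolding cis_shift_wald[of \<theta> _ b r] by (simp only: mult_ac)
    qed
    also have "\<dots> = cis (- \<theta> * b) * of_real (exp (- \<theta>\<^sup>2 * r / 2)) * (\<integral>\<omega>. indicator {\<omega>. b \<le> running_max r \<omega>} \<omega> * wald \<theta> (hit_time b \<omega>) b \<partial>W)"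
      using optional_stopping[OF b less_imp_le[OF r], of \<theta>] by simp
    \<comment> \<open>The path sits exactly at \<open>b\<close> when it is stopped, so the phase of
      \<open>Z\<close> there is \<open>cis (\<theta> * b)\<close> and is cancelled; only real
      factors are left.\<close>
    also have "\<dots> = (\<integral>\<omega>. of_real (exp (- \<theta>\<^sup>2 * r / 2) * (indicator {\<omega>. b \<le> running_max r \<omega>} \<omega> * exp (\<theta>\<^sup>2 * hit_time b \<omega> / 2))) \<partial>W)"
      unfolding Bochner_Integration.integral_mult_right_zero[symmetric]
    proof (rule Bochner_Integration.integral_cong[OF refl])
      fix \<omega>
      have "cis (- \<theta> * b) * cis (\<theta> * b) = 1" by (simp add: cis_mult)
      then have "cis (- \<theta> * b) * of_real (exp (- \<theta>\<^sup>2 * r / 2)) * wald \<theta> (hit_time b \<omega>) b = of_real (exp (- \<theta>\<^sup>2 * r / 2) * exp (\<theta>\<^sup>2 * hit_time b \<omega> / 2))"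
        unfolding wald_def of_real_mult by (rule mult_inverse_cancel)
      then show "cis (- \<theta> * b) * of_real (exp (- \<theta>\<^sup>2 * r / 2)) * (indicator {\<omega>. b \<le> running_max r \<omega>} \<omega> * wald \<theta> (hit_time b \<omega>) b) =
        of_real (exp (- \<theta>\<^sup>2 * r / 2) * (indicator {\<omega>. b \<le> running_max r \<omega>} \<omega> * exp (\<theta>\<^sup>2 * hit_time b \<omega> / 2)))"
        by (simp add: indicator_def)
    qed
    also have "\<dots> \<in> \<real>" unfolding integral_complex_of_real by (rule Reals_of_real)
    finally show ?thesis .
  qed
  have sym: "prob (G \<inter> {\<omega> \<in> space W. b < coord r \<omega>}) = prob (G \<inter> {\<omega> \<in> space W. coord r \<omega> < b})"
  proof (cases "prob G = 0")
    case True
    then have "prob (G \<inter> A) = 0" if "A \<in> events" for A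
      using finite_measure_mono[of "G \<inter> A" G] that G by (simp add: measure_le_0_iff)
    then show ?thesis by simp
  next
    case False
    \<comment> \<open>Conditioning on \<open>G\<close> turns the restricted laws of
      \<open>X_r - b\<close> and \<open>b - X_r\<close> into probabilities. Their characteristic
      functions are conjugate, hence equal because real, and Levy's uniqueness theorem
      applies.\<close>
    define N where "N = uniform_measure W G"
    have eG: "emeasure W G \<noteq> 0" "emeasure W G \<noteq> \<infinity>" using False by (auto simp: emeasure_eq_measure)
    interpret N: prob_space N unfolding N_def by (rule prob_space_uniform_measure[OF eG])
    define X1 where "X1 \<omega> = coord r \<omega> - b" for \<omega>
    define X2 where "X2 \<omega> = b - coord r \<omega>" for \<omega>
    have X [measurable]: "X1 \<in> borel_measurable W" "X2 \<in> borel_measurable W"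
      unfolding X1_def X2_def using r0 by measurable
    then have XN: "X1 \<in> borel_measurable N" "X2 \<in> borel_measurable N" by (simp_all add: N_def)
    have Nint: "(\<integral>\<omega>. f \<omega> \<partial>N) = (\<integral>\<omega>. indicator G \<omega> * f \<omega> \<partial>W) / of_real (prob G)"
      if "f \<in> borel_measurable W" for f :: "_ \<Rightarrow> complex"
      unfolding N_def by (rule integral_uniform_measure[OF that G False])
    have cisX: "(\<lambda>\<omega>. cis (\<theta> * X1 \<omega>)) \<in> borel_measurable W" for \<theta>
      using X by measurable
    have "char (distr N borel X1) = char (distr N borel X2)"
    proof
      fix \<theta>
      have "char (distr N borel X2) \<theta> = (\<integral>\<omega>. cnj (cis (\<theta> * X1 \<omega>)) \<partial>N)"
      proof -
        have "iexp (\<theta> * X2 \<omega>) = cnj (cis (\<theta> * X1 \<omega>))" for \<omega>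
          unfolding cis_conv_exp[symmetric] cis_cnj by (simp add: X1_def X2_def algebra_simps)
        then show ?thesis unfolding char_def using XN by (subst integral_distr) auto
      qed
      also have "\<dots> = cnj (\<integral>\<omega>. cis (\<theta> * X1 \<omega>) \<partial>N)" by simp
      also have "(\<integral>\<omega>. cis (\<theta> * X1 \<omega>) \<partial>N) = (\<integral>\<omega>. indicator G \<omega> * cis (\<theta> * (coord r \<omega> - b)) \<partial>W) / of_real (prob G)"
        by (subst Nint) (simp_all add: cisX X1_def[symmetric])
      also have "cnj \<dots> = \<dots>" using real[of \<theta>] by (simp add: Reals_cnj_iff)
      also have "\<dots> = (\<integral>\<omega>. cis (\<theta> * X1 \<omega>) \<partial>N)"
        by (subst Nint) (simp_all add: cisX X1_def[symmetric])
      also have "\<dots> = char (distr N borel X1) \<theta>"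
        unfolding char_def using XN by (subst integral_distr) (auto simp: cis_conv_exp)
      finally show "char (distr N borel X1) \<theta> = char (distr N borel X2) \<theta>" by simp
    qed
    then have "distr N borel X1 = distr N borel X2"
      using XN by (intro Levy_uniqueness N.real_distribution_distr)
    then have "measure N (X1 -` {0<..} \<inter> space N) = measure N (X2 -` {0<..} \<inter> space N)"
      using measure_distr[OF XN(1), of "{0<..}"] measure_distr[OF XN(2), of "{0<..}"] by simp
    moreover have "X1 -` {0<..} \<inter> space N = {\<omega> \<in> space W. b < coord r \<omega>}" "X2 -` {0<..} \<inter> space N = {\<omega> \<in> space W. coord r \<omega> < b}"
      by (auto simp: X1_def X2_def N_def)
    ultimately show ?thesis using eG False by (simp add: N_def)
  qed
  \<comment> \<open>The level \<open>b\<close> itself has probability 0, so symmetry leaves two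
    equal halves; and a path above \<open>b\<close> at time \<open>r\<close> lies in
    \<open>G\<close> automatically.\<close>
  have "prob G = prob (G \<inter> {\<omega> \<in> space W. b < coord r \<omega>}) + prob (G \<inter> {\<omega> \<in> space W. coord r \<omega> < b}) + prob (G \<inter> {\<omega> \<in> space W. coord r \<omega> = b})"
  proof -
    have eq: "G = ((G \<inter> {\<omega> \<in> space W. b < coord r \<omega>}) \<union> (G \<inter> {\<omega> \<in> space W. coord r \<omega> < b})) \<union> (G \<inter> {\<omega> \<in> space W. coord r \<omega> = b})"
      using sets.sets_into_space[OF G] by auto
    have m: "{\<omega> \<in> space W. coord r \<omega> = b} \<in> events" using r0 by measurable
    show ?thesis
      by (subst eq, subst finite_measure_Union, use m in auto, subst finite_measure_Union, auto)
  qed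
  also have "prob (G \<inter> {\<omega> \<in> space W. coord r \<omega> = b}) = 0"
  proof -
    have m: "{\<omega> \<in> space W. coord r \<omega> = b} \<in> events" using r0 by measurable
    then have "prob (G \<inter> {\<omega> \<in> space W. coord r \<omega> = b}) \<le> prob {\<omega> \<in> space W. coord r \<omega> = b}"
      by (intro finite_measure_mono) auto
    then show ?thesis using no_atom[OF r, of b] by (simp add: measure_le_0_iff)
  qed
  finally have "prob G = 2 * prob (G \<inter> {\<omega> \<in> space W. b < coord r \<omega>})" unfolding sym by simp
  also have "G \<inter> {\<omega> \<in> space W. b < coord r \<omega>} = {\<omega> \<in> space W. b < coord r \<omega>}" using up by blast
  finally show ?thesis by (simp add: G_def)
qed

end

section \<open>The killed exponential martingale\<close>

lemma wald_eq_exp: "wald \<theta> \<tau> y = exp ((of_real \<theta>)\<^sup>2 * of_real \<tau> / 2 + \<i> * of_real \<theta> * of_real y)"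
  by (simp add: wald_def exp_add cis_conv_exp exp_of_real[symmetric] mult.assoc)

text \<open>The parameter is made complex so that the mean value bound for complex-differentiable
  functions can control the difference quotients.\<close>

lemma wald_has_field_derivative:
  "((\<lambda>\<zeta>. exp (\<zeta>\<^sup>2 * of_real \<tau> / 2 + \<i> * \<zeta> * of_real y)) has_field_derivative
     (\<i> * of_real y + \<zeta> * of_real \<tau>) * exp (\<zeta>\<^sup>2 * of_real \<tau> / 2 + \<i> * \<zeta> * of_real y)) (at \<zeta> within S)"
  by (auto intro!: derivative_eq_intros simp: algebra_simps)

lemma wald_difference_quotient:
  "(\<lambda>n. (wald (\<theta> + 1 / real (Suc n)) \<tau> y - wald \<theta> \<tau> y) * of_real (real (Suc n)))
     \<longlonglongrightarrow> (\<i> * of_real y + of_real \<theta> * of_real \<tau>) * wald \<theta> \<tau> y"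
proof -
  define g where "g \<zeta> = exp (\<zeta>\<^sup>2 * of_real \<tau> / 2 + \<i> * \<zeta> * of_real y)" for \<zeta> :: complex
  have "((\<lambda>h. (g (of_real \<theta> + h) - g (of_real \<theta>)) / h) \<longlongrightarrow> (\<i> * of_real y + of_real \<theta> * of_real \<tau>) * g (of_real \<theta>)) (at 0)"
    using wald_has_field_derivative[of \<tau> y "of_real \<theta>" UNIV] by (simp add: g_def[symmetric] DERIV_def)
  moreover have "filterlim (\<lambda>n. of_real (1 / real (Suc n)) :: complex) (at 0) sequentially"
    unfolding filterlim_at
  proof
    show "(\<lambda>n. of_real (1 / real (Suc n)) :: complex) \<longlonglongrightarrow> 0"
      using tendsto_of_real[OF LIMSEQ_Suc[OF lim_1_over_n], where 'a=complex] by simp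
    show "\<forall>\<^sub>F n in sequentially. of_real (1 / real (Suc n)) \<in> UNIV \<and> (of_real (1 / real (Suc n)) :: complex) \<noteq> 0"
      by (simp del: of_nat_Suc)
  qed
  ultimately have "(\<lambda>n. (g (of_real \<theta> + of_real (1 / real (Suc n))) - g (of_real \<theta>)) / of_real (1 / real (Suc n)))
     \<longlonglongrightarrow> (\<i> * of_real y + of_real \<theta> * of_real \<tau>) * g (of_real \<theta>)"
    by (rule filterlim_compose)
  moreover have "(g (of_real \<theta> + of_real (1 / real (Suc n))) - g (of_real \<theta>)) / of_real (1 / real (Suc n)) =
    (wald (\<theta> + 1 / real (Suc n)) \<tau> y - wald \<theta> \<tau> y) * of_real (real (Suc n))" for n
    by (simp add: g_def wald_eq_exp del: of_nat_Suc)
  ultimately show ?thesis by (simp add: g_def wald_eq_exp del: of_nat_Suc)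
qed

text \<open>The mean value inequality along the segment from \<open>\<theta>\<close> to
  \<open>\<theta> + 1 / Suc n\<close>. The segment is real, so \<open>norm_wald\<close> controls the
  exponential, and its length is at most 1, whence the \<open>\<bar>\<theta>\<bar> + 1\<close> in a
  bound uniform in \<open>n\<close>.\<close>

lemma wald_difference_bound:
  assumes "0 \<le> \<tau>" "\<tau> \<le> r"
  shows "norm ((wald (\<theta> + 1 / real (Suc n)) \<tau> y - wald \<theta> \<tau> y) * of_real (real (Suc n)))
    \<le> (\<bar>y\<bar> + (\<bar>\<theta>\<bar> + 1) * r) * exp ((\<bar>\<theta>\<bar> + 1)\<^sup>2 * r / 2)"
proof -
  define h where "h = 1 / real (Suc n)"
  have h: "0 < h" "h \<le> 1" by (auto simp: h_def)
  define g where "g \<zeta> = exp (\<zeta>\<^sup>2 * of_real \<tau> / 2 + \<i> * \<zeta> * of_real y)" for \<zeta> :: complex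
  define B where "B = (\<bar>y\<bar> + (\<bar>\<theta>\<bar> + 1) * r) * exp ((\<bar>\<theta>\<bar> + 1)\<^sup>2 * r / 2)"
  let ?S = "closed_segment (complex_of_real \<theta>) (of_real (\<theta> + h))"
  have "norm (g (of_real (\<theta> + h)) - g (of_real \<theta>)) \<le> B * norm (complex_of_real (\<theta> + h) - of_real \<theta>)"
  proof (rule field_differentiable_bound[where S="?S" and f'="\<lambda>\<zeta>. (\<i> * of_real y + \<zeta> * of_real \<tau>) * g \<zeta>"])
    show "convex ?S" by simp
    show "(g has_field_derivative (\<i> * of_real y + \<zeta> * of_real \<tau>) * g \<zeta>) (at \<zeta> within ?S)" for \<zeta>
      unfolding g_def by (rule wald_has_field_derivative)
    fix \<zeta> assume "\<zeta> \<in> ?S"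
    then obtain u where u: "0 \<le> u" "u \<le> 1" "\<zeta> = (1 - u) *\<^sub>R complex_of_real \<theta> + u *\<^sub>R of_real (\<theta> + h)"
      by (auto simp: in_segment)
    define \<xi> where "\<xi> = \<theta> + u * h"
    have \<zeta>: "\<zeta> = of_real \<xi>" by (simp add: u(3) \<xi>_def scaleR_conv_of_real algebra_simps)
    have uh: "0 \<le> u * h" "u * h \<le> 1" using u h by (auto intro: mult_le_one)
    then have \<xi>: "\<bar>\<xi>\<bar> \<le> \<bar>\<theta>\<bar> + 1" unfolding \<xi>_def by linarith
    then have sq: "\<xi>\<^sup>2 \<le> (\<bar>\<theta>\<bar> + 1)\<^sup>2" using abs_le_square_iff[of \<xi> "\<bar>\<theta>\<bar> + 1"] by simp
    have "norm (g \<zeta>) = exp (\<xi>\<^sup>2 * \<tau> / 2)"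
      unfolding \<zeta> g_def using norm_wald[of \<xi> \<tau> y] by (simp add: wald_eq_exp)
    also have "\<dots> \<le> exp ((\<bar>\<theta>\<bar> + 1)\<^sup>2 * r / 2)" using assms sq by (auto intro!: mult_mono)
    finally have 1: "norm (g \<zeta>) \<le> exp ((\<bar>\<theta>\<bar> + 1)\<^sup>2 * r / 2)" .
    have "norm (\<i> * of_real y + \<zeta> * of_real \<tau>) \<le> norm (\<i> * of_real y) + norm (\<zeta> * of_real \<tau>)" by (rule norm_triangle_ineq)
    also have "\<dots> = \<bar>y\<bar> + \<bar>\<xi>\<bar> * \<tau>" using assms by (simp add: norm_mult \<zeta>)
    also have "\<dots> \<le> \<bar>y\<bar> + (\<bar>\<theta>\<bar> + 1) * r" using \<xi> assms by (auto intro!: mult_mono)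
    finally show "norm ((\<i> * of_real y + \<zeta> * of_real \<tau>) * g \<zeta>) \<le> B"
      unfolding B_def norm_mult using 1 assms by (intro mult_mono) auto
  qed auto
  also have "norm (complex_of_real (\<theta> + h) - of_real \<theta>) = h" using h by simp
  finally have "norm (g (of_real (\<theta> + h)) - g (of_real \<theta>)) * real (Suc n) \<le> B * h * real (Suc n)"
    by (rule mult_right_mono) simp
  also have "B * h * real (Suc n) = B" by (simp add: h_def)
  finally show ?thesis by (simp add: norm_mult g_def wald_eq_exp B_def h_def del: of_nat_Suc)
qed

context wiener
begin

lemma integrable_coord: "0 \<le> r \<Longrightarrow> integrable W (coord r)"
proof (cases "r = 0")
  case True
  have "AE \<omega> in W. coord r \<omega> = 0" using start_0 True by simp
  then show ?thesis using integrable_cong_AE[of "coord r" W "\<lambda>_. 0"] True by simp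
next
  case False
  assume "0 \<le> r"
  then have r: "0 < r" using False by simp
  have "integrable lborel (\<lambda>x. normal_density 0 (sqrt r) x * x)"
    using integrable_normal_moment[of "sqrt r" 0 1] r by simp
  then show ?thesis
    using distributed_integrable[OF distributed_coord[OF r], of "\<lambda>x. x"] r by simp
qed

lemma integral_stopped_wald:
  assumes b: "0 < b" and r: "0 \<le> r"
  shows "(\<integral>\<omega>. wald \<theta> (stopped_time b r \<omega>) (stopped_value b r \<omega>) \<partial>W) = 1"
proof -
  let ?I = "\<lambda>\<omega>. indicator {\<omega>. b \<le> running_max r \<omega>} \<omega> :: complex"
  have m: "{\<omega> \<in> space W. b \<le> running_max r \<omega>} \<in> events" using r by measurable
  have im: "?I \<in> borel_measurable W" using r by measurable
  have bd: "integrable W (\<lambda>\<omega>. ?I \<omega> * wald \<theta> r (coord r \<omega>))" "integrable W (\<lambda>\<omega>. wald \<theta> r (coord r \<omega>))"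
     "integrable W (\<lambda>\<omega>. ?I \<omega> * wald \<theta> (stopped_time b r \<omega>) b)"
  proof -
    show "integrable W (\<lambda>\<omega>. ?I \<omega> * wald \<theta> r (coord r \<omega>))" "integrable W (\<lambda>\<omega>. wald \<theta> r (coord r \<omega>))"
      using r im by (auto intro!: integrable_bounded_W[where K="exp (\<theta>\<^sup>2 * r / 2)"] simp: norm_mult indicator_def)
    show "integrable W (\<lambda>\<omega>. ?I \<omega> * wald \<theta> (stopped_time b r \<omega>) b)"
      using r im stopped_time_bounds(2)[OF _ r, of _ b]
      by (auto intro!: integrable_bounded_W[where K="exp (\<theta>\<^sup>2 * r / 2)"] mult_left_mono simp: norm_mult indicator_def)
  qed
  have "wald \<theta> (stopped_time b r \<omega>) (stopped_value b r \<omega>) =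
    wald \<theta> r (coord r \<omega>) - ?I \<omega> * wald \<theta> r (coord r \<omega>) + ?I \<omega> * wald \<theta> (stopped_time b r \<omega>) b" for \<omega>
    by (auto simp: stopped_time_def stopped_value_def indicator_def)
  then have "(\<integral>\<omega>. wald \<theta> (stopped_time b r \<omega>) (stopped_value b r \<omega>) \<partial>W) =
    (\<integral>\<omega>. wald \<theta> r (coord r \<omega>) - ?I \<omega> * wald \<theta> r (coord r \<omega>) + ?I \<omega> * wald \<theta> (stopped_time b r \<omega>) b \<partial>W)"
    by simp
  also have "\<dots> = 1 - (\<integral>\<omega>. ?I \<omega> * wald \<theta> r (coord r \<omega>) \<partial>W) + (\<integral>\<omega>. ?I \<omega> * wald \<theta> (stopped_time b r \<omega>) b \<partial>W)"
    using bd integral_wald[OF r, of \<theta>] by simp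
  also have "(\<integral>\<omega>. ?I \<omega> * wald \<theta> (stopped_time b r \<omega>) b \<partial>W) = (\<integral>\<omega>. ?I \<omega> * wald \<theta> (hit_time b \<omega>) b \<partial>W)"
    by (rule Bochner_Integration.integral_cong) (auto simp: stopped_time_def indicator_def)
  also have "\<dots> = (\<integral>\<omega>. ?I \<omega> * wald \<theta> r (coord r \<omega>) \<partial>W)" by (rule optional_stopping[OF b r, symmetric])
  finally show ?thesis by simp
qed

lemma norm_stopped_wald: "\<omega> \<in> path_space \<Longrightarrow> 0 \<le> r \<Longrightarrow> norm (wald \<theta> (stopped_time b r \<omega>) y) \<le> exp (\<theta>\<^sup>2 * r / 2)"
  using stopped_time_bounds(2)[of \<omega> r b] by (auto intro: mult_left_mono)

text \<open>\<open>integral_stopped_wald\<close> holds for every parameter, so the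
  \<theta>-derivative of the expectation vanishes; differentiation under the integral is dominated
  convergence along the steps \<open>1 / Suc n\<close>.\<close>

lemma integral_stopped_wald_derivative:
  assumes b: "0 < b" and r: "0 \<le> r"
  shows "(\<integral>\<omega>. (\<i> * of_real (stopped_value b r \<omega>) + of_real \<theta> * of_real (stopped_time b r \<omega>)) *
      wald \<theta> (stopped_time b r \<omega>) (stopped_value b r \<omega>) \<partial>W) = 0" (is "?I = 0")
    and "integrable W (\<lambda>\<omega>. (\<i> * of_real (stopped_value b r \<omega>) + of_real \<theta> * of_real (stopped_time b r \<omega>)) *
      wald \<theta> (stopped_time b r \<omega>) (stopped_value b r \<omega>))" (is "integrable W ?f")
proof -
  define q where "q n \<omega> = (wald (\<theta> + 1 / real (Suc n)) (stopped_time b r \<omega>) (stopped_value b r \<omega>) -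
      wald \<theta> (stopped_time b r \<omega>) (stopped_value b r \<omega>)) * of_real (real (Suc n))" for n \<omega>
  have iw: "integrable W (\<lambda>\<omega>. wald \<eta> (stopped_time b r \<omega>) (stopped_value b r \<omega>))" for \<eta>
    using r by (intro integrable_bounded_W[where K="exp (\<eta>\<^sup>2 * r / 2)"] norm_stopped_wald) auto
  have "(\<integral>\<omega>. q n \<omega> \<partial>W) = 0" for n
    unfolding q_def using iw integral_stopped_wald[OF b r] by simp
  have ab: "\<bar>stopped_value b r \<omega>\<bar> \<le> \<bar>coord r \<omega>\<bar> + b" for \<omega>
    using b by (auto simp: stopped_value_def)
  \<comment> \<open>The stopped position is bounded above by \<open>b\<close> but not below, so the
    dominating function involves \<open>\<bar>coord r \<omega>\<bar>\<close>, which is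
    integrable.\<close>
  define w where "w \<omega> = (\<bar>coord r \<omega>\<bar> + b + (\<bar>\<theta>\<bar> + 1) * r) * exp ((\<bar>\<theta>\<bar> + 1)\<^sup>2 * r / 2)" for \<omega>
  have wi: "integrable W w" unfolding w_def using integrable_coord[OF r] by (intro integrable_mult_left Bochner_Integration.integrable_add integrable_abs) auto
  have bound: "AE \<omega> in W. norm (q n \<omega>) \<le> w \<omega>" for n
    using AE_space
  proof eventually_elim
    fix \<omega> assume "\<omega> \<in> space W"
    then have "\<omega> \<in> path_space" using WD(4) by simp
    from wald_difference_bound[OF stopped_time_bounds[OF this r]]
    have "norm (q n \<omega>) \<le> (\<bar>stopped_value b r \<omega>\<bar> + (\<bar>\<theta>\<bar> + 1) * r) * exp ((\<bar>\<theta>\<bar> + 1)\<^sup>2 * r / 2)"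
      unfolding q_def .
    also have "\<dots> \<le> w \<omega>" unfolding w_def using ab[of \<omega>] by (intro mult_right_mono add_right_mono) auto
    finally show "norm (q n \<omega>) \<le> w \<omega>" .
  qed
  have lim: "AE \<omega> in W. (\<lambda>n. q n \<omega>) \<longlonglongrightarrow> ?f \<omega>"
    unfolding q_def using wald_difference_quotient by simp
  have meas: "?f \<in> borel_measurable W" "\<And>n. q n \<in> borel_measurable W"
    unfolding q_def using r by measurable
  show "integrable W ?f" by (rule integrable_dominated_convergence[OF meas(1,2) wi lim bound])
  have "(\<lambda>n. \<integral>\<omega>. q n \<omega> \<partial>W) \<longlonglongrightarrow> ?I"
    by (rule integral_dominated_convergence[OF meas(1,2) wi lim bound])
  then show "?I = 0" using \<open>\<And>n. (\<integral>\<omega>. q n \<omega> \<partial>W) = 0\<close> by (simp add: LIMSEQ_const_iff)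
qed

text \<open>Before the hit the running maximum is below \<open>b\<close> and afterwards it is not,
  so the stopped time is the length of the set of times with \<open>S < b\<close>. The clip
  \<open>max 0 v\<close> keeps the integrand meaningful at negative \<open>v\<close>.\<close>

lemma stopped_time_eq_integral:
  assumes w: "\<omega> \<in> path_space" and r: "0 \<le> r"
  shows "stopped_time b r \<omega> = (\<integral>v. indicator {0..r} v * indicator {v. running_max (max 0 v) \<omega> < b} v \<partial>lborel)"
proof -
  let ?T = "stopped_time b r \<omega>"
  note T = stopped_time_bounds[OF w r, of b]
  have "(\<integral>v. indicator {0..r} v * indicator {v. running_max (max 0 v) \<omega> < b} v \<partial>lborel) = (\<integral>v. indicator {0..<?T} v \<partial>lborel :: real)"
  proof (rule Bochner_Integration.integral_cong_AE)
    \<comment> \<open>If there is no hit up to \<open>r\<close>, the point \<open>r\<close> belongs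
      to the left set but not to \<open>{0..<?T}\<close>; it is a null exception.\<close>
    have *: "0 \<le> v \<and> v \<le> r \<and> running_max (max 0 v) \<omega> < b \<longleftrightarrow> 0 \<le> v \<and> v < ?T" if "v \<noteq> r" for v
    proof -
      have "v < ?T \<longleftrightarrow> v < r \<and> (0 \<le> v \<longrightarrow> running_max v \<omega> < b)"
        using stopped_time_le_iff[OF w r, of b v] by (auto simp: not_le[symmetric])
      then show ?thesis using that T by (auto simp: max_def)
    qed
    have "AE v in lborel. v \<noteq> r" by (rule AE_lborel_singleton)
    then show ae: "AE v in lborel. indicator {0..r} v * indicator {v. running_max (max 0 v) \<omega> < b} v = (indicator {0..<?T} v :: real)"
    proof eventually_elim
      fix v assume "v \<noteq> r"
      from *[OF this] show "indicator {0..r} v * indicator {v. running_max (max 0 v) \<omega> < b} v = (indicator {0..<?T} v :: real)"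
        by (cases "0 \<le> v") (auto simp: indicator_def max_def)
    qed
    have "(\<lambda>v. running_max (max 0 v) \<omega>) \<in> borel_measurable borel"
      by (rule borel_measurable_running_max_joint[of "{0..}"]) (auto simp: w)
    then show "(\<lambda>v. indicator {0..r} v * indicator {v. running_max (max 0 v) \<omega> < b} v :: real) \<in> borel_measurable lborel"
      by measurable
  qed measurable
  also have "\<dots> = ?T" using T by simp
  finally show ?thesis by simp
qed

lemma running_max_joint_W:
  "(\<lambda>p. running_max (max 0 (fst p)) (snd p)) \<in> borel_measurable (borel \<Otimes>\<^sub>M W)"
proof -
  have "snd \<in> borel \<Otimes>\<^sub>M W \<rightarrow>\<^sub>M path_algebra"
    using measurable_compose[OF measurable_snd measurable_W[OF measurable_ident]] by simp
  then show ?thesis by (intro borel_measurable_running_max_joint[of "{0..}"]) auto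
qed

lemma coord_joint_W:
  "(\<lambda>p. coord (max 0 (fst p)) (snd p)) \<in> borel_measurable (borel \<Otimes>\<^sub>M W)"
proof -
  have "snd \<in> borel \<Otimes>\<^sub>M W \<rightarrow>\<^sub>M path_algebra"
    using measurable_compose[OF measurable_snd measurable_W[OF measurable_ident]] by simp
  then show ?thesis by (intro borel_measurable_coord_joint[of "{0..}"]) auto
qed

text \<open>After a hit before \<open>v\<close> the processes stopped at horizons \<open>v\<close>
  and \<open>r\<close> coincide, so the difference of the two stopped exponentials lives on
  \<open>S_v < b\<close>. Its full expectation is \<open>1 - 1 = 0\<close>, which yields the
  equality without a conditional form of optional stopping.\<close>

lemma wald_killed_eq_stopped:
  assumes b: "0 < b" and v: "0 \<le> v" "v \<le> r"
  shows "(\<integral>\<omega>. indicator {\<omega>. running_max v \<omega> < b} \<omega> * wald \<theta> v (coord v \<omega>) \<partial>W) =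
    (\<integral>\<omega>. indicator {\<omega>. running_max v \<omega> < b} \<omega> * wald \<theta> (stopped_time b r \<omega>) (stopped_value b r \<omega>) \<partial>W)"
proof -
  let ?K = "\<lambda>\<omega>. indicator {\<omega>. running_max v \<omega> < b} \<omega> :: complex"
  let ?Z = "\<lambda>v \<omega>. wald \<theta> (stopped_time b v \<omega>) (stopped_value b v \<omega>)"
  have r: "0 \<le> r" using v by simp
  have km: "?K \<in> borel_measurable W" using v by measurable
  have iZ: "integrable W (\<lambda>\<omega>. ?Z u \<omega>)" "integrable W (\<lambda>\<omega>. ?K \<omega> * ?Z u \<omega>)" if "0 \<le> u" for u
    using that km norm_stopped_wald[OF _ that, of _ \<theta> b]
    by (auto intro!: integrable_bounded_W[where K="exp (\<theta>\<^sup>2 * u / 2)"] simp: norm_mult indicator_def simp del: norm_wald)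
  have eq: "?K \<omega> * wald \<theta> v (coord v \<omega>) = ?K \<omega> * ?Z v \<omega>" for \<omega>
    by (simp add: indicator_def stopped_time_def stopped_value_def)
  have "(\<integral>\<omega>. ?K \<omega> * wald \<theta> v (coord v \<omega>) \<partial>W) - (\<integral>\<omega>. ?K \<omega> * ?Z r \<omega> \<partial>W)
    = (\<integral>\<omega>. ?K \<omega> * ?Z v \<omega> \<partial>W) - (\<integral>\<omega>. ?K \<omega> * ?Z r \<omega> \<partial>W)" by (simp only: eq)
  also have "\<dots> = (\<integral>\<omega>. ?K \<omega> * ?Z v \<omega> - ?K \<omega> * ?Z r \<omega> \<partial>W)"
    using iZ v r by simp
  also have "\<dots> = (\<integral>\<omega>. ?Z v \<omega> - ?Z r \<omega> \<partial>W)"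
  proof (rule Bochner_Integration.integral_cong[OF refl])
    fix \<omega> assume "\<omega> \<in> space W"
    then have w: "\<omega> \<in> path_space" using WD(4) by simp
    show "?K \<omega> * ?Z v \<omega> - ?K \<omega> * ?Z r \<omega> = ?Z v \<omega> - ?Z r \<omega>"
      using running_max_mono[OF w v] by (auto simp: indicator_def stopped_time_def stopped_value_def)
  qed
  also have "\<dots> = 0" using iZ v r integral_stopped_wald[OF b, of _ \<theta>] by simp
  finally show ?thesis by simp
qed

text \<open>Write \<open>T\<close>, \<open>Y\<close>, \<open>Z\<close> for the stopped time,
  position and exponential. As \<open>Y = b\<close> after a hit, the first expectation is that of
  \<open>(b - Y) * Z\<close>. The derivative identity gives
  \<open>E[Y Z] = i \<theta> E[T Z]\<close>, and \<open>T\<close> is the integral over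
  \<open>v\<close> of the indicator of \<open>S_v < b\<close>, so Fubini and
  \<open>wald_killed_eq_stopped\<close> turn \<open>E[T Z]\<close> into the second integral.\<close>

lemma killed_identity:
  assumes b: "0 < b" and r: "0 \<le> r"
  shows "(\<integral>\<omega>. indicator {\<omega>. running_max r \<omega> < b} \<omega> * of_real (b - coord r \<omega>) * wald \<theta> r (coord r \<omega>) \<partial>W) +
    \<i> * of_real \<theta> * (\<integral>v. indicator {0..r} v * (\<integral>\<omega>. indicator {\<omega>. running_max (max 0 v) \<omega> < b} \<omega> * wald \<theta> (max 0 v) (coord (max 0 v) \<omega>) \<partial>W) \<partial>lborel)
    = of_real b"
proof -
  let ?T = "stopped_time b r" let ?Y = "stopped_value b r"
  let ?Z = "\<lambda>\<omega>. wald \<theta> (?T \<omega>) (?Y \<omega>)"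
  define k where "k v \<omega> = (indicator {0..r} v * indicator {\<omega>. running_max (max 0 v) \<omega> < b} \<omega> :: complex)" for v \<omega>
  interpret LW: pair_sigma_finite lborel W by unfold_locales
  have iZ: "integrable W ?Z"
    using r by (intro integrable_bounded_W[where K="exp (\<theta>\<^sup>2 * r / 2)"] norm_stopped_wald) auto
  have iTZ: "integrable W (\<lambda>\<omega>. of_real (?T \<omega>) * ?Z \<omega>)"
    using r stopped_time_bounds[OF _ r, of _ b] norm_stopped_wald[OF _ r, of _ \<theta> b]
    by (intro integrable_bounded_W[where K="r * exp (\<theta>\<^sup>2 * r / 2)"]) (auto simp: norm_mult simp del: norm_wald intro!: mult_mono)
  note d = integral_stopped_wald_derivative[OF b r, of \<theta>]
  have "(\<integral>\<omega>. indicator {\<omega>. running_max r \<omega> < b} \<omega> * of_real (b - coord r \<omega>) * wald \<theta> r (coord r \<omega>) \<partial>W) =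
     (\<integral>\<omega>. of_real b * ?Z \<omega> + (\<i> * ((\<i> * of_real (?Y \<omega>) + of_real \<theta> * of_real (?T \<omega>)) * ?Z \<omega>) - \<i> * of_real \<theta> * (of_real (?T \<omega>) * ?Z \<omega>)) \<partial>W)"
    by (rule Bochner_Integration.integral_cong[OF refl])
       (auto simp: stopped_time_def stopped_value_def indicator_def algebra_simps)
  also have "\<dots> = of_real b - \<i> * of_real \<theta> * (\<integral>\<omega>. of_real (?T \<omega>) * ?Z \<omega> \<partial>W)"
    using iZ iTZ d integral_stopped_wald[OF b r, of \<theta>] by simp
  also have "(\<integral>\<omega>. of_real (?T \<omega>) * ?Z \<omega> \<partial>W) = (\<integral>\<omega>. (\<integral>v. k v \<omega> * ?Z \<omega> \<partial>lborel) \<partial>W)"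
  proof (rule Bochner_Integration.integral_cong[OF refl])
    fix \<omega> assume "\<omega> \<in> space W"
    then have w: "\<omega> \<in> path_space" using WD(4) by simp
    have "complex_of_real (?T \<omega>) = (\<integral>v. complex_of_real (indicator {0..r} v * indicator {v. running_max (max 0 v) \<omega> < b} v) \<partial>lborel)"
      unfolding integral_complex_of_real using stopped_time_eq_integral[OF w r, of b] by simp
    also have "\<dots> = (\<integral>v. k v \<omega> \<partial>lborel)"
      by (rule Bochner_Integration.integral_cong) (auto simp: k_def indicator_def)
    finally show "of_real (?T \<omega>) * ?Z \<omega> = (\<integral>v. k v \<omega> * ?Z \<omega> \<partial>lborel)" by simp
  qed
  also have "\<dots> = (\<integral>v. (\<integral>\<omega>. k v \<omega> * ?Z \<omega> \<partial>W) \<partial>lborel)"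
  proof (rule LW.Fubini_integral)
    have m: "(\<lambda>p. k (fst p) (snd p) * ?Z (snd p)) \<in> borel_measurable (borel \<Otimes>\<^sub>M W)"
      unfolding k_def using running_max_joint_W r
        measurable_compose[OF measurable_snd measurable_stopped_time[OF r, of b]] measurable_compose[OF measurable_snd measurable_stopped_value[OF r, of b]]
      by measurable
    show "integrable (lborel \<Otimes>\<^sub>M W) (\<lambda>(v, \<omega>). k v \<omega> * ?Z \<omega>)"
    proof (rule integrableI_bounded_set[where A="{0..r} \<times> space W" and B="exp (\<theta>\<^sup>2 * r / 2)"])
      show "(\<lambda>(v, \<omega>). k v \<omega> * ?Z \<omega>) \<in> borel_measurable (lborel \<Otimes>\<^sub>M W)"
        using m by (simp add: case_prod_unfold measurable_cong_sets[OF sets_pair_measure_cong[OF sets_lborel refl] refl])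
      show "emeasure (lborel \<Otimes>\<^sub>M W) ({0..r} \<times> space W) < \<infinity>"
        using r by (subst emeasure_pair_measure_Times) (auto simp: emeasure_space_1)
      show "AE p in lborel \<Otimes>\<^sub>M W. p \<in> {0..r} \<times> space W \<longrightarrow> norm (case p of (v, \<omega>) \<Rightarrow> k v \<omega> * ?Z \<omega>) \<le> exp (\<theta>\<^sup>2 * r / 2)"
        using norm_stopped_wald[OF _ r, of _ \<theta> b] WD(4)
        by (auto simp: k_def norm_mult indicator_def simp del: norm_wald)
      show "AE p in lborel \<Otimes>\<^sub>M W. p \<notin> {0..r} \<times> space W \<longrightarrow> (case p of (v, \<omega>) \<Rightarrow> k v \<omega> * ?Z \<omega>) = 0"
        by (rule AE_I2) (auto simp: k_def indicator_def space_pair_measure)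
    qed simp
  qed
  also have "\<dots> = (\<integral>v. indicator {0..r} v * (\<integral>\<omega>. indicator {\<omega>. running_max (max 0 v) \<omega> < b} \<omega> * wald \<theta> (max 0 v) (coord (max 0 v) \<omega>) \<partial>W) \<partial>lborel)"
  proof (rule Bochner_Integration.integral_cong[OF refl])
    fix v
    show "(\<integral>\<omega>. k v \<omega> * ?Z \<omega> \<partial>W) = indicator {0..r} v * (\<integral>\<omega>. indicator {\<omega>. running_max (max 0 v) \<omega> < b} \<omega> * wald \<theta> (max 0 v) (coord (max 0 v) \<omega>) \<partial>W)"
      using wald_killed_eq_stopped[OF b, of v r \<theta>] by (cases "v \<in> {0..r}") (auto simp: k_def max_def)
  qed
  finally show ?thesis by simp
qed

end

section \<open>The law of the maximum and functionals of \<open>\<phi>\<close>\<close>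

text \<open>Lebesgue measure on the positive half-line: the limit of the law of the maximum after
  division by \<open>max_rate\<close>, hence the measure over which gains are integrated.\<close>

definition half_lborel :: "real measure" where
  "half_lborel = density lborel (\<lambda>z. ennreal (indicator {0<..} z))"

lemma sets_half_lborel [simp, measurable_cong]: "sets half_lborel = sets borel"
  by (simp add: half_lborel_def)

lemma space_half_lborel [simp]: "space half_lborel = UNIV"
  by (simp add: half_lborel_def)

lemma sigma_finite_half_lborel: "sigma_finite_measure half_lborel"
  unfolding half_lborel_def by (subst sigma_finite_measure.sigma_finite_iff_density_finite[OF sigma_finite_lborel]) auto

interpretation half_lborel: sigma_finite_measure half_lborel by (rule sigma_finite_half_lborel)

lemma nn_integral_half_lborel:
  "f \<in> borel_measurable borel \<Longrightarrow> (\<integral>\<^sup>+z. f z \<partial>half_lborel) = (\<integral>\<^sup>+z. indicator {0<..} z * f z \<partial>lborel)"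
  unfolding half_lborel_def by (subst nn_integral_density) (auto simp: ennreal_indicator)

lemma integral_half_lborel:
  fixes f :: "real \<Rightarrow> 'b::{banach, second_countable_topology}"
  shows "f \<in> borel_measurable borel \<Longrightarrow> (\<integral>z. f z \<partial>half_lborel) = (\<integral>z. indicator {0<..} z *\<^sub>R f z \<partial>lborel)"
  unfolding half_lborel_def by (rule integral_density) auto

lemma integrable_half_lborel:
  fixes f :: "real \<Rightarrow> 'b::{banach, second_countable_topology}"
  shows "f \<in> borel_measurable borel \<Longrightarrow> integrable half_lborel f \<longleftrightarrow> integrable lborel (\<lambda>z. indicator {0<..} z *\<^sub>R f z)"
  unfolding half_lborel_def by (rule integrable_density) auto

text \<open>The right limit at 0 of the density of \<open>S_r\<close>, that is, twice the centred
  normal density of variance \<open>r\<close> at 0.\<close>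

definition max_rate :: "real \<Rightarrow> real" where
  "max_rate r = sqrt (2 / (pi * r))"

lemma max_rate_pos: "0 < r \<Longrightarrow> 0 < max_rate r"
  by (simp add: max_rate_def)

lemma max_rate_antimono: "0 < r \<Longrightarrow> r \<le> s \<Longrightarrow> max_rate s \<le> max_rate r"
  unfolding max_rate_def by (intro real_sqrt_le_mono divide_left_mono mult_left_mono) auto

lemma normal_density_max_rate: "0 < r \<Longrightarrow> 2 * normal_density 0 (sqrt r) z = max_rate r * exp (- z\<^sup>2 / (2 * r))"
proof -
  assume r: "0 < r"
  have "2 / sqrt (2 * pi * r) = (2 / sqrt 2) / sqrt (pi * r)"
    by (simp add: real_sqrt_mult mult.assoc del: real_div_sqrt)
  also have "2 / sqrt 2 = sqrt 2" by (rule real_div_sqrt) simp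
  also have "sqrt 2 / sqrt (pi * r) = sqrt (2 / (pi * r))" by (rule real_sqrt_divide[symmetric])
  finally have "2 / sqrt (2 * pi * r) * exp (- z\<^sup>2 / (2 * r)) = max_rate r * exp (- z\<^sup>2 / (2 * r))"
    by (simp only: max_rate_def)
  then show ?thesis using r by (simp add: normal_density_def)
qed

lemma nn_integral_half_normal:
  assumes r: "0 < r"
  shows "(\<integral>\<^sup>+z. ennreal (2 * normal_density 0 (sqrt r) z) \<partial>half_lborel) = 1"
proof -
  let ?n = "\<lambda>z. ennreal (normal_density 0 (sqrt r) z)"
  have one: "(\<integral>\<^sup>+z. ?n z \<partial>lborel) = 1"
    using nn_integral_eq_integral[OF integrable_normal_density[of "sqrt r" 0]] r by simp
  have "(\<integral>\<^sup>+z. indicator {..<0} z * ?n z \<partial>lborel) = (\<integral>\<^sup>+z. indicator {0<..} z * ?n z \<partial>lborel)"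
    by (subst nn_integral_real_affine[where c="-1" and t=0]) (auto intro!: nn_integral_cong simp: indicator_def normal_density_def)
  moreover have "(\<integral>\<^sup>+z. ?n z \<partial>lborel) = (\<integral>\<^sup>+z. indicator {..<0} z * ?n z + indicator {0<..} z * ?n z \<partial>lborel)"
    by (rule nn_integral_cong_AE) (use AE_lborel_singleton[of 0] in \<open>eventually_elim, auto simp: indicator_def\<close>)
  ultimately have "1 = 2 * (\<integral>\<^sup>+z. indicator {0<..} z * ?n z \<partial>lborel)"
    using one by (simp add: nn_integral_add mult_2)
  also have "\<dots> = (\<integral>\<^sup>+z. indicator {0<..} z * ennreal (2 * normal_density 0 (sqrt r) z) \<partial>lborel)"
    by (subst nn_integral_cmult[symmetric]) (auto intro!: nn_integral_cong simp: ennreal_mult' mult_ac)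
  finally show ?thesis by (simp add: nn_integral_half_lborel)
qed

context wiener
begin

text \<open>The reflection principle gives the tails at levels \<open>b > 0\<close>; for
  \<open>b \<le> 0\<close> both sides have mass 1, the maximum being almost surely at least the
  starting value 0. Upper half-lines form an intersection-stable generator.\<close>

lemma distr_running_max:
  assumes r: "0 < r"
  shows "distr W borel (running_max r) = density half_lborel (\<lambda>z. ennreal (2 * normal_density 0 (sqrt r) z))" (is "?D = ?N")
proof -
  have r0: "0 \<le> r" using r by simp
  note rm = measurable_running_max_W[OF r0]
  interpret D: prob_space ?D by (rule prob_space_distr[OF rm])
  have eq: "emeasure ?D {b..} = emeasure ?N {b..}" for b
  proof -
    have D: "emeasure ?D {b..} = emeasure W {\<omega> \<in> space W. b \<le> running_max r \<omega>}"
      using rm by (subst emeasure_distr) (auto intro!: arg_cong2[where f=emeasure])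
    have N: "emeasure ?N {b..} = (\<integral>\<^sup>+z. ennreal (2 * normal_density 0 (sqrt r) z) * indicator {b..} z \<partial>half_lborel)"
      by (subst emeasure_density) auto
    show ?thesis
    proof (cases "0 < b")
      case False
      have "AE \<omega> in W. b \<le> running_max r \<omega>"
        using start_0 AE_space
      proof eventually_elim
        fix \<omega> assume "coord 0 \<omega> = 0" "\<omega> \<in> space W"
        then show "b \<le> running_max r \<omega>" using coord_le_running_max[of \<omega> 0 r] WD(4) r False by auto
      qed
      then have "emeasure ?D {b..} = 1" unfolding D using rm by (intro emeasure_eq_1_AE) (auto elim: eventually_mono)
      moreover have "emeasure ?N {b..} = 1"
      proof -
        have "emeasure ?N {b..} = (\<integral>\<^sup>+z. ennreal (2 * normal_density 0 (sqrt r) z) \<partial>half_lborel)"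
          unfolding N using False by (subst (1 2) nn_integral_half_lborel) (auto intro!: nn_integral_cong simp: indicator_def)
        then show ?thesis using nn_integral_half_normal[OF r] by simp
      qed
      ultimately show ?thesis by simp
    next
      case True
      have "emeasure ?D {b..} = ennreal (2 * prob {\<omega> \<in> space W. b < coord r \<omega>})"
        unfolding D using reflection_principle[OF True r] by (simp add: emeasure_eq_measure)
      also have "\<dots> = 2 * emeasure (distr W lborel (coord r)) {b<..}"
        using r0 by (subst emeasure_distr) (auto simp: measurable_lborel1 emeasure_eq_measure ennreal_mult' intro!: arg_cong[where f="\<lambda>A. 2 * ennreal (measure W A)"])
      also have "\<dots> = 2 * (\<integral>\<^sup>+z. ennreal (normal_density 0 (sqrt r) z) * indicator {b<..} z \<partial>lborel)"
        unfolding distributed_distr_eq_density[OF distributed_coord[OF r]] by (subst emeasure_density) auto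
      also have "\<dots> = (\<integral>\<^sup>+z. 2 * (ennreal (normal_density 0 (sqrt r) z) * indicator {b<..} z) \<partial>lborel)"
        by (rule nn_integral_cmult[symmetric]) auto
      also have "\<dots> = (\<integral>\<^sup>+z. indicator {0<..} z * (ennreal (2 * normal_density 0 (sqrt r) z) * indicator {b..} z) \<partial>lborel)"
      proof (rule nn_integral_cong_AE)
        show "AE z in lborel. 2 * (ennreal (normal_density 0 (sqrt r) z) * indicator {b<..} z) =
          indicator {0<..} z * (ennreal (2 * normal_density 0 (sqrt r) z) * indicator {b..} z)"
          using AE_lborel_singleton[of b] by eventually_elim (use True in \<open>auto simp: indicator_def ennreal_mult'\<close>)
      qed
      also have "\<dots> = emeasure ?N {b..}" unfolding N by (subst nn_integral_half_lborel) auto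
      finally show ?thesis .
    qed
  qed
  show ?thesis
  proof (rule measure_eqI_generator_eq[where E="range (\<lambda>x::real. {x..})" and \<Omega>=UNIV and A="\<lambda>i. {- real i..}"])
    show "Int_stable (range (\<lambda>x::real. {x..}))"
    proof (rule Int_stableI)
      fix a b :: "real set" assume "a \<in> range (\<lambda>x. {x..})" "b \<in> range (\<lambda>x. {x..})"
      then obtain x y where "a = {x..}" "b = {y..}" by auto
      then have "a \<inter> b = {max x y..}" by auto
      then show "a \<inter> b \<in> range (\<lambda>x. {x..})" by auto
    qed
    have "sets borel = sigma_sets UNIV (range (\<lambda>x::real. {x..}))" by (subst borel_Ici) simp
    then show "sets ?D = sigma_sets UNIV (range (\<lambda>x::real. {x..}))" "sets ?N = sigma_sets UNIV (range (\<lambda>x::real. {x..}))" by simp_all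
    show "(\<Union>i. {- real i..}) = UNIV"
    proof (intro set_eqI iffI UNIV_I)
      fix x :: real
      obtain n where "- x \<le> real n" using real_arch_simple by blast
      then show "x \<in> (\<Union>i. {- real i..})" by (intro UN_I[of n]) auto
    qed
    show "emeasure ?D {- real i..} \<noteq> \<infinity>" for i using D.emeasure_finite by simp
  qed (use eq in auto)
qed

lemma nn_integral_running_max:
  assumes r: "0 < r" and f: "f \<in> borel_measurable borel"
  shows "(\<integral>\<^sup>+\<omega>. f (running_max r \<omega>) \<partial>W) = ennreal (max_rate r) * (\<integral>\<^sup>+z. ennreal (exp (- z\<^sup>2 / (2 * r))) * f z \<partial>half_lborel)"
proof -
  have "(\<integral>\<^sup>+\<omega>. f (running_max r \<omega>) \<partial>W) = (\<integral>\<^sup>+z. f z \<partial>distr W borel (running_max r))"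
    using f r by (intro nn_integral_distr[symmetric]) auto
  also have "\<dots> = (\<integral>\<^sup>+z. ennreal (2 * normal_density 0 (sqrt r) z) * f z \<partial>half_lborel)"
    unfolding distr_running_max[OF r] using f by (subst nn_integral_density) auto
  also have "\<dots> = (\<integral>\<^sup>+z. ennreal (max_rate r) * (ennreal (exp (- z\<^sup>2 / (2 * r))) * f z) \<partial>half_lborel)"
    unfolding normal_density_max_rate[OF r] using r by (intro nn_integral_cong) (simp add: ennreal_mult' max_rate_def mult.assoc)
  also have "\<dots> = ennreal (max_rate r) * (\<integral>\<^sup>+z. ennreal (exp (- z\<^sup>2 / (2 * r))) * f z \<partial>half_lborel)"
    using f by (intro nn_integral_cmult) auto
  finally show ?thesis .
qed

end

lemma running_max_shift:
  assumes w: "\<omega> \<in> path_space" and s: "0 \<le> s" and r: "0 \<le> r"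
  shows "running_max (s + r) \<omega> = max (running_max s \<omega>) (coord s \<omega> + running_max r (path_shift s \<omega>))"
proof (rule antisym)
  note sh = path_shift_in_path_space[OF w s]
  show "running_max (s + r) \<omega> \<le> max (running_max s \<omega>) (coord s \<omega> + running_max r (path_shift s \<omega>))"
  proof (rule running_max_leI)
    fix u assume u: "0 \<le> u" "u \<le> s + r"
    show "coord u \<omega> \<le> max (running_max s \<omega>) (coord s \<omega> + running_max r (path_shift s \<omega>))"
    proof (cases "u \<le> s")
      case True
      then show ?thesis using coord_le_running_max[OF w u(1) True] by simp
    next
      case False
      then have "coord (u - s) (path_shift s \<omega>) \<le> running_max r (path_shift s \<omega>)"
        using u by (intro coord_le_running_max sh) auto
      then show ?thesis using False by (simp add: coord_path_shift)
    qed
  qed (use s r in simp)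
  have "running_max s \<omega> \<le> running_max (s + r) \<omega>" using r by (intro running_max_mono w s) simp
  moreover have "running_max r (path_shift s \<omega>) \<le> running_max (s + r) \<omega> - coord s \<omega>"
  proof (rule running_max_leI[OF r])
    fix u assume "0 \<le> u" "u \<le> r"
    then show "coord u (path_shift s \<omega>) \<le> running_max (s + r) \<omega> - coord s \<omega>"
      using coord_le_running_max[OF w, of "s + u" "s + r"] s by (simp add: coord_path_shift)
  qed
  ultimately show "max (running_max s \<omega>) (coord s \<omega> + running_max r (path_shift s \<omega>)) \<le> running_max (s + r) \<omega>" by simp
qed

text \<open>The function \<open>m\<close> of the overview. The integral form, unlike the closed one
  in \<open>max_gain_eq\<close>, is visibly linear and monotone in \<open>\<phi>\<close> and
  compares directly with the law of the maximum.\<close>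

definition max_gain :: "(real \<Rightarrow> real) \<Rightarrow> real \<Rightarrow> real \<Rightarrow> real" where
  "max_gain \<phi> s y = (\<integral>z. \<phi> (max s (y + z)) \<partial>half_lborel)"

lemma integrable_max_gain:
  fixes \<phi> :: "real \<Rightarrow> real"
  assumes \<phi>: "integrable lborel \<phi>"
  shows "integrable half_lborel (\<lambda>z. \<phi> (max s (y + z)))"
proof -
  have [measurable]: "\<phi> \<in> borel_measurable borel" using borel_measurable_integrable[OF \<phi>] by simp
  have "integrable lborel (\<lambda>z. indicator {0<..} z *\<^sub>R \<phi> (max s (y + z)))"
  proof (rule Bochner_Integration.integrable_bound)
    have "integrable lborel (\<lambda>z. indicator {0..\<bar>s - y\<bar>} z *\<^sub>R \<bar>\<phi> s\<bar>)" by simp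
    moreover have "integrable lborel (\<lambda>z. \<bar>\<phi> (y + 1 * z)\<bar>)" by (intro integrable_abs lborel_integrable_real_affine \<phi>) simp
    ultimately show "integrable lborel (\<lambda>z. indicator {0..\<bar>s - y\<bar>} z *\<^sub>R \<bar>\<phi> s\<bar> + \<bar>\<phi> (y + 1 * z)\<bar>)"
      by (rule Bochner_Integration.integrable_add)
    show "AE z in lborel. norm (indicator {0<..} z *\<^sub>R \<phi> (max s (y + z))) \<le> norm (indicator {0..\<bar>s - y\<bar>} z *\<^sub>R \<bar>\<phi> s\<bar> + \<bar>\<phi> (y + 1 * z)\<bar>)"
      by (rule AE_I2) (auto simp: indicator_def max_def)
  qed measurable
  then show ?thesis by (subst integrable_half_lborel) auto
qed

lemma nn_integral_max_gain:
  assumes \<phi>: "integrable lborel \<phi>" "\<And>x. 0 \<le> \<phi> x"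
  shows "(\<integral>\<^sup>+z. ennreal (\<phi> (max s (y + z))) \<partial>half_lborel) = ennreal (max_gain \<phi> s y)"
  unfolding max_gain_def using \<phi> by (intro nn_integral_eq_integral integrable_max_gain) auto

lemma max_gain_eq:
  assumes \<phi>: "integrable lborel \<phi>" and sy: "y \<le> s"
  shows "max_gain \<phi> s y = (s - y) * \<phi> s + (LINT x:{s<..}|lborel. \<phi> x)"
proof -
  have [measurable]: "\<phi> \<in> borel_measurable borel" using borel_measurable_integrable[OF \<phi>] by simp
  have i1: "integrable lborel (\<lambda>x. indicator {s<..} x *\<^sub>R \<phi> x)"
    using \<phi> by (intro integrable_mult_indicator) auto
  have i2: "integrable lborel (\<lambda>z. indicator {s<..} (y + 1 * z) *\<^sub>R \<phi> (y + 1 * z))"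
    using lborel_integrable_real_affine[OF i1, of 1 y] by simp
  have "max_gain \<phi> s y = (\<integral>z. indicator {0<..} z *\<^sub>R \<phi> (max s (y + z)) \<partial>lborel)"
    unfolding max_gain_def by (rule integral_half_lborel) auto
  also have "\<dots> = (\<integral>z. indicator {0<..s - y} z *\<^sub>R \<phi> s + indicator {s<..} (y + 1 * z) *\<^sub>R \<phi> (y + 1 * z) \<partial>lborel)"
    using sy by (intro Bochner_Integration.integral_cong) (auto simp: indicator_def max_def)
  also have "\<dots> = (s - y) * \<phi> s + (\<integral>z. indicator {s<..} (y + 1 * z) *\<^sub>R \<phi> (y + 1 * z) \<partial>lborel)"
    using i2 sy by (subst Bochner_Integration.integral_add) auto
  also have "(\<integral>z. indicator {s<..} (y + 1 * z) *\<^sub>R \<phi> (y + 1 * z) \<partial>lborel) = (\<integral>x. indicator {s<..} x *\<^sub>R \<phi> x \<partial>lborel)"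
    using lborel_integral_real_affine[of 1 "\<lambda>x. indicator {s<..} x *\<^sub>R \<phi> x" y] by simp
  finally show ?thesis by (simp add: set_lebesgue_integral_def)
qed

text \<open>For this \<open>\<phi>\<close> the gain is the payoff \<open>c - y\<close>, killed when
  the maximum reaches \<open>c\<close>; this is why \<open>killed_identity\<close> is the base
  case.\<close>

lemma max_gain_indicator:
  assumes "s \<le> s'" "y \<le> s'"
  shows "max_gain (indicator {s..<c}) s' y = (if s' < c then c - y else 0)"
proof -
  have "max_gain (indicator {s..<c}) s' y = (\<integral>z. indicator {0<..} z *\<^sub>R indicator {s..<c} (max s' (y + z)) \<partial>lborel)"
    unfolding max_gain_def by (rule integral_half_lborel) auto
  also have "\<dots> = (\<integral>z. indicator (if s' < c then {0<..<c - y} else {}) z \<partial>lborel)"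
    using assms by (intro Bochner_Integration.integral_cong) (auto simp: indicator_def)
  also have "\<dots> = (if s' < c then c - y else 0)" using assms by auto
  finally show ?thesis .
qed

text \<open>Linear functionals that respect dominated convergence, so that an identity linear in
  \<open>\<phi>\<close> can be verified by one induction over sets. Convergence and domination are
  required at every point: functionals such as \<open>max_gain\<close> see the single value
  \<open>\<phi> s\<close>, so null sets may not be ignored.\<close>

definition dct_functional :: "((real \<Rightarrow> real) \<Rightarrow> complex) \<Rightarrow> bool" where
  "dct_functional L \<longleftrightarrow>
     (\<forall>f g. integrable lborel f \<longrightarrow> integrable lborel g \<longrightarrow> L (\<lambda>x. f x + g x) = L f + L g) \<and>
     (\<forall>f c. integrable lborel f \<longrightarrow> L (\<lambda>x. c * f x) = of_real c * L f) \<and>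
     (\<forall>s f g. (\<forall>i. integrable lborel (s i)) \<longrightarrow> integrable lborel f \<longrightarrow> integrable lborel g \<longrightarrow>
        (\<forall>x. (\<lambda>i. s i x) \<longlonglongrightarrow> f x) \<longrightarrow> (\<forall>i x. \<bar>s i x\<bar> \<le> g x) \<longrightarrow> (\<lambda>i::nat. L (s i)) \<longlonglongrightarrow> L f)"

lemma dct_functionalD:
  assumes "dct_functional L"
  shows "integrable lborel f \<Longrightarrow> integrable lborel g \<Longrightarrow> L (\<lambda>x. f x + g x) = L f + L g"
    and "integrable lborel f \<Longrightarrow> L (\<lambda>x. c * f x) = of_real c * L f"
    and "(\<And>i. integrable lborel (s i)) \<Longrightarrow> integrable lborel f \<Longrightarrow> integrable lborel g \<Longrightarrow>
        (\<And>x. (\<lambda>i. s i x) \<longlonglongrightarrow> f x) \<Longrightarrow> (\<And>i x. \<bar>s i x\<bar> \<le> g x) \<Longrightarrow> (\<lambda>i::nat. L (s i)) \<longlonglongrightarrow> L f"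
  using assms unfolding dct_functional_def by blast+

lemma dct_functional_add:
  "dct_functional L \<Longrightarrow> dct_functional L' \<Longrightarrow> dct_functional (\<lambda>f. L f + L' f)"
  unfolding dct_functional_def by (auto simp: algebra_simps intro!: tendsto_add)

lemma dct_functional_cmult:
  "dct_functional L \<Longrightarrow> dct_functional (\<lambda>f. c * L f)"
  unfolding dct_functional_def by (auto simp: algebra_simps intro!: tendsto_mult)

lemma integrable_scaleR_bounded:
  fixes f :: "'c \<Rightarrow> real" and w :: "'c \<Rightarrow> complex"
  assumes f: "integrable N f" and w: "w \<in> borel_measurable N" "\<And>p. p \<in> space N \<Longrightarrow> norm (w p) \<le> K"
  shows "integrable N (\<lambda>p. f p *\<^sub>R w p)"
proof (rule Bochner_Integration.integrable_bound)
  show "integrable N (\<lambda>p. K * f p)" using f by simp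
  show "(\<lambda>p. f p *\<^sub>R w p) \<in> borel_measurable N" using f w by measurable
  show "AE p in N. norm (f p *\<^sub>R w p) \<le> norm (K * f p)"
  proof (rule AE_I2)
    fix p assume "p \<in> space N"
    then show "norm (f p *\<^sub>R w p) \<le> norm (K * f p)"
      using mult_left_mono[OF w(2), of p "\<bar>f p\<bar>"] order_trans[OF norm_ge_zero w(2)]
      by (simp add: abs_mult mult.commute)
  qed
qed

lemma dct_functional_integral:
  assumes w: "w \<in> borel_measurable N" "\<And>p. p \<in> space N \<Longrightarrow> norm (w p) \<le> K"
    and int: "\<And>f :: real \<Rightarrow> real. integrable lborel f \<Longrightarrow> integrable N (\<lambda>p. f (u p))"
  shows "dct_functional (\<lambda>f. \<integral>p. f (u p) *\<^sub>R (w p :: complex) \<partial>N)"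
proof -
  have int': "integrable N (\<lambda>p. f (u p) *\<^sub>R w p)" if "integrable lborel f" for f
    by (rule integrable_scaleR_bounded[OF int[OF that] w])
  show ?thesis
    unfolding dct_functional_def
  proof (intro conjI allI impI)
    fix s :: "nat \<Rightarrow> real \<Rightarrow> real" and f g :: "real \<Rightarrow> real"
    assume a: "\<forall>i. integrable lborel (s i)" "integrable lborel f" "integrable lborel g"
      "\<forall>x. (\<lambda>i. s i x) \<longlonglongrightarrow> f x" "\<forall>i x. \<bar>s i x\<bar> \<le> g x"
    show "(\<lambda>i. \<integral>p. s i (u p) *\<^sub>R w p \<partial>N) \<longlonglongrightarrow> (\<integral>p. f (u p) *\<^sub>R w p \<partial>N)"
    proof (rule integral_dominated_convergence[where w="\<lambda>p. g (u p) * K"])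
      show "integrable N (\<lambda>p. g (u p) * K)" using int[OF a(3)] by simp
      show "AE p in N. (\<lambda>i. s i (u p) *\<^sub>R w p) \<longlonglongrightarrow> f (u p) *\<^sub>R w p"
        using a(4) by (intro AE_I2 tendsto_intros) auto
      show "AE p in N. norm (s i (u p) *\<^sub>R w p) \<le> g (u p) * K" for i
      proof (rule AE_I2)
        fix p assume p: "p \<in> space N"
        have "\<bar>s i (u p)\<bar> * norm (w p) \<le> g (u p) * K"
          using a(5) w(2)[OF p] by (intro mult_mono) (auto intro: order_trans[OF abs_ge_zero])
        then show "norm (s i (u p) *\<^sub>R w p) \<le> g (u p) * K" by simp
      qed
    qed (use int'[OF a(2)] int' a(1) in auto)
  qed (use int' in \<open>auto simp: scaleR_add_left scaleR_scaleR[symmetric] scaleR_conv_of_real[of _ "integral\<^sup>L N _"] simp del: scaleR_scaleR\<close>)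
qed

text \<open>The sets \<open>A\<close> for which the functional vanishes on the indicator of
  \<open>A \<inter> {s..<N}\<close> form a Dynkin system containing the half-lines
  \<open>{..<c}\<close>. Letting \<open>N\<close> grow and using \<open>restr\<close> covers
  indicators of sets of finite measure, and integrable functions follow by approximation.\<close>

lemma dct_functional_eq_0:
  assumes L: "dct_functional L" and base: "\<And>c. L (indicator {s..<c}) = 0"
    and restr: "\<And>f. L f = L (\<lambda>x. indicator {s..} x * f x)" and \<phi>: "integrable lborel \<phi>"
  shows "L \<phi> = 0"
proof -
  note D = dct_functionalD[OF L]
  have ii: "integrable lborel (indicator (A \<inter> {s..<N}) :: real \<Rightarrow> real)" if "A \<in> sets borel" for A N
  proof -
    have "emeasure lborel (A \<inter> {s..<N}) \<le> emeasure lborel {s..N}"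
      using that by (intro emeasure_mono) auto
    also have "\<dots> < \<infinity>" by (simp add: emeasure_lborel_Icc_eq)
    finally show ?thesis using that by simp
  qed
  have L0: "L (\<lambda>_. 0) = 0" using D(2)[of "\<lambda>_. 0" 0] by simp
  \<comment> \<open>Truncating at \<open>N\<close> keeps every indicator integrable, in particular
    that of a complement, so that linearity may be applied.\<close>
  have bounded: "L (indicator (A \<inter> {s..<N})) = 0" if "A \<in> sets borel" for A N
  proof -
    have stable: "Int_stable (range (lessThan :: real \<Rightarrow> _))"
    proof (rule Int_stableI)
      fix a b :: "real set" assume "a \<in> range lessThan" "b \<in> range lessThan"
      then obtain x y where "a = {..<x}" "b = {..<y}" by auto
      then have "a \<inter> b = {..<min x y}" by auto
      then show "a \<inter> b \<in> range lessThan" by auto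
    qed
    have sigma: "sets borel = sigma_sets UNIV (range (lessThan :: real \<Rightarrow> _))" by (subst borel_Iio) simp
    have sub: "range (lessThan :: real \<Rightarrow> _) \<subseteq> Pow UNIV" by simp
    have "A \<in> sigma_sets UNIV (range lessThan)" using that unfolding sigma .
    from stable sub this show ?thesis
    proof (induction A rule: sigma_sets_induct_disjoint)
      case (basic A)
      then obtain c where "A = {..<c}" by auto
      then have "A \<inter> {s..<N} = {s..<min c N}" by auto
      then show ?case using base by simp
    next
      case empty
      then show ?case using L0 by (simp add: indicator_def[abs_def])
    next
      case (compl A)
      then have A: "A \<in> sets borel" by (simp add: sigma)
      have "indicator ((UNIV - A) \<inter> {s..<N}) = (\<lambda>x. indicator {s..<N} x + (-1) * indicator (A \<inter> {s..<N}) x :: real)"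
        by (auto simp: indicator_def)
      moreover have "L (\<lambda>x. indicator {s..<N} x + (-1) * indicator (A \<inter> {s..<N}) x) = 0"
      proof -
        have "L (\<lambda>x. (-1) * indicator (A \<inter> {s..<N}) x) = 0" using D(2)[OF ii[OF A, of N], of "-1"] compl(2) by simp
        then show ?thesis
          using D(1)[of "indicator {s..<N}" "\<lambda>x. (-1) * indicator (A \<inter> {s..<N}) x"] ii[of UNIV N] ii[OF A, of N] base[of N] by simp
      qed
      ultimately show ?case by simp
    next
      case (union A)
      then have A: "A i \<in> sets borel" for i by (auto simp: sigma)
      define S where "S n x = (\<Sum>i<n. indicator (A i \<inter> {s..<N}) x :: real)" for n :: nat and x
      have Seq: "S n x = indicator ((\<Union>i<n. A i) \<inter> {s..<N}) x" for n x
      proof -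
        have "disjoint_family_on (\<lambda>i. A i \<inter> {s..<N}) {..<n}"
          using union(1) by (auto simp: disjoint_family_on_def)
        then have "indicator (\<Union>i<n. A i \<inter> {s..<N}) x = S n x"
          unfolding S_def by (intro indicator_UN_disjoint) auto
        then show ?thesis by (simp add: UN_simps)
      qed
      have Sint: "integrable lborel (S n)" for n unfolding S_def by (intro Bochner_Integration.integrable_sum ii A)
      have "L (S n) = 0" for n
      proof (induction n)
        case 0
        show ?case using L0 by (simp add: S_def[abs_def])
      next
        case (Suc n)
        have "S (Suc n) = (\<lambda>x. S n x + indicator (A n \<inter> {s..<N}) x)" by (simp add: S_def fun_eq_iff)
        then show ?case using D(1)[OF Sint[of n] ii[OF A[of n], of N]] Suc union(3)[of n] by simp
      qed
      moreover have "(\<lambda>n. L (S n)) \<longlonglongrightarrow> L (indicator ((\<Union>i. A i) \<inter> {s..<N}))"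
      proof (rule D(3)[OF Sint])
        show "integrable lborel (indicator ((\<Union>i. A i) \<inter> {s..<N}) :: real \<Rightarrow> real)" by (rule ii) (use A in auto)
        show "integrable lborel (indicator {s..<N} :: real \<Rightarrow> real)" using ii[of UNIV N] by simp
        show "\<bar>S i x\<bar> \<le> indicator {s..<N} x" for i x unfolding Seq by (simp add: indicator_def)
        fix x
        have "(\<lambda>n. indicator (\<Union>i<n. A i \<inter> {s..<N}) x :: real) \<longlonglongrightarrow> indicator (\<Union>i. A i \<inter> {s..<N}) x"
          by (rule LIMSEQ_indicator_UN)
        then show "(\<lambda>n. S n x) \<longlonglongrightarrow> indicator ((\<Union>i. A i) \<inter> {s..<N}) x" unfolding Seq by (simp add: UN_simps)
      qed
      ultimately show ?case by (simp add: LIMSEQ_const_iff)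
    qed
  qed
  show ?thesis using \<phi>
  proof (induction \<phi> rule: integrable_induct)
    case (base A c)
    then have A: "A \<in> sets borel" and iA: "integrable lborel (indicator A :: real \<Rightarrow> real)" by auto
    have iAs: "integrable lborel (\<lambda>x. indicator {s..} x * indicator A x :: real)"
      using integrable_mult_indicator[OF _ iA, of "{s..}"] by simp
    have "(\<lambda>n. L (indicator (A \<inter> {s..<real n}))) \<longlonglongrightarrow> L (\<lambda>x. indicator {s..} x * indicator A x)"
    proof (rule D(3)[OF ii[OF A] iAs iA])
      show "\<bar>indicator (A \<inter> {s..<real i}) x\<bar> \<le> (indicator A x :: real)" for i x by (simp add: indicator_def)
      fix x :: real
      obtain n0 where n0: "x < real n0" using reals_Archimedean2 by blast
      have "\<forall>\<^sub>F n in sequentially. indicator (A \<inter> {s..<real n}) x = (indicator {s..} x * indicator A x :: real)"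
        using eventually_ge_at_top[of n0] by eventually_elim (use n0 in \<open>auto simp: indicator_def\<close>)
      then show "(\<lambda>n. indicator (A \<inter> {s..<real n}) x) \<longlonglongrightarrow> (indicator {s..} x * indicator A x :: real)"
        by (rule tendsto_eventually)
    qed
    then have "L (indicator A) = 0" using bounded[OF A] restr[of "indicator A"] by (simp add: LIMSEQ_const_iff)
    then show ?case using D(2)[OF iA, of c] by (simp add: mult.commute)
  next
    case (add f g)
    then show ?case using D(1) by simp
  next
    case (lim f s)
    have "(\<lambda>i. L (s i)) \<longlonglongrightarrow> L f"
      by (rule D(3)[where g="\<lambda>x. 2 * \<bar>f x\<bar>"]) (use lim in auto)
    then show ?case using lim by (simp add: LIMSEQ_const_iff)
  qed
qed

text \<open>The mean of \<open>\<phi> (max s (y + S_\<tau>))\<close> divided by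
  \<open>max_rate \<tau>\<close>, see \<open>nn_integral_phi_max\<close>; the Gaussian factor tends
  to 1 as \<open>\<tau>\<close> grows.\<close>

definition damped_gain :: "(real \<Rightarrow> real) \<Rightarrow> real \<Rightarrow> real \<Rightarrow> real \<Rightarrow> real" where
  "damped_gain \<phi> \<tau> s y = (\<integral>z. exp (- z\<^sup>2 / (2 * \<tau>)) * \<phi> (max s (y + z)) \<partial>half_lborel)"

lemma borel_measurable_max_gain:
  assumes [measurable]: "\<phi> \<in> borel_measurable borel" "f \<in> borel_measurable M" "g \<in> borel_measurable M"
  shows "(\<lambda>x. max_gain \<phi> (f x) (g x)) \<in> borel_measurable M"
  unfolding max_gain_def by (rule half_lborel.borel_measurable_lebesgue_integral) measurable

lemma borel_measurable_damped_gain: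
  assumes [measurable]: "\<phi> \<in> borel_measurable borel" "f \<in> borel_measurable M" "g \<in> borel_measurable M"
  shows "(\<lambda>x. damped_gain \<phi> \<tau> (f x) (g x)) \<in> borel_measurable M"
  unfolding damped_gain_def by (rule half_lborel.borel_measurable_lebesgue_integral) measurable

context
  fixes \<phi> :: "real \<Rightarrow> real"
  assumes \<phi>: "integrable lborel \<phi>" and pos: "\<And>x. 0 \<le> \<phi> x"
begin

lemma phi_measurable: "\<phi> \<in> borel_measurable borel" using borel_measurable_integrable[OF \<phi>] by simp

lemma integrable_damped_gain: "0 < \<tau> \<Longrightarrow> integrable half_lborel (\<lambda>z. exp (- z\<^sup>2 / (2 * \<tau>)) * \<phi> (max s (y + z)))"
  by (rule Bochner_Integration.integrable_bound[OF integrable_max_gain[OF \<phi>, of s y]])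
     (use phi_measurable pos in \<open>auto simp: abs_mult intro!: mult_left_le_one_le\<close>)

lemma damped_gain_nonneg: "0 \<le> damped_gain \<phi> \<tau> s y"
  unfolding damped_gain_def using pos by (intro Bochner_Integration.integral_nonneg) simp

lemma max_gain_nonneg: "0 \<le> max_gain \<phi> s y"
  unfolding max_gain_def using pos by (intro Bochner_Integration.integral_nonneg) simp

lemma damped_gain_le: "0 < \<tau> \<Longrightarrow> damped_gain \<phi> \<tau> s y \<le> max_gain \<phi> s y"
  unfolding damped_gain_def max_gain_def
  by (intro integral_mono integrable_damped_gain integrable_max_gain \<phi>) (auto intro!: mult_left_le_one_le pos)

lemma nn_integral_damped_gain:
  "0 < \<tau> \<Longrightarrow> (\<integral>\<^sup>+z. ennreal (exp (- z\<^sup>2 / (2 * \<tau>))) * ennreal (\<phi> (max s (y + z))) \<partial>half_lborel) = ennreal (damped_gain \<phi> \<tau> s y)"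
  unfolding damped_gain_def using pos
  by (subst nn_integral_eq_integral[symmetric, OF integrable_damped_gain]) (auto simp: ennreal_mult')

lemma damped_gain_tendsto: "((\<lambda>\<tau>. damped_gain \<phi> \<tau> s y) \<longlongrightarrow> max_gain \<phi> s y) at_top"
  unfolding damped_gain_def max_gain_def
proof (rule integral_dominated_convergence_at_top[where w="\<lambda>z. \<phi> (max s (y + z))"])
  show "integrable half_lborel (\<lambda>z. \<phi> (max s (y + z)))" by (rule integrable_max_gain[OF \<phi>])
  show "AE z in half_lborel. ((\<lambda>\<tau>. exp (- z\<^sup>2 / (2 * \<tau>)) * \<phi> (max s (y + z))) \<longlongrightarrow> \<phi> (max s (y + z))) at_top"
  proof (rule AE_I2)
    fix z
    have "((\<lambda>\<tau> :: real. - z\<^sup>2 / (2 * \<tau>)) \<longlongrightarrow> 0) at_top"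
      by (intro tendsto_divide_0[OF tendsto_const] filterlim_at_top_imp_at_infinity filterlim_tendsto_pos_mult_at_top[OF tendsto_const] filterlim_ident) simp
    then have "((\<lambda>\<tau>. exp (- z\<^sup>2 / (2 * \<tau>)) * \<phi> (max s (y + z))) \<longlongrightarrow> exp 0 * \<phi> (max s (y + z))) at_top"
      by (intro tendsto_intros)
    then show "((\<lambda>\<tau>. exp (- z\<^sup>2 / (2 * \<tau>)) * \<phi> (max s (y + z))) \<longlongrightarrow> \<phi> (max s (y + z))) at_top" by simp
  qed
  show "\<forall>\<^sub>F \<tau> in at_top. AE z in half_lborel. norm (exp (- z\<^sup>2 / (2 * \<tau>)) * \<phi> (max s (y + z))) \<le> \<phi> (max s (y + z))"
    using eventually_gt_at_top[of 0]
  proof eventually_elim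
    fix \<tau> :: real assume "0 < \<tau>"
    then show "AE z in half_lborel. norm (exp (- z\<^sup>2 / (2 * \<tau>)) * \<phi> (max s (y + z))) \<le> \<phi> (max s (y + z))"
      using pos by (intro AE_I2) (auto simp: abs_mult intro!: mult_left_le_one_le)
  qed
qed (use phi_measurable in measurable)

end

text \<open>Up to a constant the rate is \<open>v powr (- 1/2)\<close>, whose singularity at 0 is
  integrable. The later integrability over time rests on this.\<close>

lemma max_rate_integral_finite: "(\<integral>\<^sup>+v. indicator {0..r} v * ennreal (max_rate v) \<partial>lborel) < \<infinity>"
proof (cases "0 \<le> r")
  case True
  have "(\<lambda>x. x powr (- 1/2)) absolutely_integrable_on {0<..r}"
    using True by (intro nonnegative_absolutely_integrable_1 integrable_on_powr_from_0') auto
  then have "integrable lborel (\<lambda>x. indicator {0<..r} x *\<^sub>R (x powr (- 1/2)))"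
    unfolding set_integrable_def by (subst (asm) integrable_completion) measurable
  then have "integrable lborel (\<lambda>x. sqrt (2 / pi) * (indicator {0<..r} x *\<^sub>R (x powr (- 1/2))))" by simp
  then have fin: "(\<integral>\<^sup>+x. ennreal (norm (sqrt (2 / pi) * (indicator {0<..r} x *\<^sub>R (x powr (- 1/2))))) \<partial>lborel) < \<infinity>"
    by (simp only: integrable_iff_bounded)
  have "(\<integral>\<^sup>+v. indicator {0..r} v * ennreal (max_rate v) \<partial>lborel) = (\<integral>\<^sup>+x. ennreal (norm (sqrt (2 / pi) * (indicator {0<..r} x *\<^sub>R (x powr (- 1/2))))) \<partial>lborel)"
  proof (rule nn_integral_cong_AE)
    show "AE v in lborel. indicator {0..r} v * ennreal (max_rate v) = ennreal (norm (sqrt (2 / pi) * (indicator {0<..r} v *\<^sub>R (v powr (- 1/2)))))"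
      using AE_lborel_singleton[of 0]
    proof eventually_elim
      fix v :: real assume v: "v \<noteq> 0"
      have "max_rate v = sqrt (2 / pi) * v powr (- 1/2)" if "0 < v"
        using that by (simp add: max_rate_def real_sqrt_divide real_sqrt_mult powr_minus powr_half_sqrt divide_simps)
      then show "indicator {0..r} v * ennreal (max_rate v) = ennreal (norm (sqrt (2 / pi) * (indicator {0<..r} v *\<^sub>R (v powr (- 1/2)))))"
        using v by (auto simp: indicator_def)
    qed
  qed
  then show ?thesis using fin by simp
qed simp

context wiener
begin

lemma nn_integral_phi_max:
  assumes \<phi>: "integrable lborel \<phi>" "\<And>x. 0 \<le> \<phi> x" and \<tau>: "0 < \<tau>"
  shows "(\<integral>\<^sup>+\<omega>. ennreal (\<phi> (max s (y + running_max \<tau> \<omega>))) \<partial>W) = ennreal (max_rate \<tau> * damped_gain \<phi> \<tau> s y)"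
proof -
  have [measurable]: "\<phi> \<in> borel_measurable borel" by (rule phi_measurable[OF \<phi>])
  show ?thesis
    using nn_integral_running_max[OF \<tau>, of "\<lambda>z. ennreal (\<phi> (max s (y + z)))"] nn_integral_damped_gain[OF \<phi> \<tau>, of s y] \<tau>
    by (simp add: ennreal_mult' max_rate_def damped_gain_nonneg[OF \<phi>])
qed

text \<open>By the Markov property at \<open>r\<close>, the mean of the damped gain with horizon
  \<open>\<tau>\<close> equals the damped gain from the start with horizon
  \<open>r + \<tau>\<close>, times a ratio of rates that is at most 1. Fatou's lemma then removes
  the damping.\<close>

lemma nn_integral_max_gain_le:
  assumes \<phi>: "integrable lborel \<phi>" "\<And>x. 0 \<le> \<phi> x" and r: "0 \<le> r"
  shows "(\<integral>\<^sup>+\<omega>. ennreal (max_gain \<phi> (max s (y + running_max r \<omega>)) (y + coord r \<omega>)) \<partial>W) \<le> ennreal (max_gain \<phi> s y)"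
proof -
  have \<phi>m [measurable]: "\<phi> \<in> borel_measurable borel" by (rule phi_measurable[OF \<phi>])
  let ?S = "\<lambda>\<omega>. max s (y + running_max r \<omega>)" and ?X = "\<lambda>\<omega>. y + coord r \<omega>"
  have SX: "?S \<in> borel_measurable W" "?X \<in> borel_measurable W" using r by measurable
  have step: "(\<integral>\<^sup>+\<omega>. ennreal (damped_gain \<phi> \<tau> (?S \<omega>) (?X \<omega>)) \<partial>W) \<le> ennreal (max_gain \<phi> s y)" if \<tau>: "0 < \<tau>" for \<tau>
  proof -
    define f where "f = (\<lambda>p. ennreal (\<phi> (max (?S (fst p)) (?X (fst p) + running_max \<tau> (snd p)))))"
    have c: "running_max r \<in> borel_measurable (path_filtration r)" "coord r \<in> borel_measurable (path_filtration r)"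
      "running_max \<tau> \<in> borel_measurable path_algebra"
      using r \<tau> by (auto intro!: borel_measurable_running_max borel_measurable_coord)
    have f: "f \<in> borel_measurable (path_filtration r \<Otimes>\<^sub>M path_algebra)"
      unfolding f_def
      using measurable_compose[OF measurable_fst c(1)] measurable_compose[OF measurable_fst c(2)] measurable_compose[OF measurable_snd c(3)]
      by measurable
    have "ennreal (max_rate \<tau>) * (\<integral>\<^sup>+\<omega>. ennreal (damped_gain \<phi> \<tau> (?S \<omega>) (?X \<omega>)) \<partial>W) =
      (\<integral>\<^sup>+\<omega>. ennreal (max_rate \<tau>) * ennreal (damped_gain \<phi> \<tau> (?S \<omega>) (?X \<omega>)) \<partial>W)"
      using SX by (intro nn_integral_cmult[symmetric] measurable_compose[OF borel_measurable_damped_gain]) auto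
    also have "\<dots> = (\<integral>\<^sup>+\<omega>. \<integral>\<^sup>+\<omega>'. f (\<omega>, \<omega>') \<partial>W \<partial>W)"
      using \<tau> by (simp add: f_def nn_integral_phi_max[OF \<phi> \<tau>] ennreal_mult' max_rate_def damped_gain_nonneg[OF \<phi>])
    also have "\<dots> = (\<integral>\<^sup>+\<omega>. f (\<omega>, path_shift r \<omega>) \<partial>W)" by (rule markov_nn_integral[OF W W r f, symmetric])
    also have "\<dots> = (\<integral>\<^sup>+\<omega>. ennreal (\<phi> (max s (y + running_max (r + \<tau>) \<omega>))) \<partial>W)"
    proof (rule nn_integral_cong)
      fix \<omega> assume "\<omega> \<in> space W"
      then have "running_max (r + \<tau>) \<omega> = max (running_max r \<omega>) (coord r \<omega> + running_max \<tau> (path_shift r \<omega>))"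
        using WD(4) r \<tau> by (intro running_max_shift) auto
      then have "max s (y + running_max (r + \<tau>) \<omega>) = max (?S \<omega>) (?X \<omega> + running_max \<tau> (path_shift r \<omega>))" by (simp add: max_def)
      then show "f (\<omega>, path_shift r \<omega>) = ennreal (\<phi> (max s (y + running_max (r + \<tau>) \<omega>)))" by (simp add: f_def)
    qed
    also have "\<dots> = ennreal (max_rate (r + \<tau>) * damped_gain \<phi> (r + \<tau>) s y)"
      using r \<tau> by (intro nn_integral_phi_max \<phi>) auto
    also have "\<dots> \<le> ennreal (max_rate \<tau> * max_gain \<phi> s y)"
      using r \<tau> max_rate_antimono[of \<tau> "r + \<tau>"]
      by (intro ennreal_leI mult_mono damped_gain_le damped_gain_nonneg \<phi>) (auto simp: max_rate_def)
    finally have "ennreal (max_rate \<tau>) * (\<integral>\<^sup>+\<omega>. ennreal (damped_gain \<phi> \<tau> (?S \<omega>) (?X \<omega>)) \<partial>W) \<le> ennreal (max_rate \<tau>) * ennreal (max_gain \<phi> s y)"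
      using \<tau> by (simp add: ennreal_mult' max_rate_def)
    then show ?thesis using max_rate_pos[OF \<tau>] by (subst (asm) ennreal_mult_le_mult_iff) (auto simp: ennreal_eq_0_iff)
  qed
  have "(\<integral>\<^sup>+\<omega>. ennreal (max_gain \<phi> (?S \<omega>) (?X \<omega>)) \<partial>W) = (\<integral>\<^sup>+\<omega>. liminf (\<lambda>n. ennreal (damped_gain \<phi> (real (Suc n)) (?S \<omega>) (?X \<omega>))) \<partial>W)"
  proof (rule nn_integral_cong)
    fix \<omega>
    have "(\<lambda>n. damped_gain \<phi> (real (Suc n)) (?S \<omega>) (?X \<omega>)) \<longlonglongrightarrow> max_gain \<phi> (?S \<omega>) (?X \<omega>)"
      by (rule filterlim_compose[OF damped_gain_tendsto[OF \<phi>]]) (rule filterlim_compose[OF filterlim_real_sequentially filterlim_Suc])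
    then have "(\<lambda>n. ennreal (damped_gain \<phi> (real (Suc n)) (?S \<omega>) (?X \<omega>))) \<longlonglongrightarrow> ennreal (max_gain \<phi> (?S \<omega>) (?X \<omega>))"
      by (rule tendsto_ennrealI)
    then show "ennreal (max_gain \<phi> (?S \<omega>) (?X \<omega>)) = liminf (\<lambda>n. ennreal (damped_gain \<phi> (real (Suc n)) (?S \<omega>) (?X \<omega>)))"
      by (intro lim_imp_Liminf[symmetric]) auto
  qed
  also have "\<dots> \<le> liminf (\<lambda>n. \<integral>\<^sup>+\<omega>. ennreal (damped_gain \<phi> (real (Suc n)) (?S \<omega>) (?X \<omega>)) \<partial>W)"
    using SX by (intro nn_integral_liminf measurable_compose[OF borel_measurable_damped_gain]) auto
  also have "\<dots> \<le> ennreal (max_gain \<phi> s y)"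
    by (intro Liminf_le always_eventually allI step) auto
  finally show ?thesis .
qed

lemma integrable_gain_product:
  fixes \<phi> :: "real \<Rightarrow> real"
  assumes \<phi>: "integrable lborel \<phi>" and r: "0 \<le> r"
  shows "integrable (W \<Otimes>\<^sub>M half_lborel) (\<lambda>p. \<phi> (max (max s (y + running_max r (fst p))) (y + coord r (fst p) + snd p)))"
proof -
  have [measurable]: "\<phi> \<in> borel_measurable borel" using borel_measurable_integrable[OF \<phi>] by simp
  have n\<phi>: "integrable lborel (\<lambda>x. \<bar>\<phi> x\<bar>)" using \<phi> by simp
  note c = measurable_compose[OF measurable_fst measurable_running_max_W[OF r]] measurable_compose[OF measurable_fst measurable_coord_W[OF r]]
  have m: "(\<lambda>p. \<phi> (max (max s (y + running_max r (fst p))) (y + coord r (fst p) + snd p))) \<in> borel_measurable (W \<Otimes>\<^sub>M half_lborel)"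
    using c by measurable
  have "(\<integral>\<^sup>+p. ennreal (norm (\<phi> (max (max s (y + running_max r (fst p))) (y + coord r (fst p) + snd p)))) \<partial>(W \<Otimes>\<^sub>M half_lborel))
    = (\<integral>\<^sup>+\<omega>. \<integral>\<^sup>+z. ennreal \<bar>\<phi> (max (max s (y + running_max r \<omega>)) (y + coord r \<omega> + z))\<bar> \<partial>half_lborel \<partial>W)"
    using m by (subst half_lborel.nn_integral_fst[symmetric]) auto
  also have "\<dots> = (\<integral>\<^sup>+\<omega>. ennreal (max_gain (\<lambda>x. \<bar>\<phi> x\<bar>) (max s (y + running_max r \<omega>)) (y + coord r \<omega>)) \<partial>W)"
    by (simp add: nn_integral_max_gain[OF n\<phi>])
  also have "\<dots> \<le> ennreal (max_gain (\<lambda>x. \<bar>\<phi> x\<bar>) s y)" by (rule nn_integral_max_gain_le[OF n\<phi> _ r]) simp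
  finally show ?thesis using m by (intro integrableI_bounded) (auto intro: le_less_trans)
qed

text \<open>Lebesgue measure on \<open>[0, r]\<close>. The functions integrated against it carry the
  clip \<open>max 0 (min r v)\<close>, which is the identity on \<open>[0, r]\<close> and makes the
  bound on \<open>wald\<close> hold on the whole product space, as
  \<open>dct_functional_integral\<close> demands.\<close>

definition time_measure :: "real \<Rightarrow> real measure" where
  "time_measure r = density lborel (\<lambda>v. ennreal (indicator {0..r} v))"

lemma sets_time_measure [simp, measurable_cong]: "sets (time_measure r) = sets borel"
  by (simp add: time_measure_def)

lemma space_time_measure [simp]: "space (time_measure r) = UNIV"
  by (simp add: time_measure_def)

lemma sigma_finite_time_measure: "sigma_finite_measure (time_measure r)"
  unfolding time_measure_def by (subst sigma_finite_measure.sigma_finite_iff_density_finite[OF sigma_finite_lborel]) auto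

lemma clip_joint_W:
  "0 \<le> r \<Longrightarrow> (\<lambda>p. running_max (max 0 (min r (fst p))) (snd p)) \<in> borel_measurable (borel \<Otimes>\<^sub>M W)"
  "0 \<le> r \<Longrightarrow> (\<lambda>p. coord (max 0 (min r (fst p))) (snd p)) \<in> borel_measurable (borel \<Otimes>\<^sub>M W)"
proof -
  have m: "snd \<in> borel \<Otimes>\<^sub>M W \<rightarrow>\<^sub>M path_algebra"
    using measurable_compose[OF measurable_snd measurable_W[OF measurable_ident]] by simp
  show "0 \<le> r \<Longrightarrow> (\<lambda>p. running_max (max 0 (min r (fst p))) (snd p)) \<in> borel_measurable (borel \<Otimes>\<^sub>M W)"
    using m by (intro borel_measurable_running_max_joint[of "{0..}"]) auto
  show "0 \<le> r \<Longrightarrow> (\<lambda>p. coord (max 0 (min r (fst p))) (snd p)) \<in> borel_measurable (borel \<Otimes>\<^sub>M W)"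
    using m by (intro borel_measurable_coord_joint[of "{0..}"]) auto
qed

lemma integrable_phi_max_product:
  fixes \<phi> :: "real \<Rightarrow> real"
  assumes \<phi>: "integrable lborel \<phi>" and r: "0 \<le> r"
  shows "integrable (time_measure r \<Otimes>\<^sub>M W) (\<lambda>p. \<phi> (max s (y + running_max (max 0 (min r (fst p))) (snd p))))"
proof -
  have [measurable]: "\<phi> \<in> borel_measurable borel" using borel_measurable_integrable[OF \<phi>] by simp
  have n\<phi>: "integrable lborel (\<lambda>x. \<bar>\<phi> x\<bar>)" using \<phi> by simp
  have m0: "(\<lambda>p. \<phi> (max s (y + running_max (max 0 (min r (fst p))) (snd p)))) \<in> borel_measurable (borel \<Otimes>\<^sub>M W)"
    using clip_joint_W[OF r] by measurable
  then have m: "(\<lambda>p. \<phi> (max s (y + running_max (max 0 (min r (fst p))) (snd p)))) \<in> borel_measurable (time_measure r \<Otimes>\<^sub>M W)"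
    by (subst measurable_cong_sets[OF sets_pair_measure_cong[OF sets_time_measure refl] refl])
  have "(\<integral>\<^sup>+p. ennreal (norm (\<phi> (max s (y + running_max (max 0 (min r (fst p))) (snd p))))) \<partial>(time_measure r \<Otimes>\<^sub>M W))
    = (\<integral>\<^sup>+v. \<integral>\<^sup>+\<omega>. ennreal \<bar>\<phi> (max s (y + running_max (max 0 (min r v)) \<omega>))\<bar> \<partial>W \<partial>time_measure r)"
    using m by (subst nn_integral_fst[symmetric]) auto
  also have "\<dots> = (\<integral>\<^sup>+v. indicator {0..r} v * (\<integral>\<^sup>+\<omega>. ennreal \<bar>\<phi> (max s (y + running_max (max 0 (min r v)) \<omega>))\<bar> \<partial>W) \<partial>lborel)"
    unfolding time_measure_def
  proof (subst nn_integral_density)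
    have "(\<lambda>v. \<integral>\<^sup>+\<omega>. ennreal \<bar>\<phi> (max s (y + running_max (max 0 (min r (fst (v, \<omega>)))) (snd (v, \<omega>))))\<bar> \<partial>W) \<in> borel_measurable borel"
      using m0 by (intro borel_measurable_nn_integral_fst) simp
    then show "(\<lambda>v. \<integral>\<^sup>+\<omega>. ennreal \<bar>\<phi> (max s (y + running_max (max 0 (min r v)) \<omega>))\<bar> \<partial>W) \<in> borel_measurable lborel" by simp
  qed (auto simp: ennreal_indicator)
  \<comment> \<open>At a fixed time \<open>v > 0\<close> the expectation is at most
    \<open>max_rate v\<close> times the gain; the time 0 is a null set.\<close>
  also have "\<dots> \<le> (\<integral>\<^sup>+v. ennreal (max_gain (\<lambda>x. \<bar>\<phi> x\<bar>) s y) * (indicator {0..r} v * ennreal (max_rate v)) \<partial>lborel)"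
  proof (rule nn_integral_mono_AE)
    show "AE v in lborel. indicator {0..r} v * (\<integral>\<^sup>+\<omega>. ennreal \<bar>\<phi> (max s (y + running_max (max 0 (min r v)) \<omega>))\<bar> \<partial>W)
       \<le> ennreal (max_gain (\<lambda>x. \<bar>\<phi> x\<bar>) s y) * (indicator {0..r} v * ennreal (max_rate v))"
      using AE_lborel_singleton[of 0]
    proof eventually_elim
      fix v :: real assume v: "v \<noteq> 0"
      have "(\<integral>\<^sup>+\<omega>. ennreal \<bar>\<phi> (max s (y + running_max v \<omega>))\<bar> \<partial>W) \<le> ennreal (max_gain (\<lambda>x. \<bar>\<phi> x\<bar>) s y) * ennreal (max_rate v)" if "0 < v"
        using nn_integral_phi_max[OF n\<phi> _ that, of s y] that damped_gain_le[OF n\<phi> _ that, of s y] max_gain_nonneg[OF n\<phi>, of s y]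
        by (auto simp: ennreal_mult'[symmetric] max_rate_def mult.commute intro!: ennreal_leI mult_right_mono)
      then show "indicator {0..r} v * (\<integral>\<^sup>+\<omega>. ennreal \<bar>\<phi> (max s (y + running_max (max 0 (min r v)) \<omega>))\<bar> \<partial>W)
         \<le> ennreal (max_gain (\<lambda>x. \<bar>\<phi> x\<bar>) s y) * (indicator {0..r} v * ennreal (max_rate v))"
        using v by (auto simp: indicator_def max_def min_def)
    qed
  qed
  also have "\<dots> = ennreal (max_gain (\<lambda>x. \<bar>\<phi> x\<bar>) s y) * (\<integral>\<^sup>+v. indicator {0..r} v * ennreal (max_rate v) \<partial>lborel)"
    by (rule nn_integral_cmult) (auto simp: max_rate_def)
  also have "\<dots> < \<infinity>" using max_rate_integral_finite[of r] by (simp add: ennreal_mult_less_top)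
  finally show ?thesis using m by (intro integrableI_bounded) auto
qed

end

section \<open>The penalised limit\<close>

context wiener
begin

lemma pair_W_half: "pair_sigma_finite W half_lborel"
  by (intro pair_sigma_finite.intro sigma_finite_half_lborel) unfold_locales

lemma pair_time_W: "pair_sigma_finite (time_measure r) W"
  by (intro pair_sigma_finite.intro sigma_finite_time_measure) unfold_locales

lemma clip_wald_measurable:
  assumes r: "0 \<le> r"
  shows "(\<lambda>p. wald \<theta> (max 0 (min r (fst p))) (coord (max 0 (min r (fst p))) (snd p))) \<in> borel_measurable (time_measure r \<Otimes>\<^sub>M W)"
  using clip_joint_W(2)[OF r] by measurable

lemma norm_clip_wald: "0 \<le> r \<Longrightarrow> norm (wald \<theta> (max 0 (min r v)) y) \<le> exp (\<theta>\<^sup>2 * r / 2)"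
  by (auto intro!: mult_left_mono)

text \<open>Both sides are linear in \<open>\<phi>\<close>, and for the indicator of \<open>{s..<c}\<close> the identity is
  \<open>killed_identity\<close> with \<open>b = c - y\<close>.\<close>

lemma gain_identity:
  fixes \<phi> :: "real \<Rightarrow> real"
  assumes \<phi>: "integrable lborel \<phi>" and r: "0 \<le> r" and ys: "y \<le> s"
  shows "(\<integral>\<omega>. max_gain \<phi> (max s (y + running_max r \<omega>)) (y + coord r \<omega>) *\<^sub>R wald \<theta> r (coord r \<omega>) \<partial>W) +
     \<i> * of_real \<theta> * (\<integral>v. indicator {0..r} v *\<^sub>R (\<integral>\<omega>. \<phi> (max s (y + running_max (max 0 v) \<omega>)) *\<^sub>R wald \<theta> (max 0 v) (coord (max 0 v) \<omega>) \<partial>W) \<partial>lborel)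
     = of_real (max_gain \<phi> s y)"
proof -
  define L1 where "L1 \<phi> = (\<integral>p. \<phi> (max (max s (y + running_max r (fst p))) (y + coord r (fst p) + snd p)) *\<^sub>R wald \<theta> r (coord r (fst p)) \<partial>(W \<Otimes>\<^sub>M half_lborel))" for \<phi> :: "real \<Rightarrow> real"
  define L2 where "L2 \<phi> = (\<integral>p. \<phi> (max s (y + running_max (max 0 (min r (fst p))) (snd p))) *\<^sub>R wald \<theta> (max 0 (min r (fst p))) (coord (max 0 (min r (fst p))) (snd p)) \<partial>(time_measure r \<Otimes>\<^sub>M W))" for \<phi> :: "real \<Rightarrow> real"
  define L0 where "L0 \<phi> = (\<integral>z. \<phi> (max s (y + z)) *\<^sub>R (1 :: complex) \<partial>half_lborel)" for \<phi> :: "real \<Rightarrow> real"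
  \<comment> \<open>The difference of the two sides, as one functional of \<open>\<phi>\<close> that
    is to vanish.\<close>
  define L where "L \<phi> = (L1 \<phi> + (\<i> * of_real \<theta>) * L2 \<phi>) + (-1) * L0 \<phi>" for \<phi> :: "real \<Rightarrow> real"
  interpret WH: pair_sigma_finite W half_lborel by (rule pair_W_half)
  interpret TW: pair_sigma_finite "time_measure r" W by (rule pair_time_W)
  have w1: "(\<lambda>p. wald \<theta> r (coord r (fst p))) \<in> borel_measurable (W \<Otimes>\<^sub>M half_lborel)"
    using measurable_compose[OF measurable_fst measurable_coord_W[OF r]] by measurable
  have L1: "dct_functional L1"
    unfolding L1_def by (rule dct_functional_integral[where K="exp (\<theta>\<^sup>2 * r / 2)", OF w1]) (simp_all add: integrable_gain_product r)
  have L2: "dct_functional L2"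
    unfolding L2_def
    by (rule dct_functional_integral[where K="exp (\<theta>\<^sup>2 * r / 2)", OF clip_wald_measurable[OF r]])
       (simp_all only: integrable_phi_max_product norm_clip_wald r)
  have L0: "dct_functional L0"
    unfolding L0_def by (rule dct_functional_integral[where K=1]) (simp_all add: integrable_max_gain)
  have L: "dct_functional L"
    unfolding L_def by (intro dct_functional_add dct_functional_cmult L0 L1 L2)
  have L1eq: "L1 \<phi> = (\<integral>\<omega>. max_gain \<phi> (max s (y + running_max r \<omega>)) (y + coord r \<omega>) *\<^sub>R wald \<theta> r (coord r \<omega>) \<partial>W)"
    if \<phi>: "integrable lborel \<phi>" for \<phi>
  proof -
    have "L1 \<phi> = (\<integral>\<omega>. \<integral>z. \<phi> (max (max s (y + running_max r \<omega>)) (y + coord r \<omega> + z)) *\<^sub>R wald \<theta> r (coord r \<omega>) \<partial>half_lborel \<partial>W)"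
      unfolding L1_def
      using WH.integral_fst'[OF integrable_scaleR_bounded[OF integrable_gain_product[OF \<phi> r] w1, of "exp (\<theta>\<^sup>2 * r / 2)"]] by simp
    then show ?thesis using integrable_max_gain[OF \<phi>] by (simp add: max_gain_def)
  qed
  have L2eq: "L2 \<phi> = (\<integral>v. indicator {0..r} v *\<^sub>R (\<integral>\<omega>. \<phi> (max s (y + running_max (max 0 v) \<omega>)) *\<^sub>R wald \<theta> (max 0 v) (coord (max 0 v) \<omega>) \<partial>W) \<partial>lborel)"
    if \<phi>: "integrable lborel \<phi>" for \<phi>
  proof -
    define g where "g v = (\<integral>\<omega>. \<phi> (max s (y + running_max (max 0 (min r v)) \<omega>)) *\<^sub>R wald \<theta> (max 0 (min r v)) (coord (max 0 (min r v)) \<omega>) \<partial>W)" for v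
    have i: "integrable (time_measure r \<Otimes>\<^sub>M W) (\<lambda>p. \<phi> (max s (y + running_max (max 0 (min r (fst p))) (snd p))) *\<^sub>R wald \<theta> (max 0 (min r (fst p))) (coord (max 0 (min r (fst p))) (snd p)))"
      by (rule integrable_scaleR_bounded[OF integrable_phi_max_product[OF \<phi> r] clip_wald_measurable[OF r] norm_clip_wald[OF r]])
    have "L2 \<phi> = (\<integral>v. g v \<partial>time_measure r)"
      unfolding L2_def g_def using TW.integral_fst'[OF i] by simp
    also have "\<dots> = (\<integral>v. indicator {0..r} v *\<^sub>R g v \<partial>lborel)"
    proof -
      have "g \<in> borel_measurable (time_measure r)" unfolding g_def using TW.integrable_fst'[OF i] by simp
      then have "g \<in> borel_measurable lborel" by (simp add: measurable_cong_sets[OF sets_time_measure refl])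
      then show ?thesis unfolding time_measure_def by (intro integral_density) auto
    qed
    also have "\<dots> = (\<integral>v. indicator {0..r} v *\<^sub>R (\<integral>\<omega>. \<phi> (max s (y + running_max (max 0 v) \<omega>)) *\<^sub>R wald \<theta> (max 0 v) (coord (max 0 v) \<omega>) \<partial>W) \<partial>lborel)"
      by (rule Bochner_Integration.integral_cong[OF refl]) (auto simp: indicator_def g_def min_def)
    finally show ?thesis .
  qed
  have L0eq: "L0 \<phi> = of_real (max_gain \<phi> s y)" if \<phi>: "integrable lborel \<phi>" for \<phi>
    unfolding L0_def max_gain_def using integrable_max_gain[OF \<phi>] by (simp add: scaleR_conv_of_real)
  have base: "L (indicator {s..<c}) = 0" for c
  proof (cases "s < c")
    case False
    then have "indicator {s..<c} = (\<lambda>_. 0 :: real)" by (auto simp: indicator_def)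
    then show ?thesis using dct_functionalD(2)[OF L, of "\<lambda>_. 0" 0] by simp
  next
    case True
    define b where "b = c - y"
    have b: "0 < b" using True ys by (simp add: b_def)
    have i: "integrable lborel (indicator {s..<c} :: real \<Rightarrow> real)"
      by (rule integrable_real_indicator) (use True in auto)
    have "L1 (indicator {s..<c}) = (\<integral>\<omega>. indicator {\<omega>. running_max r \<omega> < b} \<omega> * of_real (b - coord r \<omega>) * wald \<theta> r (coord r \<omega>) \<partial>W)"
      unfolding L1eq[OF i]
    proof (rule Bochner_Integration.integral_cong[OF refl])
      fix \<omega> assume "\<omega> \<in> space W"
      then have "coord r \<omega> \<le> running_max r \<omega>" using coord_le_running_max[of \<omega> r r] WD(4) r by simp
      then have "max_gain (indicator {s..<c}) (max s (y + running_max r \<omega>)) (y + coord r \<omega>) = (if max s (y + running_max r \<omega>) < c then c - (y + coord r \<omega>) else 0)"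
        by (intro max_gain_indicator) auto
      then show "max_gain (indicator {s..<c}) (max s (y + running_max r \<omega>)) (y + coord r \<omega>) *\<^sub>R wald \<theta> r (coord r \<omega>) =
        indicator {\<omega>. running_max r \<omega> < b} \<omega> * of_real (b - coord r \<omega>) * wald \<theta> r (coord r \<omega>)"
        using True by (auto simp: b_def indicator_def scaleR_conv_of_real algebra_simps)
    qed
    moreover have "L2 (indicator {s..<c}) = (\<integral>v. indicator {0..r} v * (\<integral>\<omega>. indicator {\<omega>. running_max (max 0 v) \<omega> < b} \<omega> * wald \<theta> (max 0 v) (coord (max 0 v) \<omega>) \<partial>W) \<partial>lborel)"
    proof -
      have eq: "(indicator {s..<c} (max s (y + running_max (max 0 v) \<omega>)) :: real) *\<^sub>R wald \<theta> (max 0 v) (coord (max 0 v) \<omega>) =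
        indicator {\<omega>. running_max (max 0 v) \<omega> < b} \<omega> * wald \<theta> (max 0 v) (coord (max 0 v) \<omega>)" for v \<omega>
        using True by (auto simp: b_def indicator_def)
      have eq': "(indicator A v :: real) *\<^sub>R (z :: complex) = indicator A v * z" for A :: "real set" and v z
        by (simp add: indicator_def)
      show ?thesis unfolding L2eq[OF i] eq unfolding eq' by (rule refl)
    qed
    moreover have "L0 (indicator {s..<c}) = of_real b"
      unfolding L0eq[OF i] using max_gain_indicator[of s s y c] True ys by (simp add: b_def)
    ultimately show ?thesis using killed_identity[OF b r, of \<theta>] by (simp add: L_def)
  qed
  \<comment> \<open>\<open>\<phi>\<close> is evaluated only at maxima with \<open>s\<close>, hence
    only on \<open>{s..}\<close>.\<close>
  have restr: "L f = L (\<lambda>x. indicator {s..} x * f x)" for f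
  proof -
    have "indicator {s..} (max s a) = (1 :: real)" "indicator {s..} (max (max s a) b) = (1 :: real)" for a b by (auto simp: indicator_def)
    then show ?thesis unfolding L_def L1_def L2_def L0_def by simp
  qed
  have "L \<phi> = 0" by (rule dct_functional_eq_0[OF L base restr \<phi>])
  then show ?thesis using L1eq[OF \<phi>] L2eq[OF \<phi>] L0eq[OF \<phi>] by (simp add: L_def)
qed

end

section \<open>The martingale as a gain, and the limit of the ratios\<close>

locale penalisation = wiener +
  fixes x :: real and P :: "(real \<Rightarrow> real) measure" and \<phi> :: "real \<Rightarrow> real"
  assumes P: "brownian_law x P"
    and phi_pos: "\<And>u. 0 < \<phi> u"
    and phi_total: "has_bochner_integral lborel \<phi> 1"
begin

lemmas PD = brownian_lawD[OF P]

sublocale P: prob_space P by (rule PD(2))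

lemma phi_int: "integrable lborel \<phi>" using phi_total by (rule integrable.intros)

lemma phi_nonneg: "0 \<le> \<phi> u" using phi_pos[of u] by simp

lemma phi_borel [measurable]: "\<phi> \<in> borel_measurable borel" using borel_measurable_integrable[OF phi_int] by simp

definition tail :: "real \<Rightarrow> real" where "tail s = (LINT y:{s<..}|lborel. \<phi> y)"

lemma tail_eq: "tail s = 1 - primitive \<phi> s"
proof -
  have "(LINT y:{..s} \<union> {s<..}|lborel. \<phi> y) = primitive \<phi> s + tail s"
    unfolding primitive_def tail_def
    by (rule set_integral_Un)
       (use integrable_mult_indicator[OF _ phi_int, of "{..s}"] integrable_mult_indicator[OF _ phi_int, of "{s<..}"] in \<open>auto simp: set_integrable_def\<close>)
  moreover have "{..s} \<union> {s<..} = UNIV" by auto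
  ultimately show ?thesis using has_bochner_integral_integral_eq[OF phi_total] by (simp add: set_lebesgue_integral_def)
qed

text \<open>A vanishing tail would force the strictly positive \<open>\<phi>\<close> to vanish
  almost everywhere on \<open>{s<..s + 1}\<close>, a set of positive measure. This makes the
  normalisation by \<open>1 - primitive \<phi> x\<close> legitimate.\<close>

lemma tail_pos: "0 < tail s"
proof -
  have "0 < (\<integral>\<^sup>+y. ennreal (indicator {s<..} y * \<phi> y) \<partial>lborel)"
  proof (rule ccontr)
    assume "\<not> ?thesis"
    then have "(\<integral>\<^sup>+y. ennreal (indicator {s<..} y * \<phi> y) \<partial>lborel) = 0" by simp
    then have "AE y in lborel. ennreal (indicator {s<..} y * \<phi> y) = 0" by (subst (asm) nn_integral_0_iff_AE) auto
    then have "AE y in lborel. y \<notin> {s<..s + 1}"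
    proof eventually_elim
      fix y assume "ennreal (indicator {s<..} y * \<phi> y) = 0"
      then show "y \<notin> {s<..s + 1}" using phi_pos[of y] by (auto simp: indicator_def ennreal_eq_0_iff split: if_splits)
    qed
    then have "{s<..s + 1} \<in> null_sets lborel" using AE_iff_null_sets[of "{s<..s + 1}" lborel] by simp
    then have "emeasure lborel {s<..s + 1} = 0" by (rule null_setsD1)
    then show False using emeasure_lborel_Ioc[of s "s + 1"] by simp
  qed
  also have "\<dots> = ennreal (tail s)"
    unfolding tail_def set_lebesgue_integral_def real_scaleR_def
    by (rule nn_integral_eq_integral) (use integrable_mult_indicator[OF _ phi_int, of "{s<..}"] phi_nonneg in auto)
  finally show ?thesis by simp
qed

text \<open>\<open>M\<close> in the form of a \<open>max_gain\<close>: nonnegative for every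
  argument, which suits densities. Agreement with the closed form uses \<open>X_u \<le> S_u\<close>
  and so is stated on genuine paths (\<open>gain_eq\<close>).\<close>

definition gain :: "real \<Rightarrow> (real \<Rightarrow> real) \<Rightarrow> real" where
  "gain u \<omega> = max_gain \<phi> (running_max u \<omega>) (coord u \<omega>)"

lemma gain_eq: "\<omega> \<in> path_space \<Longrightarrow> 0 \<le> u \<Longrightarrow> gain u \<omega> = max_martingale \<phi> u \<omega>"
  using max_gain_eq[OF phi_int coord_le_running_max[of \<omega> u u]] tail_eq
  by (simp add: gain_def max_martingale_def tail_def)

lemma gain_pos:
  assumes "\<omega> \<in> path_space" "0 \<le> u" shows "0 < gain u \<omega>"
proof -
  have "gain u \<omega> = (running_max u \<omega> - coord u \<omega>) * \<phi> (running_max u \<omega>) + tail (running_max u \<omega>)"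
    using gain_eq[OF assms] tail_eq by (simp add: max_martingale_def)
  moreover have "0 \<le> (running_max u \<omega> - coord u \<omega>) * \<phi> (running_max u \<omega>)"
    using coord_le_running_max[OF assms order_refl] phi_nonneg by simp
  ultimately show ?thesis using tail_pos[of "running_max u \<omega>"] by linarith
qed

lemma gain_nonneg: "0 \<le> gain u \<omega>"
  unfolding gain_def by (rule max_gain_nonneg[OF phi_int phi_nonneg])

lemma measurable_P: "f \<in> path_algebra \<rightarrow>\<^sub>M N \<Longrightarrow> f \<in> P \<rightarrow>\<^sub>M N"
  by (simp add: measurable_cong_sets[OF PD(3) refl])

lemma filtration_coord: "0 \<le> s \<Longrightarrow> s \<le> u \<Longrightarrow> coord s \<in> borel_measurable (path_filtration u)"
  by (rule borel_measurable_coord) simp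

lemma filtration_running_max: "0 \<le> s \<Longrightarrow> s \<le> u \<Longrightarrow> running_max s \<in> borel_measurable (path_filtration u)"
  by (rule borel_measurable_running_max) auto

lemma filtration_gain: "0 \<le> s \<Longrightarrow> s \<le> u \<Longrightarrow> gain s \<in> borel_measurable (path_filtration u)"
  unfolding gain_def by (intro borel_measurable_max_gain filtration_coord filtration_running_max phi_borel)

lemma filtration_indicator: "\<Gamma> \<in> sets (path_filtration u) \<Longrightarrow> indicator \<Gamma> \<in> borel_measurable (path_filtration u)"
  by simp

lemmas measurable_filtration_P = measurable_filtration_imp[OF PD(3)]

lemma start_x: "AE \<omega> in P. coord 0 \<omega> = x" using bm_start[OF PD(1)] .

lemma max_gain_start: "max_gain \<phi> x x = tail x"
  using max_gain_eq[OF phi_int, of x x] by (simp add: tail_def)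

text \<open>Freezing the path up to \<open>u\<close>, the maximum of the remaining increments over a
  time \<open>t - u\<close> brings in the rate and the damped gain. Nonnegative integrals postpone
  questions of integrability.\<close>

lemma nn_integral_phi_running_max:
  assumes u: "0 \<le> u" "u < t" and H: "H \<in> borel_measurable (path_filtration u)"
  shows "(\<integral>\<^sup>+\<omega>. H \<omega> * ennreal (\<phi> (running_max t \<omega>)) \<partial>P) =
     ennreal (max_rate (t - u)) * (\<integral>\<^sup>+\<omega>. H \<omega> * ennreal (damped_gain \<phi> (t - u) (running_max u \<omega>) (coord u \<omega>)) \<partial>P)"
proof -
  define f where "f = (\<lambda>p. H (fst p) * ennreal (\<phi> (max (running_max u (fst p)) (coord u (fst p) + running_max (t - u) (snd p)))))"
  have rm: "running_max (t - u) \<in> borel_measurable path_algebra" using u by (intro borel_measurable_running_max) auto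
  have cu: "coord u \<in> borel_measurable (path_filtration u)" "running_max u \<in> borel_measurable (path_filtration u)"
    using u by (auto intro: filtration_coord filtration_running_max)
  have f: "f \<in> borel_measurable (path_filtration u \<Otimes>\<^sub>M path_algebra)"
    unfolding f_def
    using measurable_compose[OF measurable_fst cu(1)] measurable_compose[OF measurable_fst cu(2)] measurable_compose[OF measurable_snd rm] measurable_compose[OF measurable_fst H]
    by measurable
  have "(\<integral>\<^sup>+\<omega>. H \<omega> * ennreal (\<phi> (running_max t \<omega>)) \<partial>P) = (\<integral>\<^sup>+\<omega>. f (\<omega>, path_shift u \<omega>) \<partial>P)"
  proof (rule nn_integral_cong)
    fix \<omega> assume "\<omega> \<in> space P"
    then have "running_max t \<omega> = max (running_max u \<omega>) (coord u \<omega> + running_max (t - u) (path_shift u \<omega>))"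
      using running_max_shift[of \<omega> u "t - u"] u PD(4) by simp
    then show "H \<omega> * ennreal (\<phi> (running_max t \<omega>)) = f (\<omega>, path_shift u \<omega>)" by (simp add: f_def)
  qed
  also have "\<dots> = (\<integral>\<^sup>+\<omega>. \<integral>\<^sup>+\<omega>'. f (\<omega>, \<omega>') \<partial>W \<partial>P)" by (rule markov_nn_integral[OF P W u(1) f])
  also have "\<dots> = (\<integral>\<^sup>+\<omega>. ennreal (max_rate (t - u)) * (H \<omega> * ennreal (damped_gain \<phi> (t - u) (running_max u \<omega>) (coord u \<omega>))) \<partial>P)"
  proof (rule nn_integral_cong)
    fix \<omega>
    have "(\<integral>\<^sup>+\<omega>'. f (\<omega>, \<omega>') \<partial>W) = H \<omega> * (\<integral>\<^sup>+\<omega>'. ennreal (\<phi> (max (running_max u \<omega>) (coord u \<omega> + running_max (t - u) \<omega>'))) \<partial>W)"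
      unfolding f_def fst_conv snd_conv using u measurable_running_max_W[of "t - u"] by (intro nn_integral_cmult) measurable
    also have "\<dots> = H \<omega> * ennreal (max_rate (t - u) * damped_gain \<phi> (t - u) (running_max u \<omega>) (coord u \<omega>))"
      using u by (subst nn_integral_phi_max[OF phi_int phi_nonneg]) auto
    finally show "(\<integral>\<^sup>+\<omega>'. f (\<omega>, \<omega>') \<partial>W) = ennreal (max_rate (t - u)) * (H \<omega> * ennreal (damped_gain \<phi> (t - u) (running_max u \<omega>) (coord u \<omega>)))"
      using u by (simp add: ennreal_mult' max_rate_def mult_ac damped_gain_nonneg[OF phi_int phi_nonneg])
  qed
  also have "\<dots> = ennreal (max_rate (t - u)) * (\<integral>\<^sup>+\<omega>. H \<omega> * ennreal (damped_gain \<phi> (t - u) (running_max u \<omega>) (coord u \<omega>)) \<partial>P)"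
    by (intro nn_integral_cmult measurable_filtration_P[where s=u] borel_measurable_times_ennreal H measurable_compose[OF borel_measurable_damped_gain measurable_ennreal] phi_borel cu)
  finally show ?thesis .
qed

text \<open>Shifting at time 0 writes the path as its starting value plus a Brownian path from 0,
  which reduces the claim to \<open>nn_integral_max_gain_le\<close>.\<close>

lemma nn_integral_gain_le: 
  assumes u: "0 \<le> u"
  shows "(\<integral>\<^sup>+\<omega>. ennreal (gain u \<omega>) \<partial>P) \<le> ennreal (tail x)"
proof -
  define f where "f = (\<lambda>p. ennreal (max_gain \<phi> (max (coord 0 (fst p)) (coord 0 (fst p) + running_max u (snd p))) (coord 0 (fst p) + coord u (snd p))))"
  have m: "coord 0 \<in> borel_measurable (path_filtration 0)" "running_max u \<in> borel_measurable path_algebra" "coord u \<in> borel_measurable path_algebra"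
    using u by (auto intro: filtration_coord borel_measurable_running_max borel_measurable_coord)
  have f: "f \<in> borel_measurable (path_filtration 0 \<Otimes>\<^sub>M path_algebra)"
    unfolding f_def
    by (intro measurable_compose[OF borel_measurable_max_gain measurable_ennreal] phi_borel borel_measurable_max borel_measurable_add
        measurable_compose[OF measurable_fst m(1)] measurable_compose[OF measurable_snd m(2)] measurable_compose[OF measurable_snd m(3)])
  have "(\<integral>\<^sup>+\<omega>. ennreal (gain u \<omega>) \<partial>P) = (\<integral>\<^sup>+\<omega>. f (\<omega>, path_shift 0 \<omega>) \<partial>P)"
  proof (rule nn_integral_cong)
    fix \<omega> assume "\<omega> \<in> space P"
    then have "running_max u \<omega> = max (coord 0 \<omega>) (coord 0 \<omega> + running_max u (path_shift 0 \<omega>))"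
      using running_max_shift[of \<omega> 0 u] u PD(4) by (simp add: running_max_0)
    then show "ennreal (gain u \<omega>) = f (\<omega>, path_shift 0 \<omega>)" using u by (simp add: f_def gain_def coord_path_shift)
  qed
  also have "\<dots> = (\<integral>\<^sup>+\<omega>. \<integral>\<^sup>+\<omega>'. f (\<omega>, \<omega>') \<partial>W \<partial>P)" by (rule markov_nn_integral[OF P W order_refl f])
  also have "\<dots> \<le> (\<integral>\<^sup>+\<omega>. ennreal (tail x) \<partial>P)"
  proof (rule nn_integral_mono_AE)
    show "AE \<omega> in P. (\<integral>\<^sup>+\<omega>'. f (\<omega>, \<omega>') \<partial>W) \<le> ennreal (tail x)"
      using start_x
    proof eventually_elim
      fix \<omega> assume "coord 0 \<omega> = x"
      then show "(\<integral>\<^sup>+\<omega>'. f (\<omega>, \<omega>') \<partial>W) \<le> ennreal (tail x)"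
        using nn_integral_max_gain_le[OF phi_int phi_nonneg u, of x x] by (simp add: f_def max_gain_start)
    qed
  qed
  also have "\<dots> = ennreal (tail x)" by (simp add: P.emeasure_space_1)
  finally show ?thesis .
qed

lemma measurable_gain: "0 \<le> u \<Longrightarrow> gain u \<in> borel_measurable P"
  by (rule measurable_filtration_P[OF filtration_gain]) auto

lemma integrable_gain: "0 \<le> u \<Longrightarrow> integrable P (gain u)"
  by (rule integrableI_bounded[OF measurable_gain])
     (use nn_integral_gain_le[of u] gain_nonneg in \<open>auto intro: le_less_trans\<close>)

lemma integral_phi_running_max:
  assumes u: "0 \<le> u" "u < t" and \<Gamma>: "\<Gamma> \<in> sets (path_filtration u)"
  shows "(\<integral>\<omega>. indicator \<Gamma> \<omega> * \<phi> (running_max t \<omega>) \<partial>P) =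
    max_rate (t - u) * (\<integral>\<omega>. indicator \<Gamma> \<omega> * damped_gain \<phi> (t - u) (running_max u \<omega>) (coord u \<omega>) \<partial>P)"
proof -
  have i: "(indicator \<Gamma> :: _ \<Rightarrow> real) \<in> borel_measurable P" by (rule measurable_filtration_P[OF filtration_indicator[OF \<Gamma>]])
  have cu: "coord u \<in> borel_measurable P" "running_max u \<in> borel_measurable P" "running_max t \<in> borel_measurable P"
    using u by (auto intro!: measurable_P borel_measurable_coord borel_measurable_running_max)
  have a: "(\<integral>\<omega>. indicator \<Gamma> \<omega> * \<phi> (running_max t \<omega>) \<partial>P) = enn2real (\<integral>\<^sup>+\<omega>. indicator \<Gamma> \<omega> * ennreal (\<phi> (running_max t \<omega>)) \<partial>P)"
    using i cu phi_nonneg by (subst integral_eq_nn_integral) (auto simp: ennreal_mult' ennreal_indicator)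
  have b: "(\<integral>\<omega>. indicator \<Gamma> \<omega> * damped_gain \<phi> (t - u) (running_max u \<omega>) (coord u \<omega>) \<partial>P) =
    enn2real (\<integral>\<^sup>+\<omega>. indicator \<Gamma> \<omega> * ennreal (damped_gain \<phi> (t - u) (running_max u \<omega>) (coord u \<omega>)) \<partial>P)"
    using i cu damped_gain_nonneg[OF phi_int phi_nonneg]
    by (subst integral_eq_nn_integral) (auto simp: ennreal_mult' ennreal_indicator intro!: borel_measurable_times borel_measurable_damped_gain)
  have "indicator \<Gamma> \<in> borel_measurable (path_filtration u)" using \<Gamma> by simp
  from nn_integral_phi_running_max[OF u this] show ?thesis
    unfolding a b using u by (simp add: enn2real_mult max_rate_def)
qed

lemma integral_damped_tendsto:
  assumes u: "0 \<le> u" and \<Gamma>: "\<Gamma> \<in> sets (path_filtration u)"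
  shows "((\<lambda>t. \<integral>\<omega>. indicator \<Gamma> \<omega> * damped_gain \<phi> (t - u) (running_max u \<omega>) (coord u \<omega>) \<partial>P) \<longlongrightarrow> (\<integral>\<omega>. indicator \<Gamma> \<omega> * gain u \<omega> \<partial>P)) at_top"
proof (rule integral_dominated_convergence_at_top[where w="gain u"])
  have i: "(indicator \<Gamma> :: _ \<Rightarrow> real) \<in> borel_measurable P" by (rule measurable_filtration_P[OF filtration_indicator[OF \<Gamma>]])
  have cu: "coord u \<in> borel_measurable P" "running_max u \<in> borel_measurable P"
    using u by (auto intro!: measurable_P borel_measurable_coord borel_measurable_running_max)
  show "(\<lambda>\<omega>. indicator \<Gamma> \<omega> * gain u \<omega>) \<in> borel_measurable P"
    using i measurable_gain[OF u] by simp
  show "(\<lambda>\<omega>. indicator \<Gamma> \<omega> * damped_gain \<phi> (t - u) (running_max u \<omega>) (coord u \<omega>)) \<in> borel_measurable P" for t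
    using i cu by (intro borel_measurable_times borel_measurable_damped_gain phi_borel)
  show "integrable P (gain u)" by (rule integrable_gain[OF u])
  have shift: "filterlim (\<lambda>t. t - u) at_top at_top"
    using filterlim_tendsto_add_at_top[OF tendsto_const[of "-u"] filterlim_ident] by simp
  show "AE \<omega> in P. ((\<lambda>t. indicator \<Gamma> \<omega> * damped_gain \<phi> (t - u) (running_max u \<omega>) (coord u \<omega>)) \<longlongrightarrow> indicator \<Gamma> \<omega> * gain u \<omega>) at_top"
    unfolding gain_def
    by (intro AE_I2 tendsto_mult tendsto_const filterlim_compose[OF damped_gain_tendsto[OF phi_int phi_nonneg] shift])
  show "\<forall>\<^sub>F t in at_top. AE \<omega> in P. norm (indicator \<Gamma> \<omega> * damped_gain \<phi> (t - u) (running_max u \<omega>) (coord u \<omega>)) \<le> gain u \<omega>"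
    using eventually_gt_at_top[of u]
  proof eventually_elim
    fix t assume "u < t"
    then show "AE \<omega> in P. norm (indicator \<Gamma> \<omega> * damped_gain \<phi> (t - u) (running_max u \<omega>) (coord u \<omega>)) \<le> gain u \<omega>"
      using damped_gain_le[OF phi_int phi_nonneg, of "t - u"] damped_gain_nonneg[OF phi_int phi_nonneg] gain_nonneg
      by (intro AE_I2) (auto simp: indicator_def gain_def)
  qed
qed

lemma integral_gain_0: "(\<integral>\<omega>. gain 0 \<omega> \<partial>P) = tail x"
proof -
  have "(\<integral>\<omega>. gain 0 \<omega> \<partial>P) = (\<integral>\<omega>. tail x \<partial>P)"
  proof (rule integral_cong_AE)
    show "AE \<omega> in P. gain 0 \<omega> = tail x"
      using start_x by eventually_elim (simp add: gain_def running_max_0 max_gain_start)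
  qed (simp_all add: measurable_gain)
  then show ?thesis by (simp add: P.prob_space)
qed

lemma max_rate_ratio: "((\<lambda>t. max_rate (t - u) / max_rate t) \<longlongrightarrow> 1) at_top"
proof -
  have "((\<lambda>t. sqrt (t / (t - u))) \<longlongrightarrow> 1) at_top" by real_asymp
  moreover have "\<forall>\<^sub>F t in at_top. sqrt (t / (t - u)) = max_rate (t - u) / max_rate t"
    using eventually_gt_at_top[of "max 0 u"]
    by eventually_elim (simp add: max_rate_def real_sqrt_divide real_sqrt_mult)
  ultimately show ?thesis by (rule Lim_transform_eventually)
qed

text \<open>The numerator is conditioned at time \<open>u\<close>, the denominator at time 0. Both
  become a rate times an integral of damped gains; the rates have ratio
  \<open>sqrt (t / (t - u))\<close>, which tends to 1, and the integrals converge by domination with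
  \<open>gain u\<close> and \<open>gain 0\<close>.\<close>

theorem penalised_limit:
  assumes u: "0 \<le> u" and \<Gamma>: "\<Gamma> \<in> sets (path_filtration u)"
  shows "((\<lambda>t. (\<integral>\<omega>. indicator \<Gamma> \<omega> * \<phi> (running_max t \<omega>) \<partial>P) / (\<integral>\<omega>. \<phi> (running_max t \<omega>) \<partial>P))
     \<longlongrightarrow> (\<integral>\<omega>. indicator \<Gamma> \<omega> * gain u \<omega> \<partial>P) / tail x) at_top"
proof -
  let ?a = "\<lambda>t. \<integral>\<omega>. indicator \<Gamma> \<omega> * damped_gain \<phi> (t - u) (running_max u \<omega>) (coord u \<omega>) \<partial>P"
  let ?b = "\<lambda>t. \<integral>\<omega>. indicator path_space \<omega> * damped_gain \<phi> (t - 0) (running_max 0 \<omega>) (coord 0 \<omega>) \<partial>P"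
  have top: "path_space \<in> sets (path_filtration 0)" using sets.top[of "path_filtration 0"] by simp
  have "(\<integral>\<omega>. indicator path_space \<omega> * gain 0 \<omega> \<partial>P) = tail x"
    using integral_gain_0 PD(4) by (subst Bochner_Integration.integral_cong[OF refl, of _ _ "gain 0"]) auto
  then have b: "(?b \<longlongrightarrow> tail x) at_top" using integral_damped_tendsto[OF order_refl top] by simp
  have "((\<lambda>t. max_rate (t - u) / max_rate t * (?a t / ?b t)) \<longlongrightarrow> 1 * ((\<integral>\<omega>. indicator \<Gamma> \<omega> * gain u \<omega> \<partial>P) / tail x)) at_top"
    using tail_pos[of x] by (intro tendsto_mult tendsto_divide max_rate_ratio integral_damped_tendsto[OF u \<Gamma>] b) simp
  moreover have "\<forall>\<^sub>F t in at_top. max_rate (t - u) / max_rate t * (?a t / ?b t) =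
     (\<integral>\<omega>. indicator \<Gamma> \<omega> * \<phi> (running_max t \<omega>) \<partial>P) / (\<integral>\<omega>. \<phi> (running_max t \<omega>) \<partial>P)"
    using eventually_gt_at_top[of u]
  proof eventually_elim
    fix t assume t: "u < t"
    have "(\<integral>\<omega>. \<phi> (running_max t \<omega>) \<partial>P) = (\<integral>\<omega>. indicator path_space \<omega> * \<phi> (running_max t \<omega>) \<partial>P)"
      using PD(4) by (intro Bochner_Integration.integral_cong) auto
    also have "\<dots> = max_rate t * ?b t" using integral_phi_running_max[OF order_refl _ top, of t] t u by simp
    finally show "max_rate (t - u) / max_rate t * (?a t / ?b t) = (\<integral>\<omega>. indicator \<Gamma> \<omega> * \<phi> (running_max t \<omega>) \<partial>P) / (\<integral>\<omega>. \<phi> (running_max t \<omega>) \<partial>P)"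
      using integral_phi_running_max[OF u t \<Gamma>] by simp
  qed
  ultimately show ?thesis by (simp add: Lim_transform_eventually)
qed

text \<open>The limit in \<open>penalised_limit\<close> does not depend on the time at which \<open>\<Gamma>\<close> is regarded as
  observable, which gives the martingale property for free.\<close>

lemma gain_martingale:
  assumes "0 \<le> u" "u \<le> v" "\<Gamma> \<in> sets (path_filtration u)"
  shows "(\<integral>\<omega>. indicator \<Gamma> \<omega> * gain u \<omega> \<partial>P) = (\<integral>\<omega>. indicator \<Gamma> \<omega> * gain v \<omega> \<partial>P)"
proof -
  have "\<Gamma> \<in> sets (path_filtration v)" using sets_coord_sigma_mono[of "{0..u}" "{0..v}"] assms by auto
  then have "(\<integral>\<omega>. indicator \<Gamma> \<omega> * gain u \<omega> \<partial>P) / tail x = (\<integral>\<omega>. indicator \<Gamma> \<omega> * gain v \<omega> \<partial>P) / tail x"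
    using penalised_limit[OF assms(1,3)] penalised_limit[of v \<Gamma>] assms by (intro tendsto_unique) auto
  then show ?thesis using tail_pos[of x] by simp
qed

lemma integral_gain: "0 \<le> u \<Longrightarrow> (\<integral>\<omega>. gain u \<omega> \<partial>P) = tail x"
proof -
  assume u: "0 \<le> u"
  have eq: "(\<integral>\<omega>. indicator path_space \<omega> * gain v \<omega> \<partial>P) = (\<integral>\<omega>. gain v \<omega> \<partial>P)" for v
    using PD(4) by (intro Bochner_Integration.integral_cong) auto
  have "path_space \<in> sets (path_filtration 0)" using sets.top[of "path_filtration 0"] by simp
  from gain_martingale[OF order_refl u this] show ?thesis by (simp add: eq integral_gain_0)
qed

end

section \<open>Extension of consistent laws on path space\<close>

definition rational_times :: "real set" where
  "rational_times = {q. q \<in> \<rat> \<and> 0 \<le> q}"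

definition floor_time :: "nat \<Rightarrow> real \<Rightarrow> real" where
  "floor_time k t = real (nat \<lfloor>t * real (Suc k)\<rfloor>) / real (Suc k)"

lemma floor_time: "0 \<le> t \<Longrightarrow> floor_time k t \<in> rational_times" "0 \<le> t \<Longrightarrow> floor_time k t \<le> t"
    "0 \<le> t \<Longrightarrow> (\<lambda>k. floor_time k t) \<longlonglongrightarrow> t"
  using floor_approx_le[of t k] floor_approx_tendsto[of t]
  by (auto simp: floor_time_def[abs_def] rational_times_def simp del: of_nat_Suc)

lemma countable_rational_times: "countable rational_times"
  by (rule countable_subset[OF _ countable_rat]) (auto simp: rational_times_def)

text \<open>Continuity recovers every coordinate from rational times not exceeding it, so countably
  many coordinates generate the information up to \<open>n\<close>.\<close>

lemma sets_coord_sigma_rational: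
  "sets (coord_sigma {0..n}) = sets (coord_sigma (rational_times \<inter> {0..n}))"
proof
  show "sets (coord_sigma (rational_times \<inter> {0..n})) \<subseteq> sets (coord_sigma {0..n})" by (rule sets_coord_sigma_mono) auto
  have "(\<lambda>\<omega>. \<omega>) \<in> coord_sigma (rational_times \<inter> {0..n}) \<rightarrow>\<^sub>M coord_sigma {0..n}"
  proof (rule measurable_coord_sigmaI)
    fix t assume t: "t \<in> {0..n}"
    show "(\<lambda>\<omega>. coord t \<omega>) \<in> borel_measurable (coord_sigma (rational_times \<inter> {0..n}))"
    proof (rule borel_measurable_LIMSEQ_real)
      show "(\<lambda>k. coord (floor_time k t) \<omega>) \<longlonglongrightarrow> coord t \<omega>" if "\<omega> \<in> space (coord_sigma (rational_times \<inter> {0..n}))" for \<omega>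
        using that t floor_time(1)[of t] floor_time(3)[of t] by (intro tendsto_coord) (auto simp: rational_times_def)
      show "(\<lambda>\<omega>. coord (floor_time k t) \<omega>) \<in> borel_measurable (coord_sigma (rational_times \<inter> {0..n}))" for k
        using t floor_time(1,2)[of t k] by (intro borel_measurable_coord) (auto simp: rational_times_def)
    qed
  qed simp
  note m = this
  show "sets (coord_sigma {0..n}) \<subseteq> sets (coord_sigma (rational_times \<inter> {0..n}))"
  proof
    fix A assume A: "A \<in> sets (coord_sigma {0..n})"
    then have "A \<subseteq> path_space" using sets.sets_into_space by fastforce
    then show "A \<in> sets (coord_sigma (rational_times \<inter> {0..n}))" using measurable_sets[OF m A] by (simp add: Int_absorb2)
  qed
qed

text \<open>The condition under which a function on the rational times extends to a continuous path.
  Uniform continuity on bounded pieces involves countably many coordinates only, and so defines a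
  measurable set.\<close>

definition regular :: "(real \<Rightarrow> real) \<Rightarrow> bool" where
  "regular f \<longleftrightarrow> (\<forall>n::nat. uniformly_continuous_on (rational_times \<inter> {0..real n}) f)"

text \<open>Sending irregular functions to the zero path makes this a total map into
  \<open>path_space\<close>.\<close>

definition extend_path :: "(real \<Rightarrow> real) \<Rightarrow> real \<Rightarrow> real" where
  "extend_path f = (\<lambda>t\<in>{0..}. if regular f then lim (\<lambda>k. f (floor_time k t)) else 0)"

lemma continuous_on_halfline:
  fixes f :: "real \<Rightarrow> real"
  assumes "\<And>n :: nat. continuous_on {0..real n} f"
  shows "continuous_on {0..} f"
  unfolding continuous_on_sequentially
proof (intro allI ballI impI, elim conjE)
  fix y :: "nat \<Rightarrow> real" and a assume a: "a \<in> {0..}" and y: "\<forall>n. y n \<in> {0..}" "y \<longlonglongrightarrow> a"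
  have "Bseq y" using y(2) by (intro convergent_imp_Bseq convergentI)
  then obtain K where K: "\<And>n. \<bar>y n\<bar> \<le> K" by (auto simp: Bseq_def)
  obtain n :: nat where n: "max K a \<le> real n" using real_arch_simple by blast
  have "y k \<in> {0..real n}" for k using y(1) K[of k] n by auto
  moreover have "a \<in> {0..real n}" using a n by auto
  ultimately show "(f \<circ> y) \<longlonglongrightarrow> f a"
    unfolding o_def by (intro continuous_on_tendsto_compose[OF assms[of n] y(2)]) auto
qed

lemma extend_path_regular:
  assumes f: "regular f"
  shows "continuous_on {0..} (extend_path f)" "q \<in> rational_times \<Longrightarrow> extend_path f q = f q"
proof -
  have local: "\<exists>g. continuous_on {0..real n} g \<and> (\<forall>t\<in>{0..real n}. extend_path f t = g t) \<and> (\<forall>q\<in>rational_times \<inter> {0..real n}. f q = g q)" for n :: nat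
  proof -
    let ?I = "rational_times \<inter> {0..real n}"
    have uc: "uniformly_continuous_on ?I f" using f by (simp add: regular_def)
    obtain g where g: "uniformly_continuous_on (closure ?I) g" "\<And>x. x \<in> ?I \<Longrightarrow> f x = g x"
      by (rule uniformly_continuous_on_extension_on_closure[OF uc]) blast
    have ft: "floor_time k t \<in> ?I" if "t \<in> {0..real n}" for k t
      using floor_time(1,2)[of t k] that by (auto simp: rational_times_def)
    have cl: "{0..real n} \<subseteq> closure ?I"
    proof
      fix t assume t: "t \<in> {0..real n}"
      then show "t \<in> closure ?I"
        unfolding closure_sequential using ft floor_time(3)[of t] by (intro exI[of _ "\<lambda>k. floor_time k t"]) auto
    qed
    have cg: "continuous_on {0..real n} g"
      using uniformly_continuous_imp_continuous[OF g(1)] cl by (rule continuous_on_subset)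
    have "extend_path f t = g t" if t: "t \<in> {0..real n}" for t
    proof -
      have "(\<lambda>k. g (floor_time k t)) \<longlonglongrightarrow> g t"
        using t ft[OF t] by (intro continuous_on_tendsto_compose[OF cg floor_time(3)]) auto
      then have "(\<lambda>k. f (floor_time k t)) \<longlonglongrightarrow> g t" using g(2)[OF ft[OF t]] by simp
      then have "lim (\<lambda>k. f (floor_time k t)) = g t" by (rule limI)
      then show ?thesis using t f by (simp add: extend_path_def)
    qed
    then show ?thesis using cg g(2) by blast
  qed
  show "continuous_on {0..} (extend_path f)"
  proof (rule continuous_on_halfline)
    fix n :: nat
    from local[of n] obtain g where g: "continuous_on {0..real n} g" "\<forall>t\<in>{0..real n}. extend_path f t = g t" by blast
    show "continuous_on {0..real n} (extend_path f)"
      by (rule continuous_on_cong[THEN iffD1, OF refl _ g(1)]) (use g(2) in simp)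
  qed
  assume q: "q \<in> rational_times"
  obtain n :: nat where "q \<le> real n" using real_arch_simple by blast
  then have "q \<in> rational_times \<inter> {0..real n}" using q by (auto simp: rational_times_def)
  then show "extend_path f q = f q" using local[of n] by auto
qed

lemma extend_path_in_path_space: "extend_path f \<in> path_space"
proof (cases "regular f")
  case True
  then show ?thesis using extend_path_regular(1) by (auto simp: path_space_def extend_path_def)
next
  case False
  have "continuous_on {0..} (extend_path f) \<longleftrightarrow> continuous_on {0..} (\<lambda>_ :: real. 0 :: real)"
    by (rule continuous_on_cong) (use False in \<open>auto simp: extend_path_def\<close>)
  then show ?thesis by (simp add: path_space_def extend_path_def)
qed

lemma uniformly_continuous_on_iff_nat:
  fixes f :: "real \<Rightarrow> real"
  shows "uniformly_continuous_on I f \<longleftrightarrow>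
    (\<forall>k::nat. \<exists>m::nat. \<forall>p\<in>I. \<forall>q\<in>I. dist q p < 1 / real (Suc m) \<longrightarrow> dist (f q) (f p) < 1 / real (Suc k))"
proof
  assume "uniformly_continuous_on I f"
  show "\<forall>k::nat. \<exists>m::nat. \<forall>p\<in>I. \<forall>q\<in>I. dist q p < 1 / real (Suc m) \<longrightarrow> dist (f q) (f p) < 1 / real (Suc k)"
  proof
    fix k :: nat
    have "0 < 1 / real (Suc k)" by simp
    then obtain d where d: "0 < d" "\<forall>p\<in>I. \<forall>q\<in>I. dist q p < d \<longrightarrow> dist (f q) (f p) < 1 / real (Suc k)"
      using \<open>uniformly_continuous_on I f\<close> unfolding uniformly_continuous_on_def by blast
    obtain m where "1 / real (Suc m) < d" using nat_approx_posE[OF d(1)] by metis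
    then show "\<exists>m::nat. \<forall>p\<in>I. \<forall>q\<in>I. dist q p < 1 / real (Suc m) \<longrightarrow> dist (f q) (f p) < 1 / real (Suc k)"
      using d(2) by (meson less_trans)
  qed
next
  assume *: "\<forall>k::nat. \<exists>m::nat. \<forall>p\<in>I. \<forall>q\<in>I. dist q p < 1 / real (Suc m) \<longrightarrow> dist (f q) (f p) < 1 / real (Suc k)"
  show "uniformly_continuous_on I f"
    unfolding uniformly_continuous_on_def
  proof (intro allI impI)
    fix e :: real assume "0 < e"
    obtain k where k: "1 / real (Suc k) < e" using nat_approx_posE[OF \<open>0 < e\<close>] by metis
    from * obtain m where "\<forall>p\<in>I. \<forall>q\<in>I. dist q p < 1 / real (Suc m) \<longrightarrow> dist (f q) (f p) < 1 / real (Suc k)" by blast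
    then show "\<exists>d>0. \<forall>p\<in>I. \<forall>q\<in>I. dist q p < d \<longrightarrow> dist (f q) (f p) < e"
      using k by (intro exI[of _ "1 / real (Suc m)"]) (auto intro: less_trans)
  qed
qed

lemma sets_uniformly_continuous:
  fixes I J :: "real set"
  assumes "J \<subseteq> I" "countable J"
  shows "{f \<in> space (\<Pi>\<^sub>M i\<in>I. (borel :: real measure)). uniformly_continuous_on J f} \<in> sets (\<Pi>\<^sub>M i\<in>I. borel)"
proof -
  have *: "{f \<in> space (\<Pi>\<^sub>M i\<in>I. (borel :: real measure)). dist q p < d \<longrightarrow> dist (f q) (f p) < e} \<in> sets (\<Pi>\<^sub>M i\<in>I. borel)"
    if "p \<in> J" "q \<in> J" for p q d e
  proof (cases "dist q p < d")
    case True
    have "(\<lambda>f. f q) \<in> borel_measurable (\<Pi>\<^sub>M i\<in>I. (borel :: real measure))" "(\<lambda>f. f p) \<in> borel_measurable (\<Pi>\<^sub>M i\<in>I. (borel :: real measure))"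
      using that assms by (auto intro!: measurable_component_singleton)
    then have "(\<lambda>f. dist (f q) (f p)) \<in> borel_measurable (\<Pi>\<^sub>M i\<in>I. (borel :: real measure))" by (rule borel_measurable_dist)
    then have "{f \<in> space (\<Pi>\<^sub>M i\<in>I. (borel :: real measure)). dist (f q) (f p) < e} \<in> sets (\<Pi>\<^sub>M i\<in>I. borel)"
      by (intro borel_measurable_less) auto
    then show ?thesis using True by simp
  qed simp
  show ?thesis
    unfolding uniformly_continuous_on_iff_nat
    by (intro sets.sets_Collect_countable_All sets.sets_Collect_countable_Ex sets.sets_Collect_countable_All'[OF _ assms(2)] *)
qed

lemma prod_emb_cylinder_iff:
  fixes A :: "'i \<Rightarrow> real set"
  assumes "U \<subseteq> J"
  shows "f \<in> prod_emb J (\<lambda>_. borel) U (Pi\<^sub>E U A) \<longleftrightarrow> f \<in> extensional J \<and> (\<forall>u\<in>U. f u \<in> A u)"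
  using assms by (auto simp: prod_emb_def PiE_iff)

text \<open>Kolmogorov's theorem lives on a product space, where continuity over an uncountable time
  set is not a measurable condition, so it is applied on the rational times. On those in
  \<open>[0, n]\<close> the projective limit has the same law as \<open>D n\<close>; hence almost
  every function is uniformly continuous there, and \<open>extend_path\<close> carries the limit
  back to continuous paths.\<close>

theorem path_measure_extension:
  fixes D :: "nat \<Rightarrow> (real \<Rightarrow> real) measure"
  assumes prob: "\<And>n. prob_space (D n)" and sets: "\<And>n. sets (D n) = sets path_algebra"
    and cons: "\<And>m n \<Gamma>. m \<le> n \<Longrightarrow> \<Gamma> \<in> sets (path_filtration (real m)) \<Longrightarrow> measure (D n) \<Gamma> = measure (D m) \<Gamma>"
  shows "\<exists>Q. prob_space Q \<and> sets Q = sets path_algebra \<and>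
    (\<forall>n. \<forall>\<Gamma>\<in>sets (path_filtration (real n)). measure Q \<Gamma> = measure (D n) \<Gamma>)"
proof -
  define I where "I = rational_times"
  \<comment> \<open>An integer horizon covering the finite time set \<open>J\<close>; by
    \<open>distr_R\<close> below any larger horizon gives the same marginal.\<close>
  define N where "N J = nat \<lceil>Max (insert 0 J)\<rceil>" for J :: "real set"
  define R where "R J \<omega> = (\<lambda>q\<in>J. coord q \<omega>)" for J and \<omega> :: "real \<Rightarrow> real"
  define F where "F J = distr (D (N J)) (\<Pi>\<^sub>M i\<in>J. (borel :: real measure)) (R J)" for J
  have spD: "space (D n) = path_space" for n using sets_eq_imp_space_eq[OF sets[of n]] by simp
  have N: "J \<subseteq> {0..real (N J)}" if "finite J" "J \<subseteq> I" for J
  proof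
    fix q assume q: "q \<in> J"
    then have "q \<le> Max (insert 0 J)" using that by (intro Max_ge) auto
    also have "\<dots> \<le> real (N J)" unfolding N_def by linarith
    finally show "q \<in> {0..real (N J)}" using q that by (auto simp: I_def rational_times_def)
  qed
  have N_le: "N J \<le> n" if "finite J" "J \<subseteq> {0..real n}" for J n
  proof -
    have "Max (insert 0 J) \<le> real n" using that by (subst Max_le_iff) auto
    then show ?thesis by (simp add: N_def ceiling_le_iff)
  qed
  have Rm: "R J \<in> coord_sigma K \<rightarrow>\<^sub>M (\<Pi>\<^sub>M i\<in>J. borel)" if "J \<subseteq> K" for J K
    unfolding R_def using that by (intro measurable_restrict borel_measurable_coord) auto
  have RD: "R J \<in> D n \<rightarrow>\<^sub>M (\<Pi>\<^sub>M i\<in>J. borel)" if "J \<subseteq> {0..}" for J n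
    using Rm[OF that] by (simp add: measurable_cong_sets[OF sets refl])
  have Ipos: "I \<subseteq> {0..}" by (auto simp: I_def rational_times_def)
  have distr_R: "distr (D m) (\<Pi>\<^sub>M i\<in>J. borel) (R J) = distr (D n) (\<Pi>\<^sub>M i\<in>J. borel) (R J)"
    if J: "J \<subseteq> {0..real m}" and mn: "m \<le> n" for J m n
  proof (rule measure_eqI)
    interpret Dm: prob_space "D m" by (rule prob)
    interpret Dn: prob_space "D n" by (rule prob)
    fix A assume "A \<in> sets (distr (D m) (\<Pi>\<^sub>M i\<in>J. borel) (R J))"
    then have A: "A \<in> sets (\<Pi>\<^sub>M i\<in>J. borel)" by simp
    have J0: "J \<subseteq> {0..}" using J by auto
    have "R J -` A \<inter> path_space \<in> sets (path_filtration (real m))"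
      using measurable_sets[OF Rm[OF J] A] by simp
    then show "emeasure (distr (D m) (\<Pi>\<^sub>M i\<in>J. borel) (R J)) A = emeasure (distr (D n) (\<Pi>\<^sub>M i\<in>J. borel) (R J)) A"
      using cons[OF mn] A by (simp add: emeasure_distr[OF RD[OF J0]] spD Dm.emeasure_eq_measure Dn.emeasure_eq_measure)
  qed simp
  interpret polish_projective I F
  proof (intro polish_projective.intro projective_family.intro)
    fix J H assume JH: "J \<subseteq> H" "finite H" "H \<subseteq> I"
    then have fJ: "finite J" "J \<subseteq> I" by (auto intro: finite_subset)
    have "distr (F H) (\<Pi>\<^sub>M i\<in>J. borel) (\<lambda>f. restrict f J) = distr (D (N H)) (\<Pi>\<^sub>M i\<in>J. borel) ((\<lambda>f. restrict f J) \<circ> R H)"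
      unfolding F_def using JH Ipos by (intro distr_distr measurable_restrict_subset RD) auto
    also have "(\<lambda>f. restrict f J) \<circ> R H = R J" using JH by (auto simp: R_def fun_eq_iff restrict_def)
    also have "distr (D (N H)) (\<Pi>\<^sub>M i\<in>J. borel) (R J) = F J"
      unfolding F_def using JH fJ N[OF fJ] N[of H] by (intro distr_R[symmetric] N_le) auto
    finally show "F J = distr (F H) (\<Pi>\<^sub>M i\<in>J. borel) (\<lambda>f. restrict f J)" by (rule sym)
  next
    fix J assume "finite J" "J \<subseteq> I"
    then show "prob_space (F J)" unfolding F_def using Ipos by (intro prob_space.prob_space_distr[OF prob] RD) auto
  qed
  have lim_set: "{f \<in> space lim. \<forall>u\<in>U. f u \<in> A u} = prod_emb I (\<lambda>_. borel) U (Pi\<^sub>E U A)"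
    if "U \<subseteq> I" for U A
    by (auto simp: prod_emb_cylinder_iff[OF that] space_PiM PiE_iff)
  have lim_cyl: "emeasure lim {f \<in> space lim. \<forall>u\<in>U. f u \<in> A u} = emeasure (D n) {\<omega> \<in> path_space. \<forall>u\<in>U. coord u \<omega> \<in> A u}"
    if U: "finite U" "U \<subseteq> I \<inter> {0..real n}" and A: "\<And>u. u \<in> U \<Longrightarrow> A u \<in> sets borel" for U A n
  proof -
    have UI: "U \<subseteq> I" and Un: "U \<subseteq> {0..real n}" and U0: "U \<subseteq> {0..}" using U by auto
    have X: "Pi\<^sub>E U A \<in> sets (\<Pi>\<^sub>M i\<in>U. borel)" using U A by (intro sets_PiM_I_finite) auto
    have "emeasure lim {f \<in> space lim. \<forall>u\<in>U. f u \<in> A u} = emeasure (F U) (Pi\<^sub>E U A)"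
      unfolding lim_set[OF UI] by (rule emeasure_lim_emb[OF UI U(1) X])
    also have "F U = distr (D n) (\<Pi>\<^sub>M i\<in>U. borel) (R U)"
      unfolding F_def by (rule distr_R[OF N[OF U(1) UI] N_le[OF U(1) Un]])
    also have "emeasure \<dots> (Pi\<^sub>E U A) = emeasure (D n) {\<omega> \<in> path_space. \<forall>u\<in>U. coord u \<omega> \<in> A u}"
      using X by (subst emeasure_distr[OF RD[OF U0]]) (auto simp: spD R_def PiE_iff intro!: arg_cong2[where f=emeasure])
    finally show ?thesis .
  qed
  have reg_n: "AE f in lim. uniformly_continuous_on (rational_times \<inter> {0..real n}) f" for n
  proof -
    let ?J = "rational_times \<inter> {0..real n}"
    have J: "?J \<subseteq> I" "?J \<subseteq> {0..real n}" "?J \<subseteq> {0..}" "countable ?J" using countable_rational_times by (auto simp: I_def)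
    have rm: "(\<lambda>f. restrict f ?J) \<in> lim \<rightarrow>\<^sub>M (\<Pi>\<^sub>M i\<in>?J. borel)"
      using measurable_restrict_subset[OF J(1), of "\<lambda>_. borel"] by (simp add: measurable_cong_sets[OF sets_lim refl])
    have eq: "distr lim (\<Pi>\<^sub>M i\<in>?J. borel) (\<lambda>f. restrict f ?J) = distr (D n) (\<Pi>\<^sub>M i\<in>?J. borel) (R ?J)"
    proof (rule measure_eqI_PiM_infinite)
      fix A :: "real \<Rightarrow> real set" and U assume U: "finite U" "U \<subseteq> ?J" "\<And>i. i \<in> U \<Longrightarrow> A i \<in> sets borel"
      have X: "prod_emb ?J (\<lambda>_. borel) U (Pi\<^sub>E U A) \<in> sets (\<Pi>\<^sub>M i\<in>?J. borel)"
        using U by (intro sets_PiM_I) auto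
      have "emeasure (distr lim (\<Pi>\<^sub>M i\<in>?J. borel) (\<lambda>f. restrict f ?J)) (prod_emb ?J (\<lambda>_. borel) U (Pi\<^sub>E U A)) =
        emeasure lim {f \<in> space lim. \<forall>u\<in>U. f u \<in> A u}"
        unfolding emeasure_distr[OF rm X]
      proof (intro arg_cong2[where f=emeasure] refl set_eqI)
        fix f :: "real \<Rightarrow> real"
        have "restrict f ?J u = f u" if "u \<in> U" for u using U(2) that by auto
        then show "f \<in> (\<lambda>f. restrict f ?J) -` prod_emb ?J (\<lambda>_. borel) U (Pi\<^sub>E U A) \<inter> space lim \<longleftrightarrow> f \<in> {f \<in> space lim. \<forall>u\<in>U. f u \<in> A u}"
          by (simp add: prod_emb_cylinder_iff[OF U(2)] conj_commute del: restrict_apply)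
      qed
      also have "\<dots> = emeasure (D n) {\<omega> \<in> path_space. \<forall>u\<in>U. coord u \<omega> \<in> A u}"
        using U by (intro lim_cyl) (auto simp: I_def)
      also have "\<dots> = emeasure (distr (D n) (\<Pi>\<^sub>M i\<in>?J. borel) (R ?J)) (prod_emb ?J (\<lambda>_. borel) U (Pi\<^sub>E U A))"
        unfolding emeasure_distr[OF RD[OF J(3)] X]
      proof (intro arg_cong2[where f=emeasure] refl set_eqI)
        fix \<omega>
        have "R ?J \<omega> u = coord u \<omega>" if "u \<in> U" for u using U(2) that by (auto simp: R_def)
        moreover have "R ?J \<omega> \<in> extensional ?J" by (simp add: R_def)
        ultimately show "\<omega> \<in> {\<omega> \<in> path_space. \<forall>u\<in>U. coord u \<omega> \<in> A u} \<longleftrightarrow> \<omega> \<in> R ?J -` prod_emb ?J (\<lambda>_. borel) U (Pi\<^sub>E U A) \<inter> space (D n)"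
          by (simp add: prod_emb_cylinder_iff[OF U(2)] spD conj_commute)
      qed
      finally show "emeasure (distr lim (\<Pi>\<^sub>M i\<in>?J. borel) (\<lambda>f. restrict f ?J)) (prod_emb ?J (\<lambda>_. borel) U (Pi\<^sub>E U A)) =
        emeasure (distr (D n) (\<Pi>\<^sub>M i\<in>?J. borel) (R ?J)) (prod_emb ?J (\<lambda>_. borel) U (Pi\<^sub>E U A))" .
    qed (simp_all add: prob_space.axioms(1)[OF P.prob_space_distr[OF rm]])
    have sU: "{f \<in> space (\<Pi>\<^sub>M i\<in>?J. (borel :: real measure)). uniformly_continuous_on ?J f} \<in> sets (\<Pi>\<^sub>M i\<in>?J. borel)"
      by (rule sets_uniformly_continuous[OF order_refl J(4)])
    have "AE \<omega> in D n. uniformly_continuous_on ?J (R ?J \<omega>)"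
    proof (rule AE_I2)
      fix \<omega> assume "\<omega> \<in> space (D n)"
      then have "\<omega> \<in> path_space" using spD by simp
      then have "uniformly_continuous_on {0..real n} (\<lambda>t. coord t \<omega>)"
        by (intro compact_uniformly_continuous continuous_on_path) auto
      then have "uniformly_continuous_on ?J (\<lambda>t. coord t \<omega>)"
        unfolding uniformly_continuous_on_def by (meson IntD2)
      then show "uniformly_continuous_on ?J (R ?J \<omega>)" by (simp add: R_def uniformly_continuous_on_def)
    qed
    then have "AE f in distr (D n) (\<Pi>\<^sub>M i\<in>?J. borel) (R ?J). uniformly_continuous_on ?J f"
      by (subst AE_distr_iff[OF RD[OF J(3)] sU])
    then have "AE f in lim. uniformly_continuous_on ?J (restrict f ?J)"
      unfolding eq[symmetric] by (subst (asm) AE_distr_iff[OF rm sU])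
    then show ?thesis by eventually_elim (simp add: uniformly_continuous_on_def)
  qed
  then have reg: "AE f in lim. regular f" unfolding regular_def by (simp add: AE_all_countable)
  have reg_sets: "{f \<in> space lim. regular f} \<in> sets lim"
  proof -
    have "{f \<in> space (\<Pi>\<^sub>M i\<in>I. (borel :: real measure)). regular f} \<in> sets (\<Pi>\<^sub>M i\<in>I. borel)"
      unfolding regular_def
      using countable_rational_times by (intro sets.sets_Collect_countable_All sets_uniformly_continuous) (auto simp: I_def)
    then show ?thesis by simp
  qed
  have em: "extend_path \<in> lim \<rightarrow>\<^sub>M path_algebra"
  proof (rule measurable_coord_sigmaI)
    fix t :: real assume t: "t \<in> {0..}"
    have "(\<lambda>f. f (floor_time k t)) \<in> borel_measurable (\<Pi>\<^sub>M i\<in>I. (borel :: real measure))" for k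
      using t floor_time(1)[of t k] by (intro measurable_component_singleton) (auto simp: I_def)
    then have "(\<lambda>f. f (floor_time k t)) \<in> borel_measurable lim" for k by (simp add: measurable_cong_sets[OF sets_lim refl])
    then have "(\<lambda>f. if regular f then Topological_Spaces.lim (\<lambda>k. f (floor_time k t)) else 0) \<in> borel_measurable lim"
      using reg_sets by (intro measurable_If borel_measurable_lim_metric) auto
    then show "(\<lambda>f. coord t (extend_path f)) \<in> borel_measurable lim"
      using t by (simp add: coord_def extend_path_def)
  qed (rule extend_path_in_path_space)
  define Q where "Q = distr lim path_algebra extend_path"
  interpret Q: prob_space Q unfolding Q_def by (rule P.prob_space_distr[OF em])
  have "measure Q \<Gamma> = measure (D n) \<Gamma>" if \<Gamma>: "\<Gamma> \<in> sets (path_filtration (real n))" for n \<Gamma>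
  proof -
    let ?J = "rational_times \<inter> {0..real n}"
    interpret Dn: prob_space "D n" by (rule prob)
    have id: "(\<lambda>\<omega>. \<omega>) \<in> path_algebra \<rightarrow>\<^sub>M coord_sigma ?J" by (rule measurable_id_coord_sigma) auto
    have idQ: "(\<lambda>\<omega>. \<omega>) \<in> Q \<rightarrow>\<^sub>M coord_sigma ?J" and idD: "(\<lambda>\<omega>. \<omega>) \<in> D n \<rightarrow>\<^sub>M coord_sigma ?J"
      using id by (simp_all add: Q_def measurable_cong_sets[OF sets refl])
    have spQ: "space Q = path_space" by (simp add: Q_def)
    \<comment> \<open>The comparison is made on cylinders over rational times, where
      \<open>extend_path\<close> keeps the values of a regular function;
      \<open>sets_coord_sigma_rational\<close> then covers all of
      \<open>path_filtration (real n)\<close>.\<close>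
    have "distr Q (coord_sigma ?J) (\<lambda>\<omega>. \<omega>) = distr (D n) (coord_sigma ?J) (\<lambda>\<omega>. \<omega>)"
    proof (rule measure_eqI_cylinders[OF Q.prob_space_distr[OF idQ] Dn.prob_space_distr[OF idD] sets_distr sets_distr])
      fix C assume C0: "C \<in> cylinders ?J"
      from cylindersD[OF C0] obtain U A where C: "C = {\<omega>\<in>path_space. \<forall>u\<in>U. coord u \<omega> \<in> A u}" "finite U" "U \<subseteq> ?J" "\<And>u. A u \<in> sets borel"
        by (elim exE conjE) (erule that; simp)
      have Cs: "C \<in> sets (coord_sigma ?J)" using C0 sets_cylinders by blast
      have "?J \<subseteq> {0..}" by auto
      then have Ca: "C \<in> sets path_algebra" using Cs sets_coord_sigma_mono[of ?J "{0..}"] by blast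
      have "emeasure Q C = emeasure lim (extend_path -` C \<inter> space lim)"
        unfolding Q_def by (rule emeasure_distr[OF em Ca])
      also have "\<dots> = emeasure lim {f \<in> space lim. \<forall>u\<in>U. f u \<in> A u}"
      proof (rule emeasure_eq_AE)
        show "AE f in lim. (f \<in> extend_path -` C \<inter> space lim) = (f \<in> {f \<in> space lim. \<forall>u\<in>U. f u \<in> A u})"
          using reg
        proof eventually_elim
          fix f assume "regular f"
          then have "coord u (extend_path f) = f u" if "u \<in> U" for u
            using extend_path_regular(2)[of f u] that C(3) by (auto simp: coord_def)
          then show "(f \<in> extend_path -` C \<inter> space lim) = (f \<in> {f \<in> space lim. \<forall>u\<in>U. f u \<in> A u})"
            using extend_path_in_path_space by (auto simp: C(1))
        qed
        show "extend_path -` C \<inter> space lim \<in> sets lim" by (rule measurable_sets[OF em Ca])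
        have UI: "U \<subseteq> I" using C(3) by (auto simp: I_def)
        have "prod_emb I (\<lambda>_. borel) U (Pi\<^sub>E U A) \<in> sets (\<Pi>\<^sub>M i\<in>I. borel)"
          using UI C by (intro sets_PiM_I) auto
        then show "{f \<in> space lim. \<forall>u\<in>U. f u \<in> A u} \<in> sets lim" unfolding lim_set[OF UI] by simp
      qed
      also have "\<dots> = emeasure (D n) C" unfolding C(1) using C by (intro lim_cyl) (auto simp: I_def)
      finally show "measure (distr Q (coord_sigma ?J) (\<lambda>\<omega>. \<omega>)) C = measure (distr (D n) (coord_sigma ?J) (\<lambda>\<omega>. \<omega>)) C"
        using Cs sets.sets_into_space[OF Cs]
        by (simp add: measure_distr[OF idQ] measure_distr[OF idD] spQ spD Int_absorb2 Q.emeasure_eq_measure Dn.emeasure_eq_measure)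
    qed
    moreover have \<Gamma>': "\<Gamma> \<in> sets (coord_sigma ?J)" using \<Gamma> by (simp add: sets_coord_sigma_rational)
    ultimately have "measure Q (\<Gamma> \<inter> path_space) = measure (D n) (\<Gamma> \<inter> path_space)"
      using measure_distr[OF idQ \<Gamma>'] measure_distr[OF idD \<Gamma>'] by (simp add: spQ spD)
    then show ?thesis using sets.sets_into_space[OF \<Gamma>'] by (simp add: Int_absorb2)
  qed
  then show ?thesis using Q.prob_space_axioms by (intro exI[of _ Q]) (auto simp: Q_def)
qed

lemma measure_eqI_filtration:
  assumes M: "prob_space M" "sets M = sets path_algebra" and N: "prob_space N" "sets N = sets path_algebra"
    and eq: "\<And>u \<Gamma>. 0 \<le> u \<Longrightarrow> \<Gamma> \<in> sets (path_filtration u) \<Longrightarrow> measure M \<Gamma> = measure N \<Gamma>"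
  shows "M = N"
proof (rule measure_eqI_cylinders[OF M(1) N(1) M(2) N(2)])
  fix C assume C0: "C \<in> cylinders {0..}"
  from cylindersD[OF C0] obtain U A where C: "C = {\<omega>\<in>path_space. \<forall>u\<in>U. coord u \<omega> \<in> A u}" "finite U" "U \<subseteq> {0..}" "\<And>u. A u \<in> sets borel"
    by (elim exE conjE) (erule that; simp)
  define t where "t = Max (insert 0 U)"
  have "U \<subseteq> {0..t}" "0 \<le> t" using C(2,3) by (auto simp: t_def)
  then have "C \<in> cylinders {0..t}" unfolding C(1) using C by (intro cylindersI) auto
  then show "measure M C = measure N C" using sets_cylinders eq[of t C] \<open>0 \<le> t\<close> by blast
qed

context penalisation
begin

text \<open>The change of law by \<open>M_u\<close>, defined on the whole path algebra but meant to
  represent the penalised law on \<open>path_filtration u\<close>.\<close>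

definition tilted :: "real \<Rightarrow> (real \<Rightarrow> real) measure" where
  "tilted u = density P (\<lambda>\<omega>. ennreal (gain u \<omega> / tail x))"

lemma measure_tilted:
  assumes u: "0 \<le> u" and \<Gamma>: "\<Gamma> \<in> sets path_algebra"
  shows "emeasure (tilted u) \<Gamma> = ennreal ((\<integral>\<omega>. indicator \<Gamma> \<omega> * gain u \<omega> \<partial>P) / tail x)"
    and "measure (tilted u) \<Gamma> = (\<integral>\<omega>. indicator \<Gamma> \<omega> * gain u \<omega> \<partial>P) / tail x"
proof -
  have \<Gamma>P: "\<Gamma> \<in> sets P" using \<Gamma> PD(3) by simp
  have i: "integrable P (\<lambda>\<omega>. indicator \<Gamma> \<omega> * gain u \<omega>)"
    using integrable_mult_indicator[OF \<Gamma>P integrable_gain[OF u]] by simp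
  have "emeasure (tilted u) \<Gamma> = (\<integral>\<^sup>+\<omega>. ennreal (indicator \<Gamma> \<omega> * gain u \<omega> / tail x) \<partial>P)"
    unfolding tilted_def using \<Gamma>P measurable_gain[OF u]
    by (subst emeasure_density) (auto intro!: nn_integral_cong simp: indicator_def)
  also have "\<dots> = ennreal (\<integral>\<omega>. indicator \<Gamma> \<omega> * gain u \<omega> / tail x \<partial>P)"
    using i gain_nonneg tail_pos[of x] by (intro nn_integral_eq_integral) (auto intro!: AE_I2 divide_nonneg_pos)
  finally show 1: "emeasure (tilted u) \<Gamma> = ennreal ((\<integral>\<omega>. indicator \<Gamma> \<omega> * gain u \<omega> \<partial>P) / tail x)" by simp
  have "0 \<le> (\<integral>\<omega>. indicator \<Gamma> \<omega> * gain u \<omega> \<partial>P) / tail x"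
    using gain_nonneg tail_pos[of x] by (intro divide_nonneg_pos Bochner_Integration.integral_nonneg) auto
  then show "measure (tilted u) \<Gamma> = (\<integral>\<omega>. indicator \<Gamma> \<omega> * gain u \<omega> \<partial>P) / tail x"
    by (simp add: measure_def 1)
qed

lemma prob_space_tilted: "0 \<le> u \<Longrightarrow> prob_space (tilted u)"
proof
  assume u: "0 \<le> u"
  have "(\<integral>\<omega>. indicator path_space \<omega> * gain u \<omega> \<partial>P) = tail x"
    using integral_gain[OF u] PD(4) by (subst Bochner_Integration.integral_cong[OF refl, of _ _ "gain u"]) auto
  moreover have "path_space \<in> sets path_algebra" using sets.top[of path_algebra] by simp
  ultimately show "emeasure (tilted u) (space (tilted u)) = 1"
    using measure_tilted(1)[OF u, of path_space] tail_pos[of x] PD(4) by (simp add: tilted_def)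
qed

definition penalised_law :: "(real \<Rightarrow> real) measure \<Rightarrow> bool" where
  "penalised_law Q \<longleftrightarrow> prob_space Q \<and> sets Q = sets path_algebra \<and>
     (\<forall>u\<ge>0. \<forall>\<Gamma>\<in>sets (path_filtration u). measure Q \<Gamma> = (\<integral>\<omega>. indicator \<Gamma> \<omega> * gain u \<omega> \<partial>P) / tail x)"

text \<open>\<open>gain_martingale\<close> is the consistency of the tilted laws at integer
  horizons, and it is used once more to come down from an integer \<open>n \<ge> u\<close> to
  \<open>u\<close>.\<close>

lemma penalised_law_exists: "\<exists>Q. penalised_law Q"
proof -
  have sub: "sets (path_filtration u) \<subseteq> sets path_algebra" for u by (rule sets_coord_sigma_mono) auto
  have "\<exists>Q. prob_space Q \<and> sets Q = sets path_algebra \<and>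
    (\<forall>n. \<forall>\<Gamma>\<in>sets (path_filtration (real n)). measure Q \<Gamma> = measure (tilted (real n)) \<Gamma>)"
  proof (rule path_measure_extension)
    show "prob_space (tilted (real n))" for n by (rule prob_space_tilted) simp
    show "sets (tilted (real n)) = sets path_algebra" for n by (simp add: tilted_def PD(3))
    show "measure (tilted (real n)) \<Gamma> = measure (tilted (real m)) \<Gamma>" if "m \<le> n" "\<Gamma> \<in> sets (path_filtration (real m))" for m n \<Gamma>
    proof -
      have "\<Gamma> \<in> sets path_algebra" using that sub by blast
      then show ?thesis using gain_martingale[of "real m" "real n" \<Gamma>] that by (simp add: measure_tilted(2))
    qed
  qed
  then obtain Q where Q: "prob_space Q" "sets Q = sets path_algebra"
    "\<And>n \<Gamma>. \<Gamma> \<in> sets (path_filtration (real n)) \<Longrightarrow> measure Q \<Gamma> = measure (tilted (real n)) \<Gamma>" by blast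
  have "measure Q \<Gamma> = (\<integral>\<omega>. indicator \<Gamma> \<omega> * gain u \<omega> \<partial>P) / tail x" if u: "0 \<le> u" and \<Gamma>: "\<Gamma> \<in> sets (path_filtration u)" for u \<Gamma>
  proof -
    obtain n :: nat where n: "u \<le> real n" using real_arch_simple by blast
    then have \<Gamma>n: "\<Gamma> \<in> sets (path_filtration (real n))" using \<Gamma> sets_coord_sigma_mono[of "{0..u}" "{0..real n}"] by auto
    have "measure Q \<Gamma> = (\<integral>\<omega>. indicator \<Gamma> \<omega> * gain (real n) \<omega> \<partial>P) / tail x"
      using Q(3)[OF \<Gamma>n] \<Gamma>n sub by (subst measure_tilted(2)[symmetric]) auto
    then show ?thesis using gain_martingale[OF u n \<Gamma>] by simp
  qed
  then show ?thesis using Q by (auto simp: penalised_law_def)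
qed

lemma penalised_law_unique: "penalised_law Q \<Longrightarrow> penalised_law Q' \<Longrightarrow> Q = Q'"
  by (rule measure_eqI_filtration) (auto simp: penalised_law_def)

end

section \<open>The penalised process\<close>

context penalisation
begin

text \<open>Conditioning at time 0 and dropping the damping factor, which is at most 1. The bound is
  integrable near \<open>v = 0\<close> even if \<open>\<phi>\<close> is unbounded.\<close>

lemma nn_integral_phi_running_max_le:
  assumes v: "0 < v"
  shows "(\<integral>\<^sup>+\<omega>. ennreal (\<phi> (running_max v \<omega>)) \<partial>P) \<le> ennreal (max_rate v * tail x)"
proof -
  have "(\<integral>\<^sup>+\<omega>. ennreal (\<phi> (running_max v \<omega>)) \<partial>P) =
    ennreal (max_rate v) * (\<integral>\<^sup>+\<omega>. ennreal (damped_gain \<phi> v (running_max 0 \<omega>) (coord 0 \<omega>)) \<partial>P)"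
    using nn_integral_phi_running_max[OF order_refl v, of "\<lambda>_. 1"] by simp
  also have "\<dots> \<le> ennreal (max_rate v) * (\<integral>\<^sup>+\<omega>. ennreal (gain 0 \<omega>) \<partial>P)"
    unfolding gain_def by (intro mult_left_mono nn_integral_mono ennreal_leI damped_gain_le[OF phi_int phi_nonneg v]) auto
  also have "\<dots> \<le> ennreal (max_rate v) * ennreal (tail x)" by (intro mult_left_mono nn_integral_gain_le) auto
  finally show ?thesis using v by (simp add: ennreal_mult' max_rate_def)
qed

lemma measurable_phi_max: "0 \<le> v \<Longrightarrow> (\<lambda>\<omega>. \<phi> (running_max v \<omega>)) \<in> borel_measurable P"
  by (rule measurable_compose[OF measurable_P[OF borel_measurable_running_max] phi_borel]) auto

lemma measurable_coord_P: "0 \<le> t \<Longrightarrow> coord t \<in> borel_measurable P"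
  by (intro measurable_P borel_measurable_coord) simp

lemma integrable_phi_max:
  assumes "0 \<le> v" shows "integrable P (\<lambda>\<omega>. \<phi> (running_max v \<omega>))"
proof (cases "v = 0")
  case True
  have "AE \<omega> in P. \<phi> (running_max v \<omega>) = \<phi> x"
    using start_x by eventually_elim (simp add: True running_max_0)
  then show ?thesis
    using integrable_cong_AE[OF measurable_phi_max[OF assms], of "\<lambda>_. \<phi> x"] by simp
next
  case False
  then show ?thesis
    using assms nn_integral_phi_running_max_le[of v] phi_nonneg
    by (intro integrableI_bounded[OF measurable_phi_max]) (auto intro: le_less_trans)
qed

lemma integrable_scaleR_bounded_P:
  fixes f :: "_ \<Rightarrow> real" and w :: "_ \<Rightarrow> complex"
  assumes "integrable P f" "w \<in> borel_measurable P" "\<And>p. p \<in> path_space \<Longrightarrow> norm (w p) \<le> K"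
  shows "integrable P (\<lambda>p. f p *\<^sub>R w p)"
  using assms PD(4) by (intro integrable_scaleR_bounded[where K=K]) auto

text \<open>The Markov property at time \<open>s\<close> reduces the statement to \<open>gain_identity\<close> with starting
  level \<open>S\<^sub>s\<close> and position \<open>X\<^sub>s\<close>.\<close>

lemma gain_wald_identity:
  assumes st: "0 \<le> s" "s \<le> t" and H: "H \<in> borel_measurable (path_filtration s)"
    and bd: "\<And>\<omega>. \<omega> \<in> path_space \<Longrightarrow> norm (H \<omega> :: complex) \<le> K"
  shows "(\<integral>\<omega>. gain t \<omega> *\<^sub>R (H \<omega> * wald \<theta> t (coord t \<omega>)) \<partial>P) +
      \<i> * of_real \<theta> * (\<integral>v. indicator {s..t} v *\<^sub>R (\<integral>\<omega>. \<phi> (running_max v \<omega>) *\<^sub>R (H \<omega> * wald \<theta> v (coord v \<omega>)) \<partial>P) \<partial>lborel)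
    = (\<integral>\<omega>. gain s \<omega> *\<^sub>R (H \<omega> * wald \<theta> s (coord s \<omega>)) \<partial>P)"
proof -
  define r where "r = t - s"
  have r: "0 \<le> r" using st by (simp add: r_def)
  have K: "0 \<le> K" by (rule bound_nonneg[OF bd])
  let ?S = "running_max s" and ?X = "coord s"
  \<comment> \<open>The part of the weighted exponential known at time \<open>s\<close>;
    \<open>A\<close> and \<open>B v\<close> below are what remains after averaging over the
    increments from \<open>s\<close> on.\<close>
  define Z where "Z \<omega> = H \<omega> * wald \<theta> s (?X \<omega>)" for \<omega>
  have SX: "?S \<in> borel_measurable (path_filtration s)" "?X \<in> borel_measurable (path_filtration s)"
    using st by (auto intro: filtration_running_max filtration_coord)
  have ZF: "Z \<in> borel_measurable (path_filtration s)" unfolding Z_def using H SX by measurable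
  note ZP = measurable_filtration_P[OF ZF]
  have SXP: "?S \<in> borel_measurable P" "?X \<in> borel_measurable P" using SX by (auto intro: measurable_filtration_P)
  define C where "C = K * exp (\<theta>\<^sup>2 * s / 2)"
  have Zbd: "norm (Z \<omega>) \<le> C" if "\<omega> \<in> path_space" for \<omega>
    using bd[OF that] by (simp add: Z_def C_def norm_mult mult_right_mono)
  have C: "0 \<le> C" using K by (simp add: C_def)
  define A where "A \<omega> = (\<integral>\<omega>'. max_gain \<phi> (max (?S \<omega>) (?X \<omega> + running_max r \<omega>')) (?X \<omega> + coord r \<omega>') *\<^sub>R wald \<theta> r (coord r \<omega>') \<partial>W)" for \<omega>
  define B where "B v \<omega> = (\<integral>\<omega>'. \<phi> (max (?S \<omega>) (?X \<omega> + running_max (max 0 v) \<omega>')) *\<^sub>R wald \<theta> (max 0 v) (coord (max 0 v) \<omega>') \<partial>W)" for v \<omega>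
  have shift_max: "running_max (s + u) \<omega> = max (?S \<omega>) (?X \<omega> + running_max u (path_shift s \<omega>))" if "\<omega> \<in> space P" "0 \<le> u" for u \<omega>
    using that PD(4) st by (intro running_max_shift) auto
  have shift_coord: "coord (s + u) \<omega> = ?X \<omega> + coord u (path_shift s \<omega>)" if "0 \<le> u" for u \<omega>
    using that by (simp add: coord_path_shift)
  have wald_shift: "H \<omega> * wald \<theta> (s + u) (coord (s + u) \<omega>) = Z \<omega> * wald \<theta> u (coord u (path_shift s \<omega>))" if "0 \<le> u" for u \<omega>
    unfolding shift_coord[OF that] wald_add Z_def by simp
  have A: "(\<integral>\<omega>. gain t \<omega> *\<^sub>R (H \<omega> * wald \<theta> t (coord t \<omega>)) \<partial>P) = (\<integral>\<omega>. Z \<omega> * A \<omega> \<partial>P)"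
    and Aint: "integrable P (\<lambda>\<omega>. Z \<omega> * A \<omega>)"
  proof -
    define f where "f = (\<lambda>p. max_gain \<phi> (max (?S (fst p)) (?X (fst p) + running_max r (snd p))) (?X (fst p) + coord r (snd p)) *\<^sub>R (Z (fst p) * wald \<theta> r (coord r (snd p))))"
    have m: "running_max r \<in> borel_measurable path_algebra" "coord r \<in> borel_measurable path_algebra"
      using r by (auto intro: borel_measurable_running_max borel_measurable_coord)
    note m' = measurable_compose[OF measurable_fst SX(1)] measurable_compose[OF measurable_fst SX(2)]
      measurable_compose[OF measurable_snd m(1)] measurable_compose[OF measurable_snd m(2)] measurable_compose[OF measurable_fst ZF]
    have f: "f \<in> borel_measurable (path_filtration s \<Otimes>\<^sub>M path_algebra)"
      unfolding f_def
      by (intro borel_measurable_scaleR borel_measurable_max_gain phi_borel borel_measurable_max borel_measurable_add borel_measurable_times borel_measurable_wald borel_measurable_const m')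
    have feq: "f (\<omega>, path_shift s \<omega>) = gain t \<omega> *\<^sub>R (H \<omega> * wald \<theta> t (coord t \<omega>))" if "\<omega> \<in> space P" for \<omega>
      using shift_max[OF that r] shift_coord[OF r, of \<omega>] wald_shift[OF r, of \<omega>] by (simp add: f_def gain_def r_def)
    have int: "integrable P (\<lambda>\<omega>. f (\<omega>, path_shift s \<omega>))"
    proof (subst Bochner_Integration.integrable_cong[OF refl feq])
      have Hw: "(\<lambda>\<omega>. H \<omega> * wald \<theta> t (coord t \<omega>)) \<in> borel_measurable P"
        using measurable_filtration_P[OF H] measurable_coord_P[of t] st by simp
      have "norm (H \<omega> * wald \<theta> t (coord t \<omega>)) \<le> K * exp (\<theta>\<^sup>2 * t / 2)" if "\<omega> \<in> path_space" for \<omega>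
        using bd[OF that] by (simp add: norm_mult mult_right_mono)
      then show "integrable P (\<lambda>\<omega>. gain t \<omega> *\<^sub>R (H \<omega> * wald \<theta> t (coord t \<omega>)))"
        using st by (intro integrable_scaleR_bounded_P[OF integrable_gain Hw]) auto
    qed auto
    have inner: "(\<integral>\<omega>'. f (\<omega>, \<omega>') \<partial>W) = Z \<omega> * A \<omega>" for \<omega>
    proof -
      have "(\<integral>\<omega>'. f (\<omega>, \<omega>') \<partial>W) = (\<integral>\<omega>'. Z \<omega> * (max_gain \<phi> (max (?S \<omega>) (?X \<omega> + running_max r \<omega>')) (?X \<omega> + coord r \<omega>') *\<^sub>R wald \<theta> r (coord r \<omega>')) \<partial>W)"
        by (simp add: f_def)
      then show ?thesis by (simp add: A_def del: mult_scaleR_right)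
    qed
    have "(\<integral>\<omega>. gain t \<omega> *\<^sub>R (H \<omega> * wald \<theta> t (coord t \<omega>)) \<partial>P) = (\<integral>\<omega>. f (\<omega>, path_shift s \<omega>) \<partial>P)"
      by (rule Bochner_Integration.integral_cong[OF refl]) (simp add: feq)
    then show "(\<integral>\<omega>. gain t \<omega> *\<^sub>R (H \<omega> * wald \<theta> t (coord t \<omega>)) \<partial>P) = (\<integral>\<omega>. Z \<omega> * A \<omega> \<partial>P)"
      using markov_integral(1)[OF P W st(1) f int] by (simp add: inner)
    show "integrable P (\<lambda>\<omega>. Z \<omega> * A \<omega>)" using markov_integral(2)[OF P W st(1) f int] by (simp add: inner)
  qed
  have B: "(\<integral>\<omega>. \<phi> (running_max (s + v) \<omega>) *\<^sub>R (H \<omega> * wald \<theta> (s + v) (coord (s + v) \<omega>)) \<partial>P) = (\<integral>\<omega>. Z \<omega> * B v \<omega> \<partial>P)"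
    if v: "0 \<le> v" for v
  proof -
    have v0: "0 \<le> v" using v by simp
    define f where "f = (\<lambda>p. \<phi> (max (?S (fst p)) (?X (fst p) + running_max v (snd p))) *\<^sub>R (Z (fst p) * wald \<theta> v (coord v (snd p))))"
    have m: "running_max v \<in> borel_measurable path_algebra" "coord v \<in> borel_measurable path_algebra"
      using v by (auto intro: borel_measurable_running_max borel_measurable_coord)
    note m' = measurable_compose[OF measurable_fst SX(1)] measurable_compose[OF measurable_fst SX(2)]
      measurable_compose[OF measurable_snd m(1)] measurable_compose[OF measurable_snd m(2)] measurable_compose[OF measurable_fst ZF]
    have f: "f \<in> borel_measurable (path_filtration s \<Otimes>\<^sub>M path_algebra)"
      unfolding f_def
      by (intro borel_measurable_scaleR measurable_compose[OF _ phi_borel] borel_measurable_max borel_measurable_add borel_measurable_times borel_measurable_wald borel_measurable_const m')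
    have feq: "f (\<omega>, path_shift s \<omega>) = \<phi> (running_max (s + v) \<omega>) *\<^sub>R (H \<omega> * wald \<theta> (s + v) (coord (s + v) \<omega>))" if "\<omega> \<in> space P" for \<omega>
      using shift_max[OF that v0] wald_shift[OF v0, of \<omega>] by (simp add: f_def)
    have int: "integrable P (\<lambda>\<omega>. f (\<omega>, path_shift s \<omega>))"
    proof (subst Bochner_Integration.integrable_cong[OF refl feq])
      have Hw: "(\<lambda>\<omega>. H \<omega> * wald \<theta> (s + v) (coord (s + v) \<omega>)) \<in> borel_measurable P"
        using measurable_filtration_P[OF H] measurable_coord_P[of "s + v"] st v by simp
      have "norm (H \<omega> * wald \<theta> (s + v) (coord (s + v) \<omega>)) \<le> K * exp (\<theta>\<^sup>2 * (s + v) / 2)" if "\<omega> \<in> path_space" for \<omega>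
        using bd[OF that] by (simp add: norm_mult mult_right_mono)
      then show "integrable P (\<lambda>\<omega>. \<phi> (running_max (s + v) \<omega>) *\<^sub>R (H \<omega> * wald \<theta> (s + v) (coord (s + v) \<omega>)))"
        using st v by (intro integrable_scaleR_bounded_P[OF integrable_phi_max Hw]) auto
    qed auto
    have inner: "(\<integral>\<omega>'. f (\<omega>, \<omega>') \<partial>W) = Z \<omega> * B v \<omega>" for \<omega>
    proof -
      have "(\<integral>\<omega>'. f (\<omega>, \<omega>') \<partial>W) = (\<integral>\<omega>'. Z \<omega> * (\<phi> (max (?S \<omega>) (?X \<omega> + running_max (max 0 v) \<omega>')) *\<^sub>R wald \<theta> (max 0 v) (coord (max 0 v) \<omega>')) \<partial>W)"
        using v by (simp add: f_def)
      then show ?thesis by (simp add: B_def del: mult_scaleR_right)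
    qed
    have "(\<integral>\<omega>. \<phi> (running_max (s + v) \<omega>) *\<^sub>R (H \<omega> * wald \<theta> (s + v) (coord (s + v) \<omega>)) \<partial>P) = (\<integral>\<omega>. f (\<omega>, path_shift s \<omega>) \<partial>P)"
      by (rule Bochner_Integration.integral_cong[OF refl]) (simp add: feq)
    then show ?thesis using markov_integral(1)[OF P W st(1) f int] by (simp add: inner)
  qed
  interpret LP: pair_sigma_finite lborel P by unfold_locales
  have Bm: "(\<lambda>p. B (fst p) (snd p)) \<in> borel_measurable (borel \<Otimes>\<^sub>M P)"
  proof -
    have c: "(\<lambda>q. (fst (fst q), snd q)) \<in> (borel \<Otimes>\<^sub>M P) \<Otimes>\<^sub>M W \<rightarrow>\<^sub>M (borel :: real measure) \<Otimes>\<^sub>M W" by measurable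
    note m = measurable_compose[OF c running_max_joint_W] measurable_compose[OF c coord_joint_W]
    have m2: "(\<lambda>q. ?S (snd (fst q))) \<in> borel_measurable ((borel \<Otimes>\<^sub>M P) \<Otimes>\<^sub>M W)" "(\<lambda>q. ?X (snd (fst q))) \<in> borel_measurable ((borel \<Otimes>\<^sub>M P) \<Otimes>\<^sub>M W)"
      using measurable_compose[OF measurable_compose[OF measurable_fst measurable_snd] SXP(1)] measurable_compose[OF measurable_compose[OF measurable_fst measurable_snd] SXP(2)] by auto
    have m3: "(\<lambda>q :: (real \<times> (real \<Rightarrow> real)) \<times> (real \<Rightarrow> real). max 0 (fst (fst q))) \<in> borel_measurable ((borel \<Otimes>\<^sub>M P) \<Otimes>\<^sub>M W)" by measurable
    have "(\<lambda>(p, \<omega>'). \<phi> (max (?S (snd p)) (?X (snd p) + running_max (max 0 (fst p)) \<omega>')) *\<^sub>R wald \<theta> (max 0 (fst p)) (coord (max 0 (fst p)) \<omega>'))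
      \<in> borel_measurable ((borel \<Otimes>\<^sub>M P) \<Otimes>\<^sub>M W)"
      unfolding case_prod_unfold
      using m m2 m3 by (intro borel_measurable_scaleR measurable_compose[OF _ phi_borel] borel_measurable_max borel_measurable_add borel_measurable_wald) auto
    then show ?thesis unfolding B_def by (rule borel_measurable_lebesgue_integral)
  qed
  have Bbd: "norm (B v \<omega>) \<le> exp (\<theta>\<^sup>2 * v / 2) * (max_rate v * gain s \<omega>)" if v: "0 < v" for v \<omega>
  proof -
    let ?p = "\<lambda>\<omega>'. \<phi> (max (?S \<omega>) (?X \<omega> + running_max v \<omega>'))"
    have nn: "(\<integral>\<^sup>+\<omega>'. ennreal (?p \<omega>') \<partial>W) \<le> ennreal (max_rate v * gain s \<omega>)"
      unfolding gain_def using v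
      by (subst nn_integral_phi_max[OF phi_int phi_nonneg v]) (auto intro!: ennreal_leI mult_left_mono damped_gain_le[OF phi_int phi_nonneg] simp: max_rate_def)
    have pm: "?p \<in> borel_measurable W"
      using measurable_running_max_W[of v] v
      by (intro measurable_compose[OF _ phi_borel] borel_measurable_max borel_measurable_add borel_measurable_const) auto
    have pint: "integrable W ?p" using nn pm phi_nonneg by (intro integrableI_bounded) (auto intro: le_less_trans)
    have "norm (B v \<omega>) \<le> (\<integral>\<omega>'. norm (?p \<omega>' *\<^sub>R wald \<theta> v (coord v \<omega>')) \<partial>W)"
      unfolding B_def using v by (simp add: integral_norm_bound del: norm_scaleR)
    also have "\<dots> = exp (\<theta>\<^sup>2 * v / 2) * (\<integral>\<omega>'. ?p \<omega>' \<partial>W)" using phi_nonneg by (simp add: mult.commute)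
    also have "(\<integral>\<omega>'. ?p \<omega>' \<partial>W) \<le> max_rate v * gain s \<omega>"
    proof -
      have "ennreal (\<integral>\<omega>'. ?p \<omega>' \<partial>W) \<le> ennreal (max_rate v * gain s \<omega>)"
        using nn nn_integral_eq_integral[OF pint] phi_nonneg by simp
      then show ?thesis using v gain_nonneg by (subst (asm) ennreal_le_iff) (auto simp: max_rate_def)
    qed
    finally show ?thesis by simp
  qed
  \<comment> \<open>Fubini is justified by \<open>Bbd\<close>: the inner mean is at most a constant
    times \<open>max_rate v\<close>, which is integrable over \<open>[0, r]\<close>.\<close>
  have Fub: "integrable (lborel \<Otimes>\<^sub>M P) (\<lambda>(v, \<omega>). indicator {0..r} v *\<^sub>R (Z \<omega> * B v \<omega>))"
  proof (rule integrableI_bounded)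
    have "(\<lambda>p. indicator {0..r} (fst p) *\<^sub>R (Z (snd p) * B (fst p) (snd p))) \<in> borel_measurable (borel \<Otimes>\<^sub>M P)"
      using Bm measurable_compose[OF measurable_snd ZP] by (intro borel_measurable_scaleR borel_measurable_times) measurable
    then show m: "(\<lambda>(v, \<omega>). indicator {0..r} v *\<^sub>R (Z \<omega> * B v \<omega>)) \<in> borel_measurable (lborel \<Otimes>\<^sub>M P)"
      unfolding case_prod_unfold by (simp add: measurable_cong_sets[OF sets_pair_measure_cong[OF sets_lborel refl] refl])
    define E where "E = C * exp (\<theta>\<^sup>2 * r / 2)"
    have E: "0 \<le> E" using C by (simp add: E_def)
    have "(\<integral>\<^sup>+p. ennreal (norm (case p of (v, \<omega>) \<Rightarrow> indicator {0..r} v *\<^sub>R (Z \<omega> * B v \<omega>))) \<partial>(lborel \<Otimes>\<^sub>M P)) =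
      (\<integral>\<^sup>+v. \<integral>\<^sup>+\<omega>. ennreal (norm (indicator {0..r} v *\<^sub>R (Z \<omega> * B v \<omega>))) \<partial>P \<partial>lborel)"
      using m by (subst P.nn_integral_fst[symmetric]) auto
    also have "\<dots> \<le> (\<integral>\<^sup>+v. ennreal (E * tail x) * (indicator {0..r} v * ennreal (max_rate v)) \<partial>lborel)"
    proof (rule nn_integral_mono_AE)
      show "AE v in lborel. (\<integral>\<^sup>+\<omega>. ennreal (norm (indicator {0..r} v *\<^sub>R (Z \<omega> * B v \<omega>))) \<partial>P) \<le> ennreal (E * tail x) * (indicator {0..r} v * ennreal (max_rate v))"
        using AE_lborel_singleton[of 0]
      proof eventually_elim
        fix v :: real assume v: "v \<noteq> 0"
        show "(\<integral>\<^sup>+\<omega>. ennreal (norm (indicator {0..r} v *\<^sub>R (Z \<omega> * B v \<omega>))) \<partial>P) \<le> ennreal (E * tail x) * (indicator {0..r} v * ennreal (max_rate v))"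
        proof (cases "v \<in> {0..r}")
          case True
          then have v: "0 < v" "v \<le> r" using v by auto
          have "(\<integral>\<^sup>+\<omega>. ennreal (norm (indicator {0..r} v *\<^sub>R (Z \<omega> * B v \<omega>))) \<partial>P) \<le> (\<integral>\<^sup>+\<omega>. ennreal (E * max_rate v) * ennreal (gain s \<omega>) \<partial>P)"
          proof (rule nn_integral_mono)
            fix \<omega> assume "\<omega> \<in> space P"
            then have w: "\<omega> \<in> path_space" using PD(4) by simp
            have "norm (indicator {0..r} v *\<^sub>R (Z \<omega> * B v \<omega>)) = norm (Z \<omega>) * norm (B v \<omega>)" using True by (simp add: norm_mult)
            also have "\<dots> \<le> C * (exp (\<theta>\<^sup>2 * v / 2) * (max_rate v * gain s \<omega>))"
              by (intro mult_mono Zbd[OF w] Bbd[OF v(1)] C) simp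
            also have "\<dots> \<le> C * (exp (\<theta>\<^sup>2 * r / 2) * (max_rate v * gain s \<omega>))"
              using v C gain_nonneg by (intro mult_left_mono mult_right_mono) (auto simp: max_rate_def mult_left_mono)
            finally show "ennreal (norm (indicator {0..r} v *\<^sub>R (Z \<omega> * B v \<omega>))) \<le> ennreal (E * max_rate v) * ennreal (gain s \<omega>)"
              using E v gain_nonneg by (simp add: ennreal_mult'[symmetric] E_def max_rate_def mult_ac ennreal_leI)
          qed
          also have "\<dots> = ennreal (E * max_rate v) * (\<integral>\<^sup>+\<omega>. ennreal (gain s \<omega>) \<partial>P)"
            using measurable_gain[OF st(1)] by (intro nn_integral_cmult) auto
          also have "\<dots> \<le> ennreal (E * max_rate v) * ennreal (tail x)" by (intro mult_left_mono nn_integral_gain_le st) auto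
          also have "\<dots> = ennreal (E * tail x) * (indicator {0..r} v * ennreal (max_rate v))"
            using True E v tail_pos[of x] by (simp add: ennreal_mult'[symmetric] max_rate_def mult_ac)
          finally show ?thesis .
        qed simp
      qed
    qed
    also have "\<dots> = ennreal (E * tail x) * (\<integral>\<^sup>+v. indicator {0..r} v * ennreal (max_rate v) \<partial>lborel)"
      by (rule nn_integral_cmult) (auto simp: max_rate_def)
    also have "\<dots> < \<infinity>" using max_rate_integral_finite[of r] by (simp add: ennreal_mult_less_top)
    finally show "(\<integral>\<^sup>+p. ennreal (norm (case p of (v, \<omega>) \<Rightarrow> indicator {0..r} v *\<^sub>R (Z \<omega> * B v \<omega>))) \<partial>(lborel \<Otimes>\<^sub>M P)) < \<infinity>" .
  qed
  define G where "G v = (\<integral>\<omega>. \<phi> (running_max v \<omega>) *\<^sub>R (H \<omega> * wald \<theta> v (coord v \<omega>)) \<partial>P)" for v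
  have "(\<integral>v. indicator {s..t} v *\<^sub>R G v \<partial>lborel) = (\<integral>v. indicator {0..r} v *\<^sub>R G (s + v) \<partial>lborel)"
    using lborel_integral_real_affine[of 1 "\<lambda>v. indicator {s..t} v *\<^sub>R G v" s]
    by (auto simp: r_def indicator_def algebra_simps intro!: Bochner_Integration.integral_cong)
  also have "\<dots> = (\<integral>v. (\<integral>\<omega>. indicator {0..r} v *\<^sub>R (Z \<omega> * B v \<omega>) \<partial>P) \<partial>lborel)"
  proof (rule Bochner_Integration.integral_cong[OF refl])
    fix v :: real
    show "indicator {0..r} v *\<^sub>R G (s + v) = (\<integral>\<omega>. indicator {0..r} v *\<^sub>R (Z \<omega> * B v \<omega>) \<partial>P)"
      using B[of v] by (cases "v \<in> {0..r}") (auto simp: G_def)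
  qed
  also have "\<dots> = (\<integral>\<omega>. (\<integral>v. indicator {0..r} v *\<^sub>R (Z \<omega> * B v \<omega>) \<partial>lborel) \<partial>P)"
    by (rule LP.Fubini_integral[OF Fub, symmetric])
  finally have Gint: "(\<integral>v. indicator {s..t} v *\<^sub>R G v \<partial>lborel) = (\<integral>\<omega>. Z \<omega> * (\<integral>v. indicator {0..r} v *\<^sub>R B v \<omega> \<partial>lborel) \<partial>P)"
    by (simp only: mult_scaleR_right[symmetric] integral_mult_right_zero)
  have Jint: "integrable P (\<lambda>\<omega>. Z \<omega> * (\<integral>v. indicator {0..r} v *\<^sub>R B v \<omega> \<partial>lborel))"
    using LP.integrable_snd[OF Fub] by (simp only: mult_scaleR_right[symmetric] integral_mult_right_zero)
  have "(\<integral>\<omega>. Z \<omega> * A \<omega> \<partial>P) + \<i> * of_real \<theta> * (\<integral>\<omega>. Z \<omega> * (\<integral>v. indicator {0..r} v *\<^sub>R B v \<omega> \<partial>lborel) \<partial>P)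
    = (\<integral>\<omega>. Z \<omega> * A \<omega> + \<i> * of_real \<theta> * (Z \<omega> * (\<integral>v. indicator {0..r} v *\<^sub>R B v \<omega> \<partial>lborel)) \<partial>P)"
    using Aint Jint by simp
  \<comment> \<open>For each path \<open>gain_identity\<close> is applied with level
    \<open>S_s\<close> and position \<open>X_s\<close>, which needs
    \<open>X_s \<le> S_s\<close>.\<close>
  also have "\<dots> = (\<integral>\<omega>. gain s \<omega> *\<^sub>R (H \<omega> * wald \<theta> s (coord s \<omega>)) \<partial>P)"
  proof (rule Bochner_Integration.integral_cong[OF refl])
    fix \<omega> assume "\<omega> \<in> space P"
    then have "?X \<omega> \<le> ?S \<omega>" using coord_le_running_max[of \<omega> s s] PD(4) st by simp
    from gain_identity[OF phi_int r this, of \<theta>]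
    have "A \<omega> + \<i> * of_real \<theta> * (\<integral>v. indicator {0..r} v *\<^sub>R B v \<omega> \<partial>lborel) = of_real (gain s \<omega>)"
      unfolding A_def B_def gain_def .
    then have "Z \<omega> * (A \<omega> + \<i> * of_real \<theta> * (\<integral>v. indicator {0..r} v *\<^sub>R B v \<omega> \<partial>lborel)) = Z \<omega> * of_real (gain s \<omega>)" by simp
    then show "Z \<omega> * A \<omega> + \<i> * of_real \<theta> * (Z \<omega> * (\<integral>v. indicator {0..r} v *\<^sub>R B v \<omega> \<partial>lborel)) = gain s \<omega> *\<^sub>R (H \<omega> * wald \<theta> s (coord s \<omega>))"
      by (simp add: Z_def scaleR_conv_of_real algebra_simps)
  qed
  finally show ?thesis unfolding A using Gint by (simp add: G_def)
qed

end

section \<open>Removing the drift\<close>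

lemma norm_cis_minus_1: "norm (cis y - 1) \<le> \<bar>y\<bar>"
  using iexp_approx1[of y 0] by (simp add: cis_conv_exp)

lemma norm_cis_second_order: "norm (cis y - 1 - \<i> * of_real y) \<le> y\<^sup>2"
proof -
  have "norm (cis y - 1 - \<i> * of_real y) \<le> y\<^sup>2 / 2"
    using iexp_approx1[of y 1] by (simp add: cis_conv_exp power2_eq_square diff_diff_eq)
  also have "\<dots> \<le> y\<^sup>2" by simp
  finally show ?thesis .
qed

text \<open>The density may be unbounded, so continuity is taken over from the indefinite gauge
  integral, which coincides with the Lebesgue one here.\<close>

lemma continuous_on_indefinite_lborel:
  fixes c :: "real \<Rightarrow> real"
  assumes "integrable lborel (\<lambda>w. indicator {s..t} w *\<^sub>R c w)"
  shows "continuous_on {s..t} (\<lambda>u. \<integral>w. indicator {s..u} w *\<^sub>R c w \<partial>lborel)"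
proof -
  have i: "set_integrable lborel {s..t} c" using assms by (simp add: set_integrable_def)
  have iu: "set_integrable lborel {s..u} c" if "u \<in> {s..t}" for u
    by (rule set_integrable_subset[OF i]) (use that in auto)
  have "continuous_on {s..t} (\<lambda>u. integral {s..u} c)"
    by (rule indefinite_integral_continuous_1[OF set_borel_integral_eq_integral(1)[OF i]])
  then show ?thesis
    by (rule continuous_on_cong[THEN iffD1, OF refl, rotated])
       (simp add: set_borel_integral_eq_integral(2)[OF iu, symmetric] set_lebesgue_integral_def)
qed

definition node :: "real \<Rightarrow> real \<Rightarrow> nat \<Rightarrow> nat \<Rightarrow> real" where
  "node s t n k = s + (t - s) * real k / real (Suc n)"

lemma node:
  assumes st: "s \<le> t"
  shows "node s t n 0 = s" "node s t n (Suc n) = t" "s \<le> node s t n k" "node s t n k \<le> node s t n (Suc k)"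
    "k \<le> Suc n \<Longrightarrow> node s t n k \<le> t" "node s t n (Suc k) - node s t n k = (t - s) / real (Suc n)"
proof -
  show "node s t n 0 = s" "node s t n (Suc n) = t" by (simp_all add: node_def)
  show "s \<le> node s t n k" using st by (simp add: node_def)
  show "node s t n k \<le> node s t n (Suc k)" using st by (simp add: node_def divide_right_mono mult_left_mono)
  show "node s t n (Suc k) - node s t n k = (t - s) / real (Suc n)" by (simp add: node_def diff_divide_distrib[symmetric] algebra_simps)
  assume "k \<le> Suc n"
  then have "(t - s) * real k \<le> (t - s) * real (Suc n)" using st by (intro mult_left_mono) auto
  then have "(t - s) * real k / real (Suc n) \<le> t - s" by (simp add: pos_divide_le_eq del: of_nat_Suc)
  then show "node s t n k \<le> t" by (simp add: node_def del: of_nat_Suc)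
qed

text \<open>\<open>cis (\<theta> a)\<close> is the exponential of an absolutely continuous function \<open>a\<close> with density \<open>c\<close>; the
  remainders below are the errors of the first-order Taylor expansions along a partition.\<close>

locale partition =
  fixes s t :: real and c a :: "real \<Rightarrow> real" and z :: "real \<Rightarrow> complex" and C \<theta> :: real
  assumes st: "s \<le> t"
    and c_nonneg: "\<And>w. 0 \<le> c w"
    and c_int: "integrable lborel (\<lambda>w. indicator {s..t} w *\<^sub>R c w)"
    and z_meas: "z \<in> borel_measurable borel"
    and z_bound: "\<And>w. w \<in> {s..t} \<Longrightarrow> norm (z w) \<le> C"
    and z_cont: "continuous_on {s..t} z"
    and a_diff: "\<And>u v. s \<le> u \<Longrightarrow> u \<le> v \<Longrightarrow> v \<le> t \<Longrightarrow> a v - a u = (\<integral>w. indicator {u..v} w *\<^sub>R c w \<partial>lborel)"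
begin

text \<open>The change of \<open>cis (\<theta> * a) * z\<close> over a cell, divided by its left
  phase factor, is the first term here plus the increment of \<open>z\<close>. That increment is
  replaced by \<open>- i \<theta>\<close> times the integral of \<open>c * z\<close>, which has the
  same weighted mean in the application (\<open>wald_increment\<close>).\<close>

definition remainder :: "real \<Rightarrow> real \<Rightarrow> complex" where
  "remainder u v = z v * (cis (\<theta> * (a v - a u)) - 1) - \<i> * of_real \<theta> * (\<integral>w. indicator {u..v} w *\<^sub>R (c w *\<^sub>R z w) \<partial>lborel)"

definition remainder_sum :: "nat \<Rightarrow> complex" where
  "remainder_sum n = (\<Sum>k<Suc n. cis (\<theta> * a (node s t n k)) * remainder (node s t n k) (node s t n (Suc k)))"

lemma C_nonneg: "0 \<le> C"
  using order_trans[OF norm_ge_zero z_bound[of s]] st by simp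

lemma c_int_sub:
  assumes "s \<le> u" "v \<le> t"
  shows "integrable lborel (\<lambda>w. indicator {u..v} w *\<^sub>R c w)" "integrable lborel (\<lambda>w. indicator {u..v} w *\<^sub>R (c w *\<^sub>R z w))"
proof -
  have "set_integrable lborel {s..t} c" using c_int by (simp add: set_integrable_def)
  from set_integrable_subset[OF this, of "{u..v}"]
  show 1: "integrable lborel (\<lambda>w. indicator {u..v} w *\<^sub>R c w)" using assms by (simp add: set_integrable_def)
  have "integrable lborel (\<lambda>w. (indicator {u..v} w *\<^sub>R c w) *\<^sub>R (indicator {u..v} w *\<^sub>R z w))"
  proof (rule Bochner_Integration.integrable_bound)
    show "integrable lborel (\<lambda>w. C * (indicator {u..v} w *\<^sub>R c w))" using 1 by simp
    show "(\<lambda>w. (indicator {u..v} w *\<^sub>R c w) *\<^sub>R (indicator {u..v} w *\<^sub>R z w)) \<in> borel_measurable lborel"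
      using borel_measurable_integrable[OF 1] z_meas by measurable
    show "AE w in lborel. norm ((indicator {u..v} w *\<^sub>R c w) *\<^sub>R (indicator {u..v} w *\<^sub>R z w)) \<le> norm (C * (indicator {u..v} w *\<^sub>R c w))"
    proof (rule AE_I2)
      fix w
      show "norm ((indicator {u..v} w *\<^sub>R c w) *\<^sub>R (indicator {u..v} w *\<^sub>R z w)) \<le> norm (C * (indicator {u..v} w *\<^sub>R c w))"
        using z_bound[of w] assms c_nonneg[of w] C_nonneg
        by (cases "w \<in> {u..v}") (auto simp: mult.commute[of C] mult_left_mono)
    qed
  qed
  then show "integrable lborel (\<lambda>w. indicator {u..v} w *\<^sub>R (c w *\<^sub>R z w))"
    by (rule Bochner_Integration.integrable_cong[THEN iffD1, rotated -1]) (auto simp: indicator_def)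
qed

lemma a_mono: "s \<le> u \<Longrightarrow> u \<le> v \<Longrightarrow> v \<le> t \<Longrightarrow> a u \<le> a v"
  using a_diff[of u v] Bochner_Integration.integral_nonneg[of lborel "\<lambda>w. indicator {u..v} w *\<^sub>R c w"] scaleR_nonneg_nonneg[OF indicator_pos_le c_nonneg]
  by fastforce

lemma norm_integral_le:
  assumes "s \<le> u" "u \<le> v" "v \<le> t" "0 \<le> \<delta>" "\<And>w. w \<in> {u..v} \<Longrightarrow> norm (f w) \<le> \<delta>"
  shows "norm (\<integral>w. indicator {u..v} w *\<^sub>R (c w *\<^sub>R (f w :: complex)) \<partial>lborel) \<le> \<delta> * (a v - a u)"
proof -
  have "norm (\<integral>w. indicator {u..v} w *\<^sub>R (c w *\<^sub>R f w) \<partial>lborel) \<le> (\<integral>w. \<delta> * (indicator {u..v} w *\<^sub>R c w) \<partial>lborel)"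
  proof (cases "integrable lborel (\<lambda>w. indicator {u..v} w *\<^sub>R (c w *\<^sub>R f w))")
    case True
    then show ?thesis
    proof (rule Bochner_Integration.integral_norm_bound_integral)
      show "integrable lborel (\<lambda>w. \<delta> * (indicator {u..v} w *\<^sub>R c w))" using c_int_sub(1)[OF assms(1,3)] by simp
      show "norm (indicator {u..v} w *\<^sub>R (c w *\<^sub>R f w)) \<le> \<delta> * (indicator {u..v} w *\<^sub>R c w)" for w
        using assms(5) c_nonneg by (auto simp: indicator_def mult.commute[of \<delta>] mult_left_mono)
    qed
  next
    \<comment> \<open>Nothing but a bound is assumed on \<open>f\<close>, so the integrand may fail
      to be integrable; its Bochner integral is then 0.\<close>
    case False
    then show ?thesis
      using assms(4) c_nonneg by (simp add: not_integrable_integral_eq)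
  qed
  then show ?thesis using a_diff[OF assms(1-3)] by simp
qed

text \<open>A first-order bound whose sum over a partition telescopes: it gives the domination
  uniform in the partition.\<close>

lemma remainder_bound:
  assumes uv: "s \<le> u" "u \<le> v" "v \<le> t"
  shows "norm (remainder u v) \<le> 2 * C * \<bar>\<theta>\<bar> * (a v - a u)"
proof -
  have d: "0 \<le> a v - a u" using a_mono[OF uv] by simp
  have "norm (remainder u v) \<le> norm (z v * (cis (\<theta> * (a v - a u)) - 1)) + norm (\<i> * of_real \<theta> * (\<integral>w. indicator {u..v} w *\<^sub>R (c w *\<^sub>R z w) \<partial>lborel))"
    unfolding remainder_def by (rule norm_triangle_ineq4)
  also have "\<dots> \<le> C * (\<bar>\<theta>\<bar> * (a v - a u)) + \<bar>\<theta>\<bar> * (C * (a v - a u))"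
  proof (rule add_mono)
    have "norm (cis (\<theta> * (a v - a u)) - 1) \<le> \<bar>\<theta>\<bar> * (a v - a u)"
      using norm_cis_minus_1[of "\<theta> * (a v - a u)"] d by (simp add: abs_mult)
    then show "norm (z v * (cis (\<theta> * (a v - a u)) - 1)) \<le> C * (\<bar>\<theta>\<bar> * (a v - a u))"
      unfolding norm_mult using z_bound[of v] uv C_nonneg by (intro mult_mono) auto
    show "norm (\<i> * of_real \<theta> * (\<integral>w. indicator {u..v} w *\<^sub>R (c w *\<^sub>R z w) \<partial>lborel)) \<le> \<bar>\<theta>\<bar> * (C * (a v - a u))"
      using norm_integral_le[OF uv C_nonneg, of z] z_bound uv by (simp add: norm_mult mult_left_mono)
  qed
  finally show ?thesis by (simp add: algebra_simps)
qed

text \<open>Writing the integral of \<open>c * z\<close> as \<open>(a v - a u) * z v\<close> minus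
  an error cancels the linear term of the exponential. What is left is the quadratic Taylor error
  and the oscillation of \<open>z\<close>, each of size \<open>\<delta> * (a v - a u)\<close> up to
  constants.\<close>

lemma remainder_small:
  assumes uv: "s \<le> u" "u \<le> v" "v \<le> t" and \<delta>: "0 \<le> \<delta>" "a v - a u \<le> \<delta>" "\<And>w. w \<in> {u..v} \<Longrightarrow> norm (z v - z w) \<le> \<delta>"
  shows "norm (remainder u v) \<le> \<delta> * (C * \<theta>\<^sup>2 + \<bar>\<theta>\<bar>) * (a v - a u)"
proof -
  let ?d = "a v - a u"
  have d: "0 \<le> ?d" using a_mono[OF uv] by simp
  note i = c_int_sub[OF uv(1,3)]
  have "(\<integral>w. indicator {u..v} w *\<^sub>R (c w *\<^sub>R (z v - z w)) \<partial>lborel) =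
    (\<integral>w. (indicator {u..v} w *\<^sub>R c w) *\<^sub>R z v - indicator {u..v} w *\<^sub>R (c w *\<^sub>R z w) \<partial>lborel)"
    by (rule Bochner_Integration.integral_cong) (auto simp: algebra_simps)
  also have "\<dots> = (\<integral>w. (indicator {u..v} w *\<^sub>R c w) *\<^sub>R z v \<partial>lborel) - (\<integral>w. indicator {u..v} w *\<^sub>R (c w *\<^sub>R z w) \<partial>lborel)"
    using i by (intro Bochner_Integration.integral_diff integrable_scaleR_left) auto
  also have "(\<integral>w. (indicator {u..v} w *\<^sub>R c w) *\<^sub>R z v \<partial>lborel) = of_real ?d * z v"
    using i(1) a_diff[OF uv] by (subst integral_scaleR_left) (auto simp: scaleR_conv_of_real)
  finally have I: "(\<integral>w. indicator {u..v} w *\<^sub>R (c w *\<^sub>R z w) \<partial>lborel) =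
    of_real ?d * z v - (\<integral>w. indicator {u..v} w *\<^sub>R (c w *\<^sub>R (z v - z w)) \<partial>lborel)" by simp
  have "remainder u v = z v * (cis (\<theta> * ?d) - 1 - \<i> * of_real (\<theta> * ?d)) + \<i> * of_real \<theta> * (\<integral>w. indicator {u..v} w *\<^sub>R (c w *\<^sub>R (z v - z w)) \<partial>lborel)"
    unfolding remainder_def I by (simp add: algebra_simps)
  also have "norm \<dots> \<le> norm (z v * (cis (\<theta> * ?d) - 1 - \<i> * of_real (\<theta> * ?d))) + norm (\<i> * of_real \<theta> * (\<integral>w. indicator {u..v} w *\<^sub>R (c w *\<^sub>R (z v - z w)) \<partial>lborel))"
    by (rule norm_triangle_ineq)
  also have "\<dots> \<le> C * (\<theta>\<^sup>2 * (\<delta> * ?d)) + \<bar>\<theta>\<bar> * (\<delta> * ?d)"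
  proof (rule add_mono)
    have "norm (cis (\<theta> * ?d) - 1 - \<i> * of_real (\<theta> * ?d)) \<le> \<theta>\<^sup>2 * (?d * ?d)"
      using norm_cis_second_order[of "\<theta> * ?d"] by (simp add: power2_eq_square algebra_simps)
    also have "\<dots> \<le> \<theta>\<^sup>2 * (\<delta> * ?d)" using \<delta> d by (intro mult_left_mono mult_right_mono) auto
    finally show "norm (z v * (cis (\<theta> * ?d) - 1 - \<i> * of_real (\<theta> * ?d))) \<le> C * (\<theta>\<^sup>2 * (\<delta> * ?d))"
      unfolding norm_mult using z_bound[of v] uv C_nonneg by (intro mult_mono) auto
    show "norm (\<i> * of_real \<theta> * (\<integral>w. indicator {u..v} w *\<^sub>R (c w *\<^sub>R (z v - z w)) \<partial>lborel)) \<le> \<bar>\<theta>\<bar> * (\<delta> * ?d)"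
      using norm_integral_le[OF uv \<delta>(1), of "\<lambda>w. z v - z w"] \<delta>(3) by (simp add: norm_mult mult_left_mono)
  qed
  finally show ?thesis by (simp add: algebra_simps)
qed

lemma sum_node: "(\<Sum>k<Suc n. a (node s t n (Suc k)) - a (node s t n k)) = a t - a s"
  using sum_lessThan_telescope[of "\<lambda>k. a (node s t n k)" "Suc n"] by (simp only: node[OF st])

lemma remainder_sum_bound: "norm (remainder_sum n) \<le> 2 * C * \<bar>\<theta>\<bar> * (a t - a s)"
proof -
  have "norm (remainder_sum n) \<le> (\<Sum>k<Suc n. 2 * C * \<bar>\<theta>\<bar> * (a (node s t n (Suc k)) - a (node s t n k)))"
    unfolding remainder_sum_def
    by (rule sum_norm_le) (auto simp: norm_mult less_Suc_eq_le intro!: remainder_bound node[OF st])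
  also have "\<dots> = 2 * C * \<bar>\<theta>\<bar> * (a t - a s)" unfolding sum_distrib_left[symmetric] sum_node ..
  finally show ?thesis .
qed

text \<open>By uniform continuity of \<open>a\<close> and \<open>z\<close>, on a fine partition each
  remainder is a small multiple of the increment of \<open>a\<close>, and these increments sum to
  \<open>a t - a s\<close>.\<close>

lemma remainder_sum_tendsto: "remainder_sum \<longlonglongrightarrow> 0"
proof (rule LIMSEQ_I)
  fix e :: real assume e: "0 < e"
  define D where "D = (C * \<theta>\<^sup>2 + \<bar>\<theta>\<bar>) * (a t - a s)"
  have D: "0 \<le> D" unfolding D_def using C_nonneg a_mono[of s t] st by (intro mult_nonneg_nonneg add_nonneg_nonneg) auto
  \<comment> \<open>The \<open>+ 1\<close> covers the case \<open>D = 0\<close>.\<close>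
  define \<delta> where "\<delta> = e / (D + 1)"
  have \<delta>: "0 < \<delta>" "\<delta> * D < e" using e D by (auto simp: \<delta>_def divide_simps add_strict_increasing algebra_simps)
  have ca: "continuous_on {s..t} a"
  proof -
    have "continuous_on {s..t} (\<lambda>u. a s + (\<integral>w. indicator {s..u} w *\<^sub>R c w \<partial>lborel))"
      by (intro continuous_on_add continuous_on_const continuous_on_indefinite_lborel c_int)
    then show ?thesis
    proof (rule continuous_on_cong[THEN iffD1, OF refl, rotated])
      fix u assume "u \<in> {s..t}"
      then show "a s + (\<integral>w. indicator {s..u} w *\<^sub>R c w \<partial>lborel) = a u" using a_diff[of s u] by simp
    qed
  qed
  have "uniformly_continuous_on {s..t} a" "uniformly_continuous_on {s..t} z"
    using compact_uniformly_continuous[OF ca] compact_uniformly_continuous[OF z_cont] by auto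
  then obtain d1 d2 where d: "0 < d1" "\<And>u v. u \<in> {s..t} \<Longrightarrow> v \<in> {s..t} \<Longrightarrow> dist v u < d1 \<Longrightarrow> dist (a v) (a u) < \<delta>"
    "0 < d2" "\<And>u v. u \<in> {s..t} \<Longrightarrow> v \<in> {s..t} \<Longrightarrow> dist v u < d2 \<Longrightarrow> dist (z v) (z u) < \<delta>"
    using \<delta>(1) unfolding uniformly_continuous_on_def by metis
  obtain n0 :: nat where n0: "(t - s) / min d1 d2 < real n0" using reals_Archimedean2 by blast
  show "\<exists>n0. \<forall>n\<ge>n0. norm (remainder_sum n - 0) < e"
  proof (intro exI[of _ n0] allI impI)
    fix n assume n: "n0 \<le> n"
    have "(t - s) / min d1 d2 < real (Suc n)" using n0 n by linarith
    then have "t - s < real (Suc n) * min d1 d2" using d by (subst (asm) pos_divide_less_eq) auto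
    then have mesh: "(t - s) / real (Suc n) < min d1 d2" by (subst pos_divide_less_eq) (auto simp: mult.commute)
    have "norm (remainder_sum n) \<le> (\<Sum>k<Suc n. \<delta> * (C * \<theta>\<^sup>2 + \<bar>\<theta>\<bar>) * (a (node s t n (Suc k)) - a (node s t n k)))"
      unfolding remainder_sum_def
    proof (rule sum_norm_le)
      fix k assume k: "k \<in> {..<Suc n}"
      let ?u = "node s t n k" and ?v = "node s t n (Suc k)"
      have uv: "s \<le> ?u" "?u \<le> ?v" "?v \<le> t" using node(3,4)[OF st, of n k] node(5)[OF st, of "Suc k" n] k by auto
      have len: "?v - ?u < min d1 d2" using node(6)[OF st, of n k] mesh by simp
      have "norm (remainder ?u ?v) \<le> \<delta> * (C * \<theta>\<^sup>2 + \<bar>\<theta>\<bar>) * (a ?v - a ?u)"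
      proof (rule remainder_small[OF uv])
        have "dist (a ?v) (a ?u) < \<delta>" using uv len by (intro d(2)) (auto simp: dist_real_def)
        then show "a ?v - a ?u \<le> \<delta>" by (simp add: dist_real_def)
        fix w assume "w \<in> {?u..?v}"
        then have "dist (z ?v) (z w) < \<delta>" using uv len by (intro d(4)) (auto simp: dist_real_def)
        then show "norm (z ?v - z w) \<le> \<delta>" by (simp add: dist_norm)
      qed (use \<delta> in simp)
      then show "norm (cis (\<theta> * a ?u) * remainder ?u ?v) \<le> \<delta> * (C * \<theta>\<^sup>2 + \<bar>\<theta>\<bar>) * (a ?v - a ?u)"
        by (simp add: norm_mult)
    qed
    also have "\<dots> = \<delta> * D" unfolding sum_distrib_left[symmetric] sum_node by (simp add: D_def)
    also have "\<dots> < e" by (rule \<delta>(2))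
    finally show "norm (remainder_sum n - 0) < e" by simp
  qed
qed

end

section \<open>The penalised law, its drift and the change of measure\<close>

locale penalised = penalisation +
  fixes Q :: "(real \<Rightarrow> real) measure"
  assumes Q: "penalised_law Q"
begin

lemma QD: "prob_space Q" "sets Q = sets path_algebra" "space Q = path_space"
  using Q sets_eq_imp_space_eq[of Q path_algebra] by (auto simp: penalised_law_def)

sublocale Q: prob_space Q by (rule QD(1))

lemmas measurable_filtration_Q = measurable_filtration_imp[OF QD(2)]

lemma measurable_Q: "f \<in> path_algebra \<rightarrow>\<^sub>M N \<Longrightarrow> f \<in> Q \<rightarrow>\<^sub>M N"
  by (simp add: measurable_cong_sets[OF QD(2) refl])

text \<open>\<open>Q\<close> is tied to \<open>P\<close> through events of
  \<open>path_filtration u\<close>. Pushing both laws to that sigma-algebra makes them equal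
  measures, so integrals of functions known at time \<open>u\<close> can be transferred.\<close>

lemma distr_Q: "0 \<le> u \<Longrightarrow> distr Q (path_filtration u) (\<lambda>\<omega>. \<omega>) = distr (tilted u) (path_filtration u) (\<lambda>\<omega>. \<omega>)"
proof (rule measure_eqI)
  assume u: "0 \<le> u"
  interpret T: prob_space "tilted u" by (rule prob_space_tilted[OF u])
  have sT: "sets (tilted u) = sets path_algebra" "space (tilted u) = path_space" by (simp_all add: tilted_def PD)
  fix \<Gamma> assume "\<Gamma> \<in> sets (distr Q (path_filtration u) (\<lambda>\<omega>. \<omega>))"
  then have \<Gamma>: "\<Gamma> \<in> sets (path_filtration u)" by simp
  then have \<Gamma>a: "\<Gamma> \<in> sets path_algebra" using sets_coord_sigma_mono[of "{0..u}" "{0..}"] by auto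
  have sub: "\<Gamma> \<inter> path_space = \<Gamma>" using sets.sets_into_space[OF \<Gamma>] by (simp add: Int_absorb2)
  have "measure Q \<Gamma> = measure (tilted u) \<Gamma>"
    using Q u \<Gamma> by (simp add: penalised_law_def measure_tilted(2)[OF u \<Gamma>a])
  then show "emeasure (distr Q (path_filtration u) (\<lambda>\<omega>. \<omega>)) \<Gamma> = emeasure (distr (tilted u) (path_filtration u) (\<lambda>\<omega>. \<omega>)) \<Gamma>"
    using \<Gamma> sub by (simp add: emeasure_distr[OF measurable_id_filtration[OF QD(2)]] emeasure_distr[OF measurable_id_filtration[OF sT(1)]]
        QD(3) sT(2) Q.emeasure_eq_measure T.emeasure_eq_measure)
qed simp

lemma integral_Q:
  fixes f :: "_ \<Rightarrow> 'b::{banach, second_countable_topology}"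
  assumes u: "0 \<le> u" and f: "f \<in> borel_measurable (path_filtration u)"
  shows "(\<integral>\<omega>. f \<omega> \<partial>Q) = (1 / tail x) *\<^sub>R (\<integral>\<omega>. gain u \<omega> *\<^sub>R f \<omega> \<partial>P)"
proof -
  have sT: "sets (tilted u) = sets path_algebra" by (simp add: tilted_def PD)
  have "(\<integral>\<omega>. f \<omega> \<partial>Q) = (\<integral>\<omega>. f \<omega> \<partial>distr Q (path_filtration u) (\<lambda>\<omega>. \<omega>))"
    by (rule integral_distr[symmetric, OF measurable_id_filtration[OF QD(2)] f])
  also have "\<dots> = (\<integral>\<omega>. f \<omega> \<partial>tilted u)"
    unfolding distr_Q[OF u] by (rule integral_distr[OF measurable_id_filtration[OF sT] f])
  also have "\<dots> = (\<integral>\<omega>. (gain u \<omega> / tail x) *\<^sub>R f \<omega> \<partial>P)"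
    unfolding tilted_def using measurable_filtration_P[OF f] measurable_gain[OF u] gain_nonneg tail_pos[of x]
    by (intro integral_density) (auto intro!: AE_I2 divide_nonneg_pos)
  also have "\<dots> = (\<integral>\<omega>. (1 / tail x) *\<^sub>R (gain u \<omega> *\<^sub>R f \<omega>) \<partial>P)" by simp
  finally show ?thesis by (simp only: integral_scaleR_right)
qed

lemma nn_integral_Q:
  assumes u: "0 \<le> u" and f: "f \<in> borel_measurable (path_filtration u)"
  shows "(\<integral>\<^sup>+\<omega>. f \<omega> \<partial>Q) = (\<integral>\<^sup>+\<omega>. ennreal (gain u \<omega> / tail x) * f \<omega> \<partial>P)"
proof -
  have sT: "sets (tilted u) = sets path_algebra" by (simp add: tilted_def PD)
  have "(\<integral>\<^sup>+\<omega>. f \<omega> \<partial>Q) = (\<integral>\<^sup>+\<omega>. f \<omega> \<partial>distr Q (path_filtration u) (\<lambda>\<omega>. \<omega>))"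
    by (rule nn_integral_distr[symmetric, OF measurable_id_filtration[OF QD(2)]]) (use f in simp)
  also have "\<dots> = (\<integral>\<^sup>+\<omega>. f \<omega> \<partial>tilted u)"
    unfolding distr_Q[OF u] by (rule nn_integral_distr[OF measurable_id_filtration[OF sT]]) (use f in simp)
  also have "\<dots> = (\<integral>\<^sup>+\<omega>. ennreal (gain u \<omega> / tail x) * f \<omega> \<partial>P)"
    unfolding tilted_def using measurable_filtration_P[OF f] measurable_gain[OF u] by (intro nn_integral_density) auto
  finally show ?thesis .
qed

text \<open>The density of the drift, with time clipped at 0 so that it is jointly measurable on the
  whole line, and with \<open>gain\<close> in place of \<open>max_martingale\<close>.\<close>

definition rate :: "real \<Rightarrow> (real \<Rightarrow> real) \<Rightarrow> real" where
  "rate v \<omega> = \<phi> (running_max (max 0 v) \<omega>) / gain (max 0 v) \<omega>"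

definition drift :: "real \<Rightarrow> (real \<Rightarrow> real) \<Rightarrow> real" where
  "drift t \<omega> = (\<integral>v. indicator {0..t} v *\<^sub>R rate v \<omega> \<partial>lborel)"

lemma rate_nonneg: "0 \<le> rate v \<omega>"
  unfolding rate_def using phi_nonneg gain_nonneg by simp

lemma rate_joint:
  assumes I: "\<And>v. v \<in> I \<Longrightarrow> 0 \<le> v \<and> {0..v} \<subseteq> I"
    and h: "h \<in> borel_measurable N" "\<And>x. x \<in> space N \<Longrightarrow> max 0 (h x) \<in> I"
    and w: "w \<in> N \<rightarrow>\<^sub>M coord_sigma I"
  shows "(\<lambda>x. rate (h x) (w x)) \<in> borel_measurable N"
proof -
  have h': "(\<lambda>x. max 0 (h x)) \<in> borel_measurable N" using h(1) by simp
  have rm: "(\<lambda>x. running_max (max 0 (h x)) (w x)) \<in> borel_measurable N"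
    by (rule borel_measurable_running_max_joint[OF I h' _ w]) (use h in auto)
  have co: "(\<lambda>x. coord (max 0 (h x)) (w x)) \<in> borel_measurable N"
    by (rule borel_measurable_coord_joint[OF I h' _ w]) (use h in auto)
  show ?thesis unfolding rate_def gain_def
    using rm co by (intro borel_measurable_divide measurable_compose[OF rm phi_borel] borel_measurable_max_gain phi_borel)
qed

lemma rate_filtration: "0 \<le> v \<Longrightarrow> v \<le> t \<Longrightarrow> rate v \<in> borel_measurable (path_filtration t)"
  using rate_joint[of "{0..t}" "\<lambda>_. v" "path_filtration t" "\<lambda>\<omega>. \<omega>"] by simp

lemma rate_path: "\<omega> \<in> path_space \<Longrightarrow> (\<lambda>v. rate v \<omega>) \<in> borel_measurable borel"
  by (rule rate_joint[of "{0..}"]) auto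

lemma rate_product: "(\<lambda>p. rate (snd p) (fst p)) \<in> borel_measurable (Q \<Otimes>\<^sub>M lborel)"
proof (rule rate_joint[of "{0..}"])
  show "fst \<in> Q \<Otimes>\<^sub>M lborel \<rightarrow>\<^sub>M path_algebra"
    using measurable_compose[OF measurable_fst measurable_Q[OF measurable_ident]] by simp
qed auto

text \<open>The factor \<open>M_v\<close> of the change of law cancels the denominator of the rate,
  leaving the mean of \<open>\<phi> (S_v)\<close> under \<open>P\<close>, divided by
  \<open>tail x\<close>. This is what makes the drift integrable.\<close>

lemma nn_integral_rate_le:
  assumes v: "0 < v"
  shows "(\<integral>\<^sup>+\<omega>. ennreal (rate v \<omega>) \<partial>Q) \<le> ennreal (max_rate v)"
proof -
  have v0: "0 \<le> v" using v by simp
  have "(\<integral>\<^sup>+\<omega>. ennreal (rate v \<omega>) \<partial>Q) = (\<integral>\<^sup>+\<omega>. ennreal (gain v \<omega> / tail x) * ennreal (rate v \<omega>) \<partial>P)"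
    by (rule nn_integral_Q[OF v0]) (use rate_filtration[OF v0 order_refl] in simp)
  also have "\<dots> = (\<integral>\<^sup>+\<omega>. ennreal (1 / tail x) * ennreal (\<phi> (running_max v \<omega>)) \<partial>P)"
  proof (rule nn_integral_cong)
    fix \<omega> assume "\<omega> \<in> space P"
    then have "0 < gain v \<omega>" using gain_pos v PD(4) by simp
    then show "ennreal (gain v \<omega> / tail x) * ennreal (rate v \<omega>) = ennreal (1 / tail x) * ennreal (\<phi> (running_max v \<omega>))"
      using v tail_pos[of x] phi_nonneg by (simp add: rate_def ennreal_mult'[symmetric])
  qed
  also have "\<dots> = ennreal (1 / tail x) * (\<integral>\<^sup>+\<omega>. ennreal (\<phi> (running_max v \<omega>)) \<partial>P)"
    using measurable_phi_max[OF v0] by (intro nn_integral_cmult) simp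
  also have "\<dots> \<le> ennreal (1 / tail x) * ennreal (max_rate v * tail x)" by (intro mult_left_mono nn_integral_phi_running_max_le v) simp
  also have "\<dots> = ennreal (max_rate v)" using tail_pos[of x] by (simp add: ennreal_mult'[symmetric])
  finally show ?thesis .
qed

sublocale QL: pair_sigma_finite Q lborel by unfold_locales

lemma rate_product_integrable:
  "integrable (Q \<Otimes>\<^sub>M lborel) (\<lambda>p. indicator {0..t} (snd p) *\<^sub>R rate (snd p) (fst p))"
proof (rule integrableI_bounded)
  show m: "(\<lambda>p. indicator {0..t} (snd p) *\<^sub>R rate (snd p) (fst p)) \<in> borel_measurable (Q \<Otimes>\<^sub>M lborel)"
    using rate_product by measurable
  have "(\<integral>\<^sup>+p. ennreal (norm (indicator {0..t} (snd p) *\<^sub>R rate (snd p) (fst p))) \<partial>(Q \<Otimes>\<^sub>M lborel)) =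
    (\<integral>\<^sup>+v. \<integral>\<^sup>+\<omega>. ennreal (norm (indicator {0..t} v *\<^sub>R rate v \<omega>)) \<partial>Q \<partial>lborel)"
    using m QL.nn_integral_snd[of "\<lambda>p. ennreal (norm (indicator {0..t} (snd p) *\<^sub>R rate (snd p) (fst p)))"] by simp
  also have "\<dots> \<le> (\<integral>\<^sup>+v. indicator {0..t} v * ennreal (max_rate v) \<partial>lborel)"
  proof (rule nn_integral_mono_AE)
    show "AE v in lborel. (\<integral>\<^sup>+\<omega>. ennreal (norm (indicator {0..t} v *\<^sub>R rate v \<omega>)) \<partial>Q) \<le> indicator {0..t} v * ennreal (max_rate v)"
      using AE_lborel_singleton[of 0]
    proof eventually_elim
      fix v :: real assume "v \<noteq> 0"
      then show "(\<integral>\<^sup>+\<omega>. ennreal (norm (indicator {0..t} v *\<^sub>R rate v \<omega>)) \<partial>Q) \<le> indicator {0..t} v * ennreal (max_rate v)"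
        using nn_integral_rate_le[of v] rate_nonneg by (cases "v \<in> {0..t}") auto
    qed
  qed
  also have "\<dots> < \<infinity>" by (rule max_rate_integral_finite)
  finally show "(\<integral>\<^sup>+p. ennreal (norm (indicator {0..t} (snd p) *\<^sub>R rate (snd p) (fst p))) \<partial>(Q \<Otimes>\<^sub>M lborel)) < \<infinity>" .
qed

lemma integrable_drift: "integrable Q (drift t)"
  using QL.integrable_fst'[OF rate_product_integrable[of t]] by (simp add: drift_def[abs_def])

lemma AE_rate_integrable: "AE \<omega> in Q. integrable lborel (\<lambda>v. indicator {0..t} v *\<^sub>R rate v \<omega>)"
  using QL.AE_integrable_fst'[OF rate_product_integrable[of t]] by simp

lemma drift_filtration:
  assumes t: "0 \<le> t" shows "drift t \<in> borel_measurable (path_filtration t)"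
proof -
  \<comment> \<open>The clip at \<open>t\<close> keeps the integrand within the information up to
    time \<open>t\<close> also for \<open>v > t\<close>, where the indicator removes it.\<close>
  have "(\<lambda>p. rate (min t (snd p)) (fst p)) \<in> borel_measurable (path_filtration t \<Otimes>\<^sub>M lborel)"
    using t by (intro rate_joint[of "{0..t}"]) auto
  then have "(\<lambda>(\<omega>, v). indicator {0..t} v *\<^sub>R rate (min t v) \<omega>) \<in> borel_measurable (path_filtration t \<Otimes>\<^sub>M lborel)"
    unfolding case_prod_unfold by measurable
  then have "(\<lambda>\<omega>. \<integral>v. indicator {0..t} v *\<^sub>R rate (min t v) \<omega> \<partial>lborel) \<in> borel_measurable (path_filtration t)"
    by (rule lborel.borel_measurable_lebesgue_integral)
  also have "(\<lambda>\<omega>. \<integral>v. indicator {0..t} v *\<^sub>R rate (min t v) \<omega> \<partial>lborel) = drift t"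
    unfolding drift_def by (intro ext Bochner_Integration.integral_cong) (auto simp: indicator_def min_def)
  finally show ?thesis .
qed

lemma drift_diff:
  assumes int: "integrable lborel (\<lambda>v. indicator {0..t} v *\<^sub>R rate v \<omega>)" and uv: "0 \<le> u" "u \<le> v" "v \<le> t"
  shows "drift v \<omega> - drift u \<omega> = (\<integral>w. indicator {u..v} w *\<^sub>R rate w \<omega> \<partial>lborel)"
proof -
  have i: "set_integrable lborel {0..t} (\<lambda>w. rate w \<omega>)" using int by (simp add: set_integrable_def)
  have i1: "integrable lborel (\<lambda>w. indicator {0..u} w *\<^sub>R rate w \<omega>)" "integrable lborel (\<lambda>w. indicator {u..v} w *\<^sub>R rate w \<omega>)"
    using set_integrable_subset[OF i, of "{0..u}"] set_integrable_subset[OF i, of "{u..v}"] uv by (auto simp: set_integrable_def)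
  have "drift v \<omega> = (\<integral>w. indicator {0..u} w *\<^sub>R rate w \<omega> + indicator {u..v} w *\<^sub>R rate w \<omega> \<partial>lborel)"
    unfolding drift_def
  proof (rule integral_cong_AE)
    have "set_integrable lborel {0..v} (\<lambda>w. rate w \<omega>)" by (rule set_integrable_subset[OF i]) (use uv in auto)
    then show "(\<lambda>w. indicator {0..v} w *\<^sub>R rate w \<omega>) \<in> borel_measurable lborel" by (auto simp: set_integrable_def)
    show "(\<lambda>w. indicator {0..u} w *\<^sub>R rate w \<omega> + indicator {u..v} w *\<^sub>R rate w \<omega>) \<in> borel_measurable lborel"
      using i1 by (intro borel_measurable_add) auto
    show "AE w in lborel. indicator {0..v} w *\<^sub>R rate w \<omega> = indicator {0..u} w *\<^sub>R rate w \<omega> + indicator {u..v} w *\<^sub>R rate w \<omega>"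
      using AE_lborel_singleton[of u] by eventually_elim (use uv in \<open>auto simp: indicator_def\<close>)
  qed
  also have "\<dots> = drift u \<omega> + (\<integral>w. indicator {u..v} w *\<^sub>R rate w \<omega> \<partial>lborel)"
    using i1 by (simp add: drift_def)
  finally show ?thesis by simp
qed

end

context penalised
begin

definition clipped_wald :: "real \<Rightarrow> real \<Rightarrow> (real \<Rightarrow> real) \<Rightarrow> complex" where
  "clipped_wald \<theta> v \<omega> = wald \<theta> (max 0 v) (coord (max 0 v) \<omega>)"

definition rate_wald_integral :: "real \<Rightarrow> real \<Rightarrow> real \<Rightarrow> (real \<Rightarrow> real) \<Rightarrow> complex" where
  "rate_wald_integral \<theta> a b \<omega> = (\<integral>v. indicator {a..b} v *\<^sub>R (rate v \<omega> *\<^sub>R clipped_wald \<theta> v \<omega>) \<partial>lborel)"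

lemma clipped_wald_joint:
  assumes I: "\<And>v. v \<in> I \<Longrightarrow> 0 \<le> v \<and> {0..v} \<subseteq> I"
    and h: "h \<in> borel_measurable N" "\<And>x. x \<in> space N \<Longrightarrow> max 0 (h x) \<in> I"
    and w: "w \<in> N \<rightarrow>\<^sub>M coord_sigma I"
  shows "(\<lambda>x. clipped_wald \<theta> (h x) (w x)) \<in> borel_measurable N"
proof -
  have h': "(\<lambda>x. max 0 (h x)) \<in> borel_measurable N" using h(1) by simp
  have co: "(\<lambda>x. coord (max 0 (h x)) (w x)) \<in> borel_measurable N"
    by (rule borel_measurable_coord_joint[OF I h' _ w]) (use h in auto)
  show ?thesis unfolding clipped_wald_def using h' co by (intro borel_measurable_wald)
qed

lemma clipped_wald_filtration: "0 \<le> v \<Longrightarrow> v \<le> t \<Longrightarrow> clipped_wald \<theta> v \<in> borel_measurable (path_filtration t)"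
  using clipped_wald_joint[of "{0..t}" "\<lambda>_. v" "path_filtration t" "\<lambda>\<omega>. \<omega>"] by simp

lemma norm_clipped_wald: "v \<le> t \<Longrightarrow> 0 \<le> t \<Longrightarrow> norm (clipped_wald \<theta> v \<omega>) \<le> exp (\<theta>\<^sup>2 * t / 2)"
  unfolding clipped_wald_def by (auto intro!: mult_left_mono)

lemma integrable_bounded_Q:
  fixes f :: "_ \<Rightarrow> 'b::{banach, second_countable_topology}"
  assumes "f \<in> borel_measurable Q" "\<And>\<omega>. \<omega> \<in> path_space \<Longrightarrow> norm (f \<omega>) \<le> K"
  shows "integrable Q f"
  using assms QD(3) by (intro Q.integrable_const_bound[of _ K]) auto

text \<open>\<open>gain_wald_identity\<close> divided by \<open>tail x\<close>: the weight
  \<open>gain v\<close> of the change of law turns \<open>rate v\<close> into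
  \<open>\<phi> (running_max v)\<close>, so the time integral there becomes one of the rate under
  \<open>Q\<close>.\<close>

lemma wald_increment:
  assumes ab: "0 \<le> a" "a \<le> b" and H: "H \<in> borel_measurable (path_filtration a)"
    and bd: "\<And>\<omega>. \<omega> \<in> path_space \<Longrightarrow> norm (H \<omega> :: complex) \<le> K"
  shows "(\<integral>\<omega>. H \<omega> * (clipped_wald \<theta> b \<omega> - clipped_wald \<theta> a \<omega>) \<partial>Q) = - (\<i> * of_real \<theta>) * (\<integral>\<omega>. H \<omega> * rate_wald_integral \<theta> a b \<omega> \<partial>Q)" (is ?thesis1)
    and "integrable Q (\<lambda>\<omega>. H \<omega> * rate_wald_integral \<theta> a b \<omega>)" (is ?thesis2)
proof -
  have b: "0 \<le> b" using ab by simp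
  have K: "0 \<le> K" by (rule bound_nonneg[OF bd])
  have HQ: "H \<in> borel_measurable Q" by (rule measurable_filtration_Q[OF H])
  define f where "f p = indicator {a..b} (snd p) *\<^sub>R (rate (snd p) (fst p) *\<^sub>R (H (fst p) * clipped_wald \<theta> (snd p) (fst p)))" for p
  have fi: "integrable (Q \<Otimes>\<^sub>M lborel) f"
  proof -
    have m: "fst \<in> Q \<Otimes>\<^sub>M lborel \<rightarrow>\<^sub>M path_algebra"
      using measurable_compose[OF measurable_fst measurable_Q[OF measurable_ident]] by simp
    \<comment> \<open>The clip \<open>min b\<close> gives a bound valid at all times and changes
      nothing on the support of the indicator.\<close>
    define w where "w p = (indicator {a..b} (snd p) :: real) *\<^sub>R (H (fst p) * clipped_wald \<theta> (min b (snd p)) (fst p))" for p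
    have zm: "(\<lambda>p. clipped_wald \<theta> (min b (snd p)) (fst p)) \<in> borel_measurable (Q \<Otimes>\<^sub>M lborel)"
      by (rule clipped_wald_joint[of "{0..}", OF _ _ _ m]) auto
    have wm: "w \<in> borel_measurable (Q \<Otimes>\<^sub>M lborel)"
      unfolding w_def using zm measurable_compose[OF measurable_fst HQ] by (intro borel_measurable_scaleR borel_measurable_times) measurable
    have wb: "norm (w p) \<le> K * exp (\<theta>\<^sup>2 * b / 2)" if "p \<in> space (Q \<Otimes>\<^sub>M lborel)" for p
    proof -
      have "fst p \<in> path_space" using measurable_space[OF measurable_fst that] unfolding QD(3) .
      then have "norm (H (fst p)) * norm (clipped_wald \<theta> (min b (snd p)) (fst p)) \<le> K * exp (\<theta>\<^sup>2 * b / 2)"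
        using K b by (intro mult_mono bd norm_clipped_wald) auto
      moreover have "0 \<le> K * exp (\<theta>\<^sup>2 * b / 2)" using K by simp
      ultimately show ?thesis by (cases "snd p \<in> {a..b}") (simp_all add: w_def norm_mult)
    qed
    have "integrable (Q \<Otimes>\<^sub>M lborel) (\<lambda>p. (indicator {0..b} (snd p) *\<^sub>R rate (snd p) (fst p)) *\<^sub>R w p)"
      by (rule integrable_scaleR_bounded[OF rate_product_integrable wm wb])
    moreover have "(indicator {0..b} (snd p) *\<^sub>R rate (snd p) (fst p)) *\<^sub>R w p = f p" for p
      using ab by (auto simp: w_def f_def indicator_def min_def)
    ultimately show ?thesis by simp
  qed
  have f1: "(\<integral>v. f (\<omega>, v) \<partial>lborel) = H \<omega> * rate_wald_integral \<theta> a b \<omega>" for \<omega>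
  proof -
    have "(\<integral>v. f (\<omega>, v) \<partial>lborel) = (\<integral>v. H \<omega> * (indicator {a..b} v *\<^sub>R (rate v \<omega> *\<^sub>R clipped_wald \<theta> v \<omega>)) \<partial>lborel)"
      by (simp add: f_def)
    then show ?thesis unfolding rate_wald_integral_def by (simp only: integral_mult_right_zero)
  qed
  show ?thesis2 using QL.integrable_fst'[OF fi] by (simp only: f1)
  have "(\<integral>\<omega>. H \<omega> * rate_wald_integral \<theta> a b \<omega> \<partial>Q) = (\<integral>v. (\<integral>\<omega>. f (\<omega>, v) \<partial>Q) \<partial>lborel)"
    using QL.Fubini_integral[of "\<lambda>\<omega> v. f (\<omega>, v)"] fi by (simp add: f1)
  also have "\<dots> = (\<integral>v. (1 / tail x) *\<^sub>R (indicator {a..b} v *\<^sub>R (\<integral>\<omega>. \<phi> (running_max v \<omega>) *\<^sub>R (H \<omega> * wald \<theta> v (coord v \<omega>)) \<partial>P)) \<partial>lborel)"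
  proof (rule Bochner_Integration.integral_cong[OF refl])
    fix v :: real
    show "(\<integral>\<omega>. f (\<omega>, v) \<partial>Q) = (1 / tail x) *\<^sub>R (indicator {a..b} v *\<^sub>R (\<integral>\<omega>. \<phi> (running_max v \<omega>) *\<^sub>R (H \<omega> * wald \<theta> v (coord v \<omega>)) \<partial>P))"
    proof (cases "v \<in> {a..b}")
      case True
      then have v: "0 \<le> v" "a \<le> v" using ab by auto
      have fm: "(\<lambda>\<omega>. rate v \<omega> *\<^sub>R (H \<omega> * clipped_wald \<theta> v \<omega>)) \<in> borel_measurable (path_filtration v)"
        using rate_filtration[OF v(1) order_refl] clipped_wald_filtration[OF v(1) order_refl] measurable_filtration_mono[OF v(2) H]
        by (intro borel_measurable_scaleR borel_measurable_times)
      have "(\<integral>\<omega>. f (\<omega>, v) \<partial>Q) = (\<integral>\<omega>. rate v \<omega> *\<^sub>R (H \<omega> * clipped_wald \<theta> v \<omega>) \<partial>Q)" using True by (simp add: f_def)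
      also have "\<dots> = (1 / tail x) *\<^sub>R (\<integral>\<omega>. gain v \<omega> *\<^sub>R (rate v \<omega> *\<^sub>R (H \<omega> * clipped_wald \<theta> v \<omega>)) \<partial>P)"
        by (rule integral_Q[OF v(1) fm])
      also have "(\<integral>\<omega>. gain v \<omega> *\<^sub>R (rate v \<omega> *\<^sub>R (H \<omega> * clipped_wald \<theta> v \<omega>)) \<partial>P) = (\<integral>\<omega>. \<phi> (running_max v \<omega>) *\<^sub>R (H \<omega> * wald \<theta> v (coord v \<omega>)) \<partial>P)"
      proof (rule Bochner_Integration.integral_cong[OF refl])
        fix \<omega> assume "\<omega> \<in> space P"
        then have "gain v \<omega> \<noteq> 0" using gain_pos[of \<omega> v] v PD(4) by simp
        then show "gain v \<omega> *\<^sub>R (rate v \<omega> *\<^sub>R (H \<omega> * clipped_wald \<theta> v \<omega>)) = \<phi> (running_max v \<omega>) *\<^sub>R (H \<omega> * wald \<theta> v (coord v \<omega>))"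
          using v by (simp add: rate_def clipped_wald_def)
      qed
      finally show ?thesis using True by simp
    qed (simp add: f_def)
  qed
  also have "\<dots> = (1 / tail x) *\<^sub>R (\<integral>v. indicator {a..b} v *\<^sub>R (\<integral>\<omega>. \<phi> (running_max v \<omega>) *\<^sub>R (H \<omega> * wald \<theta> v (coord v \<omega>)) \<partial>P) \<partial>lborel)"
    by (rule integral_scaleR_right)
  finally have J: "(\<integral>\<omega>. H \<omega> * rate_wald_integral \<theta> a b \<omega> \<partial>Q) = (1 / tail x) *\<^sub>R (\<integral>v. indicator {a..b} v *\<^sub>R (\<integral>\<omega>. \<phi> (running_max v \<omega>) *\<^sub>R (H \<omega> * wald \<theta> v (coord v \<omega>)) \<partial>P) \<partial>lborel)" .
  have E: "(\<integral>\<omega>. H \<omega> * clipped_wald \<theta> v \<omega> \<partial>Q) = (1 / tail x) *\<^sub>R (\<integral>\<omega>. gain v \<omega> *\<^sub>R (H \<omega> * wald \<theta> v (coord v \<omega>)) \<partial>P)"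
    and Ei: "integrable Q (\<lambda>\<omega>. H \<omega> * clipped_wald \<theta> v \<omega>)" if "a \<le> v" for v
  proof -
    have v: "0 \<le> v" using that ab by simp
    have fm: "(\<lambda>\<omega>. H \<omega> * clipped_wald \<theta> v \<omega>) \<in> borel_measurable (path_filtration v)"
      using clipped_wald_filtration[OF v order_refl] measurable_filtration_mono[OF that H] by (intro borel_measurable_times)
    show "(\<integral>\<omega>. H \<omega> * clipped_wald \<theta> v \<omega> \<partial>Q) = (1 / tail x) *\<^sub>R (\<integral>\<omega>. gain v \<omega> *\<^sub>R (H \<omega> * wald \<theta> v (coord v \<omega>)) \<partial>P)"
      using integral_Q[OF v fm] v by (simp add: clipped_wald_def)
    show "integrable Q (\<lambda>\<omega>. H \<omega> * clipped_wald \<theta> v \<omega>)"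
      using K by (intro integrable_bounded_Q[where K="K * exp (\<theta>\<^sup>2 * v / 2)"] measurable_filtration_Q[OF fm])
        (auto simp: norm_mult simp del: norm_wald intro!: mult_mono bd norm_clipped_wald v)
  qed
  let ?G = "(\<integral>v. indicator {a..b} v *\<^sub>R (\<integral>\<omega>. \<phi> (running_max v \<omega>) *\<^sub>R (H \<omega> * wald \<theta> v (coord v \<omega>)) \<partial>P) \<partial>lborel)"
  let ?g = "\<lambda>v. \<integral>\<omega>. gain v \<omega> *\<^sub>R (H \<omega> * wald \<theta> v (coord v \<omega>)) \<partial>P"
  have id: "?g b + \<i> * of_real \<theta> * ?G = ?g a" by (rule gain_wald_identity[OF ab H bd])
  have "(\<integral>\<omega>. H \<omega> * (clipped_wald \<theta> b \<omega> - clipped_wald \<theta> a \<omega>) \<partial>Q) = (1 / tail x) *\<^sub>R ?g b - (1 / tail x) *\<^sub>R ?g a"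
    using E[of b] E[of a] Ei[of b] Ei[of a] ab by (simp add: right_diff_distrib)
  also have "\<dots> = - (\<i> * of_real \<theta>) * ((1 / tail x) *\<^sub>R ?G)" unfolding id[symmetric] by (simp add: scaleR_add_right)
  finally show ?thesis1 unfolding J .
qed

text \<open>A product rule in the mean. Over each cell the increment of the product, weighted by
  \<open>H\<close>, has the same expectation as the left phase factor times the remainder
  \<open>\<rho>\<close>; so the total change equals the expectation of \<open>H * R n\<close> for
  every partition. Almost surely \<open>R n\<close> tends to 0, dominated by a multiple of the
  increment of the drift, so the total change is 0.\<close>

lemma wald_drift_martingale:
  assumes st: "0 \<le> s" "s \<le> t" and H: "H \<in> borel_measurable (path_filtration s)"
    and bd: "\<And>\<omega>. \<omega> \<in> path_space \<Longrightarrow> norm (H \<omega> :: complex) \<le> K"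
  shows "(\<integral>\<omega>. H \<omega> * (clipped_wald \<theta> t \<omega> * cis (\<theta> * drift t \<omega>)) \<partial>Q) = (\<integral>\<omega>. H \<omega> * (clipped_wald \<theta> s \<omega> * cis (\<theta> * drift s \<omega>)) \<partial>Q)"
proof -
  have t: "0 \<le> t" using st by simp
  have K: "0 \<le> K" by (rule bound_nonneg[OF bd])
  define e where "e v \<omega> = cis (\<theta> * drift v \<omega>)" for v \<omega>
  define Y where "Y v \<omega> = clipped_wald \<theta> v \<omega> * e v \<omega>" for v \<omega>
  define \<rho> where "\<rho> a b \<omega> = clipped_wald \<theta> b \<omega> * (cis (\<theta> * (drift b \<omega> - drift a \<omega>)) - 1) - \<i> * of_real \<theta> * rate_wald_integral \<theta> a b \<omega>" for a b \<omega>
  define R where "R n \<omega> = (\<Sum>k<Suc n. e (node s t n k) \<omega> * \<rho> (node s t n k) (node s t n (Suc k)) \<omega>)" for n \<omega>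
  have eF: "e v \<in> borel_measurable (path_filtration v)" if "0 \<le> v" for v
    unfolding e_def using drift_filtration[OF that] by measurable
  have step: "(\<integral>\<omega>. H \<omega> * Y b \<omega> \<partial>Q) - (\<integral>\<omega>. H \<omega> * Y a \<omega> \<partial>Q) = (\<integral>\<omega>. H \<omega> * (e a \<omega> * \<rho> a b \<omega>) \<partial>Q)"
    and stepi: "integrable Q (\<lambda>\<omega>. H \<omega> * (e a \<omega> * \<rho> a b \<omega>))" if ab: "s \<le> a" "a \<le> b" "b \<le> t" for a b
  proof -
    have a: "0 \<le> a" and b: "0 \<le> b" using ab st by auto
    have HeF: "(\<lambda>\<omega>. H \<omega> * e a \<omega>) \<in> borel_measurable (path_filtration a)"
      using measurable_filtration_mono[OF ab(1) H] eF[OF a] by (rule borel_measurable_times)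
    have Heb: "norm (H \<omega> * e a \<omega>) \<le> K" if "\<omega> \<in> path_space" for \<omega> using bd[OF that] by (simp add: e_def norm_mult)
    note inc = wald_increment[OF a ab(2) HeF Heb, of \<theta>]
    have HQ: "H \<in> borel_measurable Q" by (rule measurable_filtration_Q[OF H])
    have mQ: "clipped_wald \<theta> v \<in> borel_measurable Q" "e v \<in> borel_measurable Q" "drift v \<in> borel_measurable Q" if "0 \<le> v" for v
      using clipped_wald_filtration[OF that order_refl] eF[OF that] drift_filtration[OF that] by (auto intro: measurable_filtration_Q)
    have iY: "integrable Q (\<lambda>\<omega>. H \<omega> * Y v \<omega>)" if "0 \<le> v" "v \<le> t" for v
      unfolding Y_def using K t that
      by (intro integrable_bounded_Q[where K="K * exp (\<theta>\<^sup>2 * t / 2)"] borel_measurable_times HQ mQ)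
         (auto simp: norm_mult e_def intro!: mult_mono bd norm_clipped_wald)
    have i1: "integrable Q (\<lambda>\<omega>. H \<omega> * e a \<omega> * (clipped_wald \<theta> b \<omega> * (cis (\<theta> * (drift b \<omega> - drift a \<omega>)) - 1)))"
    proof (rule integrable_bounded_Q[where K="K * (exp (\<theta>\<^sup>2 * t / 2) * 2)"])
      have "(\<lambda>\<omega>. cis (\<theta> * (drift b \<omega> - drift a \<omega>))) \<in> borel_measurable Q"
        using mQ(3)[OF a] mQ(3)[OF b] by measurable
      then show "(\<lambda>\<omega>. H \<omega> * e a \<omega> * (clipped_wald \<theta> b \<omega> * (cis (\<theta> * (drift b \<omega> - drift a \<omega>)) - 1))) \<in> borel_measurable Q"
        by (intro borel_measurable_times borel_measurable_diff borel_measurable_const HQ mQ a b)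
      fix \<omega> assume w: "\<omega> \<in> path_space"
      have "norm (cis (\<theta> * (drift b \<omega> - drift a \<omega>)) - 1) \<le> 2"
        using norm_triangle_ineq4[of "cis (\<theta> * (drift b \<omega> - drift a \<omega>))" 1] by simp
      then show "norm (H \<omega> * e a \<omega> * (clipped_wald \<theta> b \<omega> * (cis (\<theta> * (drift b \<omega> - drift a \<omega>)) - 1))) \<le> K * (exp (\<theta>\<^sup>2 * t / 2) * 2)"
        unfolding norm_mult[of "H \<omega> * e a \<omega>"] norm_mult[of "clipped_wald \<theta> b \<omega>"]
        using Heb[OF w] K t ab by (intro mult_mono norm_clipped_wald) auto
    qed
    have i2: "integrable Q (\<lambda>\<omega>. H \<omega> * e a \<omega> * rate_wald_integral \<theta> a b \<omega>)" by (rule inc(2))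
    have i3: "integrable Q (\<lambda>\<omega>. H \<omega> * e a \<omega> * (clipped_wald \<theta> b \<omega> - clipped_wald \<theta> a \<omega>))"
    proof (rule integrable_bounded_Q[where K="K * (exp (\<theta>\<^sup>2 * t / 2) + exp (\<theta>\<^sup>2 * t / 2))"])
      show "(\<lambda>\<omega>. H \<omega> * e a \<omega> * (clipped_wald \<theta> b \<omega> - clipped_wald \<theta> a \<omega>)) \<in> borel_measurable Q"
        by (intro borel_measurable_times borel_measurable_diff HQ mQ a b)
      fix \<omega> assume w: "\<omega> \<in> path_space"
      have "norm (clipped_wald \<theta> b \<omega> - clipped_wald \<theta> a \<omega>) \<le> exp (\<theta>\<^sup>2 * t / 2) + exp (\<theta>\<^sup>2 * t / 2)"
        using ab t by (intro order_trans[OF norm_triangle_ineq4] add_mono norm_clipped_wald) auto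
      then show "norm (H \<omega> * e a \<omega> * (clipped_wald \<theta> b \<omega> - clipped_wald \<theta> a \<omega>)) \<le> K * (exp (\<theta>\<^sup>2 * t / 2) + exp (\<theta>\<^sup>2 * t / 2))"
        unfolding norm_mult[of "H \<omega> * e a \<omega>"] using Heb[OF w] K by (intro mult_mono) auto
    qed
    have \<rho>eq: "H \<omega> * (e a \<omega> * \<rho> a b \<omega>) = H \<omega> * e a \<omega> * (clipped_wald \<theta> b \<omega> * (cis (\<theta> * (drift b \<omega> - drift a \<omega>)) - 1))
      - (\<i> * of_real \<theta>) * (H \<omega> * e a \<omega> * rate_wald_integral \<theta> a b \<omega>)" for \<omega>
      by (simp add: \<rho>_def algebra_simps)
    show "integrable Q (\<lambda>\<omega>. H \<omega> * (e a \<omega> * \<rho> a b \<omega>))" unfolding \<rho>eq using i1 i2 by simp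
    \<comment> \<open>The increment of the phase factor is paired with \<open>Z\<close> at the right
      end, that of \<open>Z\<close> with the phase factor at the left end; the weight
      \<open>H * e a\<close> is then known at time \<open>a\<close>, as
      \<open>wald_increment\<close> requires.\<close>
    have Yeq: "H \<omega> * Y b \<omega> - H \<omega> * Y a \<omega> = H \<omega> * e a \<omega> * (clipped_wald \<theta> b \<omega> * (cis (\<theta> * (drift b \<omega> - drift a \<omega>)) - 1))
      + H \<omega> * e a \<omega> * (clipped_wald \<theta> b \<omega> - clipped_wald \<theta> a \<omega>)" for \<omega>
    proof -
      have "e b \<omega> = e a \<omega> * cis (\<theta> * (drift b \<omega> - drift a \<omega>))" by (simp add: e_def cis_mult algebra_simps)
      then show ?thesis by (simp add: Y_def algebra_simps)
    qed
    have "(\<integral>\<omega>. H \<omega> * Y b \<omega> \<partial>Q) - (\<integral>\<omega>. H \<omega> * Y a \<omega> \<partial>Q) = (\<integral>\<omega>. H \<omega> * Y b \<omega> - H \<omega> * Y a \<omega> \<partial>Q)"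
      using iY[of b] iY[of a] a b ab by simp
    also have "\<dots> = (\<integral>\<omega>. H \<omega> * e a \<omega> * (clipped_wald \<theta> b \<omega> * (cis (\<theta> * (drift b \<omega> - drift a \<omega>)) - 1)) \<partial>Q)
       + (\<integral>\<omega>. H \<omega> * e a \<omega> * (clipped_wald \<theta> b \<omega> - clipped_wald \<theta> a \<omega>) \<partial>Q)"
      unfolding Yeq by (rule Bochner_Integration.integral_add[OF i1 i3])
    also have "\<dots> = (\<integral>\<omega>. H \<omega> * (e a \<omega> * \<rho> a b \<omega>) \<partial>Q)"
      unfolding \<rho>eq using i1 i2 inc(1) by (subst Bochner_Integration.integral_diff) auto
    finally show "(\<integral>\<omega>. H \<omega> * Y b \<omega> \<partial>Q) - (\<integral>\<omega>. H \<omega> * Y a \<omega> \<partial>Q) = (\<integral>\<omega>. H \<omega> * (e a \<omega> * \<rho> a b \<omega>) \<partial>Q)" .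
  qed
  have ER: "(\<integral>\<omega>. H \<omega> * R n \<omega> \<partial>Q) = (\<integral>\<omega>. H \<omega> * Y t \<omega> \<partial>Q) - (\<integral>\<omega>. H \<omega> * Y s \<omega> \<partial>Q)"
    and Ri: "integrable Q (\<lambda>\<omega>. H \<omega> * R n \<omega>)" for n
  proof -
    have ok: "s \<le> node s t n k" "node s t n k \<le> node s t n (Suc k)" "node s t n (Suc k) \<le> t" if "k < Suc n" for k
      using node(3,4)[OF st(2), of n k] node(5)[OF st(2), of "Suc k" n] that by auto
    have HR: "H \<omega> * R n \<omega> = (\<Sum>k<Suc n. H \<omega> * (e (node s t n k) \<omega> * \<rho> (node s t n k) (node s t n (Suc k)) \<omega>))" for \<omega>
      unfolding R_def by (rule sum_distrib_left)
    show "integrable Q (\<lambda>\<omega>. H \<omega> * R n \<omega>)"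
      unfolding HR by (rule Bochner_Integration.integrable_sum) (use ok in \<open>auto intro!: stepi\<close>)
    have "(\<integral>\<omega>. H \<omega> * R n \<omega> \<partial>Q) = (\<Sum>k<Suc n. \<integral>\<omega>. H \<omega> * (e (node s t n k) \<omega> * \<rho> (node s t n k) (node s t n (Suc k)) \<omega>) \<partial>Q)"
      unfolding HR by (rule Bochner_Integration.integral_sum) (use ok in \<open>auto intro!: stepi\<close>)
    also have "\<dots> = (\<Sum>k<Suc n. (\<integral>\<omega>. H \<omega> * Y (node s t n (Suc k)) \<omega> \<partial>Q) - (\<integral>\<omega>. H \<omega> * Y (node s t n k) \<omega> \<partial>Q))"
      by (rule sum.cong[OF refl]) (use ok in \<open>simp add: step\<close>)
    also have "\<dots> = (\<integral>\<omega>. H \<omega> * Y t \<omega> \<partial>Q) - (\<integral>\<omega>. H \<omega> * Y s \<omega> \<partial>Q)"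
      using sum_lessThan_telescope[of "\<lambda>k. \<integral>\<omega>. H \<omega> * Y (node s t n k) \<omega> \<partial>Q" "Suc n"] by (simp only: node[OF st(2)])
    finally show "(\<integral>\<omega>. H \<omega> * R n \<omega> \<partial>Q) = (\<integral>\<omega>. H \<omega> * Y t \<omega> \<partial>Q) - (\<integral>\<omega>. H \<omega> * Y s \<omega> \<partial>Q)" .
  qed
  define C where "C = exp (\<theta>\<^sup>2 * t / 2)"
  \<comment> \<open>The pathwise estimates need a convergent drift integral, which
    \<open>AE_rate_integrable\<close> provides almost surely.\<close>
  have path: "AE \<omega> in Q. (\<lambda>n. H \<omega> * R n \<omega>) \<longlonglongrightarrow> 0 \<and> (\<forall>n. norm (H \<omega> * R n \<omega>) \<le> K * (2 * C * \<bar>\<theta>\<bar> * (drift t \<omega> - drift s \<omega>)))"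
    using AE_rate_integrable[of t] AE_space
  proof eventually_elim
    fix \<omega> assume int: "integrable lborel (\<lambda>v. indicator {0..t} v *\<^sub>R rate v \<omega>)" and "\<omega> \<in> space Q"
    then have w: "\<omega> \<in> path_space" using QD(3) by simp
    interpret partition s t "\<lambda>v. rate v \<omega>" "\<lambda>v. drift v \<omega>" "\<lambda>v. clipped_wald \<theta> v \<omega>" C \<theta>
    proof
      show "s \<le> t" by (rule st)
      show "0 \<le> rate v \<omega>" for v by (rule rate_nonneg)
      have "set_integrable lborel {0..t} (\<lambda>w. rate w \<omega>)" using int by (simp add: set_integrable_def)
      from set_integrable_subset[OF this, of "{s..t}"]
      show "integrable lborel (\<lambda>v. indicator {s..t} v *\<^sub>R rate v \<omega>)" using st by (simp add: set_integrable_def)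
      show "(\<lambda>v. clipped_wald \<theta> v \<omega>) \<in> borel_measurable borel"
        by (rule clipped_wald_joint[of "{0..}"]) (use w in auto)
      show "norm (clipped_wald \<theta> v \<omega>) \<le> C" if "v \<in> {s..t}" for v
        unfolding C_def using that t by (intro norm_clipped_wald) auto
      show "continuous_on {s..t} (\<lambda>v. clipped_wald \<theta> v \<omega>)"
      proof (rule continuous_on_cong[THEN iffD1, OF refl])
        have "continuous_on {s..t} (\<lambda>v. coord v \<omega>)" using st w by (intro continuous_on_path) auto
        then show "continuous_on {s..t} (\<lambda>v. wald \<theta> v (coord v \<omega>))"
          unfolding wald_def by (intro continuous_intros) auto
        show "wald \<theta> v (coord v \<omega>) = clipped_wald \<theta> v \<omega>" if "v \<in> {s..t}" for v
          using that st by (simp add: clipped_wald_def)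
      qed
      show "drift v \<omega> - drift u \<omega> = (\<integral>w. indicator {u..v} w *\<^sub>R rate w \<omega> \<partial>lborel)" if "s \<le> u" "u \<le> v" "v \<le> t" for u v
        using that st by (intro drift_diff[OF int]) auto
    qed
    have Req: "R n \<omega> = remainder_sum n" for n
      unfolding R_def remainder_sum_def remainder_def  e_def \<rho>_def rate_wald_integral_def ..
    have "(\<lambda>n. H \<omega> * R n \<omega>) \<longlonglongrightarrow> H \<omega> * 0"
      unfolding Req by (intro tendsto_mult tendsto_const remainder_sum_tendsto)
    moreover have "norm (H \<omega> * R n \<omega>) \<le> K * (2 * C * \<bar>\<theta>\<bar> * (drift t \<omega> - drift s \<omega>))" for n
      unfolding Req norm_mult using K by (intro mult_mono bd[OF w] remainder_sum_bound) auto
    ultimately show "(\<lambda>n. H \<omega> * R n \<omega>) \<longlonglongrightarrow> 0 \<and> (\<forall>n. norm (H \<omega> * R n \<omega>) \<le> K * (2 * C * \<bar>\<theta>\<bar> * (drift t \<omega> - drift s \<omega>)))" by simp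
  qed
  have "(\<lambda>n. \<integral>\<omega>. H \<omega> * R n \<omega> \<partial>Q) \<longlonglongrightarrow> (\<integral>\<omega>. 0 \<partial>Q)"
  proof (rule integral_dominated_convergence)
    show "integrable Q (\<lambda>\<omega>. K * (2 * C * \<bar>\<theta>\<bar> * (drift t \<omega> - drift s \<omega>)))" using integrable_drift by simp
    show "AE \<omega> in Q. (\<lambda>n. H \<omega> * R n \<omega>) \<longlonglongrightarrow> 0" using path by eventually_elim simp
    show "AE \<omega> in Q. norm (H \<omega> * R n \<omega>) \<le> K * (2 * C * \<bar>\<theta>\<bar> * (drift t \<omega> - drift s \<omega>))" for n
      using path by eventually_elim simp
    show "(\<lambda>\<omega>. H \<omega> * R n \<omega>) \<in> borel_measurable Q" for n using Ri[of n] by simp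
  qed simp
  then have "(\<integral>\<omega>. H \<omega> * Y t \<omega> \<partial>Q) - (\<integral>\<omega>. H \<omega> * Y s \<omega> \<partial>Q) = 0"
    unfolding ER by (simp add: LIMSEQ_const_iff)
  then show ?thesis by (simp add: Y_def e_def)
qed

end

lemma char_normal:
  assumes "0 < \<sigma>"
  shows "char (density lborel (normal_density 0 \<sigma>)) \<theta> = of_real (exp (- (\<theta>\<^sup>2 * \<sigma>\<^sup>2) / 2))"
proof -
  let ?N = "density lborel (normal_density 0 \<sigma>)"
  interpret N: prob_space ?N by (rule prob_space_normal_density[OF assms])
  have "distr ?N lborel (\<lambda>y. y) = ?N" by (rule distr_id2) simp
  then have "distributed ?N lborel (\<lambda>y. y) (normal_density 0 \<sigma>)" by (simp add: distributed_def)
  from N.normal_char[OF this assms, of \<theta>] show ?thesis by (simp add: char_def cis_conv_exp)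
qed

context penalised
begin

definition B :: "real \<Rightarrow> (real \<Rightarrow> real) \<Rightarrow> real" where
  "B t \<omega> = drift_corrected \<phi> x t \<omega>"

lemma B_eq:
  assumes "\<omega> \<in> path_space" "0 \<le> t"
  shows "B t \<omega> = coord t \<omega> - x + drift t \<omega>"
proof -
  have "(\<integral>u. indicator {0..t} u *\<^sub>R (\<phi> (running_max u \<omega>) / max_martingale \<phi> u \<omega>) \<partial>lborel) = drift t \<omega>"
    unfolding drift_def
    by (rule Bochner_Integration.integral_cong[OF refl]) (use gain_eq[OF assms(1)] in \<open>auto simp: indicator_def rate_def\<close>)
  then show ?thesis by (simp add: B_def drift_corrected_def set_lebesgue_integral_def)
qed

lemma B_filtration:
  assumes t: "0 \<le> t" shows "B t \<in> borel_measurable (path_filtration t)"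
proof -
  have "(\<lambda>\<omega>. coord t \<omega> - x + drift t \<omega>) \<in> borel_measurable (path_filtration t)"
    using drift_filtration[OF t] filtration_coord[OF t order_refl] by (intro borel_measurable_add borel_measurable_diff) auto
  then show ?thesis
    by (rule measurable_cong[THEN iffD1, rotated]) (simp add: B_eq t)
qed

lemma B_measurable: "0 \<le> t \<Longrightarrow> B t \<in> borel_measurable Q"
  by (rule measurable_filtration_Q[OF B_filtration])

text \<open>Testing the martingale against the conjugate phase at time \<open>s\<close>, restricted
  to \<open>\<Gamma>\<close>, leaves the exponential of the increment alone. Its mean factorises
  with the characteristic function of a centred normal variable of variance
  \<open>t - s\<close>.\<close>

lemma increment_char:
  assumes st: "0 \<le> s" "s \<le> t" and \<Gamma>: "\<Gamma> \<in> sets (path_filtration s)"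
  shows "(\<integral>\<omega>. indicator \<Gamma> \<omega> * cis (\<theta> * (B t \<omega> - B s \<omega>)) \<partial>Q) = of_real (exp (- (\<theta>\<^sup>2 * (t - s)) / 2) * measure Q \<Gamma>)"
proof -
  have t: "0 \<le> t" using st by simp
  have \<Gamma>Q: "\<Gamma> \<in> sets Q" using \<Gamma> sets_coord_sigma_mono[of "{0..s}" "{0..}"] QD(2) by auto
  define H where "H \<omega> = indicator \<Gamma> \<omega> * cis (- \<theta> * (coord s \<omega> + drift s \<omega>))" for \<omega>
  have Hm: "H \<in> borel_measurable (path_filtration s)"
  proof -
    have "(\<lambda>\<omega>. cis (- \<theta> * (coord s \<omega> + drift s \<omega>))) \<in> borel_measurable (path_filtration s)"
      using drift_filtration[OF st(1)] filtration_coord[OF st(1) order_refl]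
      by measurable
    moreover have "(indicator \<Gamma> :: _ \<Rightarrow> complex) \<in> borel_measurable (path_filtration s)" using \<Gamma> by simp
    ultimately show ?thesis unfolding H_def by (rule borel_measurable_times[rotated])
  qed
  have Hb: "norm (H \<omega>) \<le> 1" for \<omega> by (simp add: H_def norm_mult indicator_def)
  have 1: "H \<omega> * (clipped_wald \<theta> t \<omega> * cis (\<theta> * drift t \<omega>)) = of_real (exp (\<theta>\<^sup>2 * t / 2)) * (indicator \<Gamma> \<omega> * cis (\<theta> * (B t \<omega> - B s \<omega>)))"
    if "\<omega> \<in> path_space" for \<omega>
  proof -
    have "cis (- \<theta> * (coord s \<omega> + drift s \<omega>)) * (cis (\<theta> * coord t \<omega>) * cis (\<theta> * drift t \<omega>)) = cis (\<theta> * (B t \<omega> - B s \<omega>))"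
      by (simp add: cis_mult B_eq that st t algebra_simps)
    moreover have "H \<omega> * (clipped_wald \<theta> t \<omega> * cis (\<theta> * drift t \<omega>)) =
      of_real (exp (\<theta>\<^sup>2 * t / 2)) * (indicator \<Gamma> \<omega> * (cis (- \<theta> * (coord s \<omega> + drift s \<omega>)) * (cis (\<theta> * coord t \<omega>) * cis (\<theta> * drift t \<omega>))))"
      using t by (simp add: H_def clipped_wald_def wald_def)
    ultimately show ?thesis by simp
  qed
  have 2: "H \<omega> * (clipped_wald \<theta> s \<omega> * cis (\<theta> * drift s \<omega>)) = of_real (exp (\<theta>\<^sup>2 * s / 2)) * indicator \<Gamma> \<omega>" for \<omega>
  proof -
    have "cis (- \<theta> * (coord s \<omega> + drift s \<omega>)) * (cis (\<theta> * coord s \<omega>) * cis (\<theta> * drift s \<omega>)) = 1"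
      by (simp add: cis_mult algebra_simps)
    moreover have "H \<omega> * (clipped_wald \<theta> s \<omega> * cis (\<theta> * drift s \<omega>)) =
      of_real (exp (\<theta>\<^sup>2 * s / 2)) * (indicator \<Gamma> \<omega> * (cis (- \<theta> * (coord s \<omega> + drift s \<omega>)) * (cis (\<theta> * coord s \<omega>) * cis (\<theta> * drift s \<omega>))))"
      using st by (simp add: H_def clipped_wald_def wald_def)
    ultimately show ?thesis by simp
  qed
  have "of_real (exp (\<theta>\<^sup>2 * t / 2)) * (\<integral>\<omega>. indicator \<Gamma> \<omega> * cis (\<theta> * (B t \<omega> - B s \<omega>)) \<partial>Q) =
    (\<integral>\<omega>. H \<omega> * (clipped_wald \<theta> t \<omega> * cis (\<theta> * drift t \<omega>)) \<partial>Q)"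
    unfolding integral_mult_right_zero[symmetric]
    by (rule Bochner_Integration.integral_cong[OF refl]) (simp add: 1 QD(3))
  also have "\<dots> = (\<integral>\<omega>. H \<omega> * (clipped_wald \<theta> s \<omega> * cis (\<theta> * drift s \<omega>)) \<partial>Q)"
    by (rule wald_drift_martingale[OF st Hm Hb])
  also have "\<dots> = of_real (exp (\<theta>\<^sup>2 * s / 2)) * (\<integral>\<omega>. indicator \<Gamma> \<omega> \<partial>Q)"
    unfolding 2 by (rule integral_mult_right_zero)
  also have "(\<integral>\<omega>. indicator \<Gamma> \<omega> \<partial>Q) = complex_of_real (measure Q \<Gamma>)"
  proof -
    have "(\<integral>\<omega>. indicator \<Gamma> \<omega> \<partial>Q) = (\<integral>\<omega>. complex_of_real (indicator \<Gamma> \<omega>) \<partial>Q)"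
      by (rule Bochner_Integration.integral_cong) (auto simp: indicator_def)
    also have "\<dots> = complex_of_real (measure Q \<Gamma>)"
      unfolding integral_complex_of_real using \<Gamma>Q sets.sets_into_space[OF \<Gamma>Q] by (simp add: Int_absorb2)
    finally show ?thesis .
  qed
  finally have "of_real (exp (- (\<theta>\<^sup>2 * t / 2))) * (of_real (exp (\<theta>\<^sup>2 * t / 2)) * (\<integral>\<omega>. indicator \<Gamma> \<omega> * cis (\<theta> * (B t \<omega> - B s \<omega>)) \<partial>Q))
    = of_real (exp (- (\<theta>\<^sup>2 * t / 2))) * (of_real (exp (\<theta>\<^sup>2 * s / 2)) * complex_of_real (measure Q \<Gamma>))" by simp
  then have "of_real (exp (- (\<theta>\<^sup>2 * t / 2)) * exp (\<theta>\<^sup>2 * t / 2)) * (\<integral>\<omega>. indicator \<Gamma> \<omega> * cis (\<theta> * (B t \<omega> - B s \<omega>)) \<partial>Q)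
    = of_real (exp (- (\<theta>\<^sup>2 * t / 2)) * exp (\<theta>\<^sup>2 * s / 2) * measure Q \<Gamma>)" by (simp only: of_real_mult mult.assoc)
  moreover have "exp (- (\<theta>\<^sup>2 * t / 2)) * exp (\<theta>\<^sup>2 * t / 2) = 1" by (simp add: exp_add[symmetric])
  moreover have "exp (- (\<theta>\<^sup>2 * t / 2)) * exp (\<theta>\<^sup>2 * s / 2) = exp (- (\<theta>\<^sup>2 * (t - s)) / 2)"
    unfolding exp_add[symmetric] by (rule arg_cong[where f=exp]) (simp add: field_simps)
  ultimately show ?thesis by simp
qed

text \<open>Given a past event of positive probability, the increment has the normal characteristic
  function, hence the normal law. One statement thus yields both the distribution and the
  independence of the past.\<close>

lemma increment_law:
  assumes st: "0 \<le> s" "s < t" and \<Gamma>: "\<Gamma> \<in> sets (path_filtration s)" and A: "A \<in> sets borel"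
  shows "measure Q (\<Gamma> \<inter> {\<omega> \<in> space Q. B t \<omega> - B s \<omega> \<in> A}) = measure Q \<Gamma> * measure (density lborel (normal_density 0 (sqrt (t - s)))) A"
proof -
  have \<Gamma>Q: "\<Gamma> \<in> sets Q" using \<Gamma> sets_coord_sigma_mono[of "{0..s}" "{0..}"] QD(2) by auto
  define D where "D \<omega> = B t \<omega> - B s \<omega>" for \<omega>
  have Dm: "D \<in> borel_measurable Q" unfolding D_def using st by (intro borel_measurable_diff B_measurable) auto
  have DA: "{\<omega> \<in> space Q. D \<omega> \<in> A} \<in> sets Q" using measurable_sets[OF Dm A] by (simp add: vimage_def Int_def conj_commute)
  show ?thesis
  proof (cases "measure Q \<Gamma> = 0")
    case True
    have "measure Q (\<Gamma> \<inter> {\<omega> \<in> space Q. D \<omega> \<in> A}) \<le> measure Q \<Gamma>" using \<Gamma>Q DA by (intro Q.finite_measure_mono) auto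
    then show ?thesis using True by (simp add: measure_le_0_iff D_def)
  next
    case False
    define N where "N = uniform_measure Q \<Gamma>"
    have e\<Gamma>: "emeasure Q \<Gamma> \<noteq> 0" "emeasure Q \<Gamma> \<noteq> \<infinity>" using False by (auto simp: Q.emeasure_eq_measure)
    interpret N: prob_space N unfolding N_def by (rule prob_space_uniform_measure[OF e\<Gamma>])
    have DN: "D \<in> borel_measurable N" using Dm by (simp add: N_def)
    have cD: "(\<lambda>\<omega>. cis (\<theta> * D \<omega>)) \<in> borel_measurable Q" for \<theta> using Dm by measurable
    have "char (distr N borel D) = char (density lborel (normal_density 0 (sqrt (t - s))))"
    proof
      fix \<theta>
      have "char (distr N borel D) \<theta> = (\<integral>\<omega>. cis (\<theta> * D \<omega>) \<partial>N)"
        unfolding char_def using DN by (subst integral_distr) (auto simp: cis_conv_exp)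
      also have "\<dots> = (\<integral>\<omega>. indicator \<Gamma> \<omega> * cis (\<theta> * D \<omega>) \<partial>Q) / of_real (measure Q \<Gamma>)"
        unfolding N_def by (rule Q.integral_uniform_measure[OF cD \<Gamma>Q False])
      also have "\<dots> = of_real (exp (- (\<theta>\<^sup>2 * (t - s)) / 2))"
        using increment_char[OF st(1) less_imp_le[OF st(2)] \<Gamma>, of \<theta>] False by (simp add: D_def)
      finally show "char (distr N borel D) \<theta> = char (density lborel (normal_density 0 (sqrt (t - s)))) \<theta>"
        using char_normal[of "sqrt (t - s)" \<theta>] st by simp
    qed
    moreover have "real_distribution (density lborel (normal_density 0 (sqrt (t - s))))"
      using prob_space_normal_density[of "sqrt (t - s)" 0] st by (auto simp: real_distribution_def real_distribution_axioms_def)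
    ultimately have "distr N borel D = density lborel (normal_density 0 (sqrt (t - s)))"
      using DN by (intro Levy_uniqueness N.real_distribution_distr)
    then have "measure (density lborel (normal_density 0 (sqrt (t - s)))) A = measure N (D -` A \<inter> space N)"
      using measure_distr[OF DN A] by simp
    also have "D -` A \<inter> space N = {\<omega> \<in> space Q. D \<omega> \<in> A}" by (auto simp: N_def)
    also have "measure N \<dots> = measure Q (\<Gamma> \<inter> {\<omega> \<in> space Q. D \<omega> \<in> A}) / measure Q \<Gamma>"
      unfolding N_def using e\<Gamma> DA by simp
    finally show ?thesis using False by (simp add: D_def)
  qed
qed

lemma increment_distributed:
  assumes st: "0 \<le> s" "s < t"
  shows "distributed Q lborel (\<lambda>\<omega>. B t \<omega> - B s \<omega>) (normal_density 0 (sqrt (t - s)))"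
proof -
  let ?N = "density lborel (normal_density 0 (sqrt (t - s)))"
  interpret N: prob_space ?N by (rule prob_space_normal_density) (use st in simp)
  have m: "(\<lambda>\<omega>. B t \<omega> - B s \<omega>) \<in> borel_measurable Q" using st by (intro borel_measurable_diff B_measurable) auto
  have "distr Q lborel (\<lambda>\<omega>. B t \<omega> - B s \<omega>) = ?N"
  proof (rule measure_eqI)
    fix A assume "A \<in> sets (distr Q lborel (\<lambda>\<omega>. B t \<omega> - B s \<omega>))"
    then have A: "A \<in> sets borel" by simp
    have top: "path_space \<in> sets (path_filtration s)" using sets.top[of "path_filtration s"] by simp
    have "emeasure (distr Q lborel (\<lambda>\<omega>. B t \<omega> - B s \<omega>)) A = ennreal (measure Q (path_space \<inter> {\<omega> \<in> space Q. B t \<omega> - B s \<omega> \<in> A}))"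
    proof -
      have "path_space \<inter> {\<omega> \<in> space Q. B t \<omega> - B s \<omega> \<in> A} = (\<lambda>\<omega>. B t \<omega> - B s \<omega>) -` A \<inter> space Q" by (auto simp: QD(3))
      then show ?thesis using m A by (simp add: emeasure_distr measurable_lborel1 Q.emeasure_eq_measure)
    qed
    also have "\<dots> = ennreal (measure ?N A)"
      unfolding increment_law[OF st top A] using Q.prob_space by (simp add: QD(3))
    finally show "emeasure (distr Q lborel (\<lambda>\<omega>. B t \<omega> - B s \<omega>)) A = emeasure ?N A" by (simp add: N.emeasure_eq_measure)
  qed simp
  then show ?thesis using m by (simp add: distributed_def measurable_lborel1)
qed

lemma increments_independent:
  fixes n :: nat
  assumes t0: "0 \<le> \<tau> 0" and t: "\<And>i. i < n \<Longrightarrow> \<tau> i < \<tau> (Suc i)"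
  shows "Q.indep_vars (\<lambda>_. borel) (\<lambda>i \<omega>. B (\<tau> (Suc i)) \<omega> - B (\<tau> i) \<omega>) {..<n}"
proof (cases "n = 0")
  case True
  then show ?thesis by (simp add: Q.indep_vars_def2 Q.indep_sets_def)
next
  case False
  define D where "D i \<omega> = B (\<tau> (Suc i)) \<omega> - B (\<tau> i) \<omega>" for i \<omega>
  have pos: "0 \<le> \<tau> i" if "i \<le> n" for i using increasing_times_nonneg[of \<tau> n i] t0 t that by simp
  have Dm: "D i \<in> borel_measurable Q" if "i < n" for i
    unfolding D_def using pos that by (intro borel_measurable_diff B_measurable) auto
  have DF: "D i \<in> borel_measurable (path_filtration (\<tau> (Suc i)))" if "i < n" for i
  proof -
    have "\<tau> i \<le> \<tau> (Suc i)" using t[OF that] by simp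
    moreover have "0 \<le> \<tau> i" "0 \<le> \<tau> (Suc i)" using pos[of i] pos[of "Suc i"] that by auto
    ultimately show ?thesis unfolding D_def
      by (intro borel_measurable_diff B_filtration measurable_filtration_mono[OF _ B_filtration])
  qed
  have mono: "\<tau> i \<le> \<tau> j" if "i \<le> j" "j \<le> n" for i j
    using that
  proof (induction j rule: dec_induct)
    case (step j)
    then show ?case using t[of j] by (auto intro: order_trans less_imp_le)
  qed simp
  have prod: "measure Q {\<omega> \<in> space Q. \<forall>i<m. D i \<omega> \<in> A i} = (\<Prod>i<m. measure Q {\<omega> \<in> space Q. D i \<omega> \<in> A i})"
    if "m \<le> n" "\<And>i. A i \<in> sets borel" for m and A :: "nat \<Rightarrow> real set"
    using that(1)
  proof (induction m)
    case 0
    then show ?case using Q.prob_space by simp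
  next
    case (Suc m)
    then have m: "m < n" by simp
    \<comment> \<open>The event of the earlier increments is known at time \<open>\<tau> m\<close>,
      so \<open>increment_law\<close> splits off the last factor.\<close>
    define \<Gamma> where "\<Gamma> = {\<omega> \<in> space (path_filtration (\<tau> m)). \<forall>i\<in>{..<m}. D i \<omega> \<in> A i}"
    have \<Gamma>: "\<Gamma> \<in> sets (path_filtration (\<tau> m))"
      unfolding \<Gamma>_def
      using m that(2) by (intro sets_finite_conj measurable_filtration_mono[OF mono DF]) auto
    have \<Gamma>eq: "\<Gamma> = {\<omega> \<in> space Q. \<forall>i<m. D i \<omega> \<in> A i}" by (auto simp: \<Gamma>_def QD(3))
    have top: "path_space \<in> sets (path_filtration (\<tau> m))" using sets.top[of "path_filtration (\<tau> m)"] by simp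
    have one: "measure Q {\<omega> \<in> space Q. D m \<omega> \<in> A m} = measure (density lborel (normal_density 0 (sqrt (\<tau> (Suc m) - \<tau> m)))) (A m)"
    proof -
      have "path_space \<inter> {\<omega> \<in> space Q. D m \<omega> \<in> A m} = {\<omega> \<in> space Q. D m \<omega> \<in> A m}" by (auto simp: QD(3))
      then show ?thesis
        using increment_law[OF pos t[OF m] top that(2)[of m]] m Q.prob_space by (simp add: D_def QD(3))
    qed
    have "{\<omega> \<in> space Q. \<forall>i<Suc m. D i \<omega> \<in> A i} = \<Gamma> \<inter> {\<omega> \<in> space Q. D m \<omega> \<in> A m}"
      by (auto simp: \<Gamma>eq less_Suc_eq)
    then have "measure Q {\<omega> \<in> space Q. \<forall>i<Suc m. D i \<omega> \<in> A i} = measure Q \<Gamma> * measure Q {\<omega> \<in> space Q. D m \<omega> \<in> A m}"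
      unfolding one using increment_law[OF pos t[OF m] \<Gamma> that(2)[of m]] m by (simp add: D_def)
    then show ?case using Suc.IH m by (simp add: \<Gamma>eq)
  qed
  have "Q.indep_vars (\<lambda>_. borel) D {..<n}"
  proof (subst Q.indep_vars_finite[where E="\<lambda>_. sets borel"])
    show "\<forall>A\<in>{..<n} \<rightarrow> sets borel. measure Q (\<Inter>j\<in>{..<n}. D j -` A j \<inter> space Q) = (\<Prod>j\<in>{..<n}. measure Q (D j -` A j \<inter> space Q))"
    proof
      fix A :: "nat \<Rightarrow> real set" assume A: "A \<in> {..<n} \<rightarrow> sets borel"
      \<comment> \<open>The default \<open>{}\<close> makes \<open>A'\<close> Borel at every index,
        as \<open>prod\<close> asks.\<close>
      define A' where "A' i = (if i < n then A i else {})" for i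
      have A': "A' i \<in> sets borel" for i using A by (auto simp: A'_def)
      have "(\<Inter>j\<in>{..<n}. D j -` A j \<inter> space Q) = {\<omega> \<in> space Q. \<forall>i<n. D i \<omega> \<in> A' i}"
        using False by (auto simp: A'_def)
      moreover have "(\<Prod>j\<in>{..<n}. measure Q (D j -` A j \<inter> space Q)) = (\<Prod>i<n. measure Q {\<omega> \<in> space Q. D i \<omega> \<in> A' i})"
        by (rule prod.cong) (auto simp: A'_def vimage_def Int_def conj_commute)
      ultimately show "measure Q (\<Inter>j\<in>{..<n}. D j -` A j \<inter> space Q) = (\<Prod>j\<in>{..<n}. measure Q (D j -` A j \<inter> space Q))"
        using prod[OF order_refl A'] by simp
    qed
    show "Int_stable (sets (borel :: real measure))" by (rule sets.Int_stable)
    show "sets borel = sigma_sets (space borel) (sets (borel :: real measure))" by (rule sets.sigma_sets_eq[symmetric])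
    show "D i \<in> borel_measurable Q" if "i \<in> {..<n}" for i using Dm that by simp
    show "{..<n} \<noteq> {}" using False by auto
  qed simp_all
  then show ?thesis unfolding D_def .
qed

lemma brownian_motion_B: "brownian_motion Q 0 (drift_corrected \<phi> x)"
proof -
  have start: "AE \<omega> in Q. B 0 \<omega> = 0"
  proof -
    define \<Gamma> where "\<Gamma> = {\<omega> \<in> path_space. coord 0 \<omega> = x}"
    have c0: "coord 0 \<in> borel_measurable (path_filtration 0)" by (rule filtration_coord) auto
    have \<Gamma>: "\<Gamma> \<in> sets (path_filtration 0)"
      using measurable_sets[OF c0, of "{x}"] by (simp add: \<Gamma>_def vimage_def Int_def conj_commute)
    \<comment> \<open>The starting condition is an event at time 0, so its
      \<open>Q\<close>-probability can be computed under \<open>P\<close>, where it is almost sure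
      and \<open>gain 0\<close> has mean \<open>tail x\<close>.\<close>
    have "measure Q \<Gamma> = (\<integral>\<omega>. indicator \<Gamma> \<omega> * gain 0 \<omega> \<partial>P) / tail x"
      using Q \<Gamma> by (simp add: penalised_law_def)
    also have "(\<integral>\<omega>. indicator \<Gamma> \<omega> * gain 0 \<omega> \<partial>P) = (\<integral>\<omega>. gain 0 \<omega> \<partial>P)"
    proof (rule integral_cong_AE)
      show "AE \<omega> in P. indicator \<Gamma> \<omega> * gain 0 \<omega> = gain 0 \<omega>"
        using start_x AE_space by eventually_elim (simp add: \<Gamma>_def PD(4))
      have "(indicator \<Gamma> :: _ \<Rightarrow> real) \<in> borel_measurable P"
        by (rule measurable_filtration_P[OF filtration_indicator[OF \<Gamma>]])
      then show "(\<lambda>\<omega>. indicator \<Gamma> \<omega> * gain 0 \<omega>) \<in> borel_measurable P" using measurable_gain[of 0] by simp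
    qed (simp add: measurable_gain)
    finally have "measure Q \<Gamma> = 1" using integral_gain_0 tail_pos[of x] by simp
    then have "AE \<omega> in Q. \<omega> \<in> \<Gamma>" by (rule Q.AE_prob_1)
    then show ?thesis
    proof eventually_elim
      fix \<omega> assume "\<omega> \<in> \<Gamma>"
      then have w: "\<omega> \<in> path_space" "coord 0 \<omega> = x" by (auto simp: \<Gamma>_def)
      have "drift 0 \<omega> = (\<integral>v. 0 \<partial>(lborel :: real measure))"
        unfolding drift_def
        by (rule integral_cong_AE) (use AE_lborel_singleton[of 0] rate_path[OF w(1)] in \<open>auto elim: eventually_mono\<close>)
      then show "B 0 \<omega> = 0" using B_eq[OF w(1), of 0] w(2) by simp
    qed
  qed
  have cont: "AE \<omega> in Q. continuous_on {0..} (\<lambda>t. B t \<omega>)"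
  proof -
    \<comment> \<open>Integer horizons suffice for continuity on the half-line, so one null set
      serves all of them.\<close>
    have "AE \<omega> in Q. \<forall>n::nat. integrable lborel (\<lambda>v. indicator {0..real n} v *\<^sub>R rate v \<omega>)"
      unfolding AE_all_countable using AE_rate_integrable by blast
    then show ?thesis
      using AE_space
    proof eventually_elim
      fix \<omega> assume int: "\<forall>n::nat. integrable lborel (\<lambda>v. indicator {0..real n} v *\<^sub>R rate v \<omega>)" and "\<omega> \<in> space Q"
      then have w: "\<omega> \<in> path_space" using QD(3) by simp
      have loc: "continuous_on {0..real n} (\<lambda>t. B t \<omega>)" for n
      proof (rule continuous_on_cong[THEN iffD1, OF refl])
        show "continuous_on {0..real n} (\<lambda>t. coord t \<omega> - x + drift t \<omega>)"
          unfolding drift_def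
          by (intro continuous_on_add continuous_on_diff continuous_on_const continuous_on_path[OF w] continuous_on_indefinite_lborel int[rule_format]) auto
        show "coord t \<omega> - x + drift t \<omega> = B t \<omega>" if "t \<in> {0..real n}" for t using B_eq[OF w, of t] that by simp
      qed
      show "continuous_on {0..} (\<lambda>t. B t \<omega>)" by (rule continuous_on_halfline[OF loc])
    qed
  qed
  have "B = drift_corrected \<phi> x" by (simp add: B_def fun_eq_iff)
  moreover have "brownian_motion Q 0 B"
    unfolding brownian_motion_def
    using QD(1) B_measurable start cont increment_distributed increments_independent by blast
  ultimately show ?thesis by simp
qed

end

theorem theorem3p6:
  fixes \<phi> :: "real \<Rightarrow> real"
    and P :: "real \<Rightarrow> (real \<Rightarrow> real) measure"
  assumes "\<And>x. brownian_law x (P x)"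
    and "\<phi> \<in> borel_measurable borel"
    and "\<And>u. \<phi> u > 0"
    and "has_bochner_integral lborel \<phi> 1"
  shows "(\<forall>u\<ge>0. \<forall>x. \<forall>\<Gamma>\<in>sets (path_filtration u).
            ((\<lambda>t. (LINT \<omega>|P x. indicator \<Gamma> \<omega> * \<phi> (running_max t \<omega>)) /
                  (LINT \<omega>|P x. \<phi> (running_max t \<omega>)))
             \<longlongrightarrow> 1 / (1 - primitive \<phi> x) * (LINT \<omega>|P x. indicator \<Gamma> \<omega> * max_martingale \<phi> u \<omega>)) at_top)
       \<and> (\<exists>!Q. penalised_family \<phi> P Q)
       \<and> (\<forall>Q. penalised_family \<phi> P Q \<longrightarrow> (\<forall>x. brownian_motion (Q x) 0 (drift_corrected \<phi> x)))"
proof -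
  \<comment> \<open>The member \<open>P 0\<close> of the family serves as the reference law of the
    increments, whatever the starting point \<open>x\<close>.\<close>
  have pen: "penalisation (P 0) x (P x) \<phi>" for x
    using assms by (intro penalisation.intro wiener.intro penalisation_axioms.intro) auto
  define law where "law x = penalisation.penalised_law x (P x) \<phi>" for x
  \<comment> \<open>\<open>P x\<close> lives on \<open>path_space\<close>, where
    \<open>max_martingale\<close> and \<open>gain\<close> agree at times \<open>u \<ge> 0\<close>;
    this translates the locale results into the quantities of the statement.\<close>
  have gain: "1 / (1 - primitive \<phi> x) * (LINT \<omega>|P x. indicator \<Gamma> \<omega> * max_martingale \<phi> u \<omega>) =
      (\<integral>\<omega>. indicator \<Gamma> \<omega> * penalisation.gain \<phi> u \<omega> \<partial>P x) / penalisation.tail \<phi> x"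
    if "0 \<le> u" for x u and \<Gamma> :: "(real \<Rightarrow> real) set"
  proof -
    interpret penalisation "P 0" x "P x" \<phi> by (rule pen)
    have "(LINT \<omega>|P x. indicator \<Gamma> \<omega> * max_martingale \<phi> u \<omega>) = (\<integral>\<omega>. indicator \<Gamma> \<omega> * gain u \<omega> \<partial>P x)"
      by (rule Bochner_Integration.integral_cong[OF refl]) (use gain_eq that PD(4) in auto)
    then show ?thesis by (simp add: tail_eq)
  qed
  have family: "penalised_family \<phi> P Q \<longleftrightarrow> (\<forall>x. law x (Q x))" for Q
    unfolding penalised_family_def law_def penalisation.penalised_law_def[OF pen] by (simp only: gain cong: imp_cong)
  show ?thesis
  proof (intro conjI allI impI ballI)
    fix u x :: real and \<Gamma> assume u: "0 \<le> u" and \<Gamma>: "\<Gamma> \<in> sets (path_filtration u)"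
    show "((\<lambda>t. (LINT \<omega>|P x. indicator \<Gamma> \<omega> * \<phi> (running_max t \<omega>)) / (LINT \<omega>|P x. \<phi> (running_max t \<omega>)))
       \<longlongrightarrow> 1 / (1 - primitive \<phi> x) * (LINT \<omega>|P x. indicator \<Gamma> \<omega> * max_martingale \<phi> u \<omega>)) at_top"
      unfolding gain[OF u] by (rule penalisation.penalised_limit[OF pen u \<Gamma>])
  next
    have "\<forall>x. \<exists>Q. law x Q" unfolding law_def using penalisation.penalised_law_exists[OF pen] by blast
    then obtain Q where Q: "\<forall>x. law x (Q x)" by metis
    show "\<exists>!Q. penalised_family \<phi> P Q"
    proof (rule ex1I[of _ Q])
      show "penalised_family \<phi> P Q" using Q family by simp
      fix Q' assume Q': "penalised_family \<phi> P Q'"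
      show "Q' = Q"
      proof
        fix y
        show "Q' y = Q y"
          using Q Q' family by (intro penalisation.penalised_law_unique[OF pen]) (auto simp: law_def)
      qed
    qed
  next
    fix Q x assume "penalised_family \<phi> P Q"
    then have "penalised (P 0) x (P x) \<phi> (Q x)"
      using pen by (intro penalised.intro penalised_axioms.intro) (auto simp: family law_def)
    then show "brownian_motion (Q x) 0 (drift_corrected \<phi> x)" by (rule penalised.brownian_motion_B)
  qed
qed

end
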